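(* Let $\Gamma$ be a tropical curve and $D$ an effective divisor on $\Gamma$. The fine subdivision of $\mathrm{link}(D,|D|)$, the link of $D$ in its linear system $|D|$, is a geometric realization of the order complex of the firing poset $\mathcal P_D$.
   Context: A tropical curve $\Gamma$ is a compact connected metric graph whose leaf edges may have infinite length (with a point at infinity added). Divisors are finite formal $\mathbb Z$-combinations of points of $\Gamma$; $D$ is effective if all its coefficients $D(x)$ are $\ge 0$. Rational functions are continuous piecewise linear functions with finitely many pieces and integer slopes (possibly with values $\pm\infty$ at points at infinity); $(f)=\sum_x\mathrm{ord}_x(f)\cdot x$, where $\mathrm{ord}_x(f)$ is the sum of outgoing slopes of $f$ at $x$; $R(D)=\{f:D+(f)\ge0\}$ and $|D|=\{D+(f):f\in R(D)\}$, identified with $R(D)$ modulo constant functions. A model of $\Gamma$ is given by a finite nonempty set $V$ of points (the vertices) containing all points of valence $\ne2$; the edges are the connected components of $\Gamma\setminus V$. Unless otherwise specified, the model is the coarsest one, i.e. the vertices are the points of valence $\neq 2$ (a circle has no coarsest model; there one chooses a model). Cell structure on $|D|$: with each open edge $e$ given a direction and identified with $(0,\ell(e))$, where $\ell(e)$ is its length, two divisors $D+(f)$ and $D+(g)$ lie in the same open cell iff they have the same coefficients at all vertices, the same ordered sequence of coefficients at their support points along each open edge, and $f,g$ have the same slope at the start of each edge. Link: for a cell complex $B$ and $x\in B$, $\mathrm{link}(x,B)$ is the cell complex obtained by intersecting $B$ with a sufficiently small sphere centered at $x$. Fine subdivision of $\mathrm{link}(D,|D|)$: let $D'=D+(f)\in\mathrm{link}(D,|D|)$.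 Let $h_0>h_1>\cdots>h_n$ be the values taken by $f$ on the set of points that are either vertices of $\Gamma$ or points where $f$ is not smooth; one may assume that $h_0-h_n$ is sufficiently small. Let $\Gamma_i=\{x\in\Gamma: f(x)\ge h_i\}$, giving a chain $\Gamma_0\subset\Gamma_1\subset\cdots\subset\Gamma_n=\Gamma$. Let $\Gamma_0'\subset\Gamma_1'\subset\cdots\subset\Gamma_n'=\Gamma$ be the chain of compactified graphs, where $\Gamma_i'$ is the union of the edges of $\Gamma_i$ that are between two vertices of $\Gamma$. Each cell of the link is subdivided by specifying the following additional combinatorial data: the chain of compactified graphs obtained this way and the slopes at the non-smooth points. The result is the fine subdivision. Firing poset $\mathcal P_D$: a weighted chip firing move is a rational function $f$ for which there are two disjoint (not necessarily connected) proper closed subgraphs $\Gamma_1,\Gamma_2$ of $\Gamma$ such that $f$ is constant on each of them and linear with integer slopes on the complement (a subgraph is a compact subset with finitely many connected components). An element of $\mathcal P_D$ is a weighted chip firing move without the information about the length, i.e. a closed subgraph $\Gamma'\subset\Gamma$ (nonempty and proper) together with a (positive) integer $c_e$ for each outgoing direction $e$ of $\Gamma'$, such that for each point $x\in\Gamma'$ we have $\sum c_e\le D(x)$, the sum being over all outgoing directions $e$ from $x$. The order is: $(\Gamma',c')\le(\Gamma'',c'')$ iff $\Gamma'\subset\Gamma''$ and $c'_e\ge c''_e$ for each common outgoing direction $e$ of $\Gamma'$ and $\Gamma''$. The order complex of a poset is the simplicial complex of its finite chains.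
   Formalization: D is assumed to have no chips at points at infinity (there h_0-h_n is never small and the claim fails), and in the fine subdivision the points of the support of D count as vertices along with those of the model (otherwise the chain misses firings from inside edges). *)

theory Defs
  imports "HOL-Analysis.Analysis" "Graph_Theory.Digraph"
begin

section \<open>Tropical curves\<close>

text \<open>
  A tropical curve is given together with a model: a finite multigraph (loops and parallel
  edges allowed) with edge lengths in (0, \<infinity>]. The edge \<open>e\<close> is identified with the interval
  from 0 (at the tail of \<open>e\<close>) to \<open>len \<Gamma> e\<close> (at the head of \<open>e\<close>). The model is arbitrary;
  in particular it may be the coarsest one.
\<close>

record ('v, 'e) metric_graph =
  model :: "('v, 'e) pre_digraph"
  len :: "'e \<Rightarrow> ereal"

datatype ('v, 'e) point = Vert 'v | Inner 'e real

definition epoint :: "('v, 'e) metric_graph \<Rightarrow> 'e \<Rightarrow> ereal \<Rightarrow> ('v, 'e) point" where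
  "epoint \<Gamma> e t =
     (if t \<le> 0 then Vert (tail (model \<Gamma>) e)
      else if len \<Gamma> e \<le> t then Vert (head (model \<Gamma>) e)
      else Inner e (real_of_ereal t))"

definition points :: "('v, 'e) metric_graph \<Rightarrow> ('v, 'e) point set" where
  "points \<Gamma> = Vert ` verts (model \<Gamma>) \<union>
     {Inner e t | e t. e \<in> arcs (model \<Gamma>) \<and> 0 < t \<and> ereal t < len \<Gamma> e}"

text \<open>The topology glued from the edges; it is the metric topology, with each infinite edge
  compactified by its point at infinity.\<close>

definition curve_top :: "('v, 'e) metric_graph \<Rightarrow> ('v, 'e) point topology" where
  "curve_top \<Gamma> = topology (\<lambda>U. U \<subseteq> points \<Gamma> \<and>
     (\<forall>e \<in> arcs (model \<Gamma>).
        openin (top_of_set {0..len \<Gamma> e}) {t \<in> {0..len \<Gamma> e}. epoint \<Gamma> e t \<in> U}))"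

text \<open>Tangent directions: \<open>Fwd e a\<close> and \<open>Bwd e a\<close> leave the point with coordinate \<open>a\<close> on \<open>e\<close>
  towards increasing and decreasing coordinates, respectively.\<close>

datatype 'e direction = Fwd 'e ereal | Bwd 'e ereal

definition directions :: "('v, 'e) metric_graph \<Rightarrow> 'e direction set" where
  "directions \<Gamma> =
     {Fwd e a | e a. e \<in> arcs (model \<Gamma>) \<and> 0 \<le> a \<and> a < len \<Gamma> e} \<union>
     {Bwd e a | e a. e \<in> arcs (model \<Gamma>) \<and> 0 < a \<and> a \<le> len \<Gamma> e}"

fun base :: "('v, 'e) metric_graph \<Rightarrow> 'e direction \<Rightarrow> ('v, 'e) point" where
  "base \<Gamma> (Fwd e a) = epoint \<Gamma> e a"
| "base \<Gamma> (Bwd e a) = epoint \<Gamma> e a"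

text \<open>The points close to the base point of a direction and lying in that direction; the filter
  \<open>at_left\<close> on extended reals covers the case of a point at infinity.\<close>

fun germ :: "('v, 'e) metric_graph \<Rightarrow> 'e direction \<Rightarrow> ('v, 'e) point filter" where
  "germ \<Gamma> (Fwd e a) = filtermap (epoint \<Gamma> e) (at_right a)"
| "germ \<Gamma> (Bwd e a) = filtermap (epoint \<Gamma> e) (at_left a)"

definition dirs_at :: "('v, 'e) metric_graph \<Rightarrow> ('v, 'e) point \<Rightarrow> 'e direction set" where
  "dirs_at \<Gamma> x = {d \<in> directions \<Gamma>. base \<Gamma> d = x}"

definition valence :: "('v, 'e) metric_graph \<Rightarrow> ('v, 'e) point \<Rightarrow> nat" where
  "valence \<Gamma> x = card (dirs_at \<Gamma> x)"

text \<open>An infinite edge is a leaf edge, oriented towards its point at infinity.\<close>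

definition tropical_curve :: "('v, 'e) metric_graph \<Rightarrow> bool" where
  "tropical_curve \<Gamma> \<longleftrightarrow>
     fin_digraph (model \<Gamma>) \<and> verts (model \<Gamma>) \<noteq> {} \<and>
     (\<forall>e \<in> arcs (model \<Gamma>). 0 < len \<Gamma> e \<and>
        (len \<Gamma> e = \<infinity> \<longrightarrow> valence \<Gamma> (Vert (head (model \<Gamma>) e)) = 1)) \<and>
     connected_space (curve_top \<Gamma>)"

text \<open>Chips of \<open>D\<close> at these points can be moved only by functions f with value \<infinity> there, for
  which the difference between the extreme values of f is never small.\<close>

definition infinite_points :: "('v, 'e) metric_graph \<Rightarrow> ('v, 'e) point set" where
  "infinite_points \<Gamma> = {Vert (head (model \<Gamma>) e) | e. e \<in> arcs (model \<Gamma>) \<and> len \<Gamma> e = \<infinity>}"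


section \<open>Divisors, rational functions and linear systems\<close>

type_synonym ('v, 'e) divisor = "('v, 'e) point \<Rightarrow> int"

definition is_divisor :: "('v, 'e) metric_graph \<Rightarrow> ('v, 'e) divisor \<Rightarrow> bool" where
  "is_divisor \<Gamma> D \<longleftrightarrow> finite {x. D x \<noteq> 0} \<and> {x. D x \<noteq> 0} \<subseteq> points \<Gamma>"

definition effective :: "('v, 'e) divisor \<Rightarrow> bool" where
  "effective D \<longleftrightarrow> (\<forall>x. 0 \<le> D x)"

definition rational_function ::
    "('v, 'e) metric_graph \<Rightarrow> (('v, 'e) point \<Rightarrow> ereal) \<Rightarrow> bool" where
  "rational_function \<Gamma> f \<longleftrightarrow>
     continuous_map (curve_top \<Gamma>) euclidean f \<and>
     (\<forall>x \<in> points \<Gamma> - infinite_points \<Gamma>. \<bar>f x\<bar> \<noteq> \<infinity>) \<and>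
     (\<forall>e \<in> arcs (model \<Gamma>). \<exists>B. finite B \<and>
        (\<forall>a b. a < b \<and> {a<..<b} \<subseteq> {0<..<len \<Gamma> e} - B \<longrightarrow>
           (\<exists>(m :: int) (c :: real). \<forall>t \<in> {a<..<b}.
              f (epoint \<Gamma> e t) = ereal c + ereal (of_int m) * t)))"

fun has_slope :: "('v, 'e) metric_graph \<Rightarrow> (('v, 'e) point \<Rightarrow> ereal) \<Rightarrow> int \<Rightarrow> 'e direction \<Rightarrow> bool"
  where
  "has_slope \<Gamma> f m (Fwd e a) \<longleftrightarrow>
     (\<exists>c :: real. \<forall>\<^sub>F t in at_right a. f (epoint \<Gamma> e t) = ereal c + ereal (of_int m) * t)"
| "has_slope \<Gamma> f m (Bwd e a) \<longleftrightarrow>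
     (\<exists>c :: real. \<forall>\<^sub>F t in at_left a. f (epoint \<Gamma> e t) = ereal c - ereal (of_int m) * t)"

definition slope :: "('v, 'e) metric_graph \<Rightarrow> (('v, 'e) point \<Rightarrow> ereal) \<Rightarrow> 'e direction \<Rightarrow> int" where
  "slope \<Gamma> f d = (THE m. has_slope \<Gamma> f m d)"

text \<open>The divisor (f). It vanishes outside \<open>points \<Gamma>\<close>, where there are no directions.\<close>

definition div_of :: "('v, 'e) metric_graph \<Rightarrow> (('v, 'e) point \<Rightarrow> ereal) \<Rightarrow> ('v, 'e) divisor" where
  "div_of \<Gamma> f = (\<lambda>x. \<Sum>d \<in> dirs_at \<Gamma> x. slope \<Gamma> f d)"

definition add_div :: "('v, 'e) metric_graph \<Rightarrow> ('v, 'e) divisor \<Rightarrow> (('v, 'e) point \<Rightarrow> ereal) \<Rightarrow>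
    ('v, 'e) divisor" where
  "add_div \<Gamma> D f = (\<lambda>x. D x + div_of \<Gamma> f x)"

definition R_space ::
    "('v, 'e) metric_graph \<Rightarrow> ('v, 'e) divisor \<Rightarrow> (('v, 'e) point \<Rightarrow> ereal) set" where
  "R_space \<Gamma> D = {f. rational_function \<Gamma> f \<and> effective (add_div \<Gamma> D f)}"

definition linear_system :: "('v, 'e) metric_graph \<Rightarrow> ('v, 'e) divisor \<Rightarrow> ('v, 'e) divisor set" where
  "linear_system \<Gamma> D = add_div \<Gamma> D ` R_space \<Gamma> D"


section \<open>The cell structure of a linear system\<close>

definition edge_coeffs ::
    "('v, 'e) metric_graph \<Rightarrow> ('v, 'e) divisor \<Rightarrow> 'e \<Rightarrow> int list" where
  "edge_coeffs \<Gamma> D e = map (\<lambda>t. D (Inner e t))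
     (sorted_list_of_set {t. 0 < t \<and> ereal t < len \<Gamma> e \<and> D (Inner e t) \<noteq> 0})"

definition cell_rel ::
    "('v, 'e) metric_graph \<Rightarrow> ('v, 'e) divisor \<Rightarrow> ('v, 'e) divisor rel" where
  "cell_rel \<Gamma> D = {(add_div \<Gamma> D f, add_div \<Gamma> D g) | f g. f \<in> R_space \<Gamma> D \<and> g \<in> R_space \<Gamma> D \<and>
     (\<forall>v \<in> verts (model \<Gamma>). add_div \<Gamma> D f (Vert v) = add_div \<Gamma> D g (Vert v)) \<and>
     (\<forall>e \<in> arcs (model \<Gamma>).
        edge_coeffs \<Gamma> (add_div \<Gamma> D f) e = edge_coeffs \<Gamma> (add_div \<Gamma> D g) e \<and>
        slope \<Gamma> f (Fwd e 0) = slope \<Gamma> g (Fwd e 0))}"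


section \<open>The link of a divisor and its fine subdivision\<close>

text \<open>\<open>osc\<close> is twice the quotient norm of the sup norm modulo constants. Since a rational
  function is determined up to a constant by its divisor, the infimum below is over at most one
  value; it is \<infinity> for divisors that are not linearly equivalent. With |D| identified with R(D)
  modulo constants, \<open>div_dist\<close> is the metric \<open>max (f - g) - min (f - g)\<close>, and the sphere of
  radius \<open>\<epsilon>\<close> around \<open>D\<close> consists of the D + (f) with \<open>max f - min f = \<epsilon>\<close>.\<close>

definition osc :: "('v, 'e) metric_graph \<Rightarrow> (('v, 'e) point \<Rightarrow> ereal) \<Rightarrow> ereal" where
  "osc \<Gamma> f = (SUP x \<in> points \<Gamma>. f x) - (INF x \<in> points \<Gamma>. f x)"

definition div_dist ::
    "('v, 'e) metric_graph \<Rightarrow> ('v, 'e) divisor \<Rightarrow> ('v, 'e) divisor \<Rightarrow> ereal" where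
  "div_dist \<Gamma> D1 D2 = (INF g \<in> {g. rational_function \<Gamma> g \<and> add_div \<Gamma> D1 g = D2}. osc \<Gamma> g)"

definition link ::
    "('v, 'e) metric_graph \<Rightarrow> ('v, 'e) divisor \<Rightarrow> real \<Rightarrow> ('v, 'e) divisor set" where
  "link \<Gamma> D \<epsilon> = {D' \<in> linear_system \<Gamma> D. div_dist \<Gamma> D D' = ereal \<epsilon>}"

definition link_top ::
    "('v, 'e) metric_graph \<Rightarrow> ('v, 'e) divisor \<Rightarrow> real \<Rightarrow> ('v, 'e) divisor topology" where
  "link_top \<Gamma> D \<epsilon> =
     Metric_space.mtopology (link \<Gamma> D \<epsilon>) (\<lambda>D1 D2. real_of_ereal (div_dist \<Gamma> D1 D2))"

text \<open>For the fine subdivision the points of the support of \<open>D\<close> count as vertices: if chips leave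
  such a point in the interior of an edge, then it is the point to which the superlevel sets
  around it shrink.\<close>

definition marked ::
    "('v, 'e) metric_graph \<Rightarrow> ('v, 'e) divisor \<Rightarrow> ('v, 'e) point set" where
  "marked \<Gamma> D = Vert ` verts (model \<Gamma>) \<union> {x. D x \<noteq> 0}"

text \<open>A point of valence 2 is a non-smooth point of \<open>f\<close> iff the outgoing slopes do not cancel.\<close>

definition nonsmooth_points ::
    "('v, 'e) metric_graph \<Rightarrow> (('v, 'e) point \<Rightarrow> ereal) \<Rightarrow> ('v, 'e) point set" where
  "nonsmooth_points \<Gamma> f = {Inner e t | e t. Inner e t \<in> points \<Gamma> \<and> div_of \<Gamma> f (Inner e t) \<noteq> 0}"

definition levels ::
    "('v, 'e) metric_graph \<Rightarrow> ('v, 'e) divisor \<Rightarrow> (('v, 'e) point \<Rightarrow> ereal) \<Rightarrow> ereal list" where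
  "levels \<Gamma> D f = rev (sorted_list_of_set (f ` (marked \<Gamma> D \<union> nonsmooth_points \<Gamma> f)))"

definition superlevel ::
    "('v, 'e) metric_graph \<Rightarrow> (('v, 'e) point \<Rightarrow> ereal) \<Rightarrow> ereal \<Rightarrow> ('v, 'e) point set" where
  "superlevel \<Gamma> f h = {x \<in> points \<Gamma>. h \<le> f x}"

definition compactified ::
    "('v, 'e) metric_graph \<Rightarrow> ('v, 'e) divisor \<Rightarrow> ('v, 'e) point set \<Rightarrow> ('v, 'e) point set" where
  "compactified \<Gamma> D S = (S \<inter> marked \<Gamma> D) \<union>
     \<Union> {E \<in> connected_components_of (subtopology (curve_top \<Gamma>) (points \<Gamma> - marked \<Gamma> D)). E \<subseteq> S}"

definition outgoing ::
    "('v, 'e) metric_graph \<Rightarrow> ('v, 'e) point set \<Rightarrow> 'e direction set" where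
  "outgoing \<Gamma> S = {d \<in> directions \<Gamma>. base \<Gamma> d \<in> S \<and> (\<forall>\<^sub>F x in germ \<Gamma> d. x \<notin> S)}"

text \<open>Following the direction \<open>d\<close> inside \<open>S\<close> as far as possible along its edge.\<close>

fun exit_dir ::
    "('v, 'e) metric_graph \<Rightarrow> ('v, 'e) point set \<Rightarrow> 'e direction \<Rightarrow> 'e direction" where
  "exit_dir \<Gamma> S (Fwd e a) = Fwd e (SUP b \<in> {b. a \<le> b \<and> b \<le> len \<Gamma> e \<and> epoint \<Gamma> e ` {a..b} \<subseteq> S}. b)"
| "exit_dir \<Gamma> S (Bwd e a) = Bwd e (INF b \<in> {b. 0 \<le> b \<and> b \<le> a \<and> epoint \<Gamma> e ` {b..a} \<subseteq> S}. b)"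

text \<open>The slopes are recorded at the boundary of each superlevel set; the outgoing directions
  there are indexed by those of the compactified graph, which do not move with \<open>f\<close>. They are
  taken with a minus sign, so as to be positive.\<close>

definition fine_data ::
    "('v, 'e) metric_graph \<Rightarrow> ('v, 'e) divisor \<Rightarrow> (('v, 'e) point \<Rightarrow> ereal) \<Rightarrow>
       (('v, 'e) point set \<times> ('e direction \<Rightarrow> int)) list" where
  "fine_data \<Gamma> D f = map (\<lambda>h.
     let S = superlevel \<Gamma> f h; S' = compactified \<Gamma> D S in
       (S', \<lambda>d. if d \<in> outgoing \<Gamma> S' then - slope \<Gamma> f (exit_dir \<Gamma> S d) else 0)) (levels \<Gamma> D f)"

definition fine_rel ::
    "('v, 'e) metric_graph \<Rightarrow> ('v, 'e) divisor \<Rightarrow> real \<Rightarrow> ('v, 'e) divisor rel" where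
  "fine_rel \<Gamma> D \<epsilon> = {(D1, D2) \<in> cell_rel \<Gamma> D. D1 \<in> link \<Gamma> D \<epsilon> \<and> D2 \<in> link \<Gamma> D \<epsilon> \<and>
     (\<exists>f \<in> R_space \<Gamma> D. \<exists>g \<in> R_space \<Gamma> D. D1 = add_div \<Gamma> D f \<and> D2 = add_div \<Gamma> D g \<and>
        fine_data \<Gamma> D f = fine_data \<Gamma> D g)}"

definition fine_cells ::
    "('v, 'e) metric_graph \<Rightarrow> ('v, 'e) divisor \<Rightarrow> real \<Rightarrow> ('v, 'e) divisor set set" where
  "fine_cells \<Gamma> D \<epsilon> = link \<Gamma> D \<epsilon> // fine_rel \<Gamma> D \<epsilon>"


section \<open>The firing poset\<close>

definition closed_subgraph :: "('v, 'e) metric_graph \<Rightarrow> ('v, 'e) point set \<Rightarrow> bool" where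
  "closed_subgraph \<Gamma> S \<longleftrightarrow> compactin (curve_top \<Gamma>) S \<and>
     finite (connected_components_of (subtopology (curve_top \<Gamma>) S))"

text \<open>The weights are extended by 0 to all directions that are not outgoing.\<close>

definition firing_poset ::
    "('v, 'e) metric_graph \<Rightarrow> ('v, 'e) divisor \<Rightarrow>
       (('v, 'e) point set \<times> ('e direction \<Rightarrow> int)) set" where
  "firing_poset \<Gamma> D = {(S, c). closed_subgraph \<Gamma> S \<and> S \<noteq> {} \<and> S \<noteq> points \<Gamma> \<and>
     (\<forall>d \<in> outgoing \<Gamma> S. 0 < c d) \<and> (\<forall>d. d \<notin> outgoing \<Gamma> S \<longrightarrow> c d = 0) \<and>
     (\<forall>x \<in> S. (\<Sum>d \<in> outgoing \<Gamma> S \<inter> dirs_at \<Gamma> x. c d) \<le> D x)}"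

definition firing_order ::
    "('v, 'e) metric_graph \<Rightarrow> ('v, 'e) divisor \<Rightarrow>
       (('v, 'e) point set \<times> ('e direction \<Rightarrow> int)) rel" where
  "firing_order \<Gamma> D = {((S, c), (S', c')). (S, c) \<in> firing_poset \<Gamma> D \<and> (S', c') \<in> firing_poset \<Gamma> D \<and>
     S \<subseteq> S' \<and> (\<forall>d \<in> outgoing \<Gamma> S \<inter> outgoing \<Gamma> S'. c' d \<le> c d)}"


section \<open>Order complexes and geometric realizations\<close>

definition order_complex :: "'a rel \<Rightarrow> 'a set set" where
  "order_complex r = {C \<in> Chains r. finite C \<and> C \<noteq> {}}"

text \<open>The standard realization by barycentric coordinates, for a finite simplicial complex \<open>K\<close>
  given by its nonempty simplices. The product topology on functions is the correct one
  for finite \<open>K\<close>; the firing poset is finite.\<close>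

definition realization :: "'a set set \<Rightarrow> ('a \<Rightarrow> real) set" where
  "realization K = {w. (\<forall>p. 0 \<le> w p) \<and> {p. w p \<noteq> 0} \<in> K \<and> (\<Sum>p | w p \<noteq> 0. w p) = 1}"

definition open_simplex :: "'a set set \<Rightarrow> 'a set \<Rightarrow> ('a \<Rightarrow> real) set" where
  "open_simplex K \<sigma> = {w \<in> realization K. {p. w p \<noteq> 0} = \<sigma>}"

text \<open>The space \<open>X\<close>, decomposed into the open cells \<open>\<C>\<close>, is a geometric realization of \<open>K\<close>.\<close>

definition is_geometric_realization :: "'b topology \<Rightarrow> 'b set set \<Rightarrow> 'a set set \<Rightarrow> bool" where
  "is_geometric_realization X \<C> K \<longleftrightarrow>
     (\<exists>\<phi>. homeomorphic_map (top_of_set (realization K)) X \<phi> \<and>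
          (\<lambda>\<sigma>. \<phi> ` open_simplex K \<sigma>) ` K = \<C>)"

end

theory Submission
  imports Defs
begin

text \<open>
  Choose \<open>r\<close> such that consecutive marked points (vertices and points of the support of \<open>D\<close>) on an
  edge are more than \<open>2 * r\<close> apart, and let \<open>\<epsilon> < r\<close>. If \<open>D + (f)\<close> is in the link, then \<open>f\<close> is
  convex between marked points, where \<open>D + (f) \<ge> 0\<close> forces the slope to increase. Its slopes are
  integers and \<open>max f - min f = \<epsilon>\<close>, so that \<open>f\<close> is nonincreasing within distance \<open>r\<close> of a marked
  point and constant farther away. Hence the data of \<open>f\<close> at a level \<open>h\<close>, the compactified
  superlevel set with the slopes at its boundary, is an element of the firing poset, and it
  increases as \<open>h\<close> decreases. Weighting each element \<open>p\<close> by the length of the set of levels with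
  data \<open>p\<close>, divided by \<open>\<epsilon>\<close>, gives a point of the realization of the order complex. Conversely, a
  weighted chain is sent to the sum of the weighted chip firing moves of its elements, each of
  height \<open>\<epsilon>\<close> times the weight. The cells of the fine subdivision are the images of the open
  simplices: along a simplex the positions of the chips are affine in the weights, and two chips
  that coincide at one point of the open simplex coincide on all of it.
\<close>

section \<open>Piecewise linear functions of one variable\<close>

text \<open>Integrality sets the scale: on a stretch without marked points a slope that is positive
  is at least 1 and, by convexity, stays so to the end of the stretch, which contradicts a small
  oscillation if the stretch is longer than \<open>\<epsilon>\<close>. The obstacle is that several
  chips leave along one direction and may travel together, so their positions are poor coordinates.
  They are replaced by numbers \<open>\<tau> d m\<close>, the distance up to which the slope along
  \<open>d\<close> is at most \<open>- m\<close>: the values are sums of terms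
  \<open>min x (\<tau> d m)\<close>, coincidences of chips become ties, and the values at the breaks
  determine the distances through a triangular linear system. A move of height \<open>h\<close> and
  slope \<open>- c\<close> takes length \<open>h / c\<close>, which turns weights into distances.
  Everything else is compared through masses of up-closed conditions on a chain: a level
  \<open>h\<close> is at most such a mass iff the element of the chain belonging to \<open>h\<close>
  satisfies the condition. Only the map from weights to divisors is shown to be continuous
  directly.\<close>

lemma interval_induct:
  fixes a b :: real
  assumes "a \<le> b" and start: "P a"
    and right: "\<And>t. a \<le> t \<Longrightarrow> t < b \<Longrightarrow> (\<And>x. a \<le> x \<Longrightarrow> x \<le> t \<Longrightarrow> P x) \<Longrightarrow> eventually P (at_right t)"
    and left: "\<And>t. a < t \<Longrightarrow> t \<le> b \<Longrightarrow> (\<And>x. a \<le> x \<Longrightarrow> x < t \<Longrightarrow> P x) \<Longrightarrow> P t"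
    and "a \<le> y" "y \<le> b"
  shows "P y"
proof -
  \<comment> \<open>\<open>T\<close> collects the end points of initial intervals on which
    \<open>P\<close> holds. Its supremum \<open>s\<close> inherits \<open>P\<close> from below by
    \<open>left\<close>, and \<open>right\<close> would push it further if it were less than
    \<open>b\<close>.\<close>
  define T where "T = {t \<in> {a..b}. \<forall>x\<in>{a..t}. P x}"
  have aT: "a \<in> T"
    using assms(1) start by (auto simp: T_def)
  have bdd: "bdd_above T"
    by (auto simp: T_def bdd_above_def)
  define s where "s = Sup T"
  have as: "a \<le> s"
    unfolding s_def by (rule cSup_upper[OF aT bdd])
  have sb: "s \<le> b"
  proof -
    have "T \<noteq> {}" using aT by blast
    moreover have "\<And>t. t \<in> T \<Longrightarrow> t \<le> b" by (simp add: T_def)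
    ultimately show ?thesis unfolding s_def by (rule cSup_least)
  qed
  have below: "P x" if "a \<le> x" "x < s" for x
  proof -
    have "T \<noteq> {}" using aT by blast
    then have "\<exists>t\<in>T. x < t"
      using less_cSup_iff[OF _ bdd, of x] that s_def by simp
    then obtain t where "t \<in> T" "x < t" by blast
    then show ?thesis
      using that by (auto simp: T_def)
  qed
  have Ps: "P s"
    using left[OF _ sb below] start as by (cases "a = s") auto
  have upto: "P x" if "a \<le> x" "x \<le> s" for x
    using below Ps that by (cases "x = s") auto
  have "s = b"
  proof (rule ccontr)
    assume "s \<noteq> b"
    then have "s < b" using sb by simp
    from right[OF as this upto] obtain c where c: "s < c" "\<And>z. s < z \<Longrightarrow> z < c \<Longrightarrow> P z"
      unfolding eventually_at_right_field by blast
    define t where "t = min b ((s + c) / 2)"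
    have t: "s < t" "t < c" "t \<le> b"
      using c(1) \<open>s < b\<close> by (auto simp: t_def min_less_iff_disj)
    have "P x" if "a \<le> x" "x \<le> t" for x
      using upto[of x] c(2)[of x] that t by (cases "x \<le> s") auto
    then have "t \<in> T"
      using t as by (auto simp: T_def)
    then have "t \<le> s"
      unfolding s_def by (rule cSup_upper[OF _ bdd])
    with t show False by simp
  qed
  then show ?thesis
    using upto assms by simp
qed

lemma eventually_at_right_shift:
  fixes t :: real
  shows "eventually P (at_right t) \<longleftrightarrow> (\<forall>\<^sub>F y in at_right 0. P (t + y))"
  by (simp add: eventually_at_right_to_0[of _ t] add.commute)

lemma at_right_0_obtain:
  assumes "\<forall>\<^sub>F y in at_right (0::real). P y"
  obtains \<delta> where "\<delta> > 0" "\<And>y. 0 < y \<Longrightarrow> y < \<delta> \<Longrightarrow> P y"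
  using assms unfolding eventually_at_right_field by blast

lemma at_right_0_unique:
  fixes a b :: real
  assumes "\<forall>\<^sub>F y in at_right (0::real). u y = c + a * y" "\<forall>\<^sub>F y in at_right (0::real). u y = c' + b * y"
  shows "a = b" and "c = c'"
proof -
  have "\<forall>\<^sub>F y in at_right (0::real). u y = c + a * y \<and> u y = c' + b * y"
    using assms by (rule eventually_conj)
  then obtain \<delta> where d: "\<delta> > 0" "\<And>y. 0 < y \<Longrightarrow> y < \<delta> \<Longrightarrow> c + a * y = c' + b * y"
    by (elim at_right_0_obtain) (metis (no_types, lifting))
  have 1: "c + a * (\<delta>/2) = c' + b * (\<delta>/2)" and 2: "c + a * (\<delta>/4) = c' + b * (\<delta>/4)"
    using d(2)[of "\<delta>/2"] d(2)[of "\<delta>/4"] d(1) by simp_all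
  have "(a - b) * \<delta> = 0"
    using 1 2 by (simp only: left_diff_distrib)
  then show "a = b" using d(1) by simp
  then show "c = c'" using 1 by simp
qed

text \<open>In this section \<open>sR\<close> and \<open>sL\<close> are the derivatives of \<open>u\<close> from the right and from the left.\<close>

lemma slope_bound:
  fixes u :: "real \<Rightarrow> real"
  assumes "a \<le> b"
    and R: "\<And>x. a \<le> x \<Longrightarrow> x < b \<Longrightarrow> \<forall>\<^sub>F y in at_right 0. u (x + y) = u x + sR x * y"
    and L: "\<And>x. a < x \<Longrightarrow> x \<le> b \<Longrightarrow> \<forall>\<^sub>F y in at_right 0. u (x - y) = u x - sL x * y"
    and K: "\<And>x. a \<le> x \<Longrightarrow> x < b \<Longrightarrow> sR x \<le> K"
  shows "u b \<le> u a + K * (b - a)"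
proof (rule interval_induct[where P = "\<lambda>x. u x \<le> u a + K * (x - a)", OF \<open>a \<le> b\<close>])
  fix t assume t: "a \<le> t" "t < b" and IH: "\<And>x. a \<le> x \<Longrightarrow> x \<le> t \<Longrightarrow> u x \<le> u a + K * (x - a)"
  show "\<forall>\<^sub>F x in at_right t. u x \<le> u a + K * (x - a)"
    unfolding eventually_at_right_shift[of _ t]
    using R[OF t] eventually_at_right_less[of 0]
  proof eventually_elim
    case (elim y)
    have "sR t * y \<le> K * y"
      using K[OF t] elim by (simp add: mult_right_mono)
    moreover have "K * (t + y - a) = K * (t - a) + K * y"
      by (simp add: algebra_simps)
    ultimately show ?case
      using elim IH[OF t(1) order.refl] by linarith
  qed
next
  fix t assume t: "a < t" "t \<le> b" and IH: "\<And>x. a \<le> x \<Longrightarrow> x < t \<Longrightarrow> u x \<le> u a + K * (x - a)"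
  have ev: "\<forall>\<^sub>F y in at_right 0. y < t - a"
    using t by (intro eventually_at_right_real[THEN eventually_mono]) auto
  have "\<forall>\<^sub>F y in at_right 0. u t - sL t * y \<le> u a + K * (t - y - a)"
    using L[OF t] ev eventually_at_right_less[of 0]
  proof eventually_elim
    case (elim y)
    then show ?case using IH[of "t - y"] by simp
  qed
  moreover have "((\<lambda>y. u t - sL t * y) \<longlongrightarrow> u t - sL t * 0) (at_right 0)"
    by (intro tendsto_intros)
  moreover have "((\<lambda>y. u a + K * (t - y - a)) \<longlongrightarrow> u a + K * (t - 0 - a)) (at_right 0)"
    by (intro tendsto_intros)
  ultimately have "u t - sL t * 0 \<le> u a + K * (t - 0 - a)"
    by (intro tendsto_le[of "at_right (0::real)" _ _ "\<lambda>y. u t - sL t * y"]) auto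
  then show "u t \<le> u a + K * (t - a)" by simp
qed (use assms in auto)

lemma slope_bound_below:
  fixes u :: "real \<Rightarrow> real"
  assumes "a \<le> b"
    and R: "\<And>x. a \<le> x \<Longrightarrow> x < b \<Longrightarrow> \<forall>\<^sub>F y in at_right 0. u (x + y) = u x + sR x * y"
    and L: "\<And>x. a < x \<Longrightarrow> x \<le> b \<Longrightarrow> \<forall>\<^sub>F y in at_right 0. u (x - y) = u x - sL x * y"
    and K: "\<And>x. a \<le> x \<Longrightarrow> x < b \<Longrightarrow> K \<le> sR x"
  shows "u a + K * (b - a) \<le> u b"
proof -
  have "- u b \<le> - u a + (- K) * (b - a)"
  proof (rule slope_bound[where u = "\<lambda>x. - u x" and sR = "\<lambda>x. - sR x" and sL = "\<lambda>x. - sL x"])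
    fix x assume "a \<le> x" "x < b"
    from R[OF this] show "\<forall>\<^sub>F y in at_right 0. - u (x + y) = - u x + - sR x * y"
      by eventually_elim simp
  next
    fix x assume "a < x" "x \<le> b"
    from L[OF this] show "\<forall>\<^sub>F y in at_right 0. - u (x - y) = - u x - - sL x * y"
      by eventually_elim simp
  qed (use K \<open>a \<le> b\<close> in auto)
  then show ?thesis by simp
qed

text \<open>From the left only the existence of an affine germ is asked: it provides continuity, and
  the value then follows from the right slopes by the two bounds.\<close>

lemma slope_const:
  fixes u :: "real \<Rightarrow> real"
  assumes "a \<le> b"
    and R: "\<And>x. a \<le> x \<Longrightarrow> x < b \<Longrightarrow> \<forall>\<^sub>F y in at_right 0. u (x + y) = u x + K * y"
    and L: "\<And>x. a < x \<Longrightarrow> x \<le> b \<Longrightarrow> \<exists>k. \<forall>\<^sub>F y in at_right 0. u (x - y) = u x - k * y"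
  shows "u b = u a + K * (b - a)"
proof -
  obtain sL where "\<And>x. a < x \<Longrightarrow> x \<le> b \<Longrightarrow> \<forall>\<^sub>F y in at_right 0. u (x - y) = u x - sL x * y"
    using L by metis
  then show ?thesis
    using slope_bound[of a b u "\<lambda>_. K" sL K] slope_bound_below[of a b u "\<lambda>_. K" sL K] R \<open>a \<le> b\<close> by auto
qed

text \<open>The germ at \<open>x\<close> fixes the function on a whole interval beyond
  \<open>x\<close>, so right slopes are locally constant to the right. This supplies the
  \<open>right\<close> step of \<open>interval_induct\<close>.\<close>

lemma right_slope_near:
  assumes "\<forall>\<^sub>F y in at_right 0. u (x + y) = u x + k * y"
    and "\<forall>\<^sub>F z in at_right x. \<forall>\<^sub>F y in at_right 0. u (z + y) = u z + sR z * (y::real)"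
  shows "\<forall>\<^sub>F z in at_right x. sR z = k"
proof -
  obtain \<delta> where d: "\<delta> > 0" "\<And>y. 0 < y \<Longrightarrow> y < \<delta> \<Longrightarrow> u (x + y) = u x + k * y"
    using assms(1) by (elim at_right_0_obtain) blast
  have "\<forall>\<^sub>F z in at_right x. z < x + \<delta>"
    using d by (intro eventually_at_right_real[THEN eventually_mono]) auto
  with assms(2) eventually_at_right_less[of x] show ?thesis
  proof eventually_elim
    case (elim z)
    have "\<forall>\<^sub>F y in at_right 0. y < x + \<delta> - z"
      using elim by (intro eventually_at_right_real[THEN eventually_mono]) auto
    then have "\<forall>\<^sub>F y in at_right 0. u (z + y) = u z + k * y"
      using eventually_at_right_less[of 0]
    proof eventually_elim
      case (elim y)
      then show ?case
        using d(2)[of "z + y - x"] d(2)[of "z - x"] \<open>x < z\<close> \<open>z < x + \<delta>\<close> by (simp add: algebra_simps)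
    qed
    then show ?case
      using at_right_0_unique(1)[OF elim(1)] by blast
  qed
qed

text \<open>Convexity from local data: slopes are constant just after a point, and passing a point
  replaces the slope \<open>sL\<close> by \<open>sR\<close>, which by \<open>LR\<close> is no
  smaller.\<close>

lemma right_slope_mono:
  fixes u :: "real \<Rightarrow> real"
  assumes R: "\<And>x. a \<le> x \<Longrightarrow> x < b \<Longrightarrow> \<forall>\<^sub>F y in at_right 0. u (x + y) = u x + sR x * y"
    and L: "\<And>x. a < x \<Longrightarrow> x < b \<Longrightarrow> \<forall>\<^sub>F y in at_right 0. u (x - y) = u x - sL x * y"
    and LR: "\<And>x. a < x \<Longrightarrow> x < b \<Longrightarrow> sL x \<le> sR x"
    and "a \<le> x" "x \<le> z" "z < b"
  shows "sR x \<le> sR z"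
proof (rule interval_induct[where P = "\<lambda>t. sR x \<le> sR t" and a = x and b = z])
  fix t assume t: "x \<le> t" "t < z" and IH: "\<And>y. x \<le> y \<Longrightarrow> y \<le> t \<Longrightarrow> sR x \<le> sR y"
  have "\<forall>\<^sub>F y in at_right t. \<forall>\<^sub>F d in at_right 0. u (y + d) = u y + sR y * d"
    using R assms t by (intro eventually_mono[OF eventually_at_right_real[of t z]]) auto
  then have "\<forall>\<^sub>F y in at_right t. sR y = sR t"
    using R assms t by (intro right_slope_near[of u]) auto
  then show "\<forall>\<^sub>F y in at_right t. sR x \<le> sR y"
    by eventually_elim (use IH t in auto)
next
  fix t assume t: "x < t" "t \<le> z" and IH: "\<And>y. x \<le> y \<Longrightarrow> y < t \<Longrightarrow> sR x \<le> sR y"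
  have tb: "a < t" "t < b" using t assms by auto
  obtain \<delta> where d: "\<delta> > 0" "\<And>y. 0 < y \<Longrightarrow> y < \<delta> \<Longrightarrow> u (t - y) = u t - sL t * y"
    using L[OF tb] by (elim at_right_0_obtain) blast
  \<comment> \<open>The point \<open>t - y\<close> lies in the left germ of \<open>t\<close>, where
    the right slope is already \<open>sL t\<close>, and not before \<open>x\<close>, so that the
    induction hypothesis speaks about it.\<close>
  define y where "y = min (\<delta> / 2) (t - x)"
  have y: "0 < y" "y < \<delta>" "x \<le> t - y"
    using d t by (auto simp: y_def min_less_iff_disj)
  have "\<forall>\<^sub>F e in at_right 0. e < y"
    using y by (intro eventually_at_right_real[THEN eventually_mono]) auto
  then have "\<forall>\<^sub>F e in at_right 0. u (t - y + e) = u (t - y) + sL t * e"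
    using eventually_at_right_less[of 0]
  proof eventually_elim
    case (elim e)
    then show ?case
      using d(2)[of "y - e"] d(2)[of y] y by (simp add: algebra_simps)
  qed
  moreover have "\<forall>\<^sub>F e in at_right 0. u (t - y + e) = u (t - y) + sR (t - y) * e"
    using R[of "t - y"] y assms t by auto
  ultimately have "sR (t - y) = sL t"
    using at_right_0_unique(1)[of "\<lambda>e. u (t - y + e)"] by blast
  then show "sR x \<le> sR t"
    using IH[of "t - y"] y LR[OF tb] by simp
qed (use assms in auto)

section \<open>Finite combinatorics\<close>

text \<open>Lists of levels and lists of chips on an edge are compared through a common index set.
  Values may tie, but families with the same order, ties included, have sorted lists that match
  entry by entry.\<close>

lemma sorted_list_of_set_indexed:
  fixes x :: "'k \<Rightarrow> 'a::linorder" and y :: "'k \<Rightarrow> 'b::linorder"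
  assumes "finite K" and ord: "\<And>k l. k \<in> K \<Longrightarrow> l \<in> K \<Longrightarrow> x k < x l \<longleftrightarrow> y k < y l"
    and F: "\<And>k. k \<in> K \<Longrightarrow> F (x k) = G (y k)"
  shows "map F (sorted_list_of_set (x ` K)) = map G (sorted_list_of_set (y ` K))"
proof -
  \<comment> \<open>Any index with value \<open>v\<close> may be picked, since the two families have
    the same ties by \<open>eq\<close>.\<close>
  define \<theta> where "\<theta> v = y (inv_into K x v)" for v
  have eq: "x k = x l \<longleftrightarrow> y k = y l" if "k \<in> K" "l \<in> K" for k l
    using ord[OF that] ord[OF that(2,1)] by (metis linorder_less_linear order_less_irrefl)
  have \<theta>: "\<theta> (x k) = y k" if "k \<in> K" for k
    using eq[of "inv_into K x (x k)" k] that
    by (simp add: \<theta>_def f_inv_into_f inv_into_into)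
  define xs where "xs = sorted_list_of_set (x ` K)"
  have xs: "set xs = x ` K" "sorted_wrt (<) xs"
    using assms(1) by (auto simp: xs_def)
  have "sorted_wrt (<) (map \<theta> xs)"
    unfolding sorted_wrt_map
    by (rule sorted_wrt_mono_rel[OF _ xs(2)]) (use xs(1) ord \<theta> in auto)
  moreover have "set (map \<theta> xs) = y ` K"
    using xs(1) \<theta> by (auto simp: image_image)
  ultimately have "sorted_list_of_set (y ` K) = map \<theta> xs"
    using \<open>finite K\<close> by (metis finite_imageI strict_sorted_equal set_sorted_list_of_set strict_sorted_list_of_set)
  then show ?thesis
    using xs(1) F \<theta> by (auto simp: xs_def)
qed

text \<open>Totality and transitivity survive reversing \<open>le\<close>, so the lemma also yields
  greatest elements.\<close>

lemma finite_chain_least: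
  assumes "finite A" "A \<noteq> {}"
    and total: "\<And>p q. p \<in> A \<Longrightarrow> q \<in> A \<Longrightarrow> le p q \<or> le q p"
    and trans: "\<And>p q r. le p q \<Longrightarrow> le q r \<Longrightarrow> le p r"
  shows "\<exists>p\<in>A. \<forall>q\<in>A. le p q"
  using assms(1,2,3)
proof (induction rule: finite_ne_induct)
  case (singleton x)
  then show ?case by blast
next
  case (insert x F)
  have "\<exists>p\<in>F. \<forall>q\<in>F. le p q"
    by (rule insert.IH) (use insert.prems in blast)
  then obtain p where p: "p \<in> F" "\<forall>q\<in>F. le p q" by blast
  have xx: "le x x" using insert.prems[of x x] by blast
  have "le p x \<or> le x p" using insert.prems[of p x] p by blast
  then show ?case
  proof
    assume "le p x"
    with p show ?thesis by blast
  next
    assume "le x p"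
    with p(2) trans xx show ?thesis by blast
  qed
qed

text \<open>For positive weights the chain cuts the interval from 0 to 1 into consecutive half-open
  pieces of length \<open>w p\<close>, the greatest element lowest; \<open>p\<close> is the element
  whose piece contains \<open>h\<close>.\<close>

lemma upsum_chain:
  fixes w :: "'p \<Rightarrow> real"
  assumes "finite \<sigma>" and sum1: "sum w \<sigma> = 1"
    and total: "\<And>p q. p \<in> \<sigma> \<Longrightarrow> q \<in> \<sigma> \<Longrightarrow> le p q \<or> le q p"
    and trans: "\<And>p q r. le p q \<Longrightarrow> le q r \<Longrightarrow> le p r"
    and antisym: "\<And>p q. le p q \<Longrightarrow> le q p \<Longrightarrow> p = q"
    and h: "0 < h" "h \<le> 1"
  obtains p where "p \<in> \<sigma>" "sum w {q \<in> \<sigma>. le p q \<and> q \<noteq> p} < h" "h \<le> sum w {q \<in> \<sigma>. le p q}"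
proof -
  let ?U = "\<lambda>p. {q \<in> \<sigma>. le p q}"
  define A where "A = {p \<in> \<sigma>. h \<le> sum w (?U p)}"
  have fin: "finite A" using assms(1) by (simp add: A_def)
  have ne: "\<sigma> \<noteq> {}" using sum1 by auto
  obtain p0 where p0: "p0 \<in> \<sigma>" "\<forall>q\<in>\<sigma>. le p0 q"
    using finite_chain_least[OF assms(1) ne, of le] total trans by metis
  have "?U p0 = \<sigma>" using p0 by blast
  then have "p0 \<in> A" using p0 sum1 h by (simp add: A_def)
  then have "A \<noteq> {}" by blast
  then have "\<exists>p\<in>A. \<forall>q\<in>A. le q p"
    by (rule finite_chain_least[OF fin]) (use total trans in \<open>auto simp: A_def\<close>)
  then obtain p where p: "p \<in> A" "\<forall>q\<in>A. le q p" by blast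
  let ?S = "{q \<in> \<sigma>. le p q \<and> q \<noteq> p}"
  have "sum w ?S < h"
  proof (cases "?S = {}")
    case False
    have "finite ?S" using assms(1) by simp
    then have "\<exists>q\<in>?S. \<forall>q'\<in>?S. le q q'"
      by (rule finite_chain_least[OF _ False]) (use total trans in auto)
    \<comment> \<open>\<open>q\<close> is the successor of \<open>p\<close> in the chain, so
      everything from \<open>q\<close> upwards is everything strictly above \<open>p\<close>. By the
      choice of \<open>p\<close> its total weight is less than \<open>h\<close>.\<close>
    then obtain q where q: "q \<in> ?S" "\<forall>q'\<in>?S. le q q'" by blast
    have "?U q = ?S"
    proof (intro equalityI subsetI)
      fix x assume x: "x \<in> ?U q"
      have "x \<noteq> p" using x q(1) antisym[of p q] by auto
      then show "x \<in> ?S" using x q(1) trans[of p q x] by auto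
    qed (use q in auto)
    moreover have "q \<notin> A" using p(2) q(1) antisym[of p q] by auto
    ultimately show ?thesis using q(1) by (simp add: A_def)
  next
    case True
    then show ?thesis using h by (metis sum.empty)
  qed
  with p(1) that show thesis by (auto simp: A_def)
qed

text \<open>An up-closed condition \<open>Q\<close> that fails at \<open>p\<close> can hold only
  strictly above \<open>p\<close>, where the total weight is less than \<open>h\<close>; if it holds
  at \<open>p\<close>, it holds for everything counted in the second bound on
  \<open>h\<close>.\<close>

lemma upsum_threshold:
  fixes w :: "'p \<Rightarrow> real"
  assumes "finite \<sigma>" and pos: "\<And>p. p \<in> \<sigma> \<Longrightarrow> 0 < w p" and p: "p \<in> \<sigma>"
    and total: "\<And>p q. p \<in> \<sigma> \<Longrightarrow> q \<in> \<sigma> \<Longrightarrow> le p q \<or> le q p"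
    and up: "\<And>p q. Q p \<Longrightarrow> le p q \<Longrightarrow> Q q"
    and "sum w {q \<in> \<sigma>. le p q \<and> q \<noteq> p} < h" "h \<le> sum w {q \<in> \<sigma>. le p q}"
  shows "h \<le> sum w {q \<in> \<sigma>. Q q} \<longleftrightarrow> Q p"
proof
  assume "Q p"
  then have "sum w {q \<in> \<sigma>. le p q} \<le> sum w {q \<in> \<sigma>. Q q}"
    using assms(1) by (intro sum_mono2) (auto intro: up dest: pos less_imp_le)
  then show "h \<le> sum w {q \<in> \<sigma>. Q q}" using assms by simp
next
  assume h: "h \<le> sum w {q \<in> \<sigma>. Q q}"
  show "Q p"
  proof (rule ccontr)
    assume nQ: "\<not> Q p"
    have "{q \<in> \<sigma>. Q q} \<subseteq> {q \<in> \<sigma>. le p q \<and> q \<noteq> p}"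
      using nQ up total p by blast
    then have "sum w {q \<in> \<sigma>. Q q} \<le> sum w {q \<in> \<sigma>. le p q \<and> q \<noteq> p}"
      using assms(1) by (intro sum_mono2) (auto dest: pos less_imp_le)
    then show False using h assms by simp
  qed
qed

text \<open>The layer cake formula: the disjoint fibres of \<open>G\<close> over the
  \<open>p\<close> with \<open>Q p\<close> fill the interval from 0 to \<open>v\<close>, so their
  lengths add up to \<open>v\<close>. Convexity makes the fibres measurable.\<close>

lemma layer_cake_sum:
  fixes G :: "real \<Rightarrow> 'p"
  assumes "finite P" and conv: "\<And>p. p \<in> P \<Longrightarrow> convex {h. 0 < h \<and> h \<le> e \<and> G h = p}"
    and GP: "\<And>h. 0 < h \<Longrightarrow> h \<le> e \<Longrightarrow> G h \<in> P"
    and Q: "\<And>h. 0 < h \<Longrightarrow> h \<le> e \<Longrightarrow> Q (G h) \<longleftrightarrow> h \<le> v" and v: "0 \<le> v" "v \<le> e"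
  shows "(\<Sum>p\<in>{p\<in>P. Q p}. measure lebesgue {h. 0 < h \<and> h \<le> e \<and> G h = p}) = v"
proof -
  let ?A = "\<lambda>p. {h. 0 < h \<and> h \<le> e \<and> G h = p}"
  have "?A p \<in> lmeasurable" if "p \<in> P" for p
    by (rule measurable_convex[OF conv[OF that]])
      (rule bounded_subset[of "{0..e}"], auto)
  then have "measure lebesgue (\<Union>p\<in>{p\<in>P. Q p}. ?A p) = (\<Sum>p\<in>{p\<in>P. Q p}. measure lebesgue (?A p))"
    using assms(1) by (intro measure_UNION_AE) (auto simp: disjoint_family_on_def pairwise_def fmeasurableD intro!: AE_I2)
  moreover have "(\<Union>p\<in>{p\<in>P. Q p}. ?A p) = {0<..v}"
    using GP Q v by (auto; metis order.trans)
  moreover have "measure lebesgue {0<..v} = v" using v by simp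
  ultimately show ?thesis by simp
qed

text \<open>The system is upper triangular with positive diagonal entries \<open>m\<close>, so it is
  solved from \<open>M\<close> downwards.\<close>

lemma triangular_unique:
  fixes t t' :: "nat \<Rightarrow> real"
  assumes "\<And>m. 1 \<le> m \<Longrightarrow> m \<le> M \<Longrightarrow>
      real m * t m + sum t {m<..M} = real m * t' m + sum t' {m<..M}"
    and "1 \<le> m" "m \<le> M"
  shows "t m = t' m"
  using assms(2,3)
proof (induction "M - m" arbitrary: m rule: less_induct)
  case less
  have "sum t {m<..M} = sum t' {m<..M}"
    by (rule sum.cong) (use less in auto)
  then show ?case using assms(1)[of m] less.prems by auto
qed

text \<open>Two affine paths over the unit interval that either never meet or coincide cannot
  exchange their order.\<close>

lemma affine_order_agree:
  fixes a b c d :: real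
  assumes "\<And>s. 0 \<le> s \<Longrightarrow> s \<le> 1 \<Longrightarrow> (1 - s) * a + s * b = (1 - s) * c + s * d \<Longrightarrow> a = c \<and> b = d"
  shows "a < c \<longleftrightarrow> b < d"
proof -
  have False if "(a - c) * (b - d) \<le> 0" "a \<noteq> c \<or> b \<noteq> d"
  proof -
    \<comment> \<open>\<open>s\<close> is the zero of the difference, which moves affinely from
      \<open>p\<close> to \<open>q\<close>. It lies in the unit interval when \<open>p\<close> and
      \<open>q\<close> do not have the same strict sign.\<close>
    define p q s where "p = a - c" and "q = b - d" and "s = p / (p - q)"
    have pq: "p * q \<le> 0" "p \<noteq> 0 \<or> q \<noteq> 0"
      using that by (auto simp: p_def q_def)
    then have "p \<noteq> q"
      by (metis mult_eq_0_iff order_antisym zero_le_square)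
    have "0 \<le> s" "s \<le> 1"
      using pq \<open>p \<noteq> q\<close> by (auto simp: s_def mult_le_0_iff divide_simps)
    moreover have "(1 - s) * p + s * q = 0"
      using \<open>p \<noteq> q\<close> by (simp add: s_def field_simps)
    then have "(1 - s) * a + s * b = (1 - s) * c + s * d"
      by (simp add: p_def q_def algebra_simps)
    ultimately show False
      using assms that(2) by blast
  qed
  then have "(a - c) * (b - d) > 0 \<or> a = c \<and> b = d"
    by (meson linorder_not_less)
  then show ?thesis
    by (auto simp: zero_less_mult_iff)
qed

section \<open>Realizations of finite simplicial complexes\<close>

text \<open>A finite union of closed simplices. Each is a closed slice of a product of compact sets,
  hence compact by Tychonoff, and \<open>down\<close> puts its faces into the realization
  too.\<close>

lemma compact_realization:
  assumes "finite P" and K: "K \<subseteq> Pow P" and fin: "\<And>\<sigma>. \<sigma> \<in> K \<Longrightarrow> \<sigma> \<noteq> {}"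
    and down: "\<And>\<sigma> \<tau>. \<sigma> \<in> K \<Longrightarrow> \<tau> \<subseteq> \<sigma> \<Longrightarrow> \<tau> \<noteq> {} \<Longrightarrow> \<tau> \<in> K"
  shows "compact (realization K)"
proof -
  \<comment> \<open>Points are functions on the whole type, so the coordinates outside
    \<open>\<sigma>\<close> are pinned to 0 to obtain a compact product.\<close>
  define \<Delta> where "\<Delta> \<sigma> = {w \<in> Pi\<^sub>E UNIV (\<lambda>p. if p \<in> \<sigma> then {0..1::real} else {0}). sum w \<sigma> = 1}" for \<sigma> :: "'a set"
  have "realization K = (\<Union>\<sigma>\<in>K. \<Delta> \<sigma>)"
  proof (intro equalityI subsetI)
    fix w assume w: "w \<in> realization K"
    define \<sigma> where "\<sigma> = {p. w p \<noteq> 0}"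
    have "\<sigma> \<in> K" "sum w \<sigma> = 1" and nn: "\<And>p. 0 \<le> w p"
      using w by (auto simp: realization_def \<sigma>_def)
    have "finite \<sigma>" using \<open>\<sigma> \<in> K\<close> K assms(1) by (auto intro: finite_subset)
    have "w p \<le> 1" if "p \<in> \<sigma>" for p
      using member_le_sum[OF that, of w] nn \<open>finite \<sigma>\<close> \<open>sum w \<sigma> = 1\<close> by auto
    then have "w \<in> \<Delta> \<sigma>"
      using nn \<open>sum w \<sigma> = 1\<close> by (auto simp: \<Delta>_def \<sigma>_def PiE_def Pi_def)
    with \<open>\<sigma> \<in> K\<close> show "w \<in> (\<Union>\<sigma>\<in>K. \<Delta> \<sigma>)" by blast
  next
    fix w assume "w \<in> (\<Union>\<sigma>\<in>K. \<Delta> \<sigma>)"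
    then obtain \<sigma> where \<sigma>: "\<sigma> \<in> K" "w \<in> \<Delta> \<sigma>" by blast
    have w: "w p \<in> (if p \<in> \<sigma> then {0..1} else {0})" for p
      using \<sigma>(2) by (auto simp: \<Delta>_def PiE_def Pi_def)
    have nn: "0 \<le> w p" for p using w[of p] by (auto split: if_splits)
    have sub: "{p. w p \<noteq> 0} \<subseteq> \<sigma>" using w by (auto split: if_splits) (metis singletonD)
    have "finite \<sigma>" using \<sigma>(1) K assms(1) by (auto intro: finite_subset)
    then have "sum w {p. w p \<noteq> 0} = sum w \<sigma>" using sub by (intro sum.mono_neutral_left) auto
    also have "\<dots> = 1" using \<sigma>(2) by (simp add: \<Delta>_def)
    finally have s: "sum w {p. w p \<noteq> 0} = 1" .
    then have "{p. w p \<noteq> 0} \<noteq> {}" by (metis sum.empty zero_neq_one)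
    then show "w \<in> realization K"
      using down[OF \<sigma>(1) sub] nn s by (auto simp: realization_def)
  qed
  moreover have "compact (\<Delta> \<sigma>)" if "\<sigma> \<in> K" for \<sigma>
  proof -
    have "compactin (product_topology (\<lambda>_. euclidean) UNIV) (Pi\<^sub>E UNIV (\<lambda>p. if p \<in> \<sigma> then {0..1::real} else {0}))"
      by (subst compactin_PiE) auto
    then have "compact (Pi\<^sub>E UNIV (\<lambda>p. if p \<in> \<sigma> then {0..1::real} else {0}))"
      by (simp add: euclidean_product_topology)
    moreover have "closed {w::'a \<Rightarrow> real. sum w \<sigma> = 1}"
      by (intro closed_Collect_eq continuous_on_sum continuous_on_product_coordinates continuous_intros)
    ultimately show ?thesis
      unfolding \<Delta>_def Collect_conj_eq Collect_mem_eq by (rule compact_Int_closed)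
  qed
  moreover have "finite K" using assms(1) K by (meson finite_Pow_iff finite_subset)
  ultimately show ?thesis by auto
qed

section \<open>Topology of a tropical curve\<close>

locale tropical =
  fixes \<Gamma> :: "('v, 'e) metric_graph"
  assumes tropical: "tropical_curve \<Gamma>"
begin

abbreviation E where "E \<equiv> arcs (model \<Gamma>)"
abbreviation \<l> where "\<l> \<equiv> len \<Gamma>"
abbreviation ep where "ep \<equiv> epoint \<Gamma>"
abbreviation X where "X \<equiv> curve_top \<Gamma>"
abbreviation pts where "pts \<equiv> points \<Gamma>"

lemma fin_digraph: "fin_digraph (model \<Gamma>)"
  and verts_ne: "verts (model \<Gamma>) \<noteq> {}"
  and connected: "connected_space X"
  and len_pos: "e \<in> E \<Longrightarrow> 0 < \<l> e"
  and len_inf: "e \<in> E \<Longrightarrow> \<l> e = \<infinity> \<Longrightarrow> valence \<Gamma> (Vert (head (model \<Gamma>) e)) = 1"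
  using tropical by (auto simp: tropical_curve_def)

lemma finite_E: "finite E" and finite_verts: "finite (verts (model \<Gamma>))"
  using fin_digraph by (auto simp: fin_digraph.finite_arcs fin_digraph.finite_verts)

lemma tail_in: "e \<in> E \<Longrightarrow> tail (model \<Gamma>) e \<in> verts (model \<Gamma>)"
  and head_in: "e \<in> E \<Longrightarrow> head (model \<Gamma>) e \<in> verts (model \<Gamma>)"
  using fin_digraph by (meson fin_digraph.axioms(1) wf_digraph.tail_in_verts wf_digraph.head_in_verts)+

lemma Vert_in_pts [simp]: "Vert v \<in> pts \<longleftrightarrow> v \<in> verts (model \<Gamma>)"
  by (auto simp: points_def)

lemma Inner_in_pts [simp]: "Inner e t \<in> pts \<longleftrightarrow> e \<in> E \<and> 0 < t \<and> ereal t < \<l> e"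
  by (auto simp: points_def)

lemma ep_0 [simp]: "ep e 0 = Vert (tail (model \<Gamma>) e)"
  by (simp add: epoint_def)

lemma ep_len: "e \<in> E \<Longrightarrow> ep e (\<l> e) = Vert (head (model \<Gamma>) e)"
  using len_pos[of e] by (auto simp: epoint_def)

lemma ep_Inner: "0 < t \<Longrightarrow> ereal t < \<l> e \<Longrightarrow> ep e (ereal t) = Inner e t"
  by (auto simp: epoint_def)

lemma ep_in_pts: "e \<in> E \<Longrightarrow> ep e t \<in> pts"
  by (cases t) (auto simp: epoint_def tail_in head_in)

lemma pts_cases:
  assumes "x \<in> pts"
  obtains v where "v \<in> verts (model \<Gamma>)" "x = Vert v"
  | e t where "e \<in> E" "0 < t" "ereal t < \<l> e" "x = Inner e t" "x = ep e (ereal t)"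
  using assms by (auto simp: points_def ep_Inner)

lemma edge_coord_cases:
  assumes "0 \<le> t" "t \<le> \<l> e"
  obtains "t = 0" | "t = \<l> e" | a where "t = ereal a" "0 < a" "ereal a < \<l> e"
  using assms by (cases t) (auto simp: order_less_le)

lemma istopology_curve: "istopology (\<lambda>U. U \<subseteq> pts \<and>
    (\<forall>e\<in>E. openin (top_of_set {0..\<l> e}) {t \<in> {0..\<l> e}. ep e t \<in> U}))"
  unfolding istopology_def
proof (intro conjI[of "All _"] allI impI; (elim conjE)?)
  fix S T
  assume S: "S \<subseteq> pts" "\<forall>e\<in>E. openin (top_of_set {0..\<l> e}) {t \<in> {0..\<l> e}. ep e t \<in> S}"
    and T: "T \<subseteq> pts" "\<forall>e\<in>E. openin (top_of_set {0..\<l> e}) {t \<in> {0..\<l> e}. ep e t \<in> T}"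
  have "{t \<in> {0..\<l> e}. ep e t \<in> S \<inter> T} = {t \<in> {0..\<l> e}. ep e t \<in> S} \<inter> {t \<in> {0..\<l> e}. ep e t \<in> T}" for e
    by auto
  then have "openin (top_of_set {0..\<l> e}) {t \<in> {0..\<l> e}. ep e t \<in> S \<inter> T}" if "e \<in> E" for e
    using openin_Int[OF bspec[OF S(2) that] bspec[OF T(2) that]] by (simp only:)
  then show "S \<inter> T \<subseteq> pts \<and> (\<forall>e\<in>E. openin (top_of_set {0..\<l> e}) {t \<in> {0..\<l> e}. ep e t \<in> S \<inter> T})"
    using S(1) by blast
next
  fix K
  assume K: "\<forall>U\<in>K. U \<subseteq> pts \<and> (\<forall>e\<in>E. openin (top_of_set {0..\<l> e}) {t \<in> {0..\<l> e}. ep e t \<in> U})"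
  have "{t \<in> {0..\<l> e}. ep e t \<in> \<Union> K} = \<Union> ((\<lambda>U. {t \<in> {0..\<l> e}. ep e t \<in> U}) ` K)" for e
    by auto
  moreover have "openin (top_of_set {0..\<l> e}) (\<Union> ((\<lambda>U. {t \<in> {0..\<l> e}. ep e t \<in> U}) ` K))"
    if "e \<in> E" for e
    by (rule openin_Union) (use K that in blast)
  ultimately have "openin (top_of_set {0..\<l> e}) {t \<in> {0..\<l> e}. ep e t \<in> \<Union> K}" if "e \<in> E" for e
    using that by (simp only:)
  then show "\<Union> K \<subseteq> pts \<and> (\<forall>e\<in>E. openin (top_of_set {0..\<l> e}) {t \<in> {0..\<l> e}. ep e t \<in> \<Union> K})"
    using K by blast
qed

lemma openin_curve: "openin X U \<longleftrightarrow> U \<subseteq> pts \<and>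
    (\<forall>e\<in>E. openin (top_of_set {0..\<l> e}) {t \<in> {0..\<l> e}. ep e t \<in> U})"
  unfolding curve_top_def using istopology_curve by (simp only: topology_inverse')

lemma topspace_curve [simp]: "topspace X = pts"
proof
  show "topspace X \<subseteq> pts"
    unfolding topspace_def by (auto simp: openin_curve)
  have "{t \<in> {0..\<l> e}. ep e t \<in> pts} = {0..\<l> e}" if "e \<in> E" for e
    using ep_in_pts[OF that] by auto
  then have "openin X pts"
    by (simp add: openin_curve)
  then show "pts \<subseteq> topspace X"
    by (rule openin_subset)
qed

lemma closedin_curve: "closedin X C \<longleftrightarrow> C \<subseteq> pts \<and> (\<forall>e\<in>E. closed {t \<in> {0..\<l> e}. ep e t \<in> C})"
proof -
  have "openin (top_of_set {0..\<l> e}) {t \<in> {0..\<l> e}. ep e t \<in> pts - C} \<longleftrightarrow>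
      closed {t \<in> {0..\<l> e}. ep e t \<in> C}" if "e \<in> E" for e
  proof -
    have "{t \<in> {0..\<l> e}. ep e t \<in> pts - C} = {0..\<l> e} - {t \<in> {0..\<l> e}. ep e t \<in> C}"
      using ep_in_pts[OF that] by auto
    moreover have "closed {t \<in> {0..\<l> e}. ep e t \<in> C} \<longleftrightarrow>
        closedin (top_of_set {0..\<l> e}) {t \<in> {0..\<l> e}. ep e t \<in> C}"
      by (rule iffI) (auto intro: closed_subset closedin_closed_trans)
    ultimately show ?thesis
      unfolding closedin_def by (simp only: topspace_euclidean_subtopology) blast
  qed
  then show ?thesis
    by (auto simp: closedin_def openin_curve)
qed

lemma continuous_map_ep: "e \<in> E \<Longrightarrow> continuous_map (top_of_set {0..\<l> e}) X (ep e)"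
  unfolding continuous_map_def using ep_in_pts by (auto simp: openin_curve)

lemma continuous_map_from_curve:
  "continuous_map X (euclidean :: 'b::topological_space topology) f \<longleftrightarrow>
     (\<forall>e\<in>E. continuous_on {0..\<l> e} (f \<circ> ep e))"
proof
  assume "continuous_map X euclidean f"
  then show "\<forall>e\<in>E. continuous_on {0..\<l> e} (f \<circ> ep e)"
    using continuous_map_compose[OF continuous_map_ep] by (metis continuous_map_iff_continuous)
next
  assume R: "\<forall>e\<in>E. continuous_on {0..\<l> e} (f \<circ> ep e)"
  have "openin X {x \<in> pts. f x \<in> U}" if "open U" for U
    unfolding openin_curve
  proof (intro conjI ballI)
    fix e assume e: "e \<in> E"
    have "{t \<in> {0..\<l> e}. ep e t \<in> {x \<in> pts. f x \<in> U}} = {0..\<l> e} \<inter> (f \<circ> ep e) -` U"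
      using ep_in_pts[OF e] by auto
    then show "openin (top_of_set {0..\<l> e}) {t \<in> {0..\<l> e}. ep e t \<in> {x \<in> pts. f x \<in> U}}"
      using R e that by (simp add: continuous_openin_preimage_gen)
  qed auto
  then show "continuous_map X euclidean f"
    by (simp add: continuous_map)
qed

lemma compact_space_curve: "compact_space X"
proof -
  have "compactin X (ep e ` {0..\<l> e})" if "e \<in> E" for e
    by (rule image_compactin[OF _ continuous_map_ep[OF that]])
      (auto simp: compactin_subtopology compact_eq_closed)
  \<comment> \<open>The vertices are listed separately because the curve may be a single vertex
    without edges.\<close>
  moreover have "compactin X {Vert v}" if "v \<in> verts (model \<Gamma>)" for v
    using that by simp
  ultimately have "compactin X (\<Union> ((\<lambda>e. ep e ` {0..\<l> e}) ` E \<union> (\<lambda>v. {Vert v}) ` verts (model \<Gamma>)))"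
    using finite_E finite_verts by (intro compactin_Union) auto
  moreover have "\<Union> ((\<lambda>e. ep e ` {0..\<l> e}) ` E \<union> (\<lambda>v. {Vert v}) ` verts (model \<Gamma>)) = pts"
  proof (intro equalityI subsetI)
    fix x assume "x \<in> pts"
    then show "x \<in> \<Union> ((\<lambda>e. ep e ` {0..\<l> e}) ` E \<union> (\<lambda>v. {Vert v}) ` verts (model \<Gamma>))"
    proof (cases rule: pts_cases)
      case (2 e t)
      then have "ereal t \<in> {0..\<l> e}" by auto
      with 2 show ?thesis by blast
    qed auto
  qed (auto simp: ep_in_pts)
  ultimately show ?thesis
    by (simp add: compact_space_def)
qed

text \<open>This makes compact subgraphs closed. Points are separated by two kinds of basic open
  sets, stars around vertices and open intervals inside edges.\<close>

lemma Hausdorff_curve: "Hausdorff_space X"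
proof -
  have sepI: "\<exists>U V. openin X U \<and> openin X V \<and> x \<in> U \<and> y \<in> V \<and> disjnt U V"
    if "openin X U" "openin X V" "disjnt U V" "x \<in> U" "y \<in> V" for x y U V
    using that by blast
  have mid: "\<exists>c. 0 < c \<and> ereal c < \<l> e" if "e \<in> E" for e
    using ereal_dense2[OF len_pos[OF that]] by (metis ereal_less(2))
  \<comment> \<open>\<open>\<alpha> e\<close> cuts the star at the tail of \<open>e\<close> and
    \<open>\<beta> e\<close> at its head; a loop contributes both of its ends.\<close>
  define star where "star \<alpha> \<beta> v = insert (Vert v) {Inner e t |e t. Inner e t \<in> pts \<and>
      (tail (model \<Gamma>) e = v \<and> t < \<alpha> e \<or> head (model \<Gamma>) e = v \<and> \<beta> e < t)}"
    for \<alpha> \<beta> :: "'e \<Rightarrow> real" and v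
  have star: "openin X (star \<alpha> \<beta> v)"
    if v: "v \<in> verts (model \<Gamma>)" and \<alpha>: "\<And>e. e \<in> E \<Longrightarrow> 0 < \<alpha> e \<and> ereal (\<alpha> e) < \<l> e"
      and \<beta>: "\<And>e. e \<in> E \<Longrightarrow> 0 < \<beta> e \<and> ereal (\<beta> e) < \<l> e" for \<alpha> \<beta> v
    unfolding openin_curve
  proof (intro conjI ballI)
    show "star \<alpha> \<beta> v \<subseteq> pts" using v by (auto simp: star_def)
    fix e assume e: "e \<in> E"
    let ?V = "(if tail (model \<Gamma>) e = v then {..<ereal (\<alpha> e)} else {}) \<union>
        (if head (model \<Gamma>) e = v then {ereal (\<beta> e)<..} else {})"
    have "{t \<in> {0..\<l> e}. ep e t \<in> star \<alpha> \<beta> v} = {0..\<l> e} \<inter> ?V"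
    proof (intro set_eqI iffI)
      fix t assume t: "t \<in> {t \<in> {0..\<l> e}. ep e t \<in> star \<alpha> \<beta> v}"
      then have "0 \<le> t" "t \<le> \<l> e" by auto
      then show "t \<in> {0..\<l> e} \<inter> ?V"
        by (cases rule: edge_coord_cases) (use t \<alpha>[OF e] \<beta>[OF e] e in \<open>auto simp: star_def ep_len ep_Inner\<close>)
    next
      fix t assume t: "t \<in> {0..\<l> e} \<inter> ?V"
      then have "0 \<le> t" "t \<le> \<l> e" by auto
      then show "t \<in> {t \<in> {0..\<l> e}. ep e t \<in> star \<alpha> \<beta> v}"
        by (cases rule: edge_coord_cases) (use t \<alpha>[OF e] \<beta>[OF e] e in \<open>auto simp: star_def ep_len ep_Inner split: if_splits\<close>)
    qed
    moreover have "open ?V" by auto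
    ultimately show "openin (top_of_set {0..\<l> e}) {t \<in> {0..\<l> e}. ep e t \<in> star \<alpha> \<beta> v}"
      by (simp add: openin_open_Int)
  qed
  have int: "openin X (Inner e ` {\<alpha><..<\<beta>})" if e: "e \<in> E" and "0 \<le> \<alpha>" "ereal \<beta> \<le> \<l> e" for e \<alpha> \<beta>
    unfolding openin_curve
  proof (intro conjI ballI)
    have "ereal t < \<l> e" if "t < \<beta>" for t
      using that \<open>ereal \<beta> \<le> \<l> e\<close> by (metis ereal_less_eq(3) less_ereal.simps(1) order_less_le_trans)
    with that show "Inner e ` {\<alpha><..<\<beta>} \<subseteq> pts" by auto
    fix e' assume e': "e' \<in> E"
    have "{t \<in> {0..\<l> e'}. ep e' t \<in> Inner e ` {\<alpha><..<\<beta>}} =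
        {0..\<l> e'} \<inter> (if e' = e then {ereal \<alpha><..<ereal \<beta>} else {})"
    proof (intro set_eqI iffI)
      fix t assume t: "t \<in> {t \<in> {0..\<l> e'}. ep e' t \<in> Inner e ` {\<alpha><..<\<beta>}}"
      then have "0 \<le> t" "t \<le> \<l> e'" by auto
      then show "t \<in> {0..\<l> e'} \<inter> (if e' = e then {ereal \<alpha><..<ereal \<beta>} else {})"
        by (cases rule: edge_coord_cases) (use t e' in \<open>auto simp: ep_len ep_Inner\<close>)
    next
      fix t assume t: "t \<in> {0..\<l> e'} \<inter> (if e' = e then {ereal \<alpha><..<ereal \<beta>} else {})"
      then have "0 \<le> t" "t \<le> \<l> e'" by auto
      then show "t \<in> {t \<in> {0..\<l> e'}. ep e' t \<in> Inner e ` {\<alpha><..<\<beta>}}"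
        by (cases rule: edge_coord_cases) (use t e' that in \<open>auto simp: ep_len ep_Inner split: if_splits\<close>)
    qed
    then show "openin (top_of_set {0..\<l> e'}) {t \<in> {0..\<l> e'}. ep e' t \<in> Inner e ` {\<alpha><..<\<beta>}}"
      by (simp add: openin_open_Int)
  qed
  \<comment> \<open>With one interior coordinate per edge serving as both cuts, the stars of two
    different vertices share no point of an edge.\<close>
  obtain c where c: "\<And>e. e \<in> E \<Longrightarrow> 0 < c e \<and> ereal (c e) < \<l> e"
    using mid by metis
  have VI: "\<exists>U V. openin X U \<and> openin X V \<and> Vert v \<in> U \<and> Inner e t \<in> V \<and> disjnt U V"
    if v: "v \<in> verts (model \<Gamma>)" and et: "e \<in> E" "0 < t" "ereal t < \<l> e" for v e t
  proof -
    obtain b where b: "t < b" "ereal b < \<l> e"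
      using ereal_dense2[OF et(3)] by auto
    let ?\<alpha> = "c(e := t/2)" and ?\<beta> = "c(e := b)"
    have "ereal (t/2) < \<l> e" using et(2) by (intro le_less_trans[OF _ et(3)]) simp
    then have "openin X (star ?\<alpha> ?\<beta> v)"
      using c et b v by (intro star) auto
    moreover have "openin X (Inner e ` {t/2<..<b})"
      using et b by (intro int) auto
    moreover have "disjnt (star ?\<alpha> ?\<beta> v) (Inner e ` {t/2<..<b})"
      by (auto simp: disjnt_iff star_def)
    moreover have "Vert v \<in> star ?\<alpha> ?\<beta> v" by (simp add: star_def)
    moreover have "Inner e t \<in> Inner e ` {t/2<..<b}" using et b by simp
    ultimately show ?thesis by (rule sepI)
  qed
  have II: "\<exists>U V. openin X U \<and> openin X V \<and> Inner e s \<in> U \<and> Inner e t \<in> V \<and> disjnt U V"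
    if e: "e \<in> E" and st: "0 < s" "s < t" "ereal t < \<l> e" for e s t
  proof -
    obtain b where b: "t < b" "ereal b < \<l> e"
      using ereal_dense2[OF st(3)] by auto
    have "ereal ((s + t) / 2) \<le> \<l> e"
      using st(2) by (intro less_imp_le[OF le_less_trans[OF _ st(3)]]) simp
    then have "openin X (Inner e ` {0<..<(s + t)/2})" "openin X (Inner e ` {(s+t)/2<..<b})"
      using e st b by (auto intro!: int)
    moreover have "disjnt (Inner e ` {0<..<(s + t)/2}) (Inner e ` {(s+t)/2<..<b})"
      by (auto simp: disjnt_iff)
    moreover have "Inner e s \<in> Inner e ` {0<..<(s + t)/2}" "Inner e t \<in> Inner e ` {(s+t)/2<..<b}"
      using st b by auto
    ultimately show ?thesis by (rule sepI)
  qed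
  have II': "\<exists>U V. openin X U \<and> openin X V \<and> Inner e s \<in> U \<and> Inner e' t \<in> V \<and> disjnt U V"
    if st: "Inner e s \<in> pts" "Inner e' t \<in> pts" "Inner e s \<noteq> Inner e' t" for e s e' t
  proof (cases "e = e'")
    case False
    obtain b where b: "s < b" "ereal b < \<l> e"
      using ereal_dense2[of "ereal s" "\<l> e"] st by auto
    obtain b' where b': "t < b'" "ereal b' < \<l> e'"
      using ereal_dense2[of "ereal t" "\<l> e'"] st by auto
    have "openin X (Inner e ` {0<..<b})" "openin X (Inner e' ` {0<..<b'})"
      using st b b' by (auto intro!: int)
    moreover have "disjnt (Inner e ` {0<..<b}) (Inner e' ` {0<..<b'})"
      using False by (auto simp: disjnt_iff)
    moreover have "Inner e s \<in> Inner e ` {0<..<b}" "Inner e' t \<in> Inner e' ` {0<..<b'}" using st b b' by auto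
    ultimately show ?thesis by (rule sepI)
  next
    case True
    then have "s < t \<or> t < s" using st by auto
    then show ?thesis
    proof
      assume "s < t"
      then show ?thesis using II[of e s t] st True by auto
    next
      assume "t < s"
      then have "\<exists>U V. openin X U \<and> openin X V \<and> Inner e t \<in> U \<and> Inner e s \<in> V \<and> disjnt U V"
        using II[of e t s] st True by auto
      then show ?thesis using True by (metis disjnt_sym)
    qed
  qed
  have VV: "\<exists>U V. openin X U \<and> openin X V \<and> Vert v \<in> U \<and> Vert v' \<in> V \<and> disjnt U V"
    if "v \<in> verts (model \<Gamma>)" "v' \<in> verts (model \<Gamma>)" "v \<noteq> v'" for v v'
  proof -
    have "openin X (star c c v)" "openin X (star c c v')" using c that by (auto intro!: star)
    moreover have "disjnt (star c c v) (star c c v')" using that by (auto simp: disjnt_iff star_def)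
    moreover have "Vert v \<in> star c c v" "Vert v' \<in> star c c v'" by (auto simp: star_def)
    ultimately show ?thesis by (rule sepI)
  qed
  show ?thesis
    unfolding Hausdorff_space_def topspace_curve
  proof (intro allI impI; elim conjE)
    fix x y assume xy: "x \<in> pts" "y \<in> pts" "x \<noteq> y"
    show "\<exists>U V. openin X U \<and> openin X V \<and> x \<in> U \<and> y \<in> V \<and> disjnt U V"
    proof (cases x; cases y)
      fix v v' assume "x = Vert v" "y = Vert v'"
      then show ?thesis using VV xy by auto
    next
      fix v e t assume "x = Vert v" "y = Inner e t"
      then show ?thesis using VI[of v e t] xy by auto
    next
      fix v e t assume "x = Inner e t" "y = Vert v"
      then have "\<exists>U V. openin X U \<and> openin X V \<and> y \<in> U \<and> x \<in> V \<and> disjnt U V"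
        using VI[of v e t] xy by auto
      then show ?thesis by (meson disjnt_sym)
    next
      fix e s e' t assume "x = Inner e s" "y = Inner e' t"
      then show ?thesis using II'[of e s e' t] xy by auto
    qed
  qed
qed

end

section \<open>Directions, slopes and rational functions\<close>

lemma at_right_ereal_0: "at_right (ereal a) = filtermap (\<lambda>x. ereal (a + x)) (at_right 0)"
  by (simp add: at_right_ereal at_right_to_0[of a] filtermap_filtermap add.commute)

lemma at_left_ereal_0: "at_left (ereal a) = filtermap (\<lambda>x. ereal (a - x)) (at_right 0)"
  by (simp add: at_left_ereal at_left_minus[of a] at_right_to_0[of "- a"] filtermap_filtermap)

lemma at_within_Icc_le:
  fixes a b t :: ereal
  assumes "a < b" "a \<le> t" "t \<le> b"
  shows "at t within {a..b} \<le> sup (if a < t then at_left t else bot) (if t < b then at_right t else bot)"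
proof -
  consider "t = a" | "t = b" "t \<noteq> a" | "a < t" "t < b"
    using assms by force
  then show ?thesis
  proof cases
    case 1
    then show ?thesis using assms by (simp add: at_within_Icc_at_right)
  next
    case 2
    then show ?thesis using assms by (simp add: at_within_Icc_at_left)
  next
    case 3
    then show ?thesis
      by (simp add: at_within_Icc_at le_filter_def eventually_sup eventually_at_split)
  qed
qed

context tropical
begin

fun coord :: "'e direction \<Rightarrow> ereal" where
  "coord (Fwd e a) = a"
| "coord (Bwd e a) = a"

fun pt :: "'e direction \<Rightarrow> real \<Rightarrow> ('v, 'e) point" where
  "pt (Fwd e a) x = ep e (a + ereal x)"
| "pt (Bwd e a) x = ep e (a - ereal x)"

text \<open>\<open>adv d x\<close> and \<open>bck d x\<close> are the two directions at an interior
  point \<open>pt d x\<close>, so that computations along an edge need not distinguish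
  \<open>Fwd\<close> from \<open>Bwd\<close>.\<close>

fun adv :: "'e direction \<Rightarrow> real \<Rightarrow> 'e direction" where
  "adv (Fwd e a) x = Fwd e (a + ereal x)"
| "adv (Bwd e a) x = Bwd e (a - ereal x)"

fun bck :: "'e direction \<Rightarrow> real \<Rightarrow> 'e direction" where
  "bck (Fwd e a) x = Bwd e (a + ereal x)"
| "bck (Bwd e a) x = Fwd e (a - ereal x)"

fun room :: "'e direction \<Rightarrow> ereal" where
  "room (Fwd e a) = \<l> e - a"
| "room (Bwd e a) = a"

text \<open>The directions not based at a point at infinity: from these a real distance leads to
  another point, as \<open>pt\<close> and its relatives presuppose.\<close>

definition fdirs :: "'e direction set" where
  "fdirs = {d \<in> directions \<Gamma>. coord d \<noteq> \<infinity>}"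

abbreviation dirs where "dirs \<equiv> directions \<Gamma>"
abbreviation bs where "bs \<equiv> base \<Gamma>"

lemma fdirs_cases:
  assumes "d \<in> fdirs"
  obtains (Fwd) e a where "d = Fwd e (ereal a)" "e \<in> E" "0 \<le> a" "ereal a < \<l> e"
  | (Bwd) e a where "d = Bwd e (ereal a)" "e \<in> E" "0 < a" "ereal a \<le> \<l> e"
proof (cases d)
  case (Fwd e a)
  then have "0 \<le> a" "a < \<l> e" "e \<in> E" using assms by (auto simp: fdirs_def directions_def)
  then show ?thesis using Fwd that(1) by (cases a) auto
next
  case (Bwd e a)
  then have "0 < a" "a \<le> \<l> e" "e \<in> E" "a \<noteq> \<infinity>" using assms by (auto simp: fdirs_def directions_def)
  then show ?thesis using Bwd that(2) by (cases a) auto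
qed

lemma Fwd_fdirs: "Fwd e (ereal a) \<in> fdirs \<longleftrightarrow> e \<in> E \<and> 0 \<le> a \<and> ereal a < \<l> e"
  and Bwd_fdirs: "Bwd e (ereal a) \<in> fdirs \<longleftrightarrow> e \<in> E \<and> 0 < a \<and> ereal a \<le> \<l> e"
  by (auto simp: fdirs_def directions_def)

lemma fdirs_sub: "d \<in> fdirs \<Longrightarrow> d \<in> dirs"
  by (simp add: fdirs_def)

lemma dirs_cases:
  assumes "d \<in> dirs"
  obtains (fin) "d \<in> fdirs" | (inf) e where "d = Bwd e \<infinity>" "e \<in> E" "\<l> e = \<infinity>" "d \<notin> fdirs"
proof (cases "d \<in> fdirs")
  case False
  then obtain e where "d = Fwd e \<infinity> \<or> d = Bwd e \<infinity>"
    using assms by (cases d) (auto simp: fdirs_def)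
  then show ?thesis
    using assms False inf by (auto simp: directions_def)
qed (rule fin)

lemma Bwd_inf_dirs: "e \<in> E \<Longrightarrow> \<l> e = \<infinity> \<Longrightarrow> Bwd e \<infinity> \<in> dirs \<and> Bwd e \<infinity> \<notin> fdirs"
  by (auto simp: directions_def fdirs_def)

lemma base_in_pts: "d \<in> dirs \<Longrightarrow> bs d \<in> pts"
  by (auto simp: directions_def ep_in_pts)

lemma pt_in_pts: "d \<in> dirs \<Longrightarrow> pt d x \<in> pts"
  by (auto simp: directions_def ep_in_pts)

lemma pt_0 [simp]: "d \<in> fdirs \<Longrightarrow> pt d 0 = bs d"
  by (cases d) auto

lemma room_pos: "d \<in> fdirs \<Longrightarrow> 0 < room d"
  by (erule fdirs_cases) (auto simp: ereal_less_minus)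

lemma ereal_less_minus_iff': "ereal x < l - ereal a \<longleftrightarrow> ereal (a + x) < l"
  "ereal x \<le> l - ereal a \<longleftrightarrow> ereal (a + x) \<le> l"
  by (cases l; auto)+

lemma adv_fdirs: "d \<in> fdirs \<Longrightarrow> 0 \<le> x \<Longrightarrow> ereal x < room d \<Longrightarrow> adv d x \<in> fdirs"
  by (erule fdirs_cases) (auto simp: Fwd_fdirs Bwd_fdirs ereal_less_minus_iff' intro: order_trans[rotated])

lemma back_fdirs: "d \<in> fdirs \<Longrightarrow> 0 < x \<Longrightarrow> ereal x \<le> room d \<Longrightarrow> bck d x \<in> fdirs"
proof (erule fdirs_cases)
  fix e a assume d: "d = Bwd e (ereal a)" "e \<in> E" "0 < a" "ereal a \<le> \<l> e" and x: "0 < x" "ereal x \<le> room d"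
  have "ereal (a - x) < ereal a" using x by simp
  also note d(4)
  finally show "bck d x \<in> fdirs" using d x by (simp add: Fwd_fdirs)
qed (auto simp: Bwd_fdirs ereal_less_minus_iff')

lemma base_adv: "d \<in> fdirs \<Longrightarrow> bs (adv d x) = pt d x"
  and base_back: "d \<in> fdirs \<Longrightarrow> bs (bck d x) = pt d x"
  by (cases d; simp)+

lemma pt_adv: "d \<in> fdirs \<Longrightarrow> pt (adv d x) y = pt d (x + y)"
  and pt_back: "d \<in> fdirs \<Longrightarrow> pt (bck d x) y = pt d (x - y)"
  by (erule fdirs_cases; simp add: algebra_simps)+

lemma ep_eq_Inner: "ep e' a = Inner e t \<longleftrightarrow> e' = e \<and> a = ereal t \<and> 0 < t \<and> ereal t < \<l> e"
  by (cases a) (auto simp: epoint_def)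

lemma dirs_at_Inner:
  assumes "Inner e t \<in> pts"
  shows "dirs_at \<Gamma> (Inner e t) = {Fwd e (ereal t), Bwd e (ereal t)}"
  using assms by (auto simp: dirs_at_def directions_def ep_eq_Inner)

lemma pt_interior:
  assumes "d \<in> fdirs" "0 < x" "ereal x < room d"
  shows "\<exists>e t. pt d x = Inner e t" "dirs_at \<Gamma> (pt d x) = {adv d x, bck d x}" "adv d x \<noteq> bck d x"
proof -
  have *: "\<exists>e t. pt d x = Inner e t \<and> pt d x \<in> pts \<and> {adv d x, bck d x} = {Fwd e (ereal t), Bwd e (ereal t)}"
    using assms(1)
  proof (cases rule: fdirs_cases)
    case (Fwd e a)
    then have "pt d x = Inner e (a + x)"
      using assms by (simp add: ep_eq_Inner ereal_less_minus_iff')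
    with Fwd assms show ?thesis
      by (intro exI[of _ e] exI[of _ "a + x"]) (auto simp: ereal_less_minus_iff')
  next
    case (Bwd e a)
    have "ereal (a - x) < ereal a" using assms by simp
    also have "\<dots> \<le> \<l> e" using Bwd by simp
    finally have *: "ereal (a - x) < \<l> e" .
    with Bwd have "pt d x = Inner e (a - x)"
      using assms by (simp add: ep_eq_Inner)
    with Bwd assms * show ?thesis
      by (intro exI[of _ e] exI[of _ "a - x"]) auto
  qed
  then show "\<exists>e t. pt d x = Inner e t" "dirs_at \<Gamma> (pt d x) = {adv d x, bck d x}"
    using dirs_at_Inner by (auto; metis)+
  show "adv d x \<noteq> bck d x" by (cases d) auto
qed

lemma finite_dirs_at: "finite (dirs_at \<Gamma> x)"
proof (cases x)
  case (Vert v)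
  have "dirs_at \<Gamma> x \<subseteq> (\<lambda>e. Fwd e 0) ` E \<union> (\<lambda>e. Bwd e (\<l> e)) ` E"
  proof
    fix d assume "d \<in> dirs_at \<Gamma> x"
    then have d: "d \<in> dirs" "bs d = Vert v" by (auto simp: dirs_at_def Vert)
    show "d \<in> (\<lambda>e. Fwd e 0) ` E \<union> (\<lambda>e. Bwd e (\<l> e)) ` E"
      using d by (cases d) (auto simp: directions_def epoint_def split: if_splits)
  qed
  then show ?thesis using finite_E by (meson finite_UnI finite_imageI finite_subset)
next
  case (Inner e t)
  have "dirs_at \<Gamma> x \<subseteq> {Fwd e (ereal t), Bwd e (ereal t)}"
    by (auto simp: dirs_at_def directions_def ep_eq_Inner Inner)
  then show ?thesis by (rule finite_subset) simp
qed

lemma pt_fun: "pt (Fwd e (ereal a)) = (\<lambda>x. ep e (ereal (a + x)))"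
  "pt (Bwd e (ereal a)) = (\<lambda>x. ep e (ereal (a - x)))"
  by (auto simp: fun_eq_iff)

lemma germ_pt: "d \<in> fdirs \<Longrightarrow> germ \<Gamma> d = filtermap (pt d) (at_right 0)"
  by (erule fdirs_cases) (simp_all add: at_right_ereal_0 at_left_ereal_0 filtermap_filtermap pt_fun)

lemma germ_inf: "germ \<Gamma> (Bwd e \<infinity>) = filtermap (\<lambda>x. ep e (ereal x)) at_top"
  by (simp add: at_left_PInf filtermap_filtermap)

lemma real_ex_shift: "(\<exists>c::real. P (c + k)) \<longleftrightarrow> (\<exists>c. P c)"
  by (metis diff_add_cancel)

text \<open>\<open>has_slope\<close> is written in the edge coordinate. Passing to the distance from
  the base changes only the constant \<open>c\<close>, which is existentially quantified.\<close>

lemma has_slope_pt: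
  assumes "d \<in> fdirs"
  shows "has_slope \<Gamma> f m d \<longleftrightarrow> (\<exists>c. \<forall>\<^sub>F x in at_right 0. f (pt d x) = ereal (c + of_int m * x))"
  using assms
proof (cases rule: fdirs_cases)
  case (Fwd e a)
  have "has_slope \<Gamma> f m d \<longleftrightarrow>
      (\<exists>c. \<forall>\<^sub>F x in at_right 0. f (pt d x) = ereal ((c + of_int m * a) + of_int m * x))"
    by (simp add: Fwd at_right_ereal_0 eventually_filtermap algebra_simps)
  also have "\<dots> \<longleftrightarrow> (\<exists>c. \<forall>\<^sub>F x in at_right 0. f (pt d x) = ereal (c + of_int m * x))"
    by (rule real_ex_shift)
  finally show ?thesis .
next
  case (Bwd e a)
  have "has_slope \<Gamma> f m d \<longleftrightarrow>
      (\<exists>c. \<forall>\<^sub>F x in at_right 0. f (pt d x) = ereal ((c + - of_int m * a) + of_int m * x))"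
    by (simp add: Bwd at_left_ereal_0 eventually_filtermap algebra_simps)
  also have "\<dots> \<longleftrightarrow> (\<exists>c. \<forall>\<^sub>F x in at_right 0. f (pt d x) = ereal (c + of_int m * x))"
    by (rule real_ex_shift)
  finally show ?thesis .
qed

lemma has_slope_inf:
  "has_slope \<Gamma> f m (Bwd e \<infinity>) \<longleftrightarrow> (\<exists>c. \<forall>\<^sub>F x in at_top. f (ep e (ereal x)) = ereal (c - of_int m * x))"
  by (simp add: at_left_PInf eventually_filtermap)

lemma has_slope_unique:
  assumes "d \<in> dirs" "has_slope \<Gamma> f m d" "has_slope \<Gamma> f n d"
  shows "m = n"
  using assms(1)
proof (cases rule: dirs_cases)
  case fin
  obtain c c' where "\<forall>\<^sub>F x in at_right 0. f (pt d x) = ereal (c + of_int m * x)"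
    "\<forall>\<^sub>F x in at_right 0. f (pt d x) = ereal (c' + of_int n * x)"
    using assms(2,3) by (auto simp: has_slope_pt[OF fin])
  then have "\<forall>\<^sub>F x in at_right 0. real_of_ereal (f (pt d x)) = c + of_int m * x"
    "\<forall>\<^sub>F x in at_right 0. real_of_ereal (f (pt d x)) = c' + of_int n * x"
    by (auto elim: eventually_mono)
  from at_right_0_unique(1)[OF this] show ?thesis by simp
next
  case (inf e)
  obtain c c' where "\<forall>\<^sub>F x in at_top. f (ep e (ereal x)) = ereal (c - of_int m * x)"
    "\<forall>\<^sub>F x in at_top. f (ep e (ereal x)) = ereal (c' - of_int n * x)"
    using assms(2,3) unfolding inf(1) has_slope_inf by blast
  then have "\<forall>\<^sub>F x in at_top. c - of_int m * x = c' - of_int n * x"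
    by eventually_elim simp
  then obtain N where N: "\<And>x. x \<ge> N \<Longrightarrow> c - of_int m * x = c' - of_int n * x"
    by (auto simp: eventually_at_top_linorder)
  have "of_int m = (of_int n :: real)"
    using N[of N] N[of "N + 1"] by (simp add: algebra_simps)
  then show ?thesis by simp
qed

lemma slope_eq: "d \<in> dirs \<Longrightarrow> has_slope \<Gamma> f m d \<Longrightarrow> slope \<Gamma> f d = m"
  unfolding slope_def by (blast intro: the_equality has_slope_unique)

lemma has_slope_cong:
  assumes "d \<in> dirs" "\<And>x. x \<in> pts \<Longrightarrow> f x = f' x"
  shows "has_slope \<Gamma> f m d = has_slope \<Gamma> f' m d"
  using assms by (cases d) (auto simp: directions_def ep_in_pts)

lemma slope_cong:
  assumes "d \<in> dirs" "\<And>x. x \<in> pts \<Longrightarrow> f x = f' x"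
  shows "slope \<Gamma> f d = slope \<Gamma> f' d"
  unfolding slope_def using has_slope_cong[OF assms] by simp

lemma div_of_cong: "(\<And>x. x \<in> pts \<Longrightarrow> f x = f' x) \<Longrightarrow> div_of \<Gamma> f = div_of \<Gamma> f'"
  unfolding div_of_def dirs_at_def by (intro ext sum.cong slope_cong) auto

lemma div_of_outside: "x \<notin> pts \<Longrightarrow> div_of \<Gamma> f x = 0"
  unfolding div_of_def dirs_at_def using base_in_pts by (auto intro!: sum.neutral)

lemma rational_function_cong:
  assumes "rational_function \<Gamma> f" "\<And>x. x \<in> pts \<Longrightarrow> f x = f' x"
  shows "rational_function \<Gamma> f'"
proof -
  have "continuous_map X euclidean f'"
    using assms by (auto simp: rational_function_def intro: continuous_map_eq)
  moreover have "\<forall>e\<in>E. \<forall>t. f (ep e t) = f' (ep e t)"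
    using assms ep_in_pts by blast
  ultimately show ?thesis
    using assms unfolding rational_function_def by auto
qed

lemma osc_cong:
  assumes "\<And>x. x \<in> pts \<Longrightarrow> f x = f' x"
  shows "osc \<Gamma> f = osc \<Gamma> f'"
  unfolding osc_def using assms by (simp cong: SUP_cong INF_cong)

text \<open>At a point at infinity a real-valued rational function is locally constant.\<close>

definition germ_slope :: "(('v, 'e) point \<Rightarrow> real) \<Rightarrow> int \<Rightarrow> 'e direction \<Rightarrow> bool" where
  "germ_slope g k d \<longleftrightarrow> (if d \<in> fdirs
     then \<forall>\<^sub>F x in at_right 0. g (pt d x) = g (bs d) + of_int k * x
     else k = 0 \<and> (\<forall>\<^sub>F x in germ \<Gamma> d. g x = g (bs d)))"

text \<open>Real-valued rational functions described germ by germ, which makes differences and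
  shifts immediate. That finitely many pieces suffice follows in \<open>rational_of_pl\<close> from
  the finite support of the divisor.\<close>

definition pl :: "(('v, 'e) point \<Rightarrow> real) \<Rightarrow> bool" where
  "pl g \<longleftrightarrow> (\<forall>d\<in>dirs. \<exists>k. germ_slope g k d)"

abbreviation slp :: "(('v, 'e) point \<Rightarrow> real) \<Rightarrow> 'e direction \<Rightarrow> int" where
  "slp g \<equiv> slope \<Gamma> (\<lambda>x. ereal (g x))"

abbreviation dv :: "(('v, 'e) point \<Rightarrow> real) \<Rightarrow> ('v, 'e) divisor" where
  "dv g \<equiv> div_of \<Gamma> (\<lambda>x. ereal (g x))"

lemma germ_slope_has_slope:
  assumes "d \<in> dirs" "germ_slope g k d"
  shows "has_slope \<Gamma> (\<lambda>x. ereal (g x)) k d"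
  using assms(1)
proof (cases rule: dirs_cases)
  case fin
  then show ?thesis using assms by (auto simp: has_slope_pt germ_slope_def)
next
  case (inf e)
  then have "k = 0" "\<forall>\<^sub>F x in at_top. g (ep e (ereal x)) = g (bs d)"
    using assms by (auto simp: germ_slope_def germ_inf eventually_filtermap simp del: germ.simps)
  then show ?thesis unfolding inf(1) has_slope_inf using inf(1) by auto
qed

lemma slp_eq: "d \<in> dirs \<Longrightarrow> germ_slope g k d \<Longrightarrow> slp g d = k"
  by (intro slope_eq germ_slope_has_slope)

lemma germ_slope_slp: "pl g \<Longrightarrow> d \<in> dirs \<Longrightarrow> germ_slope g (slp g d) d"
  unfolding pl_def using slp_eq by blast

lemma germ_slope_diff:
  assumes "germ_slope g k d" "germ_slope g' k' d"
  shows "germ_slope (\<lambda>x. g x - g' x) (k - k') d"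
proof (cases "d \<in> fdirs")
  case True
  then have "\<forall>\<^sub>F x in at_right 0. g (pt d x) = g (bs d) + of_int k * x"
    "\<forall>\<^sub>F x in at_right 0. g' (pt d x) = g' (bs d) + of_int k' * x"
    using assms by (auto simp: germ_slope_def)
  then have "\<forall>\<^sub>F x in at_right 0. g (pt d x) - g' (pt d x) = g (bs d) - g' (bs d) + of_int (k - k') * x"
    by eventually_elim (simp add: algebra_simps)
  then show ?thesis using True by (simp add: germ_slope_def)
next
  case False
  then have "k = 0" "k' = 0" "\<forall>\<^sub>F x in germ \<Gamma> d. g x = g (bs d)" "\<forall>\<^sub>F x in germ \<Gamma> d. g' x = g' (bs d)"
    using assms by (auto simp: germ_slope_def)
  moreover from this(3,4) have "\<forall>\<^sub>F x in germ \<Gamma> d. g x - g' x = g (bs d) - g' (bs d)"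
    by eventually_elim simp
  ultimately show ?thesis using False by (simp add: germ_slope_def)
qed

lemma germ_slope_const: "germ_slope (\<lambda>_. c) 0 d"
  by (simp add: germ_slope_def)

lemma pl_diff: "pl g \<Longrightarrow> pl g' \<Longrightarrow> pl (\<lambda>x. g x - g' x)"
  unfolding pl_def by (blast intro: germ_slope_diff)

lemma slp_diff: "pl g \<Longrightarrow> pl g' \<Longrightarrow> d \<in> dirs \<Longrightarrow> slp (\<lambda>x. g x - g' x) d = slp g d - slp g' d"
  by (intro slp_eq germ_slope_diff germ_slope_slp)

lemma dv_diff: "pl g \<Longrightarrow> pl g' \<Longrightarrow> dv (\<lambda>x. g x - g' x) = (\<lambda>x. dv g x - dv g' x)"
  unfolding div_of_def dirs_at_def by (auto simp: slp_diff sum_subtractf)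

lemma pl_const: "pl (\<lambda>_. c)"
  using germ_slope_const by (auto simp: pl_def)

lemma dv_const: "dv (\<lambda>_. c) = (\<lambda>_. 0)"
  unfolding div_of_def dirs_at_def using slp_eq[OF _ germ_slope_const] by auto

lemma pl_add_const: "pl g \<Longrightarrow> pl (\<lambda>x. g x + c)"
  using pl_diff[OF _ pl_const[of "- c"]] by simp

lemma dv_add_const: "pl g \<Longrightarrow> dv (\<lambda>x. g x + c) = dv g"
  using dv_diff[OF _ pl_const[of "- c"], of g] by (simp add: dv_const)

lemma germ_slope_tendsto:
  assumes "d \<in> dirs" "germ_slope g k d"
  shows "(g \<longlongrightarrow> g (bs d)) (germ \<Gamma> d)"
proof (cases "d \<in> fdirs")
  case True
  have "((\<lambda>x. g (bs d) + of_int k * x) \<longlongrightarrow> g (bs d) + of_int k * 0) (at_right 0)"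
    by (intro tendsto_intros)
  then have "((\<lambda>x. g (pt d x)) \<longlongrightarrow> g (bs d)) (at_right 0)"
    using assms True by (simp add: germ_slope_def tendsto_cong)
  then show ?thesis
    by (simp add: germ_pt[OF True] filterlim_filtermap)
next
  case False
  then show ?thesis using assms by (auto simp: germ_slope_def intro: tendsto_eventually)
qed

lemma continuous_pl:
  assumes "pl g"
  shows "continuous_map X euclidean g"
  unfolding continuous_map_from_curve
proof (intro ballI)
  fix e assume e: "e \<in> E"
  show "continuous_on {0..\<l> e} (g \<circ> ep e)"
    unfolding continuous_on_def
  proof
    fix t assume t: "t \<in> {0..\<l> e}"
    have "((g \<circ> ep e) \<longlongrightarrow> g (ep e t)) (at_left t)" if "0 < t"
    proof -
      have d: "Bwd e t \<in> dirs" using t that e by (auto simp: directions_def)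
      then obtain k where "germ_slope g k (Bwd e t)" using assms pl_def by blast
      from germ_slope_tendsto[OF d this] show ?thesis by (simp add: filterlim_filtermap o_def)
    qed
    moreover have "((g \<circ> ep e) \<longlongrightarrow> g (ep e t)) (at_right t)" if "t < \<l> e"
    proof -
      have d: "Fwd e t \<in> dirs" using t that e by (auto simp: directions_def)
      then obtain k where "germ_slope g k (Fwd e t)" using assms pl_def by blast
      from germ_slope_tendsto[OF d this] show ?thesis by (simp add: filterlim_filtermap o_def)
    qed
    ultimately have "((g \<circ> ep e) \<longlongrightarrow> g (ep e t))
        (sup (if 0 < t then at_left t else bot) (if t < \<l> e then at_right t else bot))"
      by (auto intro!: filterlim_sup)
    then show "((g \<circ> ep e) \<longlongrightarrow> (g \<circ> ep e) t) (at t within {0..\<l> e})"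
      using filterlim_mono[OF _ order.refl at_within_Icc_le[of 0 "\<l> e" t]] t len_pos[OF e] by simp
  qed
qed

lemma continuous_map_germ:
  assumes "continuous_map X (euclidean :: 'b::topological_space topology) f" "d \<in> dirs"
  shows "(f \<longlongrightarrow> f (bs d)) (germ \<Gamma> d)"
proof (cases d)
  case (Fwd e a)
  then have a: "e \<in> E" "0 \<le> a" "a < \<l> e" using assms by (auto simp: directions_def)
  then have "((f \<circ> ep e) \<longlongrightarrow> f (ep e a)) (at a within {0..\<l> e})"
    using assms(1) by (auto simp: continuous_map_from_curve continuous_on_def o_def)
  moreover have "at_right a \<le> at a within {0..\<l> e}"
    using a by (auto simp flip: at_within_Icc_at_right intro!: at_le)
  ultimately show ?thesis
    using Fwd by (auto simp: filterlim_filtermap o_def intro: filterlim_mono)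
next
  case (Bwd e a)
  then have a: "e \<in> E" "0 < a" "a \<le> \<l> e" using assms by (auto simp: directions_def)
  then have "((f \<circ> ep e) \<longlongrightarrow> f (ep e a)) (at a within {0..\<l> e})"
    using assms(1) by (auto simp: continuous_map_from_curve continuous_on_def o_def)
  moreover have "at_left a \<le> at a within {0..\<l> e}"
    using a by (auto simp flip: at_within_Icc_at_left intro!: at_le)
  ultimately show ?thesis
    using Bwd by (auto simp: filterlim_filtermap o_def intro: filterlim_mono)
qed

lemma rational_has_slope:
  assumes "rational_function \<Gamma> f" "d \<in> dirs"
  shows "\<exists>m. has_slope \<Gamma> f m d"
proof -
  have PL: "\<exists>B. finite B \<and> (\<forall>a b. a < b \<and> {a<..<b} \<subseteq> {0<..<\<l> e} - B \<longrightarrow>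
      (\<exists>(m :: int) (c :: real). \<forall>t\<in>{a<..<b}. f (ep e t) = ereal c + ereal (of_int m) * t))" if "e \<in> E" for e
    using assms that by (simp add: rational_function_def)
  show ?thesis
  proof (cases d)
    case (Fwd e a)
    then have a: "e \<in> E" "0 \<le> a" "a < \<l> e" using assms by (auto simp: directions_def)
    from PL[OF a(1)] obtain B where B: "finite B" "\<And>a b. a < b \<Longrightarrow> {a<..<b} \<subseteq> {0<..<\<l> e} - B \<Longrightarrow>
      (\<exists>(m :: int) (c :: real). \<forall>t\<in>{a<..<b}. f (ep e t) = ereal c + ereal (of_int m) * t)" by blast
    define b where "b = Min (insert (\<l> e) {x\<in>B. a < x})"
    have b: "a < b" "b \<le> \<l> e" "\<And>x. x \<in> B \<Longrightarrow> a < x \<Longrightarrow> b \<le> x"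
      using a B(1) by (auto simp: b_def)
    have "{a<..<b} \<subseteq> {0<..<\<l> e} - B"
      using a b by (fastforce simp: not_less[symmetric])
    from B(2)[OF b(1) this] obtain m :: int and c :: real
      where "\<And>t. t \<in> {a<..<b} \<Longrightarrow> f (ep e t) = ereal c + ereal (of_int m) * t" by blast
    then have "\<forall>\<^sub>F t in at_right a. f (ep e t) = ereal c + ereal (of_int m) * t"
      using b(1) by (auto simp: eventually_at_right[OF b(1)])
    then show ?thesis using Fwd by auto
  next
    case (Bwd e a)
    then have a: "e \<in> E" "0 < a" "a \<le> \<l> e" using assms by (auto simp: directions_def)
    from PL[OF a(1)] obtain B where B: "finite B" "\<And>a b. a < b \<Longrightarrow> {a<..<b} \<subseteq> {0<..<\<l> e} - B \<Longrightarrow>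
      (\<exists>(m :: int) (c :: real). \<forall>t\<in>{a<..<b}. f (ep e t) = ereal c + ereal (of_int m) * t)" by blast
    define b where "b = Max (insert 0 {x\<in>B. x < a})"
    have b: "b < a" "0 \<le> b" "\<And>x. x \<in> B \<Longrightarrow> x < a \<Longrightarrow> x \<le> b"
      using a B(1) by (auto simp: b_def)
    have "{b<..<a} \<subseteq> {0<..<\<l> e} - B"
      using a b by (fastforce simp: not_less[symmetric])
    from B(2)[OF b(1) this] obtain m :: int and c :: real
      where mc: "\<And>t. t \<in> {b<..<a} \<Longrightarrow> f (ep e t) = ereal c + ereal (of_int m) * t" by blast
    have "f (ep e t) = ereal c - ereal (of_int (- m)) * t" if "b < t" "t < a" for t
      using mc[of t] that b(2) by (cases t) auto
    then have "\<forall>\<^sub>F t in at_left a. f (ep e t) = ereal c - ereal (of_int (- m)) * t"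
      using b(1) by (auto simp: eventually_at_left[OF b(1)])
    then show ?thesis using Bwd by (metis has_slope.simps(2))
  qed
qed

text \<open>\<open>has_slope\<close> leaves the additive constant free; continuity at the base fixes
  it. At a point at infinity the finite limit also forces the slope to be 0.\<close>

lemma germ_slope_of_has_slope:
  assumes cont: "continuous_map X euclidean f" and fin: "\<And>x. x \<in> pts \<Longrightarrow> \<bar>f x\<bar> \<noteq> \<infinity>"
    and d: "d \<in> dirs" and m: "has_slope \<Gamma> f m d"
  shows "germ_slope (\<lambda>x. real_of_ereal (f x)) m d"
proof -
  have base: "f (bs d) = ereal (real_of_ereal (f (bs d)))"
    using fin[OF base_in_pts[OF d]] by (simp add: ereal_real)
  then have lim: "((\<lambda>x. real_of_ereal (f x)) \<longlongrightarrow> real_of_ereal (f (bs d))) (germ \<Gamma> d)"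
    using continuous_map_germ[OF cont d] by (metis lim_real_of_ereal)
  show ?thesis
    using d
  proof (cases rule: dirs_cases)
    case dfin: fin
    obtain c where c: "\<forall>\<^sub>F x in at_right 0. f (pt d x) = ereal (c + of_int m * x)"
      using m by (auto simp: has_slope_pt[OF dfin])
    then have c': "\<forall>\<^sub>F x in at_right 0. real_of_ereal (f (pt d x)) = c + of_int m * x"
      by eventually_elim simp
    have "((\<lambda>x. c + of_int m * x) \<longlongrightarrow> c + of_int m * 0) (at_right 0)"
      by (intro tendsto_intros)
    then have "((\<lambda>x. real_of_ereal (f (pt d x))) \<longlongrightarrow> c) (at_right 0)"
      using c' by (simp add: tendsto_cong)
    moreover have "((\<lambda>x. real_of_ereal (f (pt d x))) \<longlongrightarrow> real_of_ereal (f (bs d))) (at_right 0)"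
      using lim by (simp add: germ_pt[OF dfin] filterlim_filtermap)
    ultimately have "c = real_of_ereal (f (bs d))"
      using tendsto_unique trivial_limit_at_right_real by blast
    then show ?thesis using c' dfin by (simp add: germ_slope_def)
  next
    case (inf e)
    obtain c where c: "\<forall>\<^sub>F x in at_top. f (ep e (ereal x)) = ereal (c - of_int m * x)"
      using m unfolding inf(1) has_slope_inf by blast
    then have c': "\<forall>\<^sub>F x in at_top. real_of_ereal (f (ep e (ereal x))) = c - of_int m * x"
      by eventually_elim simp
    have lim': "((\<lambda>x. real_of_ereal (f (ep e (ereal x)))) \<longlongrightarrow> real_of_ereal (f (bs d))) at_top"
      using lim inf by (simp add: germ_inf filterlim_filtermap del: germ.simps)
    then have l2: "((\<lambda>x. c - of_int m * x) \<longlongrightarrow> real_of_ereal (f (bs d))) at_top"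
      using c' by (simp add: tendsto_cong)
    \<comment> \<open>Divided by \<open>x\<close>, the function tends to 0 because its limit is
      finite, and to \<open>- m\<close> by the affine formula.\<close>
    have "m = 0"
    proof (rule ccontr)
      assume "m \<noteq> 0"
      have "((\<lambda>x. (c - of_int m * x) * (1/x)) \<longlongrightarrow> real_of_ereal (f (bs d)) * 0) at_top"
        by (intro tendsto_mult l2) (use tendsto_inverse_0_at_top[OF filterlim_ident] in \<open>simp add: inverse_eq_divide\<close>)
      moreover have "\<forall>\<^sub>F x in at_top. (c - of_int m * x) * (1/x) = c * (1/x) - of_int m"
        using eventually_gt_at_top[of 0] by eventually_elim (simp add: field_simps)
      ultimately have "((\<lambda>x. c * (1/x) - of_int m) \<longlongrightarrow> 0) at_top"
        by (simp add: tendsto_cong)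
      moreover have "((\<lambda>x. c * (1/x) - of_int m) \<longlongrightarrow> c * 0 - of_int m) at_top"
        by (intro tendsto_intros) (use tendsto_inverse_0_at_top[OF filterlim_ident] in \<open>simp add: inverse_eq_divide\<close>)
      ultimately have "(0::real) = c * 0 - of_int m"
        by (rule tendsto_unique[OF trivial_limit_at_top_linorder])
      with \<open>m \<noteq> 0\<close> show False by simp
    qed
    then have "c = real_of_ereal (f (bs d))"
      using l2 tendsto_unique[OF trivial_limit_at_top_linorder tendsto_const] by simp
    then have "\<forall>\<^sub>F x in at_top. real_of_ereal (f (ep e (ereal x))) = real_of_ereal (f (bs d))"
      using c' \<open>m = 0\<close> by simp
    then show ?thesis
      using inf \<open>m = 0\<close> by (simp add: germ_slope_def germ_inf eventually_filtermap del: germ.simps)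
  qed
qed

lemma pl_of_rational:
  assumes "rational_function \<Gamma> f" "\<And>x. x \<in> pts \<Longrightarrow> \<bar>f x\<bar> \<noteq> \<infinity>"
  shows "pl (\<lambda>x. real_of_ereal (f x))"
  unfolding pl_def
proof
  fix d assume d: "d \<in> dirs"
  obtain m where m: "has_slope \<Gamma> f m d" using rational_has_slope[OF assms(1) d] by blast
  have "continuous_map X euclidean f" using assms(1) by (simp add: rational_function_def)
  from germ_slope_of_has_slope[OF this assms(2) d m]
  show "\<exists>k. germ_slope (\<lambda>x. real_of_ereal (f x)) k d" by blast
qed

text \<open>Where the divisor vanishes, the two outgoing slopes at an interior point cancel.
  Applying \<open>right_slope_mono\<close> to \<open>u\<close> and to \<open>- u\<close> then makes
  the slope constant between points of the support, which serve as the finite set of breaks.\<close>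

lemma rational_of_pl:
  assumes "pl g" and K: "finite {x \<in> pts. dv g x \<noteq> 0}"
  shows "rational_function \<Gamma> (\<lambda>x. ereal (g x))"
  unfolding rational_function_def
proof (intro conjI ballI)
  show "continuous_map X euclidean (\<lambda>x. ereal (g x))"
    using continuous_map_compose[OF continuous_pl[OF assms(1)], of euclidean ereal]
    by (simp add: o_def continuous_on_ereal)
  fix e assume e: "e \<in> E"
  define B where "B = {ereal t |t. Inner e t \<in> {x \<in> pts. dv g x \<noteq> 0}}"
  have "finite ((Inner e) -` {x \<in> pts. dv g x \<noteq> 0})"
    using K by (rule finite_vimageI) (auto simp: inj_def)
  moreover have "B = ereal ` ((Inner e) -` {x \<in> pts. dv g x \<noteq> 0})"
    by (auto simp: B_def)
  ultimately have "finite B" by simp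
  moreover have "\<exists>(m :: int) (c :: real). \<forall>t\<in>{a<..<b}. ereal (g (ep e t)) = ereal c + ereal (of_int m) * t"
    if ab: "a < b" and sub: "{a<..<b} \<subseteq> {0<..<\<l> e} - B" for a b
  proof -
    define s where "s x = slp g (Fwd e (ereal x))" for x
    define u where "u x = g (ep e (ereal x))" for x
    have x: "0 < x" "ereal x < \<l> e" "dv g (Inner e x) = 0" if "a < ereal x" "ereal x < b" for x
      using that sub e by (auto simp: B_def subset_iff)
    have R: "\<forall>\<^sub>F y in at_right 0. u (x + y) = u x + of_int (s x) * y" if "a < ereal x" "ereal x < b" for x
    proof -
      have "Fwd e (ereal x) \<in> fdirs" using x[OF that] e by (simp add: Fwd_fdirs)
      with germ_slope_slp[OF assms(1) fdirs_sub[OF this]] show ?thesis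
        by (simp add: germ_slope_def u_def s_def)
    qed
    have L: "\<forall>\<^sub>F y in at_right 0. u (x - y) = u x - of_int (s x) * y" if "a < ereal x" "ereal x < b" for x
    proof -
      have "Inner e x \<in> pts" using x[OF that] e by simp
      from x(3)[OF that] have "slp g (Bwd e (ereal x)) = - s x"
        unfolding div_of_def dirs_at_Inner[OF \<open>Inner e x \<in> pts\<close>] s_def by simp
      moreover have "Bwd e (ereal x) \<in> fdirs" using x[OF that] e by (simp add: Bwd_fdirs)
      ultimately show ?thesis
        using germ_slope_slp[OF assms(1) fdirs_sub, of "Bwd e (ereal x)"]
        by (simp add: germ_slope_def u_def s_def)
    qed
    have between: "a < ereal y" "ereal y < b" if "a < ereal x" "x \<le> y" "y \<le> z" "ereal z < b" for x y z
      using that by (metis ereal_less_eq(3) less_le_trans le_less_trans)+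
    have s_eq: "s x = s z" if xz: "a < ereal x" "x \<le> z" "ereal z < b" for x z
    proof -
      obtain b' where b': "ereal z < ereal b'" "ereal b' < b" using ereal_dense2[OF xz(3)] by blast
      have btw: "a < ereal y" "ereal y < b" if "x \<le> y" "y < b'" for y
        using between[OF xz(1) that(1) less_imp_le[OF that(2)] b'(2)] by auto
      have "real_of_int (s x) \<le> of_int (s z)"
        by (rule right_slope_mono[where a = x and b = b' and u = u and sL = "\<lambda>x. of_int (s x)"])
          (use btw R L b' xz in auto)
      moreover have "- real_of_int (s x) \<le> - of_int (s z)"
      proof (rule right_slope_mono[where a = x and b = b' and u = "\<lambda>x. - u x"
            and sL = "\<lambda>x. - of_int (s x)" and sR = "\<lambda>x. - of_int (s x)"])
        fix y assume "x \<le> y" "y < b'"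
        from R[OF btw[OF this]] show "\<forall>\<^sub>F w in at_right 0. - u (y + w) = - u y + - of_int (s y) * w"
          by eventually_elim simp
      next
        fix y assume "x < y" "y < b'"
        then show "\<forall>\<^sub>F w in at_right 0. - u (y - w) = - u y - - of_int (s y) * w"
          using L[OF btw[of y]] by (auto elim: eventually_mono)
      qed (use b' xz in auto)
      ultimately show ?thesis by simp
    qed
    have u_eq: "u z = u x + of_int (s x) * (z - x)" if xz: "a < ereal x" "x \<le> z" "ereal z < b" for x z
    proof (rule slope_const[OF xz(2)])
      fix y assume y: "x \<le> y" "y < z"
      then have "a < ereal y" "ereal y < b" using between[OF xz(1) y(1) _ xz(3)] by auto
      then show "\<forall>\<^sub>F w in at_right 0. u (y + w) = u y + of_int (s x) * w"
        using R[of y] s_eq[OF xz(1) y(1)] by simp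
    next
      fix y assume y: "x < y" "y \<le> z"
      then have "a < ereal y" "ereal y < b" using between[OF xz(1) _ y(2) xz(3)] by auto
      then show "\<exists>k. \<forall>\<^sub>F w in at_right 0. u (y - w) = u y - k * w"
        using L[of y] by blast
    qed
    \<comment> \<open>The interval may reach infinity, so the affine formula is anchored at an
      interior point.\<close>
    obtain x0 where x0: "a < ereal x0" "ereal x0 < b" using ereal_dense2[OF ab] by blast
    have "ereal (g (ep e t)) = ereal (u x0 - of_int (s x0) * x0) + ereal (of_int (s x0)) * t"
      if t: "t \<in> {a<..<b}" for t
    proof -
      have "0 < t" "t < \<l> e" using t sub by auto
      then obtain x where x: "t = ereal x" by (cases t) auto
      have "u x = u x0 + of_int (s x0) * (x - x0)"
      proof (cases "x0 \<le> x")
        case True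
        then show ?thesis using u_eq[OF x0(1)] t x by auto
      next
        case False
        then show ?thesis using u_eq[of x x0] s_eq[of x x0] t x x0 by (auto simp: algebra_simps)
      qed
      then show ?thesis by (simp add: x u_def algebra_simps)
    qed
    then show ?thesis by blast
  qed
  ultimately show "\<exists>B. finite B \<and> (\<forall>a b. a < b \<and> {a<..<b} \<subseteq> {0<..<\<l> e} - B \<longrightarrow>
      (\<exists>(m :: int) (c :: real). \<forall>t\<in>{a<..<b}. ereal (g (ep e t)) = ereal c + ereal (of_int m) * t))"
    by blast
qed auto

section \<open>The maximum principle and functions with a given divisor\<close>

lemma pts_ne: "pts \<noteq> {}"
  using verts_ne by (auto simp: points_def)

lemma pl_attains:
  assumes "pl g"
  obtains x y where "x \<in> pts" "y \<in> pts" "\<And>z. z \<in> pts \<Longrightarrow> g y \<le> g z \<and> g z \<le> g x"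
proof -
  have "compactin euclidean (g ` pts)"
    using image_compactin[OF _ continuous_pl[OF assms]] compact_space_curve
    by (simp add: compact_space_def)
  then have "compact (g ` pts)" by simp
  with pts_ne compact_attains_sup[of "g ` pts"] compact_attains_inf[of "g ` pts"]
  obtain x y where "x \<in> pts" "y \<in> pts" "\<forall>z\<in>pts. g z \<le> g x" "\<forall>z\<in>pts. g y \<le> g z" by auto
  then show thesis using that by blast
qed

lemma openin_of_germs:
  assumes "U \<subseteq> pts" "\<And>d. d \<in> dirs \<Longrightarrow> bs d \<in> U \<Longrightarrow> \<forall>\<^sub>F x in germ \<Gamma> d. x \<in> U"
  shows "openin X U"
  unfolding openin_curve
proof (intro conjI ballI)
  fix e assume e: "e \<in> E"
  let ?T = "{t \<in> {0..\<l> e}. ep e t \<in> U}"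
  have "\<exists>T'. openin (top_of_set {0..\<l> e}) T' \<and> t \<in> T' \<and> T' \<subseteq> ?T" if t: "t \<in> ?T" for t
  proof -
    have "\<forall>\<^sub>F s in (if 0 < t then at_left t else bot). ep e s \<in> U"
      using assms(2)[of "Bwd e t"] t e by (auto simp: directions_def eventually_filtermap)
    moreover have "\<forall>\<^sub>F s in (if t < \<l> e then at_right t else bot). ep e s \<in> U"
      using assms(2)[of "Fwd e t"] t e by (auto simp: directions_def eventually_filtermap)
    ultimately have "\<forall>\<^sub>F s in at t within {0..\<l> e}. ep e s \<in> U"
      using at_within_Icc_le[of 0 "\<l> e" t] t len_pos[OF e] by (auto simp: le_filter_def eventually_sup)
    then obtain W where W: "open W" "t \<in> W" "\<And>s. s \<in> W \<Longrightarrow> s \<noteq> t \<Longrightarrow> s \<in> {0..\<l> e} \<Longrightarrow> ep e s \<in> U"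
      unfolding eventually_at_topological by blast
    have "openin (top_of_set {0..\<l> e}) ({0..\<l> e} \<inter> W)" using W(1) by (rule openin_open_Int)
    moreover have "{0..\<l> e} \<inter> W \<subseteq> ?T" using W(3) t by blast
    ultimately show ?thesis using W(2) t by blast
  qed
  then show "openin (top_of_set {0..\<l> e}) ?T"
    by (subst openin_subopen) blast
qed (rule assms(1))

text \<open>At a maximum no slope is positive, and as the slopes add up to 0, all of them vanish.
  The set of maxima is therefore open as well as closed, and the curve is connected.\<close>

lemma harmonic_const:
  assumes "pl g" "\<And>x. x \<in> pts \<Longrightarrow> dv g x = 0"
  shows "\<exists>c. \<forall>x\<in>pts. g x = c"
proof -
  obtain x0 where x0: "x0 \<in> pts" "\<And>z. z \<in> pts \<Longrightarrow> g z \<le> g x0"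
    using pl_attains[OF assms(1)] by metis
  let ?A = "{x \<in> pts. g x = g x0}"
  have "closedin X {x \<in> topspace X. g x \<in> {g x0}}"
    by (rule closedin_continuous_map_preimage[OF continuous_pl[OF assms(1)]]) simp
  then have cl: "closedin X ?A" by simp
  have nonpos: "slp g d \<le> 0" if d: "d \<in> dirs" "bs d \<in> ?A" for d
    using d(1)
  proof (cases rule: dirs_cases)
    case fin
    then have "\<forall>\<^sub>F x in at_right 0. g (pt d x) = g x0 + of_int (slp g d) * x"
      using germ_slope_slp[OF assms(1) d(1)] d(2) by (simp add: germ_slope_def)
    then obtain \<delta> where \<delta>: "\<delta> > 0" "\<And>y. 0 < y \<Longrightarrow> y < \<delta> \<Longrightarrow> g (pt d y) = g x0 + of_int (slp g d) * y"
      by (elim at_right_0_obtain) blast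
    have "g x0 + of_int (slp g d) * (\<delta> / 2) \<le> g x0"
      using \<delta>(2)[of "\<delta>/2"] \<delta>(1) x0(2)[OF pt_in_pts[OF d(1)], of "\<delta>/2"] by simp
    then show ?thesis using \<delta>(1) by (simp add: mult_le_0_iff)
  next
    case (inf e)
    then show ?thesis using germ_slope_slp[OF assms(1) d(1)] by (simp add: germ_slope_def)
  qed
  have zero: "slp g d = 0" if d: "d \<in> dirs" "bs d \<in> ?A" for d
  proof -
    have "(\<Sum>d'\<in>dirs_at \<Gamma> (bs d). slp g d') = 0"
      using assms(2)[of "bs d"] base_in_pts[OF d(1)] by (simp add: div_of_def)
    moreover have "slp g d' \<le> 0" if "d' \<in> dirs_at \<Gamma> (bs d)" for d'
      using nonpos[of d'] that d by (auto simp: dirs_at_def)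
    ultimately have "\<forall>d'\<in>dirs_at \<Gamma> (bs d). - slp g d' = 0"
      using sum_nonneg_eq_0_iff[OF finite_dirs_at, of "bs d" "\<lambda>d'. - slp g d'"] by (simp add: sum_negf)
    then show ?thesis using d by (simp add: dirs_at_def)
  qed
  have "openin X ?A"
  proof (rule openin_of_germs)
    fix d assume d: "d \<in> dirs" "bs d \<in> ?A"
    have "\<forall>\<^sub>F x in germ \<Gamma> d. g x = g (bs d)"
    proof (cases "d \<in> fdirs")
      case True
      then show ?thesis
        using germ_slope_slp[OF assms(1) d(1)] zero[OF d] by (simp add: germ_slope_def germ_pt eventually_filtermap)
    next
      case False
      then show ?thesis using germ_slope_slp[OF assms(1) d(1)] by (simp add: germ_slope_def)
    qed
    moreover have "\<forall>\<^sub>F x in germ \<Gamma> d. x \<in> pts"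
      using d(1) by (cases d) (auto simp: directions_def eventually_filtermap ep_in_pts)
    ultimately show "\<forall>\<^sub>F x in germ \<Gamma> d. x \<in> ?A"
      by eventually_elim (use d in auto)
  qed auto
  with cl have "?A = {} \<or> ?A = topspace X"
    using connected unfolding connected_space_clopen_in by blast
  then have "?A = pts" using x0(1) by auto
  then show ?thesis by blast
qed

lemma pl_same_div:
  assumes "pl g" "pl g'" "dv g = dv g'"
  shows "\<exists>c. \<forall>x\<in>pts. g x = g' x + c"
proof -
  have "\<exists>c. \<forall>x\<in>pts. g x - g' x = c"
    by (rule harmonic_const[OF pl_diff[OF assms(1,2)]]) (simp add: dv_diff assms)
  then show ?thesis by (metis diff_add_cancel add.commute)
qed

lemma osc_pl:
  assumes "pl g" "x \<in> pts" "y \<in> pts" "\<And>z. z \<in> pts \<Longrightarrow> g y \<le> g z \<and> g z \<le> g x"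
  shows "osc \<Gamma> (\<lambda>x. ereal (g x)) = ereal (g x - g y)"
proof -
  have "(SUP z\<in>pts. ereal (g z)) = ereal (g x)"
    by (rule antisym) (auto intro!: SUP_least SUP_upper simp: assms)
  moreover have "(INF z\<in>pts. ereal (g z)) = ereal (g y)"
    by (rule antisym) (auto intro!: INF_greatest INF_lower simp: assms)
  ultimately show ?thesis by (simp add: osc_def)
qed

text \<open>A priori \<open>f\<close> may be infinite at a point at infinity. Such a point has a
  single direction, so its coefficient in the divisor is the slope, which is 0 for the real-valued
  \<open>g\<close>. Hence \<open>f\<close> is constant nearby and finite, and
  \<open>pl_same_div\<close> applies.\<close>

lemma rational_same_div:
  assumes f: "rational_function \<Gamma> f" and g: "pl g" and eq: "div_of \<Gamma> f = dv g"
  shows "\<exists>c. \<forall>x\<in>pts. f x = ereal (g x + c)"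
proof -
  have fin: "\<bar>f x\<bar> \<noteq> \<infinity>" if x: "x \<in> pts" for x
  proof (cases "x \<in> infinite_points \<Gamma>")
    case False
    then show ?thesis using f x by (simp add: rational_function_def)
  next
    case True
    then obtain e where e: "e \<in> E" "\<l> e = \<infinity>" "x = Vert (head (model \<Gamma>) e)"
      by (auto simp: infinite_points_def)
    let ?d = "Bwd e \<infinity>"
    have d: "?d \<in> dirs" "?d \<notin> fdirs" using Bwd_inf_dirs[OF e(1,2)] by auto
    have bsd: "bs ?d = x" using ep_len[OF e(1)] e(2,3) by simp
    have "card (dirs_at \<Gamma> x) = 1" using len_inf[OF e(1,2)] e(3) by (simp add: valence_def)
    then obtain d' where "dirs_at \<Gamma> x = {d'}" by (auto simp: card_1_singleton_iff)
    moreover have "?d \<in> dirs_at \<Gamma> x" using d bsd by (simp add: dirs_at_def)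
    ultimately have da: "dirs_at \<Gamma> x = {?d}" by auto
    have "slp g ?d = 0" using germ_slope_slp[OF g d(1)] d(2) by (simp add: germ_slope_def)
    then have "slope \<Gamma> f ?d = 0"
      using fun_cong[OF eq, of x] by (simp add: div_of_def da)
    moreover obtain m where m: "has_slope \<Gamma> f m ?d" using rational_has_slope[OF f d(1)] by blast
    ultimately have "has_slope \<Gamma> f 0 ?d" using slope_eq[OF d(1) m] by simp
    then obtain c where "\<forall>\<^sub>F t in at_top. f (ep e (ereal t)) = ereal c"
      unfolding has_slope_inf by auto
    then have "((\<lambda>t. f (ep e (ereal t))) \<longlongrightarrow> ereal c) at_top"
      by (rule tendsto_eventually)
    moreover have "((\<lambda>t. f (ep e (ereal t))) \<longlongrightarrow> f x) at_top"
      using continuous_map_germ[OF _ d(1), of f] f bsd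
      by (simp add: rational_function_def germ_inf filterlim_filtermap del: germ.simps base.simps)
    ultimately have "f x = ereal c"
      using tendsto_unique trivial_limit_at_top_linorder by blast
    then show ?thesis by simp
  qed
  let ?f = "\<lambda>x. real_of_ereal (f x)"
  have f_eq: "f x = ereal (?f x)" if "x \<in> pts" for x using fin[OF that] by (simp add: ereal_real)
  have "pl ?f" using pl_of_rational[OF f fin] .
  moreover have "dv ?f = dv g" using eq div_of_cong[OF f_eq] by simp
  ultimately obtain c where "\<forall>x\<in>pts. ?f x = g x + c" using pl_same_div g by blast
  then show ?thesis using f_eq by metis
qed

lemma div_dist_pl:
  assumes g: "pl g" "rational_function \<Gamma> (\<lambda>x. ereal (g x))" and D': "D' = add_div \<Gamma> D (\<lambda>x. ereal (g x))"
  shows "div_dist \<Gamma> D D' = osc \<Gamma> (\<lambda>x. ereal (g x))"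
proof -
  have "osc \<Gamma> f = osc \<Gamma> (\<lambda>x. ereal (g x))" if f: "rational_function \<Gamma> f" "add_div \<Gamma> D f = D'" for f
  proof -
    have "div_of \<Gamma> f = dv g"
      using f(2) D' by (auto simp: add_div_def fun_eq_iff)
    then obtain c where c: "\<forall>x\<in>pts. f x = ereal (g x + c)" using rational_same_div[OF f(1) g(1)] by blast
    obtain x y where xy: "x \<in> pts" "y \<in> pts" "\<And>z. z \<in> pts \<Longrightarrow> g y \<le> g z \<and> g z \<le> g x"
      using pl_attains[OF g(1)] by metis
    have "osc \<Gamma> f = osc \<Gamma> (\<lambda>x. ereal (g x + c))" using c by (intro osc_cong) auto
    also have "\<dots> = ereal ((g x + c) - (g y + c))"
      by (rule osc_pl[OF pl_add_const[OF g(1)] xy(1,2)]) (use xy(3) in auto)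
    also have "\<dots> = osc \<Gamma> (\<lambda>x. ereal (g x))"
      using osc_pl[OF g(1) xy] by simp
    finally show ?thesis .
  qed
  moreover have "(\<lambda>x. ereal (g x)) \<in> {f. rational_function \<Gamma> f \<and> add_div \<Gamma> D f = D'}"
    using g D' by simp
  ultimately have "osc \<Gamma> ` {f. rational_function \<Gamma> f \<and> add_div \<Gamma> D f = D'} = {osc \<Gamma> (\<lambda>x. ereal (g x))}"
    by blast
  then show ?thesis by (simp add: div_dist_def)
qed

end

section \<open>Subdividing the edges at the support of the divisor\<close>

locale tropical_divisor = tropical \<Gamma> for \<Gamma> :: "('v, 'e) metric_graph" +
  fixes D :: "('v, 'e) divisor"
  assumes is_div: "is_divisor \<Gamma> D" and effD: "effective D"
    and D_inf: "\<forall>x \<in> infinite_points \<Gamma>. D x = 0"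
begin

abbreviation mk where "mk \<equiv> marked \<Gamma> D"

lemma D_nonneg: "0 \<le> D x"
  using effD by (simp add: effective_def)

lemma finite_mk: "finite mk" and mk_pts: "mk \<subseteq> pts"
  using is_div finite_verts by (auto simp: marked_def is_divisor_def)

definition nodes :: "'e \<Rightarrow> ereal set" where
  "nodes e = {0, \<l> e} \<union> {ereal t | t. 0 < t \<and> ereal t < \<l> e \<and> D (Inner e t) \<noteq> 0}"

lemma finite_nodes: "finite (nodes e)"
proof -
  have "finite ((Inner e) -` {x. D x \<noteq> 0})"
    using is_div by (intro finite_vimageI) (auto simp: inj_def is_divisor_def)
  moreover have "nodes e \<subseteq> {0, \<l> e} \<union> ereal ` ((Inner e) -` {x. D x \<noteq> 0})"
    by (auto simp: nodes_def)
  ultimately show ?thesis by (meson finite.emptyI finite.insertI finite_UnI finite_imageI finite_subset)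
qed

lemma nodes_bounds: "e \<in> E \<Longrightarrow> a \<in> nodes e \<Longrightarrow> 0 \<le> a \<and> a \<le> \<l> e"
  using len_pos[of e] by (auto simp: nodes_def)

lemma ep_marked:
  assumes "e \<in> E" "0 \<le> a" "a \<le> \<l> e"
  shows "ep e a \<in> mk \<longleftrightarrow> a \<in> nodes e"
  using assms(2,3)
proof (cases rule: edge_coord_cases)
  case (3 t)
  then show ?thesis by (auto simp: marked_def nodes_def ep_Inner)
qed (use assms in \<open>auto simp: marked_def nodes_def tail_in head_in ep_len\<close>)

text \<open>Pairs of consecutive nodes encode the components of the complement of the marked points,
  see \<open>components_unmarked\<close>. Only the right end can be infinite.\<close>

definition segs :: "('e \<times> ereal \<times> ereal) set" where
  "segs = {(e, a, b). e \<in> E \<and> a \<in> nodes e \<and> b \<in> nodes e \<and> a < b \<and> (\<forall>c\<in>nodes e. \<not> (a < c \<and> c < b))}"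

fun seg :: "'e \<times> ereal \<times> ereal \<Rightarrow> ('v, 'e) point set" where
  "seg (e, a, b) = ep e ` {a<..<b}"

declare seg.simps [simp del]

lemma insideI: "a < t \<Longrightarrow> t < b \<Longrightarrow> ep e t \<in> seg (e, a, b)"
  by (simp add: seg.simps)

lemma insideE:
  assumes "x \<in> seg (e, a, b)"
  obtains t where "x = ep e t" "a < t" "t < b"
  using assms by (auto simp: seg.simps)

lemma finite_segs: "finite segs"
proof -
  have "segs \<subseteq> (SIGMA e:E. nodes e \<times> nodes e)" by (auto simp: segs_def)
  then show ?thesis using finite_E finite_nodes by (meson finite_SigmaI finite_subset)
qed

lemma segs_D:
  assumes "(e, a, b) \<in> segs"
  shows "e \<in> E" "0 \<le> a" "a < b" "b \<le> \<l> e" "a \<in> nodes e" "b \<in> nodes e" "\<exists>\<alpha>. a = ereal \<alpha>"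
    "b = \<infinity> \<Longrightarrow> \<l> e = \<infinity>" "b \<noteq> \<infinity> \<Longrightarrow> \<exists>\<beta>. b = ereal \<beta>"
proof -
  show *: "e \<in> E" "a < b" "a \<in> nodes e" "b \<in> nodes e" using assms by (auto simp: segs_def)
  then show **: "0 \<le> a" "b \<le> \<l> e" using nodes_bounds by auto
  then show "b = \<infinity> \<Longrightarrow> \<l> e = \<infinity>" by simp
  show "\<exists>\<alpha>. a = ereal \<alpha>" using * ** by (cases a) auto
  show "b \<noteq> \<infinity> \<Longrightarrow> \<exists>\<beta>. b = ereal \<beta>" using * ** by (cases b) auto
qed

lemma segs_range: "(e, a, b) \<in> segs \<Longrightarrow> a \<le> t \<Longrightarrow> t \<le> b \<Longrightarrow> 0 \<le> t \<and> t \<le> \<l> e"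
  using segs_D(2,4) order_trans by blast

lemma segs_range': "(e, a, b) \<in> segs \<Longrightarrow> a < t \<Longrightarrow> t < b \<Longrightarrow> 0 < t \<and> t < \<l> e"
  using segs_D(2,4) le_less_trans less_le_trans by blast

lemma segs_no_node: "(e, a, b) \<in> segs \<Longrightarrow> a < t \<Longrightarrow> t < b \<Longrightarrow> t \<notin> nodes e"
  by (auto simp: segs_def)

lemma inside_Inner:
  assumes "(e, a, b) \<in> segs"
  shows "seg (e, a, b) = {Inner e t |t. a < ereal t \<and> ereal t < b}"
proof -
  have "\<exists>t'. t = ereal t' \<and> ep e t = Inner e t'" if "a < t" "t < b" for t
    using segs_range'[OF assms that] by (cases t) (auto intro!: ep_Inner)
  moreover have "ep e (ereal t) = Inner e t" if "a < ereal t" "ereal t < b" for t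
    using segs_range'[OF assms that] by (auto intro!: ep_Inner)
  ultimately show ?thesis
    by (auto simp: seg.simps image_iff) (metis greaterThanLessThan_iff)+
qed

lemma inside_pts: "s \<in> segs \<Longrightarrow> seg s \<subseteq> pts"
  by (cases s) (auto simp: ep_in_pts segs_D(1) seg.simps)

lemma inside_unmarked: "s \<in> segs \<Longrightarrow> x \<in> seg s \<Longrightarrow> x \<notin> mk"
proof (cases s)
  fix e a b assume s: "s = (e, a, b)" "s \<in> segs" "x \<in> seg s"
  then obtain t where t: "x = ep e t" "a < t" "t < b" using insideE by blast
  then have "0 \<le> t" "t \<le> \<l> e" using segs_range[of e a b t] s by auto
  then show "x \<notin> mk" using ep_marked t s segs_no_node segs_D(1) by blast
qed

lemma seg_at:
  assumes "e \<in> E" "0 \<le> t" "t \<le> \<l> e" "t \<notin> nodes e"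
  obtains a b where "(e, a, b) \<in> segs" "a < t" "t < b"
proof -
  define a where "a = Max {c \<in> nodes e. c < t}"
  define b where "b = Min {c \<in> nodes e. t < c}"
  have 0: "0 \<in> nodes e" "\<l> e \<in> nodes e" by (auto simp: nodes_def)
  have t: "0 < t" "t < \<l> e" using assms 0 by (metis order_less_le)+
  have "a \<in> {c \<in> nodes e. c < t}"
    unfolding a_def by (rule Max_in) (use t 0 finite_nodes in auto)
  moreover have "b \<in> {c \<in> nodes e. t < c}"
    unfolding b_def by (rule Min_in) (use t 0 finite_nodes in auto)
  moreover have "\<not> (a < c \<and> c < b)" if "c \<in> nodes e" for c
  proof
    assume c: "a < c \<and> c < b"
    have "c \<noteq> t" using that assms by auto
    then consider "c < t" | "t < c" by force
    then show False
    proof cases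
      case 1
      then have "c \<le> a" unfolding a_def using that finite_nodes by (intro Max_ge) auto
      with c show False using leD by blast
    next
      case 2
      then have "b \<le> c" unfolding b_def using that finite_nodes by (intro Min_le) auto
      with c show False using leD by blast
    qed
  qed
  ultimately show thesis
    using assms by (intro that[of a b]) (auto simp: segs_def)
qed

lemma seg_right_of:
  assumes "e \<in> E" "a \<in> nodes e" "a < \<l> e"
  obtains b where "(e, a, b) \<in> segs"
proof -
  define b where "b = Min {c \<in> nodes e. a < c}"
  have "b \<in> {c \<in> nodes e. a < c}"
    unfolding b_def by (rule Min_in) (use assms finite_nodes in \<open>auto simp: nodes_def\<close>)
  moreover have "\<not> (a < c \<and> c < b)" if "c \<in> nodes e" for c
  proof
    assume c: "a < c \<and> c < b"
    then have "b \<le> c" unfolding b_def using that finite_nodes by (intro Min_le) auto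
    with c show False using leD by blast
  qed
  ultimately show thesis using assms by (intro that[of b]) (auto simp: segs_def)
qed

lemma seg_left_of:
  assumes "e \<in> E" "b \<in> nodes e" "0 < b"
  obtains a where "(e, a, b) \<in> segs"
proof -
  define a where "a = Max {c \<in> nodes e. c < b}"
  have "a \<in> {c \<in> nodes e. c < b}"
    unfolding a_def by (rule Max_in) (use assms finite_nodes in \<open>auto simp: nodes_def\<close>)
  moreover have "\<not> (a < c \<and> c < b)" if "c \<in> nodes e" for c
  proof
    assume c: "a < c \<and> c < b"
    then have "c \<le> a" unfolding a_def using that finite_nodes by (intro Max_ge) auto
    with c show False using leD by blast
  qed
  ultimately show thesis using assms by (intro that[of a]) (auto simp: segs_def)
qed

lemma unmarked_inside:
  assumes "x \<in> pts" "x \<notin> mk"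
  obtains s where "s \<in> segs" "x \<in> seg s"
  using assms(1)
proof (cases rule: pts_cases)
  case (1 v)
  then show ?thesis using assms by (simp add: marked_def)
next
  case (2 e t)
  then have "ereal t \<notin> nodes e" using assms ep_marked[of e "ereal t"] by auto
  then obtain a b where "(e, a, b) \<in> segs" "a < ereal t" "ereal t < b"
    using 2 by (elim seg_at[of e "ereal t", rotated 3]) auto
  then show ?thesis using 2 insideI that by metis
qed

lemma inside_disjoint:
  assumes "s \<in> segs" "s' \<in> segs" "x \<in> seg s" "x \<in> seg s'"
  shows "s = s'"
proof -
  obtain e a b where s: "s = (e, a, b)" by (cases s) auto
  obtain e' a' b' where s': "s' = (e', a', b')" by (cases s') auto
  have "\<exists>t. x = Inner e t \<and> a < ereal t \<and> ereal t < b"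
    using inside_Inner[of e a b] assms s by auto
  then obtain t where t: "x = Inner e t" "a < ereal t" "ereal t < b" by blast
  have "\<exists>t. x = Inner e' t \<and> a' < ereal t \<and> ereal t < b'"
    using inside_Inner[of e' a' b'] assms s' by auto
  then have t': "e' = e" "a' < ereal t" "ereal t < b'" using t(1) by auto
  have nn: "\<not> (a < c \<and> c < b)" "\<not> (a' < c \<and> c < b')" if "c \<in> nodes e" for c
    using segs_no_node assms s s' t' that by blast+
  have n: "a \<in> nodes e" "b \<in> nodes e" "a' \<in> nodes e" "b' \<in> nodes e"
    using segs_D(5,6) assms s s' t' by blast+
  have "a = a'" "b = b'"
    using nn(1)[OF n(3)] nn(1)[OF n(4)] nn(2)[OF n(1)] nn(2)[OF n(2)] t t' by (auto simp: not_less)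
  then show ?thesis using s s' t' by simp
qed

text \<open>The directions along which chips can leave: all those at marked points except the ones
  based at infinity, where \<open>D\<close> has no chips.\<close>

definition ports :: "'e direction set" where
  "ports = {d \<in> fdirs. bs d \<in> mk}"

lemma ports_fdirs: "d \<in> ports \<Longrightarrow> d \<in> fdirs" and ports_dirs: "d \<in> ports \<Longrightarrow> d \<in> dirs"
  and ports_mk: "d \<in> ports \<Longrightarrow> bs d \<in> mk"
  by (auto simp: ports_def fdirs_sub)

lemma ports_cases:
  assumes "d \<in> ports"
  obtains (Fwd) e a b where "d = Fwd e (ereal a)" "(e, ereal a, b) \<in> segs"
  | (Bwd) e a b where "d = Bwd e (ereal b)" "(e, ereal a, ereal b) \<in> segs"
  using ports_fdirs[OF assms]
proof (cases rule: fdirs_cases)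
  case F: (Fwd e a)
  then have "ereal a \<in> nodes e" using ports_mk[OF assms] ep_marked[of e "ereal a"] by auto
  then show ?thesis using seg_right_of[of e "ereal a"] F Fwd by metis
next
  case B: (Bwd e b)
  then have "ereal b \<in> nodes e" using ports_mk[OF assms] ep_marked[of e "ereal b"] by auto
  then obtain a where s: "(e, a, ereal b) \<in> segs" using seg_left_of[of e "ereal b"] B by auto
  then obtain \<alpha> where "a = ereal \<alpha>" using segs_D(7) by blast
  with s show ?thesis using B Bwd by metis
qed

lemma segs_ports:
  assumes "(e, a, b) \<in> segs"
  shows "Fwd e a \<in> ports" "b \<noteq> \<infinity> \<Longrightarrow> Bwd e b \<in> ports"
  using segs_D[OF assms] ep_marked[of e a] ep_marked[of e b]
  by (auto simp: ports_def fdirs_def directions_def)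

lemma finite_ports: "finite ports"
proof -
  have "ports \<subseteq> (\<lambda>(e, a, b). Fwd e a) ` segs \<union> (\<lambda>(e, a, b). Bwd e b) ` segs"
  proof
    fix d assume "d \<in> ports"
    then show "d \<in> (\<lambda>(e, a, b). Fwd e a) ` segs \<union> (\<lambda>(e, a, b). Bwd e b) ` segs"
      by (cases rule: ports_cases) force+
  qed
  then show ?thesis using finite_segs by (meson finite_UnI finite_imageI finite_subset)
qed

lemma openin_inside: "s \<in> segs \<Longrightarrow> openin X (seg s)"
proof -
  assume s: "s \<in> segs"
  obtain e a b where sab: "s = (e, a, b)" by (cases s) auto
  show ?thesis
  proof (rule openin_of_germs[OF inside_pts[OF s]])
    fix d assume d: "d \<in> dirs" "bs d \<in> seg s"
    obtain t where t: "bs d = Inner e t" "a < ereal t" "ereal t < b"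
      using d(2) inside_Inner s sab by auto
    then have "d \<in> dirs_at \<Gamma> (Inner e t)" using d by (simp add: dirs_at_def)
    then have "d = Fwd e (ereal t) \<or> d = Bwd e (ereal t)"
      using dirs_at_Inner base_in_pts[OF d(1)] t(1) by auto
    then show "\<forall>\<^sub>F x in germ \<Gamma> d. x \<in> seg s"
    proof
      assume d: "d = Fwd e (ereal t)"
      have "\<forall>\<^sub>F z in at_right (ereal t). z \<in> {a<..<b}"
        using t unfolding eventually_at_right[OF t(3)] by auto
      then show ?thesis unfolding sab d by (auto simp: eventually_filtermap elim!: eventually_mono intro: insideI)
    next
      assume d: "d = Bwd e (ereal t)"
      have "\<forall>\<^sub>F z in at_left (ereal t). z \<in> {a<..<b}"
        using t unfolding eventually_at_left[OF t(2)] by auto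
      then show ?thesis unfolding sab d by (auto simp: eventually_filtermap elim!: eventually_mono intro: insideI)
    qed
  qed
qed

lemma connectedin_ep: "e \<in> E \<Longrightarrow> A \<subseteq> {0..\<l> e} \<Longrightarrow> connected A \<Longrightarrow> connectedin X (ep e ` A)"
  by (rule connectedin_continuous_map_image[OF continuous_map_ep])
    (auto simp: connectedin_subtopology)

lemma connectedin_inside: "s \<in> segs \<Longrightarrow> connectedin X (seg s)"
proof (cases s)
  fix e a b assume s: "s = (e, a, b)" "s \<in> segs"
  show ?thesis
    unfolding s(1) seg.simps
  proof (rule connectedin_ep)
    show "e \<in> E" using segs_D(1) s by blast
    show "{a<..<b} \<subseteq> {0..\<l> e}" using segs_range[of e a b] s by auto
  qed simp
qed

text \<open>The segments are connected, open and disjoint, and they cover the complement of the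
  marked points; so each is also closed there and thus a whole component. This translates
  \<open>compactified\<close> into segments.\<close>

lemma components_unmarked:
  "connected_components_of (subtopology X (pts - mk)) = seg ` segs"
proof -
  let ?Y = "subtopology X (pts - mk)"
  have top: "topspace ?Y = pts - mk" by auto
  have sub: "seg s \<subseteq> pts - mk" if "s \<in> segs" for s
    using inside_pts inside_unmarked that by blast
  have cl: "closedin ?Y (seg s)" if s: "s \<in> segs" for s
  proof -
    have "pts - mk - seg s = \<Union> (seg ` (segs - {s}))"
    proof (intro equalityI subsetI)
      fix x assume "x \<in> pts - mk - seg s"
      then show "x \<in> \<Union> (seg ` (segs - {s}))" using unmarked_inside by (metis DiffE DiffI UN_I singletonD)
    next
      fix x assume "x \<in> \<Union> (seg ` (segs - {s}))"
      then obtain s' where s': "s' \<in> segs" "s' \<noteq> s" "x \<in> seg s'" by blast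
      then show "x \<in> pts - mk - seg s" using sub[OF s'(1)] inside_disjoint[OF s s'(1) _ s'(3)] by blast
    qed
    moreover have "openin X (\<Union> (seg ` (segs - {s})))"
      by (rule openin_Union) (auto intro: openin_inside)
    ultimately have "openin ?Y (topspace ?Y - seg s)"
      unfolding top openin_subtopology by blast
    then show ?thesis unfolding closedin_def top using sub[OF s] by blast
  qed
  have op: "openin ?Y (seg s)" if s: "s \<in> segs" for s
    unfolding openin_subtopology using openin_inside[OF s] sub[OF s] by blast
  have conn: "connectedin ?Y (seg s)" if "s \<in> segs" for s
    using connectedin_inside[OF that] sub[OF that] by (simp add: connectedin_subtopology)
  have comp: "connected_component_of_set ?Y x = seg s" if s: "s \<in> segs" "x \<in> seg s" for s x
  proof
    show "seg s \<subseteq> connected_component_of_set ?Y x"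
      using connected_component_of_maximal[OF conn[OF s(1)] s(2)] by simp
    have "x \<in> topspace ?Y" using sub[OF s(1)] s(2) top by blast
    then have x: "x \<in> connected_component_of_set ?Y x"
      by (simp add: connected_component_of_refl)
    have "connected_component_of_set ?Y x \<subseteq> seg s \<or> disjnt (connected_component_of_set ?Y x) (seg s)"
      by (rule connectedin_clopen_cases[OF connectedin_connected_component_of cl[OF s(1)] op[OF s(1)]])
    then show "connected_component_of_set ?Y x \<subseteq> seg s"
      using x s(2) by (auto simp: disjnt_iff)
  qed
  show ?thesis
  proof (intro equalityI subsetI)
    fix C assume "C \<in> connected_components_of ?Y"
    then obtain x where x: "x \<in> pts - mk" "C = connected_component_of_set ?Y x"
      unfolding connected_components_of_def top by blast
    then obtain s where "s \<in> segs" "x \<in> seg s" using unmarked_inside by blast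
    then show "C \<in> seg ` segs" using comp x by blast
  next
    fix C assume "C \<in> seg ` segs"
    then obtain s where s: "s \<in> segs" "C = seg s" by blast
    obtain x where "x \<in> seg s"
    proof -
      obtain e a b where sab: "s = (e, a, b)" by (cases s) auto
      have "a < b" using s(1) sab segs_D(3) by blast
      then obtain t where "a < t" "t < b" using dense by blast
      then show thesis using that[of "ep e t"] sab insideI by blast
    qed
    then show "C \<in> connected_components_of ?Y"
      unfolding connected_components_of_def top using comp[OF s(1)] s sub[OF s(1)] by blast
  qed
qed

lemma mem_compactified:
  "x \<in> compactified \<Gamma> D S \<longleftrightarrow> x \<in> S \<and> x \<in> mk \<or> (\<exists>s\<in>segs. x \<in> seg s \<and> seg s \<subseteq> S)"
  unfolding compactified_def components_unmarked by blast

subsection \<open>Unions of marked points and closed segments\<close>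

text \<open>An end at infinity may not be isolated in \<open>S\<close>: the direction leaving it
  would be outgoing and need a positive weight, but \<open>D\<close> has no chip there. Finite ends
  of a segment disjoint from \<open>S\<close> may belong to \<open>S\<close>.\<close>

definition cellular :: "('v, 'e) point set \<Rightarrow> bool" where
  "cellular S \<longleftrightarrow> S \<subseteq> pts \<and> (\<forall>(e, a, b)\<in>segs. ep e ` {a..b} \<subseteq> S \<or>
     seg (e, a, b) \<inter> S = {} \<and> (b = \<infinity> \<longrightarrow> ep e b \<notin> S))"

lemma cellular_pts: "cellular S \<Longrightarrow> S \<subseteq> pts"
  by (simp add: cellular_def)

lemma cellular_seg:
  assumes "cellular S" "(e, a, b) \<in> segs"
  obtains (full) "ep e ` {a..b} \<subseteq> S" "seg (e, a, b) \<subseteq> S"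
  | (empty) "seg (e, a, b) \<inter> S = {}" "b = \<infinity> \<Longrightarrow> ep e b \<notin> S"
proof -
  have "seg (e, a, b) \<subseteq> ep e ` {a..b}" by (auto simp: seg.simps intro!: imageI)
  moreover have "ep e ` {a..b} \<subseteq> S \<or> seg (e, a, b) \<inter> S = {} \<and> (b = \<infinity> \<longrightarrow> ep e b \<notin> S)"
    using assms unfolding cellular_def by fast
  ultimately show thesis using that by blast
qed

lemma cellular_inside:
  assumes "cellular S" "s \<in> segs" "x \<in> seg s" "y \<in> seg s"
  shows "x \<in> S \<longleftrightarrow> y \<in> S"
proof -
  obtain e a b where s: "s = (e, a, b)" by (cases s) auto
  have "(e, a, b) \<in> segs" using s assms(2) by simp
  with assms(1) show ?thesis
    by (cases rule: cellular_seg) (use assms(3,4) s in blast)+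
qed

lemma cellular_closed:
  assumes "cellular S"
  shows "closedin X S"
  unfolding closedin_curve
proof (intro conjI ballI)
  fix e assume e: "e \<in> E"
  let ?A = "{t \<in> nodes e. ep e t \<in> S}" and ?B = "{(e', a, b) \<in> segs. e' = e \<and> ep e ` {a..b} \<subseteq> S}"
  have "{t \<in> {0..\<l> e}. ep e t \<in> S} = ?A \<union> (\<Union>(e', a, b)\<in>?B. {a..b})"
  proof (intro equalityI subsetI)
    fix t assume t: "t \<in> {t \<in> {0..\<l> e}. ep e t \<in> S}"
    show "t \<in> ?A \<union> (\<Union>(e', a, b)\<in>?B. {a..b})"
    proof (cases "t \<in> nodes e")
      case False
      then obtain a b where s: "(e, a, b) \<in> segs" "a < t" "t < b"
        using e t by (elim seg_at[of e t, rotated 3]) auto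
      from assms s(1) have "ep e ` {a..b} \<subseteq> S"
        by (cases rule: cellular_seg) (use insideI[OF s(2,3)] t in blast)+
      then have "(e, a, b) \<in> ?B" using s by blast
      moreover have "t \<in> {a..b}" using s by auto
      ultimately show ?thesis by blast
    qed (use t in auto)
  next
    fix t assume "t \<in> ?A \<union> (\<Union>(e', a, b)\<in>?B. {a..b})"
    then show "t \<in> {t \<in> {0..\<l> e}. ep e t \<in> S}"
    proof
      assume "t \<in> ?A"
      then show ?thesis using nodes_bounds[OF e] by auto
    next
      assume "t \<in> (\<Union>(e', a, b)\<in>?B. {a..b})"
      then obtain a b where s: "(e, a, b) \<in> segs" "ep e ` {a..b} \<subseteq> S" "t \<in> {a..b}" by blast
      then have "0 \<le> t" "t \<le> \<l> e" using segs_range[OF s(1)] by auto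
      then show ?thesis using s by auto
    qed
  qed
  moreover have "closed (?A \<union> (\<Union>(e', a, b)\<in>?B. {a..b}))"
  proof (intro closed_Un closed_UN)
    show "finite ?B" by (rule finite_subset[OF _ finite_segs]) auto
    show "closed ?A" by (rule finite_imp_closed) (simp add: finite_nodes)
  qed auto
  ultimately show "closed {t \<in> {0..\<l> e}. ep e t \<in> S}" by simp
qed (rule cellular_pts[OF assms])

lemma finite_components:
  assumes "finite \<C>" "\<And>C. C \<in> \<C> \<Longrightarrow> connectedin Y C" "topspace Y \<subseteq> \<Union> \<C>"
  shows "finite (connected_components_of Y)"
proof -
  have "connected_components_of Y \<subseteq> (\<lambda>C. connected_component_of_set Y (SOME y. y \<in> C)) ` \<C>"
  proof
    fix K assume "K \<in> connected_components_of Y"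
    then obtain x where x: "x \<in> topspace Y" "K = connected_component_of_set Y x"
      by (auto simp: connected_components_of_def)
    then obtain C where C: "C \<in> \<C>" "x \<in> C" using assms(3) by blast
    have "(SOME y. y \<in> C) \<in> C" using C(2) by (rule someI)
    then have "connected_component_of Y x (SOME y. y \<in> C)"
      using assms(2)[OF C(1)] C(2) unfolding connected_component_of_def by blast
    then have "K = connected_component_of_set Y (SOME y. y \<in> C)"
      using x by (simp add: connected_component_of_equiv)
    with C(1) show "K \<in> (\<lambda>C. connected_component_of_set Y (SOME y. y \<in> C)) ` \<C>" by blast
  qed
  then show ?thesis using assms(1) by (meson finite_imageI finite_subset)
qed

lemma cellular_closed_subgraph:
  assumes "cellular S"
  shows "closed_subgraph \<Gamma> S"
proof -
  have "compactin X S"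
    using cellular_closed[OF assms] compact_space_curve by (rule closedin_compact_space[rotated])
  moreover have "finite (connected_components_of (subtopology X S))"
  proof (rule finite_components)
    let ?\<C> = "(\<lambda>x. {x}) ` (mk \<inter> S) \<union> {seg s |s. s \<in> segs \<and> seg s \<subseteq> S}"
    have "{seg s |s. s \<in> segs \<and> seg s \<subseteq> S} \<subseteq> seg ` segs" by blast
    then show "finite ?\<C>" using finite_mk finite_segs by (meson finite_Int finite_UnI finite_imageI finite_subset)
    show "connectedin (subtopology X S) C" if C: "C \<in> ?\<C>" for C
      unfolding connectedin_subtopology
      using C
    proof
      assume "C \<in> (\<lambda>x. {x}) ` (mk \<inter> S)"
      then obtain x where "x \<in> S" "C = {x}" by blast
      then show "connectedin X C \<and> C \<subseteq> S" using cellular_pts[OF assms] by auto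
    next
      assume "C \<in> {seg s |s. s \<in> segs \<and> seg s \<subseteq> S}"
      then show "connectedin X C \<and> C \<subseteq> S" using connectedin_inside by blast
    qed
    have "x \<in> \<Union> ?\<C>" if x: "x \<in> S" for x
    proof (cases "x \<in> mk")
      case False
      then obtain s where s: "s \<in> segs" "x \<in> seg s"
        using unmarked_inside x cellular_pts[OF assms] by blast
      then have "seg s \<subseteq> S" using cellular_inside[OF assms s] x by blast
      with s show ?thesis by blast
    qed (use x in blast)
    then have "S \<subseteq> \<Union> ?\<C>" by (rule subsetI)
    then show "topspace (subtopology X S) \<subseteq> \<Union> ?\<C>" by (simp only: topspace_subtopology) blast
  qed
  ultimately show ?thesis by (simp add: closed_subgraph_def)
qed

subsection \<open>The firing poset\<close>

abbreviation P where "P \<equiv> firing_poset \<Gamma> D"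
abbreviation le_P where "le_P p q \<equiv> (p, q) \<in> firing_order \<Gamma> D"

lemma P_weight_le:
  assumes "(S, c) \<in> P" "d \<in> outgoing \<Gamma> S"
  shows "0 < c d" "c d \<le> D (bs d)"
proof -
  show pos: "0 < c d" using assms by (simp add: firing_poset_def)
  have "d \<in> outgoing \<Gamma> S \<inter> dirs_at \<Gamma> (bs d)" "bs d \<in> S"
    using assms by (auto simp: outgoing_def dirs_at_def)
  moreover have "finite (outgoing \<Gamma> S \<inter> dirs_at \<Gamma> (bs d))" using finite_dirs_at by blast
  moreover have "0 \<le> c d'" if "d' \<in> outgoing \<Gamma> S" for d'
    using that assms by (auto simp: firing_poset_def intro: less_imp_le)
  ultimately have "c d \<le> (\<Sum>d'\<in>outgoing \<Gamma> S \<inter> dirs_at \<Gamma> (bs d). c d')"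
    by (intro member_le_sum) auto
  also have "\<dots> \<le> D (bs d)" using assms \<open>bs d \<in> S\<close> by (auto simp: firing_poset_def)
  finally show "c d \<le> D (bs d)" .
qed

text \<open>Without chips inside a segment no direction based there can be outgoing. So a closed
  \<open>S\<close> that meets a segment has no boundary point in it and contains it
  entirely.\<close>

lemma P_cellular:
  assumes p: "(S, c) \<in> P"
  shows "cellular S"
proof -
  have comp: "compactin X S" using p by (auto simp: firing_poset_def closed_subgraph_def)
  then have Spts: "S \<subseteq> pts" using compactin_subset_topspace by fastforce
  have cl: "closedin X S" by (rule compactin_imp_closedin[OF Hausdorff_curve comp])
  have no_out: "D (bs d) = 0 \<Longrightarrow> d \<notin> outgoing \<Gamma> S" for d
    using P_weight_le[OF p, of d] by auto
  have "ep e ` {a..b} \<subseteq> S \<or> seg (e, a, b) \<inter> S = {} \<and> (b = \<infinity> \<longrightarrow> ep e b \<notin> S)"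
    if s: "(e, a, b) \<in> segs" for e a b
  proof -
    note sD = segs_D[OF s]
    let ?T = "{t \<in> {0..\<l> e}. ep e t \<in> S}"
    have T: "closed ?T" using cl sD(1) by (auto simp: closedin_curve)
    have Dz: "D (ep e t) = 0" if "a < t" "t < b" for t
      using inside_unmarked[OF s insideI[OF that]] by (auto simp: marked_def)
    show ?thesis
    proof (cases "seg (e, a, b) \<inter> S = {}")
      case True
      moreover have "ep e b \<notin> S" if b: "b = \<infinity>"
      proof
        assume S: "ep e b \<in> S"
        have le: "\<l> e = \<infinity>" using sD(8) b by simp
        have d: "Bwd e \<infinity> \<in> dirs" using Bwd_inf_dirs[OF sD(1) le] by blast
        have out: "ep e t \<notin> S" if "t \<in> {a<..<b}" for t
          using insideI[of a t b e] that True by auto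
        have "\<forall>\<^sub>F t in at_left \<infinity>. t \<in> {a<..<b}"
          using sD(3) b unfolding eventually_at_left[OF sD(3)[unfolded b]] by auto
        then have "\<forall>\<^sub>F x in germ \<Gamma> (Bwd e \<infinity>). x \<notin> S"
          using out by (auto simp: eventually_filtermap simp del: ereal_infty_less elim!: eventually_mono)
        then have "Bwd e \<infinity> \<in> outgoing \<Gamma> S" using d S b by (auto simp: outgoing_def)
        moreover have "bs (Bwd e \<infinity>) \<in> infinite_points \<Gamma>"
          using ep_len[OF sD(1)] le sD(1) by (auto simp: infinite_points_def)
        ultimately show False using no_out D_inf by blast
      qed
      ultimately show ?thesis by blast
    next
      case False
      then obtain t0 where t0: "a < t0" "t0 < b" "ep e t0 \<in> S" by (auto elim: insideE)
      have "ep e t \<in> S" if t: "a < t" "t < b" for t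
      proof (rule ccontr)
        assume nt: "ep e t \<notin> S"
        then have "t \<noteq> t0" using t0 by auto
        then consider "t0 < t" | "t < t0" by force
        then show False
        proof cases
          case 1
          let ?K = "?T \<inter> {t0..t}"
          have "compact ?K" unfolding compact_eq_closed by (rule closed_Int[OF T closed_atLeastAtMost])
          moreover have "t0 \<in> ?K" using t0 segs_range'[OF s t0(1,2)] 1 by auto
          \<comment> \<open>The last point of \<open>S\<close> before \<open>t\<close>: the
            direction forward from it leaves \<open>S\<close>, although \<open>D\<close> vanishes
            there.\<close>
          ultimately obtain s0 where s0: "s0 \<in> ?K" "\<And>z. z \<in> ?K \<Longrightarrow> z \<le> s0"
            using compact_attains_sup[of ?K] by blast
          have st: "s0 < t" using s0(1) nt by (auto simp: order_less_le)
          have s0': "a < s0" "s0 < b" "0 < s0" "s0 < \<l> e"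
            using s0(1) t0 t segs_range'[OF s, of s0] by auto
          have out: "ep e z \<notin> S" if "s0 < z" "z < t" for z
          proof
            assume "ep e z \<in> S"
            moreover have "t0 \<le> z" "0 \<le> z" "z \<le> \<l> e"
              using that s0(1) segs_range'[OF s t] by auto
            ultimately have "z \<le> s0" using that by (intro s0(2)) auto
            with that show False by auto
          qed
          have "\<forall>\<^sub>F z in at_right s0. ep e z \<notin> S"
            unfolding eventually_at_right[OF st] using out st by blast
          then have "Fwd e s0 \<in> outgoing \<Gamma> S"
            using s0(1) sD(1) s0' by (auto simp: outgoing_def directions_def eventually_filtermap)
          with no_out Dz s0' show False by auto
        next
          case 2
          let ?K = "?T \<inter> {t..t0}"
          have "compact ?K" unfolding compact_eq_closed by (rule closed_Int[OF T closed_atLeastAtMost])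
          moreover have "t0 \<in> ?K" using t0 segs_range'[OF s t0(1,2)] 2 by auto
          ultimately obtain s0 where s0: "s0 \<in> ?K" "\<And>z. z \<in> ?K \<Longrightarrow> s0 \<le> z"
            using compact_attains_inf[of ?K] by blast
          have st: "t < s0" using s0(1) nt by (auto simp: order_less_le)
          have s0': "a < s0" "s0 < b" "0 < s0" "s0 < \<l> e"
            using s0(1) t0 t segs_range'[OF s, of s0] by auto
          have out: "ep e z \<notin> S" if "z < s0" "t < z" for z
          proof
            assume "ep e z \<in> S"
            moreover have "z \<le> t0" "0 \<le> z" "z \<le> \<l> e"
              using that s0(1) segs_range'[OF s t] by auto
            ultimately have "s0 \<le> z" using that by (intro s0(2)) auto
            with that show False by auto
          qed
          have "\<forall>\<^sub>F z in at_left s0. ep e z \<notin> S"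
            unfolding eventually_at_left[OF st] using out st by blast
          then have "Bwd e s0 \<in> outgoing \<Gamma> S"
            using s0(1) sD(1) s0' by (auto simp: outgoing_def directions_def eventually_filtermap)
          with no_out Dz s0' show False by auto
        qed
      qed
      then have "{a<..<b} \<subseteq> ?T" using segs_range[OF s] by auto
      \<comment> \<open>Closedness adds the end points of the segment, an infinite one
        included.\<close>
      then have "closure {a<..<b} \<subseteq> ?T" using T by (rule closure_minimal)
      then have "{a..b} \<subseteq> ?T" by (simp only: closure_greaterThanLessThan[OF sD(3)])
      then show ?thesis by blast
    qed
  qed
  then show ?thesis using Spts unfolding cellular_def by fast
qed

lemma P_nonempty_proper:
  "(S, c) \<in> P \<Longrightarrow> S \<noteq> {} \<and> S \<noteq> pts"
  by (simp add: firing_poset_def)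

text \<open>The degree of \<open>D\<close>. It bounds the weights in the firing poset and the
  steepness at a port, and thus the number of chips that can leave along one direction.\<close>

definition Dmax :: nat where
  "Dmax = nat (\<Sum>x\<in>mk. D x)"

lemma D_le_Dmax: "D x \<le> int Dmax"
proof (cases "D x = 0")
  case False
  then have "x \<in> mk" by (simp add: marked_def)
  then have "D x \<le> (\<Sum>x\<in>mk. D x)" using finite_mk D_nonneg by (intro member_le_sum) auto
  then show ?thesis by (simp add: Dmax_def)
qed simp

lemma le_P_refl: "p \<in> P \<Longrightarrow> le_P p p"
  by (cases p) (auto simp: firing_order_def)

lemma le_P_outgoing:
  assumes "S \<subseteq> S'" "d \<in> outgoing \<Gamma> S'" "bs d \<in> S"
  shows "d \<in> outgoing \<Gamma> S"
  using assms by (auto simp: outgoing_def elim!: eventually_mono)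

text \<open>The order compares weights only at common outgoing directions. A direction common to the
  two outer subgraphs is outgoing for the middle one as well: its base lies in the smallest and it
  leaves the largest.\<close>

lemma le_P_trans:
  assumes "le_P p q" "le_P q r"
  shows "le_P p r"
proof -
  obtain S c S' c' S'' c'' where pqr: "p = (S, c)" "q = (S', c')" "r = (S'', c'')"
    by (metis prod.exhaust)
  have 1: "S \<subseteq> S'" "S' \<subseteq> S''" "(S, c) \<in> P" "(S'', c'') \<in> P"
    "\<And>d. d \<in> outgoing \<Gamma> S \<inter> outgoing \<Gamma> S' \<Longrightarrow> c' d \<le> c d"
    "\<And>d. d \<in> outgoing \<Gamma> S' \<inter> outgoing \<Gamma> S'' \<Longrightarrow> c'' d \<le> c' d"
    using assms by (auto simp: pqr firing_order_def)
  have "c'' d \<le> c d" if d: "d \<in> outgoing \<Gamma> S" "d \<in> outgoing \<Gamma> S''" for d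
  proof -
    have "bs d \<in> S'" using d(1) 1(1) by (auto simp: outgoing_def)
    then have "d \<in> outgoing \<Gamma> S'" using le_P_outgoing[OF 1(2) d(2)] by blast
    then show ?thesis using 1(5)[of d] 1(6)[of d] d by auto
  qed
  then show ?thesis using 1 by (auto simp: pqr firing_order_def)
qed

lemma le_P_antisym:
  assumes "le_P p q" "le_P q p"
  shows "p = q"
proof -
  obtain S c S' c' where pq: "p = (S, c)" "q = (S', c')" by (metis prod.exhaust)
  have S: "S = S'" using assms by (auto simp: pq firing_order_def)
  have "c d = c' d" for d
  proof (cases "d \<in> outgoing \<Gamma> S")
    case True
    then show ?thesis using assms S by (auto simp: pq firing_order_def intro: antisym)
  next
    case False
    then show ?thesis using assms S by (auto simp: pq firing_order_def firing_poset_def)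
  qed
  then show ?thesis using S pq by auto
qed

end

text \<open>As a function of \<open>t\<close> the sum is concave with breaks at the
  \<open>\<tau> m\<close>. Its slope to the right counts the indices with
  \<open>t < \<tau> m\<close>, its slope to the left those with \<open>t \<le> \<tau> m\<close>; the
  drop at \<open>t\<close> is the number of indices with \<open>\<tau> m = t\<close>, which will be
  the number of chips there.\<close>

lemma sum_min_right:
  fixes \<tau> :: "'m \<Rightarrow> real"
  assumes "finite A"
  shows "\<forall>\<^sub>F y in at_right 0. (\<Sum>m\<in>A. min (t + y) (\<tau> m)) = (\<Sum>m\<in>A. min t (\<tau> m)) + real (card {m\<in>A. t < \<tau> m}) * y"
proof -
  have "\<forall>\<^sub>F y in at_right 0. \<forall>m\<in>A. min (t + y) (\<tau> m) = min t (\<tau> m) + (if t < \<tau> m then y else 0)"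
  proof (rule eventually_ball_finite[OF assms], rule ballI)
    fix m
    show "\<forall>\<^sub>F y in at_right 0. min (t + y) (\<tau> m) = min t (\<tau> m) + (if t < \<tau> m then y else 0)"
    proof (cases "t < \<tau> m")
      case True
      then have "\<forall>\<^sub>F y in at_right 0. y < \<tau> m - t"
        by (intro eventually_at_right_real[THEN eventually_mono]) auto
      then show ?thesis by eventually_elim (use True in auto)
    next
      case False
      show ?thesis using eventually_at_right_less[of 0] by eventually_elim (use False in auto)
    qed
  qed
  then show ?thesis
  proof eventually_elim
    case (elim y)
    then have "(\<Sum>m\<in>A. min (t + y) (\<tau> m)) = (\<Sum>m\<in>A. min t (\<tau> m) + (if t < \<tau> m then y else 0))"
      by (intro sum.cong) auto
    then show ?case using assms by (simp add: sum.distrib sum.inter_filter[symmetric])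
  qed
qed

lemma sum_min_left:
  fixes \<tau> :: "'m \<Rightarrow> real"
  assumes "finite A"
  shows "\<forall>\<^sub>F y in at_right 0. (\<Sum>m\<in>A. min (t - y) (\<tau> m)) = (\<Sum>m\<in>A. min t (\<tau> m)) - real (card {m\<in>A. t \<le> \<tau> m}) * y"
proof -
  have "\<forall>\<^sub>F y in at_right 0. \<forall>m\<in>A. min (t - y) (\<tau> m) = min t (\<tau> m) - (if t \<le> \<tau> m then y else 0)"
  proof (rule eventually_ball_finite[OF assms], rule ballI)
    fix m
    show "\<forall>\<^sub>F y in at_right 0. min (t - y) (\<tau> m) = min t (\<tau> m) - (if t \<le> \<tau> m then y else 0)"
    proof (cases "\<tau> m < t")
      case True
      then have "\<forall>\<^sub>F y in at_right 0. y < t - \<tau> m"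
        by (intro eventually_at_right_real[THEN eventually_mono]) auto
      then show ?thesis by eventually_elim (use True in auto)
    next
      case False
      show ?thesis using eventually_at_right_less[of 0] by eventually_elim (use False in auto)
    qed
  qed
  then show ?thesis
  proof eventually_elim
    case (elim y)
    then have "(\<Sum>m\<in>A. min (t - y) (\<tau> m)) = (\<Sum>m\<in>A. min t (\<tau> m) - (if t \<le> \<tau> m then y else 0))"
      by (intro sum.cong) auto
    then show ?case using assms by (simp add: sum_subtractf sum.inter_filter[symmetric])
  qed
qed

lemma (in tropical_divisor) ex_gap: "\<exists>r>0. \<forall>(e, a, b)\<in>segs. a + ereal (2 * r) < b"
proof -
  have "\<forall>\<^sub>F r in at_right (0::real). \<forall>s\<in>segs. fst (snd s) + ereal (2 * r) < snd (snd s)"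
  proof (rule eventually_ball_finite[OF finite_segs], rule ballI)
    fix s assume "s \<in> segs"
    then obtain e a b where s: "s = (e, a, b)" "(e, a, b) \<in> segs" by (cases s) auto
    obtain \<alpha> where \<alpha>: "a = ereal \<alpha>" using segs_D(7)[OF s(2)] by blast
    \<comment> \<open>A real bound strictly below \<open>b\<close> is taken because \<open>b\<close>
      may be infinite.\<close>
    obtain \<beta> where \<beta>: "\<alpha> < \<beta>" "ereal \<beta> < b"
      using ereal_dense2[OF segs_D(3)[OF s(2)]] \<alpha> by auto
    have "\<forall>\<^sub>F r in at_right (0::real). r < (\<beta> - \<alpha>) / 2"
      using eventually_at_right_real[of 0 "(\<beta> - \<alpha>) / 2"] \<beta> by (auto elim: eventually_mono)
    then show "\<forall>\<^sub>F r in at_right (0::real). fst (snd s) + ereal (2 * r) < snd (snd s)"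
    proof eventually_elim
      case (elim r)
      then have "\<alpha> + 2 * r < \<beta>" by (simp add: field_simps)
      then have "ereal (\<alpha> + 2 * r) < ereal \<beta>" by simp
      also have "\<dots> < b" by (rule \<beta>)
      finally show ?case using s \<alpha> by simp
    qed
  qed
  then obtain \<delta> where \<delta>: "\<delta> > 0" "\<And>r. 0 < r \<Longrightarrow> r < \<delta> \<Longrightarrow> \<forall>s\<in>segs. fst (snd s) + ereal (2 * r) < snd (snd s)"
    by (elim at_right_0_obtain) blast
  have "0 < \<delta> / 2 \<and> (\<forall>s\<in>segs. fst (snd s) + ereal (2 * (\<delta> / 2)) < snd (snd s))"
    using \<delta>(1) \<delta>(2)[of "\<delta> / 2"] by simp
  then show ?thesis by (intro exI[of _ "\<delta> / 2"]) (simp add: case_prod_unfold)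
qed

section \<open>The arms at the marked points\<close>

locale small_link = tropical_divisor \<Gamma> D for \<Gamma> :: "('v, 'e) metric_graph" and D +
  fixes r \<epsilon> :: real
  assumes r_pos: "0 < r" and r_gap: "\<forall>(e, a, b)\<in>segs. a + ereal (2 * r) < b"
    and eps_pos: "0 < \<epsilon>" and eps_r: "\<epsilon> < r"
begin

text \<open>The factor 2 leaves room for one arm of length \<open>r\<close> at each end of a segment
  and for a middle part between them.\<close>

lemma gap: "(e, ereal a, b) \<in> segs \<Longrightarrow> ereal (a + 2 * r) < b"
  using r_gap by force

lemma port_seg:
  assumes "d \<in> ports"
  obtains s where "s \<in> segs" "\<And>x. 0 < x \<Longrightarrow> x \<le> 2 * r \<Longrightarrow> pt d x \<in> seg s \<and> ereal x < room d"
  using assms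
proof (cases rule: ports_cases)
  case (Fwd e a b)
  have "pt d x \<in> seg (e, ereal a, b) \<and> ereal x < room d" if x: "0 < x" "x \<le> 2 * r" for x
  proof -
    have "ereal (a + x) \<le> ereal (a + 2 * r)" using x by simp
    also have "\<dots> < b" by (rule gap[OF Fwd(2)])
    finally have b: "ereal (a + x) < b" .
    then have "ereal (a + x) < \<l> e" using segs_D(4)[OF Fwd(2)] by auto
    then show ?thesis using Fwd(1) x b by (auto simp: ereal_less_minus_iff' intro!: insideI)
  qed
  then show ?thesis using that Fwd(2) by blast
next
  case (Bwd e a b)
  have "pt d x \<in> seg (e, ereal a, ereal b) \<and> ereal x < room d" if x: "0 < x" "x \<le> 2 * r" for x
  proof -
    have "a + 2 * r < b" using gap[OF Bwd(2)] by simp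
    moreover have "0 \<le> a" using segs_D(2)[OF Bwd(2)] by simp
    ultimately show ?thesis using Bwd(1) x by (auto intro!: insideI)
  qed
  then show ?thesis using that Bwd(2) by blast
qed

lemma port_room: "d \<in> ports \<Longrightarrow> x \<le> 2 * r \<Longrightarrow> ereal x < room d"
  using port_seg[of d] room_pos[OF ports_fdirs, of d]
  by (metis ereal_less_eq(3) le_less_trans linorder_not_less zero_ereal_def)

lemma pt_unmarked: "d \<in> ports \<Longrightarrow> 0 < x \<Longrightarrow> x \<le> 2 * r \<Longrightarrow> pt d x \<notin> mk"
  using port_seg[of d] inside_unmarked by metis

text \<open>Arms at the two ends of a segment are disjoint by \<open>gap\<close>, and different
  segments do not meet. Hence the position of a chip determines its port and its distance from the
  base.\<close>

lemma pt_inj: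
  assumes d: "d \<in> ports" "d' \<in> ports" and x: "0 < x" "x \<le> r" "0 < x'" "x' \<le> r" and eq: "pt d x = pt d' x'"
  shows "d = d' \<and> x = x'"
proof -
  have rep: "\<exists>e a b. (e, a, b) \<in> segs \<and> pt d x \<in> seg (e, a, b) \<and>
      (\<exists>\<alpha>. a = ereal \<alpha> \<and> d = Fwd e a \<and> pt d x = Inner e (\<alpha> + x) \<or>
       (\<exists>\<alpha> \<beta>. a = ereal \<alpha> \<and> b = ereal \<beta> \<and> d = Bwd e b \<and> pt d x = Inner e (\<beta> - x) \<and> \<alpha> + 2 * r < \<beta>))"
    if "d \<in> ports" "0 < x" "x \<le> r" for d x
    using that(1)
  proof (cases rule: ports_cases)
    case (Fwd e a b)
    have "ereal (a + x) < b" using gap[OF Fwd(2)] that by (auto intro: le_less_trans[of _ "ereal (a + 2 * r)"])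
    then have "pt d x \<in> seg (e, ereal a, b)" using Fwd(1) that by (auto intro!: insideI)
    moreover from this have "pt d x = Inner e (a + x)"
      using inside_Inner[OF Fwd(2)] Fwd(1) by (auto simp: ep_eq_Inner)
    ultimately show ?thesis using Fwd by blast
  next
    case (Bwd e a b)
    have ab: "a + 2 * r < b" using gap[OF Bwd(2)] by simp
    then have "pt d x \<in> seg (e, ereal a, ereal b)" using Bwd(1) that by (auto intro!: insideI)
    moreover from this have "pt d x = Inner e (b - x)"
      using inside_Inner[OF Bwd(2)] Bwd(1) by (auto simp: ep_eq_Inner)
    ultimately show ?thesis using Bwd ab by blast
  qed
  from rep[OF d(1) x(1,2)] obtain e a b where 1: "(e, a, b) \<in> segs" "pt d x \<in> seg (e, a, b)"
     "(\<exists>\<alpha>. a = ereal \<alpha> \<and> d = Fwd e a \<and> pt d x = Inner e (\<alpha> + x) \<or>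
       (\<exists>\<alpha> \<beta>. a = ereal \<alpha> \<and> b = ereal \<beta> \<and> d = Bwd e b \<and> pt d x = Inner e (\<beta> - x) \<and> \<alpha> + 2 * r < \<beta>))"
    by blast
  from rep[OF d(2) x(3,4)] obtain e' a' b' where 2: "(e', a', b') \<in> segs" "pt d' x' \<in> seg (e', a', b')"
     "(\<exists>\<alpha>. a' = ereal \<alpha> \<and> d' = Fwd e' a' \<and> pt d' x' = Inner e' (\<alpha> + x') \<or>
       (\<exists>\<alpha> \<beta>. a' = ereal \<alpha> \<and> b' = ereal \<beta> \<and> d' = Bwd e' b' \<and> pt d' x' = Inner e' (\<beta> - x') \<and> \<alpha> + 2 * r < \<beta>))"
    by blast
  have "(e, a, b) = (e', a', b')" using inside_disjoint[OF 1(1) 2(1) 1(2)] 2(2) eq by simp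
  then show ?thesis using 1(3) 2(3) eq x by auto
qed

text \<open>\<open>pt d r\<close> serves as the test point of the segment entered by
  \<open>d\<close>: a cellular set contains the whole segment iff it contains this point.\<close>

lemma cell_port:
  assumes "cellular S" "d \<in> ports" "0 < x" "x \<le> 2 * r"
  shows "pt d x \<in> S \<longleftrightarrow> pt d r \<in> S"
proof -
  obtain s where s: "s \<in> segs" "\<And>x. 0 < x \<Longrightarrow> x \<le> 2 * r \<Longrightarrow> pt d x \<in> seg s \<and> ereal x < room d"
    using port_seg[OF assms(2)] by blast
  show ?thesis
    by (rule cellular_inside[OF assms(1) s(1)]) (use s(2) assms r_pos in auto)
qed

lemma cell_port_base:
  assumes S: "cellular S" and d: "d \<in> ports" and m: "pt d r \<in> S"
  shows "bs d \<in> S"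
  using d
proof (cases rule: ports_cases)
  case (Fwd e a b)
  have "pt d r \<in> seg (e, ereal a, b)"
    using Fwd gap[OF Fwd(2)] r_pos by (auto intro!: insideI intro: le_less_trans[of _ "ereal (a + 2 * r)"])
  with S Fwd(2) show ?thesis
    by (cases rule: cellular_seg) (use m Fwd segs_D(3)[OF Fwd(2)] in auto)
next
  case (Bwd e a b)
  have "pt d r \<in> seg (e, ereal a, ereal b)"
    using Bwd gap[OF Bwd(2)] r_pos by (auto intro!: insideI)
  with S Bwd(2) show ?thesis
    by (cases rule: cellular_seg) (use m Bwd segs_D(3)[OF Bwd(2)] in auto)
qed

lemma seg_port:
  assumes "s \<in> segs"
  obtains d where "d \<in> ports" "pt d r \<in> seg s"
proof -
  obtain e a b where s: "s = (e, a, b)" "(e, a, b) \<in> segs" using assms by (cases s) auto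
  obtain \<alpha> where \<alpha>: "a = ereal \<alpha>" using segs_D(7)[OF s(2)] by blast
  have "ereal (\<alpha> + r) < b"
    using gap[of e \<alpha> b] s(2) \<alpha> r_pos by (auto intro: le_less_trans[of _ "ereal (\<alpha> + 2 * r)"])
  then have "pt (Fwd e a) r \<in> seg s" using s \<alpha> r_pos by (auto intro!: insideI)
  then show thesis using that segs_ports(1)[OF s(2)] by blast
qed

lemma cellular_eqI:
  assumes "cellular S" "cellular S'" "\<And>x. x \<in> mk \<Longrightarrow> x \<in> S \<longleftrightarrow> x \<in> S'"
    and "\<And>d. d \<in> ports \<Longrightarrow> pt d r \<in> S \<longleftrightarrow> pt d r \<in> S'"
  shows "S = S'"
proof -
  have "x \<in> S \<longleftrightarrow> x \<in> S'" if "x \<in> pts" for x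
  proof (cases "x \<in> mk")
    case False
    then obtain s where s: "s \<in> segs" "x \<in> seg s" using unmarked_inside \<open>x \<in> pts\<close> by blast
    obtain d where d: "d \<in> ports" "pt d r \<in> seg s" using seg_port[OF s(1)] by blast
    show ?thesis
      using cellular_inside[OF assms(1) s(1) s(2) d(2)] cellular_inside[OF assms(2) s(1) s(2) d(2)]
        assms(4)[OF d(1)] by blast
  qed (use assms(3) in blast)
  then show ?thesis using cellular_pts[OF assms(1)] cellular_pts[OF assms(2)] by blast
qed

text \<open>A direction based inside a segment of \<open>S\<close> stays in \<open>S\<close>, and so
  does one based at an infinite point of \<open>S\<close>, since its segment belongs to
  \<open>S\<close> too. So only ports can leave, and the test point decides whether they do.\<close>

lemma outgoing_cellular:
  assumes S: "cellular S"
  shows "outgoing \<Gamma> S = {d \<in> ports. bs d \<in> S \<and> pt d r \<notin> S}"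
proof (intro equalityI subsetI)
  fix d assume "d \<in> {d \<in> ports. bs d \<in> S \<and> pt d r \<notin> S}"
  then have d: "d \<in> ports" "bs d \<in> S" "pt d r \<notin> S" by auto
  have "\<forall>\<^sub>F x in at_right 0. x < 2 * r"
    using r_pos by (intro eventually_at_right_real[THEN eventually_mono]) auto
  then have "\<forall>\<^sub>F x in at_right 0. pt d x \<notin> S"
    using eventually_at_right_less[of 0] by eventually_elim (use cell_port[OF S d(1)] d(3) in auto)
  then show "d \<in> outgoing \<Gamma> S"
    using d ports_dirs[OF d(1)] by (simp add: outgoing_def germ_pt[OF ports_fdirs[OF d(1)]] eventually_filtermap)
next
  fix d assume d: "d \<in> outgoing \<Gamma> S"
  then have dd: "d \<in> dirs" "bs d \<in> S" "\<forall>\<^sub>F x in germ \<Gamma> d. x \<notin> S" by (auto simp: outgoing_def)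
  have nb: "germ \<Gamma> d \<noteq> bot"
  proof (cases "d \<in> fdirs")
    case True
    then show ?thesis by (simp add: germ_pt filtermap_bot_iff trivial_limit_at_right_real)
  next
    case False
    with dd(1) obtain e where "d = Bwd e \<infinity>" by (cases rule: dirs_cases) auto
    then show ?thesis by (simp only: germ_inf filtermap_bot_iff trivial_limit_at_top_linorder not_False_eq_True)
  qed
  have notin: "\<not> (\<forall>\<^sub>F x in germ \<Gamma> d. x \<in> S)"
  proof
    assume "\<forall>\<^sub>F x in germ \<Gamma> d. x \<in> S"
    with dd(3) have "\<forall>\<^sub>F x in germ \<Gamma> d. False" by eventually_elim simp
    with nb show False by (simp add: eventually_False)
  qed
  have "bs d \<in> mk"
  proof (rule ccontr)
    assume "bs d \<notin> mk"
    then obtain s where s: "s \<in> segs" "bs d \<in> seg s" using unmarked_inside base_in_pts[OF dd(1)] by blast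
    then have "seg s \<subseteq> S" using cellular_inside[OF S s] dd(2) by blast
    moreover have "\<forall>\<^sub>F x in germ \<Gamma> d. x \<in> seg s"
    proof -
      obtain e a b where sab: "s = (e, a, b)" by (cases s) auto
      obtain t where t: "bs d = Inner e t" "a < ereal t" "ereal t < b"
        using s inside_Inner sab by auto
      then have "d \<in> dirs_at \<Gamma> (Inner e t)" using dd by (simp add: dirs_at_def)
      then have "d = Fwd e (ereal t) \<or> d = Bwd e (ereal t)"
        using dirs_at_Inner base_in_pts[OF dd(1)] t(1) by auto
      then show ?thesis
      proof
        assume d: "d = Fwd e (ereal t)"
        have "\<forall>\<^sub>F z in at_right (ereal t). z \<in> {a<..<b}"
          using t unfolding eventually_at_right[OF t(3)] by auto
        then show ?thesis unfolding sab d by (auto simp: eventually_filtermap elim!: eventually_mono intro: insideI)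
      next
        assume d: "d = Bwd e (ereal t)"
        have "\<forall>\<^sub>F z in at_left (ereal t). z \<in> {a<..<b}"
          using t unfolding eventually_at_left[OF t(2)] by auto
        then show ?thesis unfolding sab d by (auto simp: eventually_filtermap elim!: eventually_mono intro: insideI)
      qed
    qed
    ultimately have "\<forall>\<^sub>F x in germ \<Gamma> d. x \<in> S" by (auto elim: eventually_mono)
    with notin show False by blast
  qed
  moreover have "d \<in> fdirs"
  proof (rule ccontr)
    assume "d \<notin> fdirs"
    with dd(1) obtain e where e: "d = Bwd e \<infinity>" "e \<in> E" "\<l> e = \<infinity>" by (cases rule: dirs_cases) auto
    have "\<infinity> \<in> nodes e" using e by (simp add: nodes_def)
    then obtain a where s: "(e, a, \<infinity>) \<in> segs" using seg_left_of[of e \<infinity>] e by auto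
    from S s have sub: "seg (e, a, \<infinity>) \<subseteq> S"
      by (cases rule: cellular_seg) (use dd(2) e in auto)
    have ai: "a < \<infinity>" using segs_D(3)[OF s] .
    have "\<forall>\<^sub>F t in at_left \<infinity>. t \<in> {a<..<\<infinity>}"
      using ai unfolding eventually_at_left[OF ai] by auto
    then have "\<forall>\<^sub>F x in germ \<Gamma> d. x \<in> S"
      unfolding e(1) germ.simps eventually_filtermap
    proof eventually_elim
      case (elim t)
      then have "ep e t \<in> seg (e, a, \<infinity>)" by (intro insideI) auto
      with sub show ?case by blast
    qed
    with notin show False by blast
  qed
  ultimately have port: "d \<in> ports" by (simp add: ports_def)
  have "pt d r \<notin> S"
  proof
    assume m: "pt d r \<in> S"
    have "\<forall>\<^sub>F x in at_right 0. x < 2 * r"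
      using r_pos by (intro eventually_at_right_real[THEN eventually_mono]) auto
    then have "\<forall>\<^sub>F x in at_right 0. pt d x \<in> S"
      using eventually_at_right_less[of 0] by eventually_elim (use cell_port[OF S port] m in auto)
    then show False
      using notin by (simp add: germ_pt[OF ports_fdirs[OF port]] eventually_filtermap)
  qed
  then show "d \<in> {d \<in> ports. bs d \<in> S \<and> pt d r \<notin> S}" using port dd(2) by blast
qed

lemma P_snd:
  assumes "p \<in> P"
  shows "cellular (fst p)" "0 \<le> snd p d" "snd p d \<le> int Dmax"
    "0 < snd p d \<longleftrightarrow> d \<in> ports \<and> bs d \<in> fst p \<and> pt d r \<notin> fst p"
proof -
  obtain S c where p: "p = (S, c)" by (cases p)
  with assms have SP: "(S, c) \<in> P" by simp
  have S: "cellular S" by (rule P_cellular[OF SP])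
  then show "cellular (fst p)" by (simp add: p)
  have zero: "c d = 0" if "d \<notin> outgoing \<Gamma> S" for d using SP that by (simp add: firing_poset_def)
  show "0 \<le> snd p d" using P_weight_le(1)[OF SP, of d] zero[of d] p by force
  show "snd p d \<le> int Dmax"
    using P_weight_le(2)[OF SP, of d] zero[of d] p D_le_Dmax[of "bs d"] by (cases "d \<in> outgoing \<Gamma> S") auto
  show "0 < snd p d \<longleftrightarrow> d \<in> ports \<and> bs d \<in> fst p \<and> pt d r \<notin> fst p"
    using P_weight_le(1)[OF SP, of d] zero[of d] p
    by (cases "d \<in> outgoing \<Gamma> S") (auto simp: outgoing_cellular[OF S])
qed

lemma P_snd_0: "p \<in> P \<Longrightarrow> d \<in> ports \<Longrightarrow> bs d \<in> fst p \<Longrightarrow> snd p d = 0 \<longleftrightarrow> pt d r \<in> fst p"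
  using P_snd(2,4)[of p d] by force

text \<open>Weights vanish off the outgoing directions, so the sum may run over all ports at
  \<open>x\<close>, an index set that does not depend on the subgraph.\<close>

lemma port_sum:
  assumes "finite A" "A \<subseteq> ports" "\<And>d. d \<in> ports - A \<Longrightarrow> c d = 0"
  shows "(\<Sum>d\<in>A \<inter> dirs_at \<Gamma> x. c d) = (\<Sum>d\<in>{d \<in> ports. bs d = x}. (c d :: int))"
  using finite_ports assms ports_dirs by (intro sum.mono_neutral_left) (auto simp: dirs_at_def)

lemma P_sum:
  assumes "p \<in> P" "x \<in> fst p"
  shows "(\<Sum>d\<in>{d \<in> ports. bs d = x}. snd p d) \<le> D x"
proof -
  obtain S c where p: "p = (S, c)" by (cases p)
  with assms have SP: "(S, c) \<in> P" by simp
  have "(\<Sum>d\<in>outgoing \<Gamma> S \<inter> dirs_at \<Gamma> x. c d) = (\<Sum>d\<in>{d \<in> ports. bs d = x}. c d)"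
    using SP finite_ports outgoing_cellular[OF P_cellular[OF SP]] by (intro port_sum) (auto simp: firing_poset_def)
  then show ?thesis using SP assms(2) p by (auto simp: firing_poset_def)
qed

lemma P_I:
  assumes S: "cellular S" "S \<noteq> {}" "S \<noteq> pts"
    and c: "\<And>d. d \<in> ports \<Longrightarrow> bs d \<in> S \<Longrightarrow> pt d r \<notin> S \<Longrightarrow> 0 < c d"
      "\<And>d. \<not> (d \<in> ports \<and> bs d \<in> S \<and> pt d r \<notin> S) \<Longrightarrow> c d = 0"
    and sum: "\<And>x. x \<in> mk \<Longrightarrow> x \<in> S \<Longrightarrow> (\<Sum>d\<in>{d \<in> ports. bs d = x}. c d) \<le> D x"
  shows "(S, c) \<in> P"
proof -
  have "(\<Sum>d\<in>outgoing \<Gamma> S \<inter> dirs_at \<Gamma> x. c d) \<le> D x" if x: "x \<in> S" for x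
  proof -
    have eq: "(\<Sum>d\<in>outgoing \<Gamma> S \<inter> dirs_at \<Gamma> x. c d) = (\<Sum>d\<in>{d \<in> ports. bs d = x}. c d)"
      using finite_ports c(2) unfolding outgoing_cellular[OF S(1)] by (intro port_sum) auto
    show ?thesis
    proof (cases "x \<in> mk")
      case False
      then have none: "{d \<in> ports. bs d = x} = {}" using ports_mk by blast
      show ?thesis using eq D_nonneg unfolding none by simp
    qed (use eq sum x in simp)
  qed
  then show ?thesis
    using S c cellular_closed_subgraph[OF S(1)] outgoing_cellular[OF S(1)] by (auto simp: firing_poset_def)
qed

text \<open>Because weights are extended by 0, they can be compared at every direction based in the
  smaller subgraph, not only at common outgoing ones.\<close>

lemma le_P_D:
  assumes "le_P p q"
  shows "p \<in> P" "q \<in> P" "fst p \<subseteq> fst q" "bs d \<in> fst p \<Longrightarrow> snd q d \<le> snd p d"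
proof -
  obtain S c S' c' where pq: "p = (S, c)" "q = (S', c')" by (metis prod.exhaust)
  have *: "(S, c) \<in> P" "(S', c') \<in> P" "S \<subseteq> S'" "\<And>d. d \<in> outgoing \<Gamma> S \<inter> outgoing \<Gamma> S' \<Longrightarrow> c' d \<le> c d"
    using assms by (auto simp: pq firing_order_def)
  then show "p \<in> P" "q \<in> P" "fst p \<subseteq> fst q" by (auto simp: pq)
  assume "bs d \<in> fst p"
  then have "c' d \<le> c d"
  proof (cases "d \<in> outgoing \<Gamma> S'")
    case True
    then have "d \<in> outgoing \<Gamma> S" using le_P_outgoing[OF *(3)] \<open>bs d \<in> fst p\<close> pq by simp
    with True *(4) show ?thesis by blast
  next
    case False
    then have "c' d = 0" using *(2) by (simp add: firing_poset_def)
    then show ?thesis using P_snd(2)[OF *(1), of d] by simp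
  qed
  then show "snd q d \<le> snd p d" by (simp add: pq)
qed

lemma le_P_I:
  assumes "p \<in> P" "q \<in> P" "fst p \<subseteq> fst q" "\<And>d. bs d \<in> fst p \<Longrightarrow> snd q d \<le> snd p d"
  shows "le_P p q"
proof -
  obtain S c S' c' where pq: "p = (S, c)" "q = (S', c')" by (metis prod.exhaust)
  show ?thesis using assms by (auto simp: pq firing_order_def outgoing_def)
qed

text \<open>Used in contrapositive form: a strict step in the poset shows either in a new marked
  point or in a smaller weight at an old port. In particular, when a segment joins the subgraph
  between old marked points, the weight at its port drops to 0.\<close>

lemma le_P_eqI:
  assumes le: "le_P p q" and mk: "\<And>x. x \<in> mk \<Longrightarrow> x \<in> fst q \<Longrightarrow> x \<in> fst p"
    and w: "\<And>d. d \<in> ports \<Longrightarrow> bs d \<in> fst p \<Longrightarrow> snd p d \<le> snd q d"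
  shows "p = q"
proof -
  note L = le_P_D[OF le]
  have S: "fst p = fst q"
  proof (rule cellular_eqI[OF P_snd(1)[OF L(1)] P_snd(1)[OF L(2)]])
    fix d assume d: "d \<in> ports"
    show "pt d r \<in> fst p \<longleftrightarrow> pt d r \<in> fst q"
    proof
      assume q: "pt d r \<in> fst q"
      then have bq: "bs d \<in> fst q" using cell_port_base[OF P_snd(1)[OF L(2)] d] by blast
      then have bp: "bs d \<in> fst p" using mk ports_mk[OF d] by blast
      have "snd q d = 0" using P_snd_0[OF L(2) d bq] q by blast
      then have "snd p d = 0" using w[OF d bp] P_snd(2)[OF L(1), of d] by simp
      then show "pt d r \<in> fst p" using P_snd_0[OF L(1) d bp] by blast
    qed (use L(3) in blast)
  qed (use L(3) mk in blast)
  have "snd p d = snd q d" for d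
  proof (cases "d \<in> ports \<and> bs d \<in> fst p")
    case True
    then show ?thesis using w[of d] L(4)[of d] by auto
  next
    case False
    then show ?thesis using S P_snd(2,4)[OF L(1), of d] P_snd(2,4)[OF L(2), of d] by force
  qed
  then show ?thesis using S by (intro prod_eqI ext) auto
qed

text \<open>A cellular set is determined by its marked points and segments, and the weights at the
  ports lie between 0 and \<open>Dmax\<close>.\<close>

lemma finite_P: "finite P"
proof -
  let ?\<S> = "(\<lambda>(A, B). A \<union> \<Union> (seg ` B)) ` (Pow mk \<times> Pow segs)"
  let ?C = "{c. \<forall>d. (d \<in> ports \<longrightarrow> c d \<in> {0..int Dmax}) \<and> (d \<notin> ports \<longrightarrow> c d = 0)}"
  have "P \<subseteq> ?\<S> \<times> ?C"
  proof
    fix p assume p: "p \<in> P"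
    have cel: "cellular (fst p)" by (rule P_snd(1)[OF p])
    let ?A = "mk \<inter> fst p" and ?B = "{s \<in> segs. seg s \<subseteq> fst p}"
    have "fst p = ?A \<union> \<Union> (seg ` ?B)"
    proof (intro equalityI subsetI)
      fix x assume x: "x \<in> fst p"
      show "x \<in> ?A \<union> \<Union> (seg ` ?B)"
      proof (cases "x \<in> mk")
        case False
        then obtain s where s: "s \<in> segs" "x \<in> seg s"
          using unmarked_inside x cellular_pts[OF cel] by blast
        then have "seg s \<subseteq> fst p" using cellular_inside[OF cel s] x by blast
        with s show ?thesis by blast
      qed (use x in blast)
    qed blast
    moreover have "(\<lambda>(A, B). A \<union> \<Union> (seg ` B)) (?A, ?B) \<in> ?\<S>" by (rule imageI) blast
    ultimately have "fst p \<in> ?\<S>" by (simp only: prod.case)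
    moreover have "snd p d \<in> {0..int Dmax}" for d using P_snd(2,3)[OF p] by simp
    then have "snd p \<in> ?C" using P_snd(2,4)[OF p] by (auto simp: order.order_iff_strict)
    ultimately show "p \<in> ?\<S> \<times> ?C" unfolding mem_Times_iff by (rule conjI)
  qed
  moreover have "finite ?\<S>" using finite_mk finite_segs by simp
  moreover have "finite ?C" using finite_ports by (intro finite_set_of_finite_funs) auto
  ultimately show ?thesis by (rule finite_subset[OF _ finite_cartesian_product])
qed

abbreviation K where "K \<equiv> order_complex (firing_order \<Gamma> D)"

lemma K_D:
  assumes "\<sigma> \<in> K"
  shows "\<sigma> \<subseteq> P" "finite \<sigma>" "\<sigma> \<noteq> {}" "p \<in> \<sigma> \<Longrightarrow> q \<in> \<sigma> \<Longrightarrow> le_P p q \<or> le_P q p"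
  using assms le_P_D(1) unfolding order_complex_def Chains_def by blast+

lemma K_I:
  assumes "\<sigma> \<subseteq> P" "\<sigma> \<noteq> {}" "\<And>p q. p \<in> \<sigma> \<Longrightarrow> q \<in> \<sigma> \<Longrightarrow> le_P p q \<or> le_P q p"
  shows "\<sigma> \<in> K"
  using assms finite_subset[OF assms(1) finite_P] by (auto simp: order_complex_def Chains_def)

lemma compact_realization_K: "compact (realization K)"
proof (rule compact_realization[OF finite_P])
  show "K \<subseteq> Pow P" using K_D(1) by blast
  show "\<tau> \<in> K" if "\<sigma> \<in> K" "\<tau> \<subseteq> \<sigma>" "\<tau> \<noteq> {}" for \<sigma> \<tau>
    using K_D[OF that(1)] that(2,3) by (intro K_I) blast+
qed (rule K_D(3))

end

section \<open>Functions in normal form\<close>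

context small_link
begin

text \<open>The function \<open>g\<close> has slope at most \<open>- m\<close> along the port \<open>d\<close> exactly up to distance \<open>\<tau> d m\<close> from its
  base; the chips of \<open>D + (g)\<close> that left along \<open>d\<close> sit at the positive distances \<open>\<tau> d m\<close>.\<close>

definition nform :: "(('v, 'e) point \<Rightarrow> real) \<Rightarrow> ('e direction \<Rightarrow> nat \<Rightarrow> real) \<Rightarrow> bool" where
  "nform g \<tau> \<longleftrightarrow>
    (\<forall>d\<in>ports. \<forall>m. 0 \<le> \<tau> d m \<and> \<tau> d m \<le> \<epsilon>) \<and>
    (\<forall>d\<in>ports. \<forall>m n. m \<le> n \<longrightarrow> \<tau> d n \<le> \<tau> d m) \<and>
    (\<forall>d\<in>ports. \<forall>x. 0 \<le> x \<and> x \<le> r \<longrightarrow> g (pt d x) = g (bs d) - (\<Sum>m=1..Dmax. min x (\<tau> d m))) \<and>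
    (\<forall>(e, a, b)\<in>segs. \<forall>t. a + ereal r \<le> t \<and> t + ereal r \<le> b \<longrightarrow> g (ep e t) = g (ep e (a + ereal r))) \<and>
    (\<forall>x\<in>mk. (\<Sum>d\<in>{d \<in> ports. bs d = x}. int (card {m\<in>{1..Dmax}. 0 < \<tau> d m})) \<le> D x)"

lemma nform_D:
  assumes "nform g \<tau>"
  shows "d \<in> ports \<Longrightarrow> 0 \<le> \<tau> d m" "d \<in> ports \<Longrightarrow> \<tau> d m \<le> \<epsilon>" "d \<in> ports \<Longrightarrow> m \<le> n \<Longrightarrow> \<tau> d n \<le> \<tau> d m"
    "d \<in> ports \<Longrightarrow> 0 \<le> x \<Longrightarrow> x \<le> r \<Longrightarrow> g (pt d x) = g (bs d) - (\<Sum>m=1..Dmax. min x (\<tau> d m))"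
    "(e, a, b) \<in> segs \<Longrightarrow> a + ereal r \<le> t \<Longrightarrow> t + ereal r \<le> b \<Longrightarrow> g (ep e t) = g (ep e (a + ereal r))"
    "u \<in> mk \<Longrightarrow> (\<Sum>d\<in>{d \<in> ports. bs d = u}. int (card {m\<in>{1..Dmax}. 0 < \<tau> d m})) \<le> D u"
  using assms unfolding nform_def by blast+

lemma nform_tau_r: "nform g \<tau> \<Longrightarrow> d \<in> ports \<Longrightarrow> \<tau> d m < r"
  using nform_D(2) eps_r by (meson le_less_trans)

lemma seg_gap:
  assumes "(e, a, b) \<in> segs"
  obtains \<alpha> where "a = ereal \<alpha>" "0 \<le> \<alpha>" "ereal (\<alpha> + 2 * r) < b"
  using segs_D(2,7)[OF assms] gap assms by auto

text \<open>Distance exactly \<open>r\<close> belongs to the middle part: since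
  \<open>\<tau> d m < r\<close>, a normal form is already flat there on both sides.\<close>

lemma point_cases:
  assumes "x \<in> pts"
  obtains (marked) "x \<in> mk"
  | (arm) d t where "d \<in> ports" "0 < t" "t < r" "x = pt d t" "x \<notin> mk"
  | (mid) e \<alpha> b t where "(e, ereal \<alpha>, b) \<in> segs" "\<alpha> + r \<le> t" "ereal (t + r) \<le> b" "x = ep e (ereal t)"
      "x = Inner e t" "x \<notin> mk"
proof (cases "x \<in> mk")
  case False
  then obtain e a b where s: "(e, a, b) \<in> segs" "x \<in> seg (e, a, b)"
    using unmarked_inside[OF assms] by (metis prod_cases3)
  obtain \<alpha> where \<alpha>: "a = ereal \<alpha>" "0 \<le> \<alpha>" "ereal (\<alpha> + 2 * r) < b" using seg_gap[OF s(1)] by blast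
  obtain t where t: "x = Inner e t" "\<alpha> < t" "ereal t < b"
    using inside_Inner[OF s(1)] s(2) \<alpha> by auto
  have x: "x = ep e (ereal t)"
    using segs_range'[OF s(1), of "ereal t"] t \<alpha> by (auto simp: ep_Inner)
  show thesis
  proof (cases "t < \<alpha> + r")
    case True
    have "x = pt (Fwd e a) (t - \<alpha>)" using x \<alpha> by simp
    then show thesis
      using arm[of "Fwd e a" "t - \<alpha>"] segs_ports(1)[OF s(1)] t True False by simp
  next
    case left: False
    show thesis
    proof (cases "ereal (t + r) \<le> b")
      case True
      show thesis
        by (rule mid[of e \<alpha> b t]) (use s \<alpha> left True x t False in auto)
    next
      case right: False
      then have "b \<noteq> \<infinity>" by auto
      then obtain \<beta> where \<beta>: "b = ereal \<beta>" using segs_D(9)[OF s(1)] by blast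
      have "x = pt (Bwd e b) (\<beta> - t)" using x \<beta> by simp
      then show thesis
        using arm[of "Bwd e b" "\<beta> - t"] segs_ports(2)[OF s(1)] \<beta> t right False by simp
    qed
  qed
qed (rule marked)

section \<open>Slopes and divisor of a function in normal form\<close>

lemma nf_right:
  assumes nf: "nform g \<tau>" and d: "d \<in> ports" and t: "0 \<le> t" "t < r"
  shows "germ_slope g (- int (card {m\<in>{1..Dmax}. t < \<tau> d m})) (adv d t)"
proof -
  have fd: "d \<in> fdirs" by (rule ports_fdirs[OF d])
  have "adv d t \<in> fdirs" using adv_fdirs[OF fd t(1)] port_room[OF d, of t] t r_pos by simp
  moreover have "\<forall>\<^sub>F y in at_right 0. y < r - t"
    using t by (intro eventually_at_right_real[THEN eventually_mono]) auto
  then have "\<forall>\<^sub>F y in at_right 0. g (pt d (t + y)) = g (pt d t) - real (card {m\<in>{1..Dmax}. t < \<tau> d m}) * y"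
    using sum_min_right[of "{1..Dmax}" t "\<tau> d", OF finite_atLeastAtMost] eventually_at_right_less[of 0]
  proof eventually_elim
    case (elim y)
    then show ?case
      using nform_D(4)[OF nf d, of "t + y"] nform_D(4)[OF nf d, of t] t by simp
  qed
  ultimately show ?thesis
    by (simp add: germ_slope_def base_adv[OF fd] pt_adv[OF fd])
qed

lemma nf_left:
  assumes nf: "nform g \<tau>" and d: "d \<in> ports" and t: "0 < t" "t \<le> r"
  shows "germ_slope g (int (card {m\<in>{1..Dmax}. t \<le> \<tau> d m})) (bck d t)"
proof -
  have fd: "d \<in> fdirs" by (rule ports_fdirs[OF d])
  have "bck d t \<in> fdirs" using back_fdirs[OF fd t(1)] port_room[OF d, of t] t r_pos by simp
  moreover have "\<forall>\<^sub>F y in at_right 0. y < t"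
    using t by (intro eventually_at_right_real[THEN eventually_mono]) auto
  then have "\<forall>\<^sub>F y in at_right 0. g (pt d (t - y)) = g (pt d t) + real (card {m\<in>{1..Dmax}. t \<le> \<tau> d m}) * y"
    using sum_min_left[of "{1..Dmax}" t "\<tau> d", OF finite_atLeastAtMost] eventually_at_right_less[of 0]
  proof eventually_elim
    case (elim y)
    then show ?case
      using nform_D(4)[OF nf d, of "t - y"] nform_D(4)[OF nf d, of t] t by simp
  qed
  ultimately show ?thesis
    by (simp add: germ_slope_def base_back[OF fd] pt_back[OF fd])
qed

lemma nf_mid_right:
  assumes nf: "nform g \<tau>" and s: "(e, ereal \<alpha>, b) \<in> segs" and t: "\<alpha> + r \<le> t" "ereal (t + r) < b"
  shows "germ_slope g 0 (Fwd e (ereal t))"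
proof -
  have "ereal t < ereal (t + r)" using r_pos by simp
  also note t(2)
  finally have "0 < ereal t" "ereal t < \<l> e"
    using segs_range'[OF s, of "ereal t"] t(1) r_pos by auto
  then have fd: "Fwd e (ereal t) \<in> fdirs" using segs_D(1)[OF s] by (simp add: Fwd_fdirs)
  obtain \<beta> where \<beta>: "t + r < \<beta>" "ereal \<beta> < b" using ereal_dense2[OF t(2)] by auto
  have N2: "g (ep e (ereal (t + y))) = g (ep e (ereal \<alpha> + ereal r))" if "0 \<le> y" "y < \<beta> - (t + r)" for y
  proof (rule nform_D(5)[OF nf s])
    have "ereal (t + y) + ereal r \<le> ereal \<beta>" using that by simp
    also note \<beta>(2)
    finally show "ereal (t + y) + ereal r \<le> b" by simp
  qed (use that t in simp)
  have "\<forall>\<^sub>F y in at_right 0. y < \<beta> - (t + r)"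
    using \<beta> by (intro eventually_at_right_real[THEN eventually_mono]) auto
  then have "\<forall>\<^sub>F y in at_right 0. g (ep e (ereal (t + y))) = g (ep e (ereal t))"
    using eventually_at_right_less[of 0]
    by eventually_elim (use N2[of 0] N2 \<beta> in auto)
  then show ?thesis using fd by (simp add: germ_slope_def)
qed

lemma nf_mid_left:
  assumes nf: "nform g \<tau>" and s: "(e, ereal \<alpha>, b) \<in> segs" and t: "\<alpha> + r < t" "ereal (t + r) \<le> b"
  shows "germ_slope g 0 (Bwd e (ereal t))"
proof -
  have "ereal t < ereal (t + r)" using r_pos by simp
  also note t(2)
  finally have "0 < ereal t" "ereal t < \<l> e"
    using segs_range'[OF s, of "ereal t"] t(1) r_pos by auto
  then have fd: "Bwd e (ereal t) \<in> fdirs" using segs_D(1)[OF s] by (simp add: Bwd_fdirs)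
  have N2: "g (ep e (ereal (t - y))) = g (ep e (ereal \<alpha> + ereal r))" if "0 \<le> y" "y < t - (\<alpha> + r)" for y
  proof (rule nform_D(5)[OF nf s])
    have "ereal (t - y) + ereal r \<le> ereal (t + r)" using that by simp
    also note t(2)
    finally show "ereal (t - y) + ereal r \<le> b" .
  qed (use that t in simp)
  have "\<forall>\<^sub>F y in at_right 0. y < t - (\<alpha> + r)"
    using t by (intro eventually_at_right_real[THEN eventually_mono]) auto
  then have "\<forall>\<^sub>F y in at_right 0. g (ep e (ereal (t - y))) = g (ep e (ereal t))"
    using eventually_at_right_less[of 0]
    by eventually_elim (use N2[of 0] N2 t in auto)
  then show ?thesis using fd by (simp add: germ_slope_def)
qed

lemma nf_inf:
  assumes nf: "nform g \<tau>" and e: "e \<in> E" "\<l> e = \<infinity>"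
  shows "germ_slope g 0 (Bwd e \<infinity>)"
proof -
  have "\<infinity> \<in> nodes e" using e by (simp add: nodes_def)
  then obtain a where s: "(e, a, \<infinity>) \<in> segs" using seg_left_of[of e \<infinity>] e by auto
  obtain \<alpha> where \<alpha>: "a = ereal \<alpha>" using seg_gap[OF s] by blast
  have "g (ep e (ereal x)) = g (ep e \<infinity>)" if "\<alpha> + r \<le> x" for x
    using nform_D(5)[OF nf s, of "ereal x"] nform_D(5)[OF nf s, of \<infinity>] \<alpha> that by simp
  then have "\<forall>\<^sub>F x in at_top. g (ep e (ereal x)) = g (ep e \<infinity>)"
    by (auto simp: eventually_at_top_linorder)
  then show ?thesis
    using Bwd_inf_dirs[OF e] by (simp add: germ_slope_def germ_inf eventually_filtermap del: germ.simps)
qed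

lemma nf_left_r: "nform g \<tau> \<Longrightarrow> d \<in> ports \<Longrightarrow> germ_slope g 0 (bck d r)"
proof -
  assume nf: "nform g \<tau>" "d \<in> ports"
  then have z: "{m\<in>{1..Dmax}. r \<le> \<tau> d m} = {}" using nform_tau_r by (auto simp: not_le)
  show ?thesis using nf_left[OF nf r_pos order.refl] unfolding z by simp
qed

text \<open>At the boundary of the middle part one of the two directions points into an arm; there
  the slope is 0 by \<open>nf_left_r\<close>, applied to the port at that end.\<close>

lemma nf_mid:
  assumes nf: "nform g \<tau>" and s: "(e, ereal \<alpha>, b) \<in> segs" and t: "\<alpha> + r \<le> t" "ereal (t + r) \<le> b"
  shows "germ_slope g 0 (Fwd e (ereal t))" "germ_slope g 0 (Bwd e (ereal t))"
proof -
  show "germ_slope g 0 (Fwd e (ereal t))"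
  proof (cases "ereal (t + r) < b")
    case False
    then have b: "b = ereal (t + r)" using t by simp
    then have d: "Bwd e b \<in> ports" using segs_ports(2)[OF s] by simp
    show ?thesis using nf_left_r[OF nf d] b by simp
  qed (rule nf_mid_right[OF nf s t(1)])
  show "germ_slope g 0 (Bwd e (ereal t))"
  proof (cases "\<alpha> + r < t")
    case False
    then have t: "t = \<alpha> + r" using t by simp
    have d: "Fwd e (ereal \<alpha>) \<in> ports" using segs_ports(1)[OF s] .
    show ?thesis using nf_left_r[OF nf d] t by simp
  qed (rule nf_mid_left[OF nf s _ t(2)])
qed

lemma adv_0: "d \<in> fdirs \<Longrightarrow> adv d 0 = d"
  by (cases d) auto

lemma nf_port: "nform g \<tau> \<Longrightarrow> d \<in> ports \<Longrightarrow> germ_slope g (- int (card {m\<in>{1..Dmax}. 0 < \<tau> d m})) d"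
  using nf_right[of g \<tau> d 0] r_pos adv_0[OF ports_fdirs] by simp

lemma dirs_at_arm:
  assumes "d \<in> ports" "0 < t" "t \<le> r"
  shows "\<exists>e t'. pt d t = Inner e t'" "dirs_at \<Gamma> (pt d t) = {adv d t, bck d t}" "adv d t \<noteq> bck d t"
  using pt_interior[OF ports_fdirs[OF assms(1)] assms(2)] port_room[OF assms(1), of t] assms r_pos by auto

lemma nf_pl:
  assumes nf: "nform g \<tau>"
  shows "pl g"
  unfolding pl_def
proof
  fix d assume d: "d \<in> dirs"
  from base_in_pts[OF d] show "\<exists>k. germ_slope g k d"
  proof (cases rule: point_cases)
    case marked
    from d show ?thesis
    proof (cases rule: dirs_cases)
      case fin
      then have "d \<in> ports" using marked by (simp add: ports_def)
      then show ?thesis using nf_port[OF nf] by blast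
    next
      case (inf e)
      then show ?thesis using nf_inf[OF nf] by blast
    qed
  next
    case (arm d' t)
    then have "d \<in> {adv d' t, bck d' t}"
      using dirs_at_arm(2)[of d' t] d by (auto simp: dirs_at_def)
    then show ?thesis using nf_right[OF nf, of d' t] nf_left[OF nf, of d' t] arm by auto
  next
    case (mid e \<alpha> b t)
    then have "d \<in> {Fwd e (ereal t), Bwd e (ereal t)}"
      using dirs_at_Inner[of e t] base_in_pts[OF d] d by (auto simp: dirs_at_def)
    then show ?thesis using nf_mid[OF nf mid(1-3)] by blast
  qed
qed

text \<open>Outwards the slope is minus the number of breaks beyond \<open>t\<close>, backwards it
  is the number of breaks at \<open>t\<close> or beyond. Their sum counts the breaks at
  \<open>t\<close>.\<close>

lemma nf_dv_arm:
  assumes nf: "nform g \<tau>" and d: "d \<in> ports" and t: "0 < t" "t < r"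
  shows "dv g (pt d t) = int (card {m\<in>{1..Dmax}. \<tau> d m = t})"
proof -
  note da = dirs_at_arm[OF d t(1) less_imp_le[OF t(2)]]
  have dd: "adv d t \<in> dirs" "bck d t \<in> dirs" using da(2) by (auto simp: dirs_at_def)
  have "slp g (adv d t) = - int (card {m\<in>{1..Dmax}. t < \<tau> d m})"
    by (rule slp_eq[OF dd(1) nf_right[OF nf d]]) (use t in auto)
  moreover have "slp g (bck d t) = int (card {m\<in>{1..Dmax}. t \<le> \<tau> d m})"
    by (rule slp_eq[OF dd(2) nf_left[OF nf d]]) (use t in auto)
  moreover have "card {m\<in>{1..Dmax}. t \<le> \<tau> d m} = card {m\<in>{1..Dmax}. t < \<tau> d m} + card {m\<in>{1..Dmax}. \<tau> d m = t}"
    by (subst card_Un_disjoint[symmetric]) (auto intro!: arg_cong[of _ _ card])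
  ultimately show ?thesis using da(3) by (simp add: div_of_def da(2))
qed

lemma nf_dv_mid:
  assumes nf: "nform g \<tau>" and s: "(e, ereal \<alpha>, b) \<in> segs" and t: "\<alpha> + r \<le> t" "ereal (t + r) \<le> b"
    and x: "Inner e t \<in> pts"
  shows "dv g (Inner e t) = 0"
proof -
  have "Fwd e (ereal t) \<in> dirs" "Bwd e (ereal t) \<in> dirs"
    using dirs_at_Inner[OF x] by (auto simp: dirs_at_def)
  then show ?thesis
    using slp_eq nf_mid[OF nf s t] by (simp add: div_of_def dirs_at_Inner[OF x])
qed

lemma nf_dv_marked:
  assumes nf: "nform g \<tau>" and x: "x \<in> mk"
  shows "dv g x = - (\<Sum>d\<in>{d \<in> ports. bs d = x}. int (card {m\<in>{1..Dmax}. 0 < \<tau> d m}))"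
proof -
  have "dv g x = (\<Sum>d\<in>{d \<in> ports. bs d = x}. slp g d)"
    unfolding div_of_def
  proof (rule sum.mono_neutral_right[OF finite_dirs_at])
    show "\<forall>d\<in>dirs_at \<Gamma> x - {d \<in> ports. bs d = x}. slp g d = 0"
    proof
      fix d assume d: "d \<in> dirs_at \<Gamma> x - {d \<in> ports. bs d = x}"
      then have dd: "d \<in> dirs" "d \<notin> fdirs" using x by (auto simp: dirs_at_def ports_def)
      then show "slp g d = 0"
        using germ_slope_slp[OF nf_pl[OF nf] dd(1)] by (simp add: germ_slope_def)
    qed
  qed (auto simp: dirs_at_def ports_dirs)
  also have "\<dots> = (\<Sum>d\<in>{d \<in> ports. bs d = x}. - int (card {m\<in>{1..Dmax}. 0 < \<tau> d m}))"
    by (rule sum.cong) (use slp_eq[OF ports_dirs nf_port[OF nf]] in auto)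
  finally show ?thesis by (simp add: sum_negf)
qed

definition breaks :: "('e direction \<Rightarrow> nat \<Rightarrow> real) \<Rightarrow> ('v, 'e) point set" where
  "breaks \<tau> = (\<lambda>(d, m). pt d (\<tau> d m)) ` {(d, m). d \<in> ports \<and> m \<in> {1..Dmax} \<and> 0 < \<tau> d m}"

text \<open>By \<open>nf_nonsmooth\<close> these are the points whose values form the list
  \<open>levels\<close>.\<close>

definition crit :: "('e direction \<Rightarrow> nat \<Rightarrow> real) \<Rightarrow> ('v, 'e) point set" where
  "crit \<tau> = mk \<union> breaks \<tau>"

lemma finite_crit: "finite (crit \<tau>)"
proof -
  have "{(d, m). d \<in> ports \<and> m \<in> {1..Dmax} \<and> 0 < \<tau> d m} \<subseteq> ports \<times> {1..Dmax}" by auto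
  then have "finite {(d, m). d \<in> ports \<and> m \<in> {1..Dmax} \<and> 0 < \<tau> d m}"
    by (rule finite_subset) (simp add: finite_ports)
  then show ?thesis using finite_mk by (simp add: crit_def breaks_def)
qed

lemma nf_nonsmooth:
  assumes nf: "nform g \<tau>"
  shows "mk \<union> nonsmooth_points \<Gamma> (\<lambda>x. ereal (g x)) = crit \<tau>" "{x \<in> pts. dv g x \<noteq> 0} \<subseteq> crit \<tau>"
proof -
  show sub: "{x \<in> pts. dv g x \<noteq> 0} \<subseteq> crit \<tau>"
  proof
    fix x assume "x \<in> {x \<in> pts. dv g x \<noteq> 0}"
    then have x: "x \<in> pts" "dv g x \<noteq> 0" by auto
    from x(1) show "x \<in> crit \<tau>"
    proof (cases rule: point_cases)
      case (arm d t)
      then have "card {m\<in>{1..Dmax}. \<tau> d m = t} \<noteq> 0" using nf_dv_arm[OF nf, of d t] x(2) by simp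
      then obtain m where m: "m \<in> {1..Dmax}" "\<tau> d m = t"
        by (metis (mono_tags, lifting) Collect_empty_eq card.empty)
      then have "(d, m) \<in> {(d, m). d \<in> ports \<and> m \<in> {1..Dmax} \<and> 0 < \<tau> d m}" using arm by auto
      then have "(\<lambda>(d, m). pt d (\<tau> d m)) (d, m) \<in> breaks \<tau>" unfolding breaks_def by (rule imageI)
      then show ?thesis using m arm by (simp add: crit_def)
    next
      case (mid e \<alpha> b t)
      then show ?thesis using nf_dv_mid[OF nf mid(1-3)] x by simp
    qed (simp add: crit_def)
  qed
  show "mk \<union> nonsmooth_points \<Gamma> (\<lambda>x. ereal (g x)) = crit \<tau>"
  proof
    show "mk \<union> nonsmooth_points \<Gamma> (\<lambda>x. ereal (g x)) \<subseteq> crit \<tau>"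
      using sub unfolding nonsmooth_points_def crit_def by blast
    have "x \<in> nonsmooth_points \<Gamma> (\<lambda>x. ereal (g x))" if xb: "x \<in> breaks \<tau>" for x
    proof -
      obtain d m where dm: "d \<in> ports" "m \<in> {1..Dmax}" "0 < \<tau> d m" "x = pt d (\<tau> d m)"
        using xb unfolding breaks_def by fast
      have tr: "\<tau> d m < r" by (rule nform_tau_r[OF nf dm(1)])
      have "0 < card {n\<in>{1..Dmax}. \<tau> d n = \<tau> d m}" using dm(2) by (subst card_gt_0_iff) auto
      then have "dv g x \<noteq> 0" unfolding dm(4) nf_dv_arm[OF nf dm(1,3) tr] by linarith
      moreover obtain e t where "x = Inner e t" using dirs_at_arm(1)[OF dm(1,3)] tr dm(4) by auto
      moreover have "x \<in> pts" using pt_in_pts[OF ports_dirs[OF dm(1)]] dm(4) by simp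
      ultimately show ?thesis by (auto simp: nonsmooth_points_def)
    qed
    then show "crit \<tau> \<subseteq> mk \<union> nonsmooth_points \<Gamma> (\<lambda>x. ereal (g x))" by (auto simp: crit_def)
  qed
qed

lemma nf_rational: "nform g \<tau> \<Longrightarrow> rational_function \<Gamma> (\<lambda>x. ereal (g x))"
  by (intro rational_of_pl nf_pl finite_subset[OF nf_nonsmooth(2) finite_crit])

lemma nf_dv_nonneg:
  assumes nf: "nform g \<tau>" and x: "x \<in> pts" "x \<notin> mk"
  shows "0 \<le> dv g x"
  using x(1)
proof (cases rule: point_cases)
  case (arm d t)
  then show ?thesis using nf_dv_arm[OF nf arm(1-3)] by simp
next
  case (mid e \<alpha> b t)
  have "dv g (Inner e t) = 0" by (rule nf_dv_mid[OF nf mid(1-3)]) (use mid x in metis)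
  then show ?thesis unfolding mid(5) by simp
qed (use x in simp)

lemma nf_R_space:
  assumes nf: "nform g \<tau>"
  shows "(\<lambda>x. ereal (g x)) \<in> R_space \<Gamma> D"
proof -
  have "0 \<le> D x + dv g x" for x
  proof (cases "x \<in> mk")
    case True
    then show ?thesis using nf_dv_marked[OF nf True] nform_D(6)[OF nf True] by simp
  next
    case False
    then have "0 \<le> dv g x"
      using nf_dv_nonneg[OF nf, of x] div_of_outside[of x] by (cases "x \<in> pts") auto
    then show ?thesis using D_nonneg[of x] by simp
  qed
  then show ?thesis using nf_rational[OF nf] by (simp add: R_space_def effective_def add_div_def)
qed

section \<open>Superlevel sets and the data at a level\<close>

lemma nf_antimono:
  assumes nf: "nform g \<tau>" and d: "d \<in> ports" and t: "0 \<le> s" "s \<le> t" "t \<le> r"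
  shows "g (pt d t) \<le> g (pt d s)"
proof -
  have "(\<Sum>m=1..Dmax. min s (\<tau> d m)) \<le> (\<Sum>m=1..Dmax. min t (\<tau> d m))"
    using t by (intro sum_mono) auto
  then show ?thesis using nform_D(4)[OF nf d, of s] nform_D(4)[OF nf d, of t] t by simp
qed

text \<open>If the function still falls somewhere beyond \<open>s\<close>, then some
  \<open>\<tau> d m\<close> exceeds \<open>s\<close>, and this one makes it fall immediately after
  \<open>s\<close>.\<close>

lemma nf_strict:
  assumes nf: "nform g \<tau>" and d: "d \<in> ports" and t: "0 \<le> s" "s < t" "t \<le> r" and 1: "g (pt d r) < g (pt d s)"
  shows "g (pt d t) < g (pt d s)"
proof -
  have "(\<Sum>m=1..Dmax. min s (\<tau> d m)) < (\<Sum>m=1..Dmax. min r (\<tau> d m))"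
    using nform_D(4)[OF nf d, of s] nform_D(4)[OF nf d, of r] t 1 by simp
  then have "\<exists>m\<in>{1..Dmax}. \<not> min r (\<tau> d m) \<le> min s (\<tau> d m)"
    using sum_mono[of "{1..Dmax}" "\<lambda>m. min r (\<tau> d m)" "\<lambda>m. min s (\<tau> d m)"] by (meson not_le)
  then obtain m where m: "m \<in> {1..Dmax}" "\<not> min r (\<tau> d m) \<le> min s (\<tau> d m)" by blast
  then have "s < \<tau> d m" by (auto simp: min_def split: if_splits)
  note m = m(1) this
  have "(\<Sum>m=1..Dmax. min s (\<tau> d m)) < (\<Sum>m=1..Dmax. min t (\<tau> d m))"
    using m t by (intro sum_strict_mono_ex1) (auto intro!: bexI[of _ m])
  then show ?thesis using nform_D(4)[OF nf d, of s] nform_D(4)[OF nf d, of t] t by simp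
qed

lemma nf_base_ge: "nform g \<tau> \<Longrightarrow> d \<in> ports \<Longrightarrow> g (pt d r) \<le> g (bs d)"
  using nf_antimono[of g \<tau> d 0 r] r_pos pt_0[OF ports_fdirs] by simp

lemma nf_seg_ends:
  assumes nf: "nform g \<tau>" and s: "(e, a, b) \<in> segs"
  shows "g (pt (Fwd e a) r) = g (ep e (a + ereal r))"
    "b \<noteq> \<infinity> \<Longrightarrow> g (pt (Bwd e b) r) = g (ep e (a + ereal r))"
    "b = \<infinity> \<Longrightarrow> g (ep e b) = g (ep e (a + ereal r))"
    "a + ereal r \<le> t \<Longrightarrow> t + ereal r \<le> b \<Longrightarrow> g (ep e t) = g (ep e (a + ereal r))"
proof -
  obtain \<alpha> where \<alpha>: "a = ereal \<alpha>" "ereal (\<alpha> + 2 * r) < b" using seg_gap[OF s] by blast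
  show "g (pt (Fwd e a) r) = g (ep e (a + ereal r))" by simp
  show "a + ereal r \<le> t \<Longrightarrow> t + ereal r \<le> b \<Longrightarrow> g (ep e t) = g (ep e (a + ereal r))"
    by (rule nform_D(5)[OF nf s])
  show "b = \<infinity> \<Longrightarrow> g (ep e b) = g (ep e (a + ereal r))"
    using \<alpha> by (intro nform_D(5)[OF nf s]) auto
  assume "b \<noteq> \<infinity>"
  then obtain \<beta> where \<beta>: "b = ereal \<beta>" using segs_D(9)[OF s] by blast
  show "g (pt (Bwd e b) r) = g (ep e (a + ereal r))"
    unfolding pt.simps by (rule nform_D(5)[OF nf s]) (use \<alpha> \<beta> in auto)
qed

lemma port_of_seg:
  assumes d: "d \<in> ports" "pt d x \<in> seg (e, a, b)" "(e, a, b) \<in> segs" "0 < x" "x \<le> 2 * r"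
  shows "d = Fwd e a \<or> b \<noteq> \<infinity> \<and> d = Bwd e b"
  using d(1)
proof (cases rule: ports_cases)
  case (Fwd e' a' b')
  have "ereal (a' + x) < b'" using gap[OF Fwd(2)] d by (auto intro: le_less_trans[of _ "ereal (a' + 2 * r)"])
  then have "pt d x \<in> seg (e', ereal a', b')" using Fwd d by (auto intro!: insideI)
  from inside_disjoint[OF d(3) Fwd(2) d(2) this] show ?thesis using Fwd by auto
next
  case (Bwd e' a' b')
  have "pt d x \<in> seg (e', ereal a', ereal b')" using Bwd d gap[OF Bwd(2)] by (auto intro!: insideI)
  from inside_disjoint[OF d(3) Bwd(2) d(2) this] show ?thesis using Bwd by auto
qed

text \<open>The arms descend towards the middle, so the middle value is the minimum and alone
  decides whether a superlevel set contains the segment.\<close>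

lemma nf_seg_min:
  assumes nf: "nform g \<tau>" and s: "(e, a, b) \<in> segs" and y: "y \<in> seg (e, a, b)"
  shows "g (ep e (a + ereal r)) \<le> g y"
proof -
  have "y \<in> pts" using inside_pts[OF s] y by blast
  then show ?thesis
  proof (cases rule: point_cases)
    case marked
    then show ?thesis using inside_unmarked[OF s y] by simp
  next
    case (arm d t)
    have "d = Fwd e a \<or> b \<noteq> \<infinity> \<and> d = Bwd e b"
      using port_of_seg[OF arm(1) _ s arm(2)] arm y by auto
    then have "g (pt d r) = g (ep e (a + ereal r))" using nf_seg_ends(1,2)[OF nf s] by auto
    then show ?thesis using nf_antimono[OF nf arm(1), of t r] arm by simp
  next
    case (mid e' \<alpha> b' t)
    have "ereal t < ereal (t + r)" using r_pos by simp
    then have "ereal t < b'" using mid(3) by (rule less_le_trans)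
    then have "y \<in> seg (e', ereal \<alpha>, b')" using mid r_pos by (auto intro!: insideI)
    then have "(e, a, b) = (e', ereal \<alpha>, b')" using inside_disjoint[OF s mid(1) y] by simp
    then show ?thesis using nf_seg_ends(4)[OF nf mid(1), of "ereal t"] mid by simp
  qed
qed

lemma nf_le_marked:
  assumes nf: "nform g \<tau>" and x: "x \<in> pts"
  shows "\<exists>u\<in>mk. g x \<le> g u"
  using x
proof (cases rule: point_cases)
  case (arm d t)
  then have "g x \<le> g (bs d)" using nf_antimono[OF nf arm(1), of 0 t] pt_0[OF ports_fdirs[OF arm(1)]] by simp
  then show ?thesis using ports_mk[OF arm(1)] by blast
next
  case (mid e \<alpha> b t)
  have d: "Fwd e (ereal \<alpha>) \<in> ports" using segs_ports(1)[OF mid(1)] .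
  have "g x = g (pt (Fwd e (ereal \<alpha>)) r)"
    using nf_seg_ends(1)[OF nf mid(1)] nf_seg_ends(4)[OF nf mid(1), of "ereal t"] mid by simp
  then have "g x \<le> g (bs (Fwd e (ereal \<alpha>)))" using nf_base_ge[OF nf d] by simp
  then show ?thesis using ports_mk[OF d] by blast
qed auto

abbreviation Sh :: "(('v, 'e) point \<Rightarrow> real) \<Rightarrow> real \<Rightarrow> ('v, 'e) point set" where
  "Sh g h \<equiv> compactified \<Gamma> D (superlevel \<Gamma> (\<lambda>x. ereal (g x)) (ereal h))"

lemma Sh_sub: "x \<in> Sh g h \<Longrightarrow> x \<in> pts \<and> h \<le> g x"
  unfolding mem_compactified superlevel_def by auto

text \<open>By \<open>nf_seg_min\<close> a segment belongs to the compactified set iff its middle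
  value is at least \<open>h\<close>. Its ends then belong to it as well, since values only increase
  towards the bases. At an infinite end the value is the middle value, which gives the last clause
  of \<open>cellular\<close>.\<close>

lemma Sh_props:
  assumes nf: "nform g \<tau>"
  shows "cellular (Sh g h)" "x \<in> mk \<Longrightarrow> x \<in> Sh g h \<longleftrightarrow> h \<le> g x"
    "d \<in> ports \<Longrightarrow> pt d r \<in> Sh g h \<longleftrightarrow> h \<le> g (pt d r)"
proof -
  show mk: "x \<in> Sh g h \<longleftrightarrow> h \<le> g x" if "x \<in> mk" for x
    using that mk_pts inside_unmarked[of _ x] unfolding mem_compactified superlevel_def by auto
  have seg_in: "x \<in> Sh g h \<longleftrightarrow> h \<le> g (ep e (a + ereal r))" if s: "(e, a, b) \<in> segs" "x \<in> seg (e, a, b)" for x e a b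
  proof
    assume h: "h \<le> g (ep e (a + ereal r))"
    have "seg (e, a, b) \<subseteq> superlevel \<Gamma> (\<lambda>x. ereal (g x)) (ereal h)"
      using nf_seg_min[OF nf s(1)] h inside_pts[OF s(1)] by (force simp: superlevel_def)
    then show "x \<in> Sh g h" using s unfolding mem_compactified by blast
  next
    assume "x \<in> Sh g h"
    then have "seg (e, a, b) \<subseteq> superlevel \<Gamma> (\<lambda>x. ereal (g x)) (ereal h)"
      unfolding mem_compactified using s inside_unmarked[OF s] inside_disjoint[OF s(1)] by metis
    moreover have "ep e (a + ereal r) \<in> seg (e, a, b)"
    proof -
      obtain \<alpha> where \<alpha>: "a = ereal \<alpha>" "ereal (\<alpha> + 2 * r) < b" using seg_gap[OF s(1)] by blast
      then have "ereal (\<alpha> + r) < b" using r_pos by (auto intro: le_less_trans[of _ "ereal (\<alpha> + 2 * r)"])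
      then show ?thesis using \<alpha> r_pos by (intro insideI) auto
    qed
    ultimately show "h \<le> g (ep e (a + ereal r))" by (auto simp: superlevel_def)
  qed
  show "pt d r \<in> Sh g h \<longleftrightarrow> h \<le> g (pt d r)" if d: "d \<in> ports" for d
  proof
    assume h: "h \<le> g (pt d r)"
    obtain s where s: "s \<in> segs" "\<And>x. 0 < x \<Longrightarrow> x \<le> 2 * r \<Longrightarrow> pt d x \<in> seg s \<and> ereal x < room d"
      using port_seg[OF d] by blast
    obtain e a b where sab: "s = (e, a, b)" by (cases s) auto
    have p: "pt d r \<in> seg (e, a, b)" using s(2)[of r] r_pos sab by auto
    have "d = Fwd e a \<or> b \<noteq> \<infinity> \<and> d = Bwd e b"
      using port_of_seg[OF d p _ r_pos] s(1) sab r_pos by auto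
    then have "g (pt d r) = g (ep e (a + ereal r))" using nf_seg_ends(1,2)[OF nf] s(1) sab by blast
    then show "pt d r \<in> Sh g h" using seg_in[OF _ p] s(1) sab h by simp
  qed (use Sh_sub in blast)
  show "cellular (Sh g h)"
    unfolding cellular_def
  proof (intro conjI ballI)
    fix s assume "s \<in> segs"
    then obtain e a b where s: "s = (e, a, b)" "(e, a, b) \<in> segs" by (cases s) auto
    have ab: "a < b" "e \<in> E" by (rule segs_D[OF s(2)])+
    have ends: "ep e a \<in> mk" "ep e b \<in> mk"
      using ep_marked[OF ab(2)] segs_range[OF s(2)] segs_D(5,6)[OF s(2)] ab by auto
    show "case s of (e, a, b) \<Rightarrow> ep e ` {a..b} \<subseteq> Sh g h \<or> seg (e, a, b) \<inter> Sh g h = {} \<and> (b = \<infinity> \<longrightarrow> ep e b \<notin> Sh g h)"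
    proof (cases "h \<le> g (ep e (a + ereal r))")
      case True
      have "h \<le> g (ep e a)"
        using nf_base_ge[OF nf segs_ports(1)[OF s(2)]] nf_seg_ends(1)[OF nf s(2)] True by simp
      moreover have "h \<le> g (ep e b)"
        using nf_base_ge[OF nf segs_ports(2)[OF s(2)]] nf_seg_ends(2,3)[OF nf s(2)] True
        by (cases "b = \<infinity>") auto
      ultimately have "ep e t \<in> Sh g h" if "t \<in> {a..b}" for t
        using that mk ends seg_in[OF s(2) insideI[of a t b e]] True by (cases "t = a \<or> t = b") auto
      then show ?thesis unfolding s by auto
    next
      case False
      then have "seg (e, a, b) \<inter> Sh g h = {}" using seg_in[OF s(2)] by blast
      moreover have "ep e b \<notin> Sh g h" if "b = \<infinity>"
        using nf_seg_ends(3)[OF nf s(2) that] mk[OF ends(2)] False by simp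
      ultimately show ?thesis unfolding s by blast
    qed
  qed (use Sh_sub in blast)
qed

text \<open>The entry of \<open>fine_data\<close> at height \<open>h\<close>, for arbitrary
  \<open>h\<close> and not only for critical values; the exit slope is expressed as the number of
  breaks that lie below \<open>h\<close>. The lengths of its fibres will be the weights of the
  chain.\<close>

definition Gd :: "(('v, 'e) point \<Rightarrow> real) \<Rightarrow> ('e direction \<Rightarrow> nat \<Rightarrow> real) \<Rightarrow> real \<Rightarrow>
    ('v, 'e) point set \<times> ('e direction \<Rightarrow> int)" where
  "Gd g \<tau> h = (Sh g h, \<lambda>d. if d \<in> ports \<and> h \<le> g (bs d) \<and> g (pt d r) < h
     then int (card {m\<in>{1..Dmax}. g (pt d (\<tau> d m)) < h}) else 0)"

lemma nf_outgoing:
  assumes nf: "nform g \<tau>"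
  shows "outgoing \<Gamma> (Sh g h) = {d \<in> ports. h \<le> g (bs d) \<and> g (pt d r) < h}"
  using outgoing_cellular[OF Sh_props(1)[OF nf]] Sh_props(2,3)[OF nf] ports_mk by (auto simp: not_le)

text \<open>The intermediate value theorem gives a crossing \<open>t\<close>. As the value at the
  end of the arm is below \<open>h\<close>, \<open>nf_strict\<close> applies at \<open>t\<close>, so
  no later point of the arm is at height \<open>h\<close> or above.\<close>

lemma nf_exit:
  assumes nf: "nform g \<tau>" and d: "d \<in> ports" and h: "h \<le> g (bs d)" "g (pt d r) < h"
  obtains t where "0 \<le> t" "t < r" "g (pt d t) = h" "\<And>s. 0 \<le> s \<Longrightarrow> s \<le> r \<Longrightarrow> h \<le> g (pt d s) \<longleftrightarrow> s \<le> t"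
proof -
  let ?\<phi> = "\<lambda>x. g (bs d) - (\<Sum>m=1..Dmax. min x (\<tau> d m))"
  have \<phi>: "g (pt d x) = ?\<phi> x" if "0 \<le> x" "x \<le> r" for x using nform_D(4)[OF nf d that] .
  have "\<exists>t\<ge>0. t \<le> r \<and> ?\<phi> t = h"
  proof (rule IVT2')
    show "?\<phi> r \<le> h" using \<phi>[of r] h r_pos by simp
    show "h \<le> ?\<phi> 0" using \<phi>[of 0] h r_pos pt_0[OF ports_fdirs[OF d]] by simp
    show "continuous_on {0..r} ?\<phi>" by (intro continuous_intros)
  qed (use r_pos in simp)
  then obtain t where t: "0 \<le> t" "t \<le> r" "g (pt d t) = h" using \<phi> by auto
  have tr: "t < r" using t h by (cases "t = r") auto
  have "h \<le> g (pt d s) \<longleftrightarrow> s \<le> t" if "0 \<le> s" "s \<le> r" for s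
    using nf_antimono[OF nf d that(1), of t] nf_strict[OF nf d t(1), of s] t that h by (cases "s \<le> t") auto
  then show thesis using that t tr by blast
qed

lemma exit_dir_port:
  assumes nf: "nform g \<tau>" and d: "d \<in> ports" and t: "0 \<le> t" "t < r"
    and ht: "\<And>s. 0 \<le> s \<Longrightarrow> s \<le> r \<Longrightarrow> h \<le> g (pt d s) \<longleftrightarrow> s \<le> t"
  shows "exit_dir \<Gamma> (superlevel \<Gamma> (\<lambda>x. ereal (g x)) (ereal h)) d = adv d t"
proof -
  let ?S = "superlevel \<Gamma> (\<lambda>x. ereal (g x)) (ereal h)"
  have S: "pt d s \<in> ?S \<longleftrightarrow> s \<le> t" if "0 \<le> s" "s \<le> r" for s
    using ht[OF that] pt_in_pts[OF ports_dirs[OF d]] by (simp add: superlevel_def)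
  from d show ?thesis
  proof (cases rule: ports_cases)
    case (Fwd e a b)
    let ?B = "{b. ereal a \<le> b \<and> b \<le> \<l> e \<and> ep e ` {ereal a..b} \<subseteq> ?S}"
    have len: "ereal (a + t) \<le> \<l> e"
    proof -
      have "ereal (a + t) \<le> ereal (a + 2 * r)" using t by simp
      also have "\<dots> \<le> \<l> e" using gap[OF Fwd(2)] segs_D(4)[OF Fwd(2)] by simp
      finally show ?thesis .
    qed
    have "ep e z \<in> ?S" if z: "z \<in> {ereal a..ereal (a + t)}" for z
    proof -
      obtain \<zeta> where \<zeta>: "z = ereal \<zeta>" using z by (cases z) auto
      then show ?thesis using S[of "\<zeta> - a"] z Fwd t by simp
    qed
    then have in_B: "ereal (a + t) \<in> ?B" using t len by auto
    have "b \<le> ereal (a + t)" if b: "b \<in> ?B" for b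
    proof (rule ccontr)
      assume "\<not> b \<le> ereal (a + t)"
      then have "ereal (a + t) < min b (ereal (a + r))" using t by (auto simp: min_def)
      \<comment> \<open>\<open>z\<close> lies beyond the exit point but still on the arm, where
        \<open>S\<close> decides membership.\<close>
      from ereal_dense2[OF this] obtain z where z: "a + t < z" "ereal z < min b (ereal (a + r))" by auto
      then have "ereal z \<in> {ereal a..b}" using t by auto
      then have "ep e (ereal z) \<in> ?S" using b by blast
      moreover have "ep e (ereal z) = pt d (z - a)" using Fwd by simp
      ultimately show False using S[of "z - a"] z t by auto
    qed
    then have "(SUP b\<in>?B. b) = ereal (a + t)"
      using in_B by (intro antisym SUP_least SUP_upper) auto
    then show ?thesis using Fwd by simp
  next
    case (Bwd e a' a)
    let ?B = "{b. 0 \<le> b \<and> b \<le> ereal a \<and> ep e ` {b..ereal a} \<subseteq> ?S}"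
    have len: "0 \<le> a - r" using gap[OF Bwd(2)] segs_D(2)[OF Bwd(2)] r_pos by simp
    have "ep e z \<in> ?S" if z: "z \<in> {ereal (a - t)..ereal a}" for z
    proof -
      obtain \<zeta> where \<zeta>: "z = ereal \<zeta>" using z by (cases z) auto
      then show ?thesis using S[of "a - \<zeta>"] z Bwd t by simp
    qed
    then have in_B: "ereal (a - t) \<in> ?B" using t len by auto
    have "ereal (a - t) \<le> b" if b: "b \<in> ?B" for b
    proof (rule ccontr)
      assume "\<not> ereal (a - t) \<le> b"
      then have "max b (ereal (a - r)) < ereal (a - t)" using t by (auto simp: max_def)
      from ereal_dense2[OF this] obtain z where z: "z < a - t" "max b (ereal (a - r)) < ereal z" by auto
      then have "ereal z \<in> {b..ereal a}" using t by auto
      then have "ep e (ereal z) \<in> ?S" using b by blast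
      moreover have "ep e (ereal z) = pt d (a - z)" using Bwd by simp
      ultimately show False using S[of "a - z"] z t by auto
    qed
    then have "(INF b\<in>?B. b) = ereal (a - t)"
      using in_B by (intro antisym INF_greatest INF_lower) auto
    then show ?thesis using Bwd by simp
  qed
qed

text \<open>The slope just after the exit point \<open>t\<close> counts the breaks with
  \<open>t < \<tau> d m\<close>. These are the breaks whose value is below \<open>h\<close>, a
  description that no longer mentions \<open>t\<close>.\<close>

lemma nf_exit_slope:
  assumes nf: "nform g \<tau>" and d: "d \<in> ports" and h: "h \<le> g (bs d)" "g (pt d r) < h"
  shows "- slp g (exit_dir \<Gamma> (superlevel \<Gamma> (\<lambda>x. ereal (g x)) (ereal h)) d) =
    int (card {m\<in>{1..Dmax}. g (pt d (\<tau> d m)) < h})"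
proof -
  obtain t where t: "0 \<le> t" "t < r" "g (pt d t) = h" "\<And>s. 0 \<le> s \<Longrightarrow> s \<le> r \<Longrightarrow> h \<le> g (pt d s) \<longleftrightarrow> s \<le> t"
    using nf_exit[OF assms] by blast
  have "adv d t \<in> dirs"
    using adv_fdirs[OF ports_fdirs[OF d] t(1)] port_room[OF d, of t] t r_pos fdirs_sub by simp
  then have "slp g (adv d t) = - int (card {m\<in>{1..Dmax}. t < \<tau> d m})"
    using slp_eq nf_right[OF nf d t(1,2)] by blast
  moreover have "t < \<tau> d m \<longleftrightarrow> g (pt d (\<tau> d m)) < h" for m
    using t(4)[of "\<tau> d m"] nform_D(1)[OF nf d, of m] nform_tau_r[OF nf d, of m] by auto
  ultimately show ?thesis using exit_dir_port[OF nf d t(1,2,4)] by simp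
qed

lemma fine_data_nf:
  assumes nf: "nform g \<tau>"
  shows "fine_data \<Gamma> D (\<lambda>x. ereal (g x)) = map (Gd g \<tau>) (rev (sorted_list_of_set (g ` crit \<tau>)))"
proof -
  have "map ereal (sorted_list_of_set (g ` crit \<tau>)) = map id (sorted_list_of_set ((\<lambda>x. ereal (g x)) ` crit \<tau>))"
    by (rule sorted_list_of_set_indexed[OF finite_crit]) auto
  then have "sorted_list_of_set ((\<lambda>x. ereal (g x)) ` crit \<tau>) = map ereal (sorted_list_of_set (g ` crit \<tau>))"
    by simp
  then have lev: "levels \<Gamma> D (\<lambda>x. ereal (g x)) = map ereal (rev (sorted_list_of_set (g ` crit \<tau>)))"
    unfolding levels_def nf_nonsmooth(1)[OF nf] by (simp only: rev_map)
  have "(let S = superlevel \<Gamma> (\<lambda>x. ereal (g x)) (ereal h); S' = compactified \<Gamma> D S in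
       (S', \<lambda>d. if d \<in> outgoing \<Gamma> S' then - slp g (exit_dir \<Gamma> S d) else 0)) = Gd g \<tau> h" for h
    unfolding Let_def Gd_def nf_outgoing[OF nf] using nf_exit_slope[OF nf] by (auto simp: fun_eq_iff)
  then show ?thesis unfolding fine_data_def lev by simp
qed

text \<open>The breaks counted at a level are among the positive ones, whose number at each marked
  point is bounded by \<open>D\<close> in \<open>nform\<close>. A marked point at height
  \<open>h\<close> makes the subgraph nonempty, a point below \<open>h\<close> makes it
  proper.\<close>

lemma Gd_P:
  assumes nf: "nform g \<tau>" and u: "u \<in> mk" "h \<le> g u" and x: "x \<in> pts" "g x < h"
  shows "Gd g \<tau> h \<in> P"
  unfolding Gd_def
proof (rule P_I[OF Sh_props(1)[OF nf]])
  note S = Sh_props[OF nf, where h = h]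
  show "Sh g h \<noteq> {}" using S(2)[OF u(1)] u(2) by blast
  show "Sh g h \<noteq> pts" using Sh_sub[of x g h] x by auto
  fix d
  show "(if d \<in> ports \<and> h \<le> g (bs d) \<and> g (pt d r) < h
     then int (card {m\<in>{1..Dmax}. g (pt d (\<tau> d m)) < h}) else 0) = 0"
    if "\<not> (d \<in> ports \<and> bs d \<in> Sh g h \<and> pt d r \<notin> Sh g h)"
    using that S(2)[OF ports_mk] S(3) by auto
  assume d: "d \<in> ports" "bs d \<in> Sh g h" "pt d r \<notin> Sh g h"
  then have h: "h \<le> g (bs d)" "g (pt d r) < h" using S(2)[OF ports_mk[OF d(1)]] S(3)[OF d(1)] by auto
  have "(\<Sum>m=1..Dmax. min r (\<tau> d m)) > 0"
    using nform_D(4)[OF nf d(1), of r] h r_pos by simp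
  then have "1 \<le> Dmax" by (cases Dmax) auto
  \<comment> \<open>The break with index 1 is the farthest; beyond it the function is flat, so it
    lies below \<open>h\<close> and the weight is positive.\<close>
  moreover have "g (pt d (\<tau> d 1)) = g (pt d r)"
  proof -
    have "(\<Sum>m=1..Dmax. min (\<tau> d 1) (\<tau> d m)) = (\<Sum>m=1..Dmax. min r (\<tau> d m))"
    proof (rule sum.cong[OF refl])
      fix m assume "m \<in> {1..Dmax}"
      then have "\<tau> d m \<le> \<tau> d 1" "\<tau> d m \<le> r"
        using nform_D(3)[OF nf d(1), of 1 m] nform_tau_r[OF nf d(1), of m] by auto
      then show "min (\<tau> d 1) (\<tau> d m) = min r (\<tau> d m)" by simp
    qed
    then show ?thesis
      using nform_D(4)[OF nf d(1), of r] nform_D(4)[OF nf d(1), of "\<tau> d 1"] nform_D(1)[OF nf d(1), of 1]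
        nform_tau_r[OF nf d(1), of 1] r_pos by simp
  qed
  ultimately have "1 \<in> {m\<in>{1..Dmax}. g (pt d (\<tau> d m)) < h}" using h by simp
  then have "0 < card {m\<in>{1..Dmax}. g (pt d (\<tau> d m)) < h}"
    by (auto simp: card_gt_0_iff)
  then show "0 < (if d \<in> ports \<and> h \<le> g (bs d) \<and> g (pt d r) < h
     then int (card {m\<in>{1..Dmax}. g (pt d (\<tau> d m)) < h}) else 0)"
    using d h by simp
next
  fix y assume y: "y \<in> mk" "y \<in> Sh g h"
  have "(\<Sum>d\<in>{d \<in> ports. bs d = y}. if d \<in> ports \<and> h \<le> g (bs d) \<and> g (pt d r) < h
     then int (card {m\<in>{1..Dmax}. g (pt d (\<tau> d m)) < h}) else 0)
     \<le> (\<Sum>d\<in>{d \<in> ports. bs d = y}. int (card {m\<in>{1..Dmax}. 0 < \<tau> d m}))"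
  proof (rule sum_mono)
    fix d assume d: "d \<in> {d \<in> ports. bs d = y}"
    have "0 < \<tau> d m" if "g (pt d (\<tau> d m)) < h" "h \<le> g (bs d)" for m
      using that d nform_D(1)[OF nf, of d m] pt_0[OF ports_fdirs, of d] by (cases "\<tau> d m = 0") auto
    then have "h \<le> g (bs d) \<Longrightarrow> card {m\<in>{1..Dmax}. g (pt d (\<tau> d m)) < h} \<le> card {m\<in>{1..Dmax}. 0 < \<tau> d m}"
      by (intro card_mono) auto
    then show "(if d \<in> ports \<and> h \<le> g (bs d) \<and> g (pt d r) < h
     then int (card {m\<in>{1..Dmax}. g (pt d (\<tau> d m)) < h}) else 0) \<le> int (card {m\<in>{1..Dmax}. 0 < \<tau> d m})"
      by auto
  qed
  also have "\<dots> \<le> D y" by (rule nform_D(6)[OF nf y(1)])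
  finally show "(\<Sum>d\<in>{d \<in> ports. bs d = y}. if d \<in> ports \<and> h \<le> g (bs d) \<and> g (pt d r) < h
     then int (card {m\<in>{1..Dmax}. g (pt d (\<tau> d m)) < h}) else 0) \<le> D y" .
qed

text \<open>Going down, the superlevel set grows and fewer breaks lie below the level, which are the
  two conditions of the order.\<close>

lemma Gd_le:
  assumes nf: "nform g \<tau>" and P: "Gd g \<tau> h \<in> P" "Gd g \<tau> h' \<in> P" and h: "h \<le> h'"
  shows "le_P (Gd g \<tau> h') (Gd g \<tau> h)"
proof (rule le_P_I[OF P(2,1)])
  have "superlevel \<Gamma> (\<lambda>x. ereal (g x)) (ereal h') \<subseteq> superlevel \<Gamma> (\<lambda>x. ereal (g x)) (ereal h)"
    using h by (auto simp: superlevel_def intro: order_trans[of "ereal h" "ereal h'"])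
  then show "fst (Gd g \<tau> h') \<subseteq> fst (Gd g \<tau> h)"
    unfolding Gd_def fst_conv subset_iff mem_compactified by blast
next
  fix d assume "bs d \<in> fst (Gd g \<tau> h')"
  then have h': "h' \<le> g (bs d)" using Sh_sub[of "bs d" g h'] by (simp add: Gd_def)
  have "card {m\<in>{1..Dmax}. g (pt d (\<tau> d m)) < h} \<le> card {m\<in>{1..Dmax}. g (pt d (\<tau> d m)) < h'}"
    using h by (intro card_mono) auto
  then show "snd (Gd g \<tau> h) d \<le> snd (Gd g \<tau> h') d" using h h' by (auto simp: Gd_def)
qed

text \<open>In the sum of the terms \<open>min (\<tau> d m) (\<tau> d j)\<close> an index
  \<open>j \<le> m\<close> contributes \<open>\<tau> d m\<close> and a larger one
  \<open>\<tau> d j\<close>. So the drops down to the breaks depend on the distances through the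
  system of \<open>triangular_unique\<close>.\<close>

lemma nf_T:
  assumes nf: "nform g \<tau>" and d: "d \<in> ports" and m: "1 \<le> m" "m \<le> Dmax"
  shows "g (bs d) - g (pt d (\<tau> d m)) = real m * \<tau> d m + sum (\<tau> d) {m<..Dmax}"
proof -
  have "{1..Dmax} = {1..m} \<union> {m<..Dmax}" using m by auto
  then have "(\<Sum>j=1..Dmax. min (\<tau> d m) (\<tau> d j)) = (\<Sum>j=1..m. min (\<tau> d m) (\<tau> d j)) + (\<Sum>j\<in>{m<..Dmax}. min (\<tau> d m) (\<tau> d j))"
    by (simp only:) (rule sum.union_disjoint, auto)
  also have "(\<Sum>j=1..m. min (\<tau> d m) (\<tau> d j)) = (\<Sum>j=1..m. \<tau> d m)"
    using nform_D(3)[OF nf d, of _ m] by (intro sum.cong) auto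
  also have "(\<Sum>j\<in>{m<..Dmax}. min (\<tau> d m) (\<tau> d j)) = sum (\<tau> d) {m<..Dmax}"
    using nform_D(3)[OF nf d, of m] by (intro sum.cong) auto
  finally show ?thesis
    using nform_D(4)[OF nf d, of "\<tau> d m"] nform_D(1)[OF nf d, of m] nform_tau_r[OF nf d, of m] by simp
qed

end

section \<open>Elements of the linear system close to the divisor are in normal form\<close>

context small_link
begin

lemma dv_marked:
  assumes "pl g" "x \<in> mk"
  shows "dv g x = (\<Sum>d\<in>{d \<in> ports. bs d = x}. slp g d)"
  unfolding div_of_def
proof (rule sum.mono_neutral_right[OF finite_dirs_at])
  show "\<forall>d\<in>dirs_at \<Gamma> x - {d \<in> ports. bs d = x}. slp g d = 0"
  proof
    fix d assume d: "d \<in> dirs_at \<Gamma> x - {d \<in> ports. bs d = x}"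
    then have dd: "d \<in> dirs" "d \<notin> fdirs" using assms(2) by (auto simp: dirs_at_def ports_def)
    then show "slp g d = 0"
      using germ_slope_slp[OF assms(1) dd(1)] by (simp add: germ_slope_def)
  qed
qed (auto simp: dirs_at_def ports_dirs)

text \<open>A stretch along which convexity holds up to its end. \<open>L\<close> may exceed
  \<open>2 * r\<close> by far, which \<open>middle_const\<close> uses to cross the middle of a long
  segment.\<close>

definition free :: "'e direction \<Rightarrow> real \<Rightarrow> bool" where
  "free d L \<longleftrightarrow> d \<in> fdirs \<and> (\<forall>t. 0 < t \<and> t < L \<longrightarrow> ereal t < room d \<and> pt d t \<notin> mk)"

context
  fixes g
  assumes pl: "pl g" and eff: "\<And>x. 0 \<le> D x + dv g x"
    and osc: "\<And>x y. x \<in> pts \<Longrightarrow> y \<in> pts \<Longrightarrow> g x - g y \<le> \<epsilon>"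
begin

lemma slope_right:
  assumes "d \<in> fdirs" "0 \<le> t" "ereal t < room d"
  shows "\<forall>\<^sub>F y in at_right 0. g (pt d (t + y)) = g (pt d t) + of_int (slp g (adv d t)) * y"
proof -
  have a: "adv d t \<in> fdirs" by (rule adv_fdirs[OF assms])
  show ?thesis
    using germ_slope_slp[OF pl fdirs_sub[OF a]] a by (simp add: germ_slope_def base_adv[OF assms(1)] pt_adv[OF assms(1)])
qed

lemma slope_left:
  assumes "d \<in> fdirs" "0 < t" "ereal t \<le> room d"
  shows "\<forall>\<^sub>F y in at_right 0. g (pt d (t - y)) = g (pt d t) - (- of_int (slp g (bck d t))) * y"
proof -
  have a: "bck d t \<in> fdirs" by (rule back_fdirs[OF assms])
  show ?thesis
    using germ_slope_slp[OF pl fdirs_sub[OF a]] a by (simp add: germ_slope_def base_back[OF assms(1)] pt_back[OF assms(1)])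
qed

lemma free_D:
  assumes "free d L"
  shows "d \<in> fdirs" "0 \<le> t \<Longrightarrow> t < L \<Longrightarrow> ereal t < room d" "0 < t \<Longrightarrow> t < L \<Longrightarrow> pt d t \<notin> mk"
proof -
  show d: "d \<in> fdirs" and "0 < t \<Longrightarrow> t < L \<Longrightarrow> pt d t \<notin> mk" using assms by (auto simp: free_def)
  show "0 \<le> t \<Longrightarrow> t < L \<Longrightarrow> ereal t < room d"
    using assms room_pos[OF d] by (cases "t = 0") (auto simp: free_def zero_ereal_def)
qed

lemma free_mono:
  assumes f: "free d L" and x: "0 \<le> x" "x \<le> z" "z < L"
  shows "slp g (adv d x) \<le> slp g (adv d z)"
proof -
  have "real_of_int (slp g (adv d x)) \<le> of_int (slp g (adv d z))"
  proof (rule right_slope_mono[where a = 0 and b = L and u = "\<lambda>t. g (pt d t)" and sR = "\<lambda>t. of_int (slp g (adv d t))"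
        and sL = "\<lambda>t. - of_int (slp g (bck d t))"])
    fix t assume "0 \<le> t" "t < L"
    then show "\<forall>\<^sub>F y in at_right 0. g (pt d (t + y)) = g (pt d t) + of_int (slp g (adv d t)) * y"
      using slope_right[OF free_D(1)[OF f]] free_D(2)[OF f] by blast
  next
    fix t assume t: "0 < t" "t < L"
    then have room: "ereal t < room d" using free_D(2)[OF f, of t] by simp
    then show "\<forall>\<^sub>F y in at_right 0. g (pt d (t - y)) = g (pt d t) - - of_int (slp g (bck d t)) * y"
      using slope_left[OF free_D(1)[OF f] t(1)] by simp
    note i = pt_interior[OF free_D(1)[OF f] t(1) room]
    have "D (pt d t) = 0" using free_D(3)[OF f t] by (simp add: marked_def)
    then have "0 \<le> dv g (pt d t)" using eff[of "pt d t"] by simp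
    also have "dv g (pt d t) = slp g (adv d t) + slp g (bck d t)"
      using i(3) by (simp add: div_of_def i(2))
    finally show "- real_of_int (slp g (bck d t)) \<le> of_int (slp g (adv d t))" by simp
  qed (use x in auto)
  then show ?thesis by simp
qed

text \<open>A positive integer slope is at least 1 and by convexity stays so until the end of the
  stretch. More than \<open>\<epsilon>\<close> of it remains, so the function would rise by more
  than its oscillation.\<close>

lemma no_rise:
  assumes f: "free d L" and t: "0 \<le> t" "t + \<epsilon> < L"
  shows "slp g (adv d t) \<le> 0"
proof (rule ccontr)
  assume "\<not> slp g (adv d t) \<le> 0"
  then have 1: "1 \<le> slp g (adv d t)" by simp
  \<comment> \<open>Beyond \<open>t + \<epsilon>\<close>, but still on the stretch.\<close>
  define z where "z = (t + \<epsilon> + L) / 2"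
  have z: "t + \<epsilon> < z" "z < L" using t by (auto simp: z_def)
  have "g (pt d t) + 1 * (z - t) \<le> g (pt d z)"
  proof (rule slope_bound_below[where u = "\<lambda>t. g (pt d t)" and sR = "\<lambda>t. of_int (slp g (adv d t))"
        and sL = "\<lambda>t. - of_int (slp g (bck d t))"])
    fix x assume x: "t \<le> x" "x < z"
    then show "\<forall>\<^sub>F y in at_right 0. g (pt d (x + y)) = g (pt d x) + of_int (slp g (adv d x)) * y"
      using slope_right[OF free_D(1)[OF f]] free_D(2)[OF f, of x] t z by simp
    have "slp g (adv d t) \<le> slp g (adv d x)" by (rule free_mono[OF f]) (use x t z in auto)
    then have "1 \<le> slp g (adv d x)" using 1 by linarith
    then show "1 \<le> real_of_int (slp g (adv d x))" by simp
  next
    fix x assume "t < x" "x \<le> z"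
    then show "\<forall>\<^sub>F y in at_right 0. g (pt d (x - y)) = g (pt d x) - - of_int (slp g (bck d x)) * y"
      using slope_left[OF free_D(1)[OF f], of x] free_D(2)[OF f, of x] t z by simp
  qed (use z eps_pos in auto)
  moreover have "g (pt d z) - g (pt d t) \<le> \<epsilon>"
    using pt_in_pts[OF fdirs_sub[OF free_D(1)[OF f]]] by (intro osc)
  ultimately show False using z by simp
qed

text \<open>The mirror image: a negative slope at \<open>t\<close> means slope at most
  \<open>- 1\<close> all the way from the start, so the function has already fallen by
  \<open>t\<close>.\<close>

lemma no_late_fall:
  assumes f: "free d L" and t: "0 \<le> t" "t < L" and fall: "slp g (adv d t) < 0"
  shows "t \<le> \<epsilon>"
proof -
  have "g (pt d t) \<le> g (pt d 0) + (-1) * (t - 0)"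
  proof (rule slope_bound[where u = "\<lambda>t. g (pt d t)" and sR = "\<lambda>t. of_int (slp g (adv d t))"
        and sL = "\<lambda>t. - of_int (slp g (bck d t))"])
    fix x assume x: "0 \<le> x" "x < t"
    then show "\<forall>\<^sub>F y in at_right 0. g (pt d (x + y)) = g (pt d x) + of_int (slp g (adv d x)) * y"
      using slope_right[OF free_D(1)[OF f]] free_D(2)[OF f, of x] t by simp
    have "slp g (adv d x) \<le> slp g (adv d t)" by (rule free_mono[OF f]) (use x t in auto)
    then have "slp g (adv d x) \<le> -1" using fall by linarith
    then show "real_of_int (slp g (adv d x)) \<le> -1" by simp
  next
    fix x assume "0 < x" "x \<le> t"
    then show "\<forall>\<^sub>F y in at_right 0. g (pt d (x - y)) = g (pt d x) - - of_int (slp g (bck d x)) * y"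
      using slope_left[OF free_D(1)[OF f], of x] free_D(2)[OF f, of x] t by simp
  qed (use t in auto)
  moreover have "g (pt d 0) - g (pt d t) \<le> \<epsilon>"
    using pt_in_pts[OF fdirs_sub[OF free_D(1)[OF f]]] by (intro osc)
  ultimately show ?thesis by simp
qed

lemma port_free: "d \<in> ports \<Longrightarrow> free d (2 * r)"
  using ports_fdirs port_room pt_unmarked by (auto simp: free_def)

text \<open>No slope at the marked point is positive, so each of them is at least their sum, the
  coefficient of the divisor of \<open>g\<close>, which is at least \<open>- D\<close>. Further out
  the slope only increases.\<close>

lemma port_slope:
  assumes d: "d \<in> ports" and t: "0 \<le> t" "t < r"
  shows "- int Dmax \<le> slp g (adv d t)" "slp g (adv d t) \<le> 0"
proof -
  have le0: "slp g (adv d t) \<le> 0" if "d \<in> ports" "0 \<le> t" "t < r" for d t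
    by (rule no_rise[OF port_free[OF that(1)] that(2)]) (use that eps_r in simp)
  show "slp g (adv d t) \<le> 0" by (rule le0[OF assms])
  have a0: "adv d 0 = d" if "d \<in> ports" for d using adv_0[OF ports_fdirs[OF that]] .
  have nonpos: "slp g d \<le> 0" if "d \<in> ports" for d
    using le0[OF that, of 0] r_pos a0[OF that] by simp
  have "(\<Sum>d'\<in>{d' \<in> ports. bs d' = bs d}. - slp g d') \<ge> - slp g d"
    using nonpos finite_ports d by (intro member_le_sum) auto
  then have "dv g (bs d) \<le> slp g d"
    unfolding dv_marked[OF pl ports_mk[OF d]] by (simp add: sum_negf)
  then have "- int Dmax \<le> slp g d" using eff[of "bs d"] D_le_Dmax[of "bs d"] by linarith
  also have "\<dots> \<le> slp g (adv d t)"
    using free_mono[OF port_free[OF d], of 0 t] a0[OF d] t by simp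
  finally show "- int Dmax \<le> slp g (adv d t)" .
qed

text \<open>Inserting 0 gives distance 0 when the slope is nowhere so steep. The index 0 is read as
  1: otherwise the whole arm would qualify, and the supremum would be \<open>r\<close> instead of at
  most \<open>\<epsilon>\<close>.\<close>

definition breakpoint :: "'e direction \<Rightarrow> nat \<Rightarrow> real" where
  "breakpoint d m = Sup (insert 0 {t \<in> {0..<r}. slp g (adv d t) \<le> - int (max 1 m)})"

lemma breakpoint_set:
  assumes d: "d \<in> ports"
  shows "insert 0 {t \<in> {0..<r}. slp g (adv d t) \<le> - int (max 1 m)} \<subseteq> {0..\<epsilon>}"
  using no_late_fall[OF port_free[OF d]] eps_pos by auto

lemma breakpoint_bdd: "d \<in> ports \<Longrightarrow> bdd_above (insert 0 {t \<in> {0..<r}. slp g (adv d t) \<le> - int (max 1 m)})"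
  using breakpoint_set bdd_above_mono bdd_above_Icc by meson

lemma breakpoint_bounds:
  assumes d: "d \<in> ports"
  shows "0 \<le> breakpoint d m" "breakpoint d m \<le> \<epsilon>"
proof -
  show "0 \<le> breakpoint d m"
    unfolding breakpoint_def by (intro cSup_upper breakpoint_bdd[OF d]) simp
  show "breakpoint d m \<le> \<epsilon>"
    unfolding breakpoint_def by (intro cSup_least) (use breakpoint_set[OF d, of m] in auto)
qed

lemma breakpoint_antimono:
  assumes d: "d \<in> ports" and "m \<le> n"
  shows "breakpoint d n \<le> breakpoint d m"
  unfolding breakpoint_def by (intro cSup_subset_mono breakpoint_bdd[OF d]) (use assms in auto)

text \<open>The inequality is strict because right slopes persist: if the slope at \<open>t\<close>
  is at most \<open>- m\<close>, then so it is at some \<open>z > t\<close>, and the supremum lies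
  beyond \<open>t\<close>.\<close>

lemma less_breakpoint:
  assumes d: "d \<in> ports" and t: "0 \<le> t" "t < r" and m: "1 \<le> m"
  shows "t < breakpoint d m \<longleftrightarrow> slp g (adv d t) \<le> - int m"
proof
  have mm: "max 1 m = m" using m by simp
  show "slp g (adv d t) \<le> - int m" if "t < breakpoint d m"
  proof -
    have "t < Sup (insert 0 {t \<in> {0..<r}. slp g (adv d t) \<le> - int (max 1 m)})"
      using that by (simp only: breakpoint_def)
    then obtain t' where "t' \<in> insert 0 {t \<in> {0..<r}. slp g (adv d t) \<le> - int (max 1 m)}" "t < t'"
      unfolding less_cSup_iff[OF insert_not_empty breakpoint_bdd[OF d]] by blast
    then have t': "t < t'" "t' < r" "slp g (adv d t') \<le> - int m" using t mm by auto
    have "slp g (adv d t) \<le> slp g (adv d t')"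
      by (rule free_mono[OF port_free[OF d]]) (use t t' r_pos in auto)
    then show ?thesis using t' by simp
  qed
  assume s: "slp g (adv d t) \<le> - int m"
  have fd: "d \<in> fdirs" by (rule ports_fdirs[OF d])
  have R: "\<forall>\<^sub>F y in at_right 0. g (pt d (x + y)) = g (pt d x) + of_int (slp g (adv d x)) * y"
    if "0 \<le> x" "x < r" for x
    using slope_right[OF fd that(1)] port_room[OF d, of x] that r_pos by simp
  have "\<forall>\<^sub>F z in at_right t. real_of_int (slp g (adv d z)) = of_int (slp g (adv d t))"
  proof (rule right_slope_near[where u = "\<lambda>x. g (pt d x)", OF R[OF t]])
    show "\<forall>\<^sub>F z in at_right t. \<forall>\<^sub>F y in at_right 0. g (pt d (z + y)) = g (pt d z) + of_int (slp g (adv d z)) * y"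
      using t R by (intro eventually_mono[OF eventually_at_right_real[of t r]]) auto
  qed
  then have "\<forall>\<^sub>F z in at_right t. z \<in> {t<..<r} \<and> slp g (adv d z) = slp g (adv d t)"
    using eventually_at_right_real[OF t(2)] by eventually_elim auto
  then obtain z where z: "z \<in> {t<..<r}" "slp g (adv d z) = slp g (adv d t)"
    using eventually_happens'[OF trivial_limit_at_right_real] by blast
  have "z \<le> breakpoint d m"
    unfolding breakpoint_def by (rule cSup_upper[OF _ breakpoint_bdd[OF d]]) (use z s t mm in auto)
  then show "t < breakpoint d m" using z by simp
qed

lemma card_breakpoints:
  assumes d: "d \<in> ports" and t: "0 \<le> t" "t < r"
  shows "int (card {m\<in>{1..Dmax}. t < breakpoint d m}) = - slp g (adv d t)"
proof -
  have "{m\<in>{1..Dmax}. t < breakpoint d m} = {1..nat (- slp g (adv d t))}"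
    using less_breakpoint[OF d t] port_slope[OF d t] by auto
  then show ?thesis using port_slope(2)[OF d t] by simp
qed

lemma breakpoint_N1:
  assumes d: "d \<in> ports" and x: "0 \<le> x" "x \<le> r"
  shows "g (pt d x) = g (bs d) - (\<Sum>m=1..Dmax. min x (breakpoint d m))"
proof -
  have fd: "d \<in> fdirs" by (rule ports_fdirs[OF d])
  let ?v = "\<lambda>x. \<Sum>m=1..Dmax. min x (breakpoint d m)"
  \<comment> \<open>By \<open>card_breakpoints\<close> the right slopes of the two summands cancel
    everywhere on the arm, so \<open>?w\<close> is constant.\<close>
  let ?w = "\<lambda>x. g (pt d x) + ?v x"
  have "?w x = ?w 0 + 0 * (x - 0)"
  proof (rule slope_const[OF x(1), of ?w])
    fix t assume t: "0 \<le> t" "t < x"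
    then have room: "ereal t < room d" using port_room[OF d, of t] x r_pos by simp
    have card: "real (card {m\<in>{1..Dmax}. t < breakpoint d m}) = - of_int (slp g (adv d t))"
      using card_breakpoints[OF d t(1)] t x by linarith
    from slope_right[OF fd t(1) room] sum_min_right[of "{1..Dmax}" t "breakpoint d", OF finite_atLeastAtMost]
    show "\<forall>\<^sub>F y in at_right 0. ?w (t + y) = ?w t + 0 * y"
      by eventually_elim (use card in simp)
  next
    fix t assume t: "0 < t" "t \<le> x"
    then have room: "ereal t \<le> room d" using port_room[OF d, of t] x r_pos by simp
    from slope_left[OF fd t(1) room] sum_min_left[of "{1..Dmax}" t "breakpoint d", OF finite_atLeastAtMost]
    have "\<forall>\<^sub>F y in at_right 0. ?w (t - y) = ?w t -
       (- of_int (slp g (bck d t)) + real (card {m\<in>{1..Dmax}. t \<le> breakpoint d m})) * y"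
      by eventually_elim (simp add: algebra_simps)
    then show "\<exists>k. \<forall>\<^sub>F y in at_right 0. ?w (t - y) = ?w t - k * y" by blast
  qed
  moreover have "?v 0 = 0" using breakpoint_bounds[OF d] by (intro sum.neutral) auto
  ultimately show ?thesis using pt_0[OF fd] by simp
qed

text \<open>At distance at least \<open>r\<close> from both ends \<open>no_rise\<close> and
  \<open>no_late_fall\<close> both apply, because \<open>\<epsilon> < r\<close>, and leave only
  slope 0. The value at infinity is attained at large real coordinates too.\<close>

lemma middle_const:
  assumes s: "(e, a, b) \<in> segs" and t: "a + ereal r \<le> t" "t + ereal r \<le> b"
  shows "g (ep e t) = g (ep e (a + ereal r))"
proof -
  obtain \<alpha> where \<alpha>: "a = ereal \<alpha>" "0 \<le> \<alpha>" "ereal (\<alpha> + 2 * r) < b" using seg_gap[OF s] by blast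
  define d where "d = Fwd e a"
  have d: "d \<in> ports" unfolding d_def by (rule segs_ports(1)[OF s])
  have fd: "d \<in> fdirs" by (rule ports_fdirs[OF d])
  have mid_real: "g (ep e (ereal x)) = g (ep e (a + ereal r))" if x: "\<alpha> + r \<le> x" "ereal (x + r) \<le> b" for x
  proof -
    \<comment> \<open>The stretch extends \<open>r\<close> beyond \<open>x\<close>, so more than
      \<open>\<epsilon>\<close> of it remains after every point up to \<open>x\<close>.\<close>
    define L where "L = x + r - \<alpha>"
    have free: "free d L"
      unfolding free_def
    proof (intro conjI allI impI)
      fix y assume y: "0 < y \<and> y < L"
      then have "ereal (\<alpha> + y) < ereal (x + r)" by (simp add: L_def)
      also note x(2)
      finally have b: "ereal (\<alpha> + y) < b" .
      then have "pt d y \<in> seg (e, a, b)" using y \<alpha>(1) by (auto simp: d_def intro!: insideI)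
      then show "pt d y \<notin> mk" by (rule inside_unmarked[OF s])
      show "ereal y < room d"
        using b segs_D(4)[OF s] \<alpha>(1) by (auto simp: d_def ereal_less_minus_iff')
    qed (rule fd)
    have "g (pt d (x - \<alpha>)) = g (pt d r) + 0 * (x - \<alpha> - r)"
    proof (rule slope_const[of r "x - \<alpha>" "\<lambda>y. g (pt d y)"])
      fix y assume y: "r \<le> y" "y < x - \<alpha>"
      then have yL: "0 \<le> y" "y < L" "y + \<epsilon> < L" using r_pos eps_r by (auto simp: L_def)
      have "slp g (adv d y) \<le> 0" by (rule no_rise[OF free yL(1,3)])
      moreover have "\<not> slp g (adv d y) < 0"
        using no_late_fall[OF free yL(1,2)] y eps_r by auto
      ultimately have "slp g (adv d y) = 0" by simp
      then show "\<forall>\<^sub>F z in at_right 0. g (pt d (y + z)) = g (pt d y) + 0 * z"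
        using slope_right[OF fd yL(1) free_D(2)[OF free yL(1,2)]] by simp
    next
      fix y assume y: "r < y" "y \<le> x - \<alpha>"
      then have yL: "0 < y" "y < L" using r_pos by (auto simp: L_def)
      then show "\<exists>k. \<forall>\<^sub>F z in at_right 0. g (pt d (y - z)) = g (pt d y) - k * z"
        using slope_left[OF fd yL(1)] free_D(2)[OF free, of y] by fastforce
    qed (use x in simp)
    then show ?thesis by (simp add: d_def \<alpha>(1))
  qed
  show ?thesis
  proof (cases t)
    case (real x)
    then show ?thesis using mid_real[of x] t \<alpha>(1) by simp
  next
    case PInf
    then have b: "b = \<infinity>" using t by simp
    have e: "e \<in> E" "\<l> e = \<infinity>" using segs_D(1,8)[OF s] b by auto
    have "\<forall>\<^sub>F x in at_top. g (ep e (ereal x)) = g (ep e \<infinity>)"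
      using germ_slope_slp[OF pl conjunct1[OF Bwd_inf_dirs[OF e]]] Bwd_inf_dirs[OF e]
      by (simp add: germ_slope_def germ_inf eventually_filtermap del: germ.simps)
    then have "\<forall>\<^sub>F x in at_top. \<alpha> + r \<le> x \<and> g (ep e (ereal x)) = g (ep e \<infinity>)"
      using eventually_ge_at_top[of "\<alpha> + r"] by eventually_elim simp
    then obtain x where "\<alpha> + r \<le> x" "g (ep e (ereal x)) = g (ep e \<infinity>)"
      using eventually_happens'[OF trivial_limit_at_top_linorder] by blast
    then show ?thesis using mid_real[of x] PInf b by simp
  qed (use t \<alpha> in auto)
qed

lemma nform_breakpoint: "nform g breakpoint"
  unfolding nform_def
proof (intro conjI ballI allI impI; (elim conjE)?)
  fix x assume x: "x \<in> mk"
  have "(\<Sum>d\<in>{d \<in> ports. bs d = x}. int (card {m\<in>{1..Dmax}. 0 < breakpoint d m})) = (\<Sum>d\<in>{d \<in> ports. bs d = x}. - slp g d)"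
    using card_breakpoints[of _ 0] r_pos adv_0[OF ports_fdirs] by (intro sum.cong) auto
  also have "\<dots> = - dv g x" using dv_marked[OF pl x] by (simp add: sum_negf)
  finally show "(\<Sum>d\<in>{d \<in> ports. bs d = x}. int (card {m\<in>{1..Dmax}. 0 < breakpoint d m})) \<le> D x"
    using eff[of x] by simp
next
  fix s assume "s \<in> segs"
  then show "case s of (e, a, b) \<Rightarrow> \<forall>t. a + ereal r \<le> t \<and> t + ereal r \<le> b \<longrightarrow> g (ep e t) = g (ep e (a + ereal r))"
    using middle_const by (cases s) auto
qed (use breakpoint_bounds breakpoint_antimono breakpoint_N1 in auto)

end

end

section \<open>From weighted chains to functions\<close>

text \<open>A move of slope \<open>c\<close> and height \<open>x\<close> puts the breaks with
  indices up to \<open>c\<close> at distance \<open>x / c\<close> and adds 0 to the others. For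
  \<open>m \<le> c\<close> the left side is \<open>m + (c - m)\<close> times \<open>x / c\<close>,
  that is, the full height \<open>x\<close> of the move.\<close>

lemma slope_sum_aux:
  fixes x :: real
  assumes "c \<le> M"
  shows "real m * (if m \<le> c then x / real c else 0) + (\<Sum>j\<in>{m<..M}. if j \<le> c then x / real c else 0) =
    (if m \<le> c \<and> 0 < c then x else 0)"
proof -
  have "{j \<in> {m<..M}. j \<le> c} = {m<..c}" using assms by auto
  then have "(\<Sum>j\<in>{m<..M}. if j \<le> c then x / real c else 0) = real (c - m) * (x / real c)"
    by (simp add: sum.inter_filter[symmetric])
  then show ?thesis by (auto simp: of_nat_diff field_simps)
qed

context small_link
begin

text \<open>A move \<open>p\<close> of height \<open>\<epsilon> * w p\<close> takes length
  \<open>\<epsilon> * w p / snd p d\<close> along \<open>d\<close>. The combined function has slope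
  at most \<open>- m\<close> on the pieces of those \<open>p\<close> with weight at least
  \<open>m\<close>, and these come first along \<open>d\<close>. For \<open>m = 0\<close> the terms
  with weight 0 vanish, as division by 0 gives 0.\<close>

definition tw :: "(('v, 'e) point set \<times> ('e direction \<Rightarrow> int) \<Rightarrow> real) \<Rightarrow> 'e direction \<Rightarrow> nat \<Rightarrow> real" where
  "tw w d m = \<epsilon> * (\<Sum>p\<in>{p \<in> P. int m \<le> snd p d}. w p / of_int (snd p d))"

text \<open>The distance of \<open>x\<close> from the base of the port \<open>d\<close>, cut off at \<open>r\<close>.\<close>

definition adist :: "'e direction \<Rightarrow> ('v, 'e) point \<Rightarrow> real" where
  "adist d x = (if x \<in> pt d ` {0<..r} then the_inv_into {0<..r} (pt d) x else r)"

text \<open>The first summand collects the moves whose subgraph contains \<open>x\<close>, the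
  second what the others still contribute on the arms, regrouped by port and break. Off the arms
  \<open>adist d x = r\<close> exceeds every break, so that the second summand vanishes for
  \<open>w\<close> in the realization.\<close>

definition gw :: "(('v, 'e) point set \<times> ('e direction \<Rightarrow> int) \<Rightarrow> real) \<Rightarrow> ('v, 'e) point \<Rightarrow> real" where
  "gw w x = \<epsilon> * sum w {p \<in> P. x \<in> fst p} + (\<Sum>d\<in>ports. \<Sum>m=1..Dmax. max 0 (tw w d m - adist d x))"

text \<open>\<open>slope_sum_aux\<close> summed over the moves. The left side is the triangular
  expression of \<open>nf_T\<close>, so the mass on the right is the drop from the base of the port
  to its \<open>m\<close>-th break.\<close>

lemma tw_sum:
  assumes d: "d \<in> ports"
  shows "real m * tw w d m + sum (tw w d) {m<..Dmax} = \<epsilon> * sum w {p \<in> P. int m \<le> snd p d \<and> 0 < snd p d}"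
proof -
  let ?f = "\<lambda>p j. if j \<le> nat (snd p d) then w p / real (nat (snd p d)) else 0"
  have tw: "tw w d j = \<epsilon> * (\<Sum>p\<in>P. ?f p j)" for j
  proof -
    have "tw w d j = \<epsilon> * (\<Sum>p\<in>P. if int j \<le> snd p d then w p / of_int (snd p d) else 0)"
      unfolding tw_def by (simp add: sum.inter_filter[OF finite_P])
    also have "(\<Sum>p\<in>P. if int j \<le> snd p d then w p / of_int (snd p d) else 0) = (\<Sum>p\<in>P. ?f p j)"
      using P_snd(2) by (intro sum.cong) (auto simp: le_nat_iff)
    finally show ?thesis .
  qed
  have "real m * tw w d m + sum (tw w d) {m<..Dmax} =
      \<epsilon> * (\<Sum>p\<in>P. real m * ?f p m + (\<Sum>j\<in>{m<..Dmax}. ?f p j))"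
    unfolding tw sum_distrib_left[symmetric] sum.distrib
    by (subst sum.swap) (simp add: algebra_simps sum_distrib_left)
  also have "(\<Sum>p\<in>P. real m * ?f p m + (\<Sum>j\<in>{m<..Dmax}. ?f p j)) = (\<Sum>p\<in>P. if int m \<le> snd p d \<and> 0 < snd p d then w p else 0)"
  proof (rule sum.cong[OF refl])
    fix p assume p: "p \<in> P"
    have "nat (snd p d) \<le> Dmax" using P_snd(3)[OF p, of d] by simp
    from slope_sum_aux[OF this, of m "w p"]
    show "real m * ?f p m + (\<Sum>j\<in>{m<..Dmax}. ?f p j) = (if int m \<le> snd p d \<and> 0 < snd p d then w p else 0)"
      using P_snd(2)[OF p, of d] by (simp add: le_nat_iff)
  qed
  also have "\<dots> = sum w {p \<in> P. int m \<le> snd p d \<and> 0 < snd p d}"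
    by (simp add: sum.inter_filter[OF finite_P])
  finally show ?thesis .
qed

lemma adist_pt:
  assumes "d \<in> ports" "0 < t" "t \<le> r"
  shows "adist d (pt d t) = t"
proof -
  have "inj_on (pt d) {0<..r}" using pt_inj[OF assms(1,1)] by (auto intro!: inj_onI)
  then show ?thesis using assms by (auto simp: adist_def the_inv_into_f_f)
qed

lemma adist_other:
  assumes "d \<in> ports" "\<And>t. 0 < t \<Longrightarrow> t < r \<Longrightarrow> x \<noteq> pt d t"
  shows "adist d x = r"
proof (cases "x \<in> pt d ` {0<..r}")
  case True
  then obtain t where t: "0 < t" "t \<le> r" "x = pt d t" by auto
  then have "t = r" using assms(2)[of t] by force
  then show ?thesis using adist_pt[OF assms(1) t(1,2)] t by simp
qed (simp add: adist_def)

lemma adist_marked: "d \<in> ports \<Longrightarrow> x \<in> mk \<Longrightarrow> adist d x = r"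
  using pt_unmarked[of d] r_pos by (intro adist_other) auto

lemma adist_arm: "d \<in> ports \<Longrightarrow> d' \<in> ports \<Longrightarrow> d \<noteq> d' \<Longrightarrow> 0 < t \<Longrightarrow> t \<le> r \<Longrightarrow> adist d (pt d' t) = r"
  using pt_inj[of d' d t] by (intro adist_other) force+

lemma adist_mid:
  assumes d: "d \<in> ports" and s: "(e, a, b) \<in> segs" and t: "a + ereal r \<le> t" "t + ereal r \<le> b"
  shows "adist d (ep e t) = r"
proof (rule adist_other[OF d])
  fix y assume y: "0 < y" "y < r"
  obtain \<alpha> where \<alpha>: "a = ereal \<alpha>" "0 \<le> \<alpha>" "ereal (\<alpha> + 2 * r) < b" using seg_gap[OF s] by blast
  show "ep e t \<noteq> pt d y"
  proof
    assume eq: "ep e t = pt d y"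
    have um: "pt d y \<notin> mk" using pt_unmarked[OF d y(1)] y by simp
    have at: "a < t" using t(1) \<alpha>(1) r_pos by (cases t) auto
    have "t \<noteq> \<infinity>"
    proof
      assume "t = \<infinity>"
      then have "b = \<infinity>" "t = b" using t by auto
      then have "ep e t \<in> mk"
        using ep_marked[OF segs_D(1)[OF s], of b] segs_range[OF s, of b] segs_D(3,6)[OF s] by simp
      with eq um show False by simp
    qed
    then obtain x where x: "t = ereal x" using at by (cases t) auto
    have "ereal x < ereal (x + r)" using r_pos by simp
    also have "\<dots> \<le> b" using t x by simp
    finally have tb: "t < b" using x by simp
    have "d = Fwd e a \<or> b \<noteq> \<infinity> \<and> d = Bwd e b"
      using port_of_seg[OF d _ s y(1)] insideI[OF at tb, of e] eq y by simp
    then show False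
    proof (elim disjE conjE)
      assume "d = Fwd e a"
      then have "ep e (ereal x) = ep e (ereal (\<alpha> + y))" using eq x \<alpha> by simp
      moreover have "ep e (ereal x) = Inner e x" using segs_range'[OF s at tb] x by (auto intro!: ep_Inner)
      ultimately have "ep e (ereal (\<alpha> + y)) = Inner e x" by (simp only:)
      then have "x = \<alpha> + y" by (simp only: ep_eq_Inner ereal.inject)
      then show False using t(1) \<alpha> x y by simp
    next
      assume "b \<noteq> \<infinity>" "d = Bwd e b"
      then obtain \<beta> where \<beta>: "b = ereal \<beta>" "d = Bwd e (ereal \<beta>)" using segs_D(9)[OF s] by blast
      then have "ep e (ereal x) = ep e (ereal (\<beta> - y))" using eq x by simp
      moreover have "ep e (ereal x) = Inner e x" using segs_range'[OF s at tb] x by (auto intro!: ep_Inner)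
      ultimately have "ep e (ereal (\<beta> - y)) = Inner e x" by (simp only:)
      then have "x = \<beta> - y" by (simp only: ep_eq_Inner ereal.inject)
      then show False using t(2) \<beta> x y by simp
    qed
  qed
qed

lemma cellular_mid:
  assumes S: "cellular S" and s: "(e, a, b) \<in> segs" and t: "a + ereal r \<le> t" "t + ereal r \<le> b"
  shows "ep e t \<in> S \<longleftrightarrow> ep e (a + ereal r) \<in> S"
proof -
  obtain \<alpha> where \<alpha>: "a = ereal \<alpha>" "0 \<le> \<alpha>" "ereal (\<alpha> + 2 * r) < b" using seg_gap[OF s] by blast
  have at: "a < t" using t(1) \<alpha>(1) r_pos by (cases t) auto
  have ar: "a < a + ereal r" "a + ereal r < b"
    using \<alpha> r_pos by (auto intro: le_less_trans[of _ "ereal (\<alpha> + 2 * r)"])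
  show ?thesis
  proof (cases "t < b")
    case True
    then show ?thesis using cellular_inside[OF S s insideI[OF at True] insideI[OF ar]] by blast
  next
    case False
    have "t = \<infinity>" "b = \<infinity>"
    proof -
      show "t = \<infinity>"
      proof (rule ccontr)
        assume "t \<noteq> \<infinity>"
        then obtain x where x: "t = ereal x" using at by (cases t) auto
        have "ereal x < ereal (x + r)" using r_pos by simp
        also have "\<dots> \<le> b" using t x by simp
        finally show False using False x by simp
      qed
      then show "b = \<infinity>" using t by simp
    qed
    from S s show ?thesis
    proof (cases rule: cellular_seg)
      case full
      then show ?thesis using at \<open>t = \<infinity>\<close> \<open>b = \<infinity>\<close> insideI[OF ar, of e] by auto
    next
      case empty
      then show ?thesis using \<open>t = \<infinity>\<close> \<open>b = \<infinity>\<close> insideI[OF ar, of e] by auto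
    qed
  qed
qed

lemma realization_D:
  assumes w: "w \<in> realization K"
  shows "0 \<le> w p" "{p. w p \<noteq> 0} \<in> K" "sum w {p \<in> P. Q p} = sum w {p \<in> {p. w p \<noteq> 0}. Q p}" "sum w P = 1"
proof -
  show nn: "0 \<le> w p" using w unfolding realization_def by blast
  show \<sigma>: "{p. w p \<noteq> 0} \<in> K" using w unfolding realization_def by blast
  have sub: "{p. w p \<noteq> 0} \<subseteq> P" by (rule K_D(1)[OF \<sigma>])
  then show *: "sum w {p \<in> P. Q p} = sum w {p \<in> {p. w p \<noteq> 0}. Q p}" for Q
    using finite_P by (intro sum.mono_neutral_right) auto
  show "sum w P = 1" using *[of "\<lambda>_. True"] w by (simp add: realization_def)
qed

section \<open>The function of a weighted chain is in normal form\<close>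

context
  fixes w assumes w: "w \<in> realization K"
begin

abbreviation supp where "supp \<equiv> {p. w p \<noteq> 0}"

lemma supp_pos: "p \<in> supp \<Longrightarrow> 0 < w p"
  using realization_D(1)[OF w, of p] by (simp add: order_less_le)

lemma tw_nonneg: "0 \<le> tw w d m"
  unfolding tw_def using eps_pos realization_D(1)[OF w] P_snd(2)
  by (intro mult_nonneg_nonneg sum_nonneg divide_nonneg_nonneg) auto

lemma tw_le: "tw w d m \<le> \<epsilon>"
proof -
  have "w p / of_int (snd p d) \<le> w p" if "p \<in> P" for p
  proof (cases "snd p d = 0")
    case False
    then have "1 \<le> snd p d" using P_snd(2)[OF that, of d] by simp
    then have "w p * 1 \<le> w p * of_int (snd p d)"
      using realization_D(1)[OF w, of p] by (intro mult_left_mono) auto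
    then show ?thesis using \<open>1 \<le> snd p d\<close> by (simp add: field_simps)
  qed (use realization_D(1)[OF w] in simp)
  then have "(\<Sum>p\<in>{p \<in> P. int m \<le> snd p d}. w p / of_int (snd p d)) \<le> (\<Sum>p\<in>{p \<in> P. int m \<le> snd p d}. w p)"
    by (intro sum_mono) auto
  also have "\<dots> \<le> sum w P"
    using finite_P realization_D(1)[OF w] by (intro sum_mono2) auto
  finally show ?thesis
    unfolding tw_def using realization_D(4)[OF w] eps_pos by (simp add: mult_le_cancel_left1)
qed

lemma tw_antimono: "m \<le> n \<Longrightarrow> tw w d n \<le> tw w d m"
  unfolding tw_def using eps_pos finite_P realization_D(1)[OF w] P_snd(2)
  by (intro mult_left_mono sum_mono2 divide_nonneg_nonneg) auto

lemma tw_pos: "1 \<le> m \<Longrightarrow> 0 < tw w d m \<longleftrightarrow> (\<exists>p\<in>supp. int m \<le> snd p d)"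
proof -
  assume m: "1 \<le> m"
  have "0 < tw w d m \<longleftrightarrow> 0 < (\<Sum>p\<in>{p \<in> P. int m \<le> snd p d}. w p / of_int (snd p d))"
    unfolding tw_def using eps_pos by (simp add: zero_less_mult_iff)
  also have "\<dots> \<longleftrightarrow> (\<exists>p\<in>{p \<in> P. int m \<le> snd p d}. w p / of_int (snd p d) \<noteq> 0)"
  proof -
    let ?f = "\<lambda>p. w p / of_int (snd p d)" and ?A = "{p \<in> P. int m \<le> snd p d}"
    have nn: "0 \<le> ?f p" if "p \<in> ?A" for p
      using realization_D(1)[OF w, of p] P_snd(2)[of p d] that by auto
    have "finite ?A" using finite_P by simp
    then have *: "sum ?f ?A = 0 \<longleftrightarrow> (\<forall>p\<in>?A. ?f p = 0)"
      using nn by (rule sum_nonneg_eq_0_iff)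
    have "0 \<le> sum ?f ?A" using nn by (rule sum_nonneg)
    then have "0 < sum ?f ?A \<longleftrightarrow> sum ?f ?A \<noteq> 0" by linarith
    then show ?thesis unfolding * by blast
  qed
  also have "\<dots> \<longleftrightarrow> (\<exists>p\<in>supp. int m \<le> snd p d)"
    using m K_D(1)[OF realization_D(2)[OF w]] by auto
  finally show ?thesis .
qed

lemma gw_no_arm:
  assumes "\<And>d. d \<in> ports \<Longrightarrow> adist d x = r"
  shows "gw w x = \<epsilon> * sum w {p \<in> P. x \<in> fst p}"
proof -
  have "max 0 (tw w d m - adist d x) = 0" if "d \<in> ports" for d m
    using assms[OF that] tw_le[of d m] eps_r by simp
  then show ?thesis unfolding gw_def by simp
qed

lemma gw_marked: "x \<in> mk \<Longrightarrow> gw w x = \<epsilon> * sum w {p \<in> P. x \<in> fst p}"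
  by (rule gw_no_arm) (rule adist_marked)

lemma gw_arm:
  assumes d: "d \<in> ports" and t: "0 < t" "t \<le> r"
  shows "gw w (pt d t) = \<epsilon> * sum w {p \<in> P. pt d r \<in> fst p} + (\<Sum>m=1..Dmax. max 0 (tw w d m - t))"
proof -
  have "max 0 (tw w d' m - adist d' (pt d t)) = 0" if "d' \<in> ports - {d}" for d' m
    using adist_arm[of d' d t] that d t tw_le[of d' m] eps_r by auto
  then have "(\<Sum>d'\<in>ports. \<Sum>m=1..Dmax. max 0 (tw w d' m - adist d' (pt d t))) =
      (\<Sum>m=1..Dmax. max 0 (tw w d m - adist d (pt d t)))"
    using d finite_ports by (subst sum.remove[of _ d]) auto
  moreover have "{p \<in> P. pt d t \<in> fst p} = {p \<in> P. pt d r \<in> fst p}"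
    using cell_port[OF P_snd(1) d t(1)] t r_pos by auto
  ultimately show ?thesis unfolding gw_def using adist_pt[OF d t] by simp
qed

lemma gw_mid_port: "d \<in> ports \<Longrightarrow> gw w (pt d r) = \<epsilon> * sum w {p \<in> P. pt d r \<in> fst p}"
proof -
  assume d: "d \<in> ports"
  have "(\<Sum>m=1..Dmax. max 0 (tw w d m - r)) = 0"
  proof (rule sum.neutral, rule ballI)
    fix m
    show "max 0 (tw w d m - r) = 0" using tw_le[of d m] eps_r by simp
  qed
  then show ?thesis using gw_arm[OF d r_pos order.refl] by simp
qed

text \<open>An element whose subgraph contains the base either contains the whole segment ahead or
  fires along \<open>d\<close>, never both.\<close>

lemma gw_base_split:
  assumes d: "d \<in> ports"
  shows "gw w (bs d) = \<epsilon> * sum w {p \<in> P. pt d r \<in> fst p} + (\<Sum>m=1..Dmax. tw w d m)"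
proof -
  have "{p \<in> P. bs d \<in> fst p} = {p \<in> P. pt d r \<in> fst p} \<union> {p \<in> P. 0 < snd p d}"
    using P_snd(4)[of _ d] cell_port_base[OF P_snd(1) d] d by auto
  moreover have "{p \<in> P. pt d r \<in> fst p} \<inter> {p \<in> P. 0 < snd p d} = {}"
    using P_snd(4)[of _ d] by auto
  ultimately have "sum w {p \<in> P. bs d \<in> fst p} = sum w {p \<in> P. pt d r \<in> fst p} + sum w {p \<in> P. 0 < snd p d}"
    using finite_P by (simp add: sum.union_disjoint)
  moreover have "sum (tw w d) {0<..Dmax} = \<epsilon> * sum w {p \<in> P. 0 < snd p d}"
    using tw_sum[OF d, of 0 w] by (auto intro!: arg_cong[of _ _ "sum w"] simp: P_snd(2))
  moreover have "{0<..Dmax} = {1..Dmax}" by auto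
  ultimately show ?thesis using gw_marked[OF ports_mk[OF d]] by (simp add: algebra_simps)
qed

text \<open>Among the elements of the chain that contain \<open>x\<close>, the least one has the
  largest weight at each port based at \<open>x\<close>. So it bounds the number of chips leaving
  along each of them, and its own weights add up to at most \<open>D x\<close>.\<close>

lemma gw_N3:
  assumes x: "x \<in> mk"
  shows "(\<Sum>d\<in>{d \<in> ports. bs d = x}. int (card {m\<in>{1..Dmax}. 0 < tw w d m})) \<le> D x"
proof -
  note \<sigma> = K_D[OF realization_D(2)[OF w]]
  let ?A = "{p \<in> supp. x \<in> fst p}"
  show ?thesis
  proof (cases "?A = {}")
    case True
    have "card {m\<in>{1..Dmax}. 0 < tw w d m} = 0" if "bs d = x" for d
    proof -
      have "\<not> 0 < tw w d m" if m: "1 \<le> m" for m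
      proof
        assume "0 < tw w d m"
        then obtain p where p: "p \<in> supp" "int m \<le> snd p d" using tw_pos[OF m] by blast
        then have "0 < snd p d" using m by linarith
        then have "p \<in> ?A" using P_snd(4)[of p d] \<sigma>(1) p \<open>bs d = x\<close> by blast
        with True show False by blast
      qed
      then have "{m\<in>{1..Dmax}. 0 < tw w d m} = {}" by auto
      then show ?thesis by (simp only: card.empty)
    qed
    then have "(\<Sum>d\<in>{d \<in> ports. bs d = x}. int (card {m\<in>{1..Dmax}. 0 < tw w d m})) = 0"
      by (intro sum.neutral) auto
    then show ?thesis using D_nonneg by simp
  next
    case False
    have "finite ?A" using \<sigma>(2) by simp
    then have "\<exists>p\<in>?A. \<forall>q\<in>?A. le_P p q"
      by (rule finite_chain_least[OF _ False]) (use \<sigma>(4) le_P_trans in blast)+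
    then obtain p where p: "p \<in> supp" "x \<in> fst p" "\<And>q. q \<in> ?A \<Longrightarrow> le_P p q" by blast
    have pP: "p \<in> P" using \<sigma>(1) p by blast
    have "int (card {m\<in>{1..Dmax}. 0 < tw w d m}) \<le> snd p d" if d: "d \<in> {d \<in> ports. bs d = x}" for d
    proof -
      have "m \<le> nat (snd p d)" if m: "1 \<le> m" "0 < tw w d m" for m
      proof -
        obtain q where q: "q \<in> supp" "int m \<le> snd q d" using tw_pos[OF m(1)] m(2) by blast
        then have "0 < snd q d" using m by linarith
        then have "q \<in> ?A" using P_snd(4)[of q d] \<sigma>(1) q d by blast
        then have "snd q d \<le> snd p d" using le_P_D(4)[OF p(3)] p(2) d by blast
        then show ?thesis using q by linarith
      qed
      then have "{m\<in>{1..Dmax}. 0 < tw w d m} \<subseteq> {1..nat (snd p d)}" by auto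
      then have "card {m\<in>{1..Dmax}. 0 < tw w d m} \<le> nat (snd p d)"
        using card_mono[of "{1..nat (snd p d)}"] by fastforce
      then show ?thesis using P_snd(2)[OF pP, of d] by linarith
    qed
    then have "(\<Sum>d\<in>{d \<in> ports. bs d = x}. int (card {m\<in>{1..Dmax}. 0 < tw w d m})) \<le> (\<Sum>d\<in>{d \<in> ports. bs d = x}. snd p d)"
      by (rule sum_mono)
    also have "\<dots> \<le> D x" by (rule P_sum[OF pP p(2)])
    finally show ?thesis .
  qed
qed

lemma nform_gw: "nform (gw w) (tw w)"
  unfolding nform_def
proof (intro conjI ballI allI impI; (elim conjE)?)
  fix d x assume d: "d \<in> ports" and x: "0 \<le> x" "x \<le> r"
  show "gw w (pt d x) = gw w (bs d) - (\<Sum>m=1..Dmax. min x (tw w d m))"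
  proof (cases "x = 0")
    case True
    then show ?thesis using pt_0[OF ports_fdirs[OF d]] tw_nonneg by (simp add: min_absorb1)
  next
    case False
    have "(\<Sum>m=1..Dmax. max 0 (tw w d m - x)) = (\<Sum>m=1..Dmax. tw w d m) - (\<Sum>m=1..Dmax. min x (tw w d m))"
      unfolding sum_subtractf[symmetric] by (intro sum.cong) auto
    then show ?thesis using gw_arm[OF d, of x] gw_base_split[OF d] False x by simp
  qed
next
  fix s assume "s \<in> segs"
  then obtain e a b where s: "s = (e, a, b)" "(e, a, b) \<in> segs" by (cases s) auto
  have "gw w (ep e t) = gw w (ep e (a + ereal r))" if t: "a + ereal r \<le> t" "t + ereal r \<le> b" for t
  proof -
    obtain \<alpha> where \<alpha>: "a = ereal \<alpha>" "0 \<le> \<alpha>" "ereal (\<alpha> + 2 * r) < b" using seg_gap[OF s(2)] by blast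
    have "a + ereal r + ereal r = ereal (\<alpha> + 2 * r)" using \<alpha>(1) by simp
    then have t': "a + ereal r + ereal r \<le> b" using less_imp_le[OF \<alpha>(3)] by (simp only:)
    have "{p \<in> P. ep e t \<in> fst p} = {p \<in> P. ep e (a + ereal r) \<in> fst p}"
      using cellular_mid[OF P_snd(1) s(2) t] by auto
    then show ?thesis
      using gw_no_arm[of "ep e t"] gw_no_arm[of "ep e (a + ereal r)"] adist_mid[OF _ s(2) t]
        adist_mid[OF _ s(2) order.refl t'] by simp
  qed
  then show "case s of (e, a, b) \<Rightarrow> \<forall>t. a + ereal r \<le> t \<and> t + ereal r \<le> b \<longrightarrow> gw w (ep e t) = gw w (ep e (a + ereal r))"
    unfolding s by simp
qed (use tw_nonneg tw_le tw_antimono gw_N3 in auto)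

text \<open>Subtracting the drop \<open>tw_sum\<close> from the value at the base leaves the
  elements that contain the base and have weight less than \<open>m\<close>. This condition is
  up-closed, so \<open>threshold\<close> can be applied to it.\<close>

lemma gw_break:
  assumes d: "d \<in> ports" and m: "1 \<le> m" "m \<le> Dmax"
  shows "gw w (pt d (tw w d m)) = \<epsilon> * sum w {p \<in> P. bs d \<in> fst p \<and> snd p d < int m}"
proof -
  have "{p \<in> P. bs d \<in> fst p} = {p \<in> P. bs d \<in> fst p \<and> snd p d < int m} \<union> {p \<in> P. int m \<le> snd p d \<and> 0 < snd p d}"
  proof (rule set_eqI)
    fix p
    show "p \<in> {p \<in> P. bs d \<in> fst p} \<longleftrightarrow>
        p \<in> {p \<in> P. bs d \<in> fst p \<and> snd p d < int m} \<union> {p \<in> P. int m \<le> snd p d \<and> 0 < snd p d}"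
      using P_snd(4)[of p d] m by auto
  qed
  moreover have "{p \<in> P. bs d \<in> fst p \<and> snd p d < int m} \<inter> {p \<in> P. int m \<le> snd p d \<and> 0 < snd p d} = {}"
    by auto
  ultimately have "sum w {p \<in> P. bs d \<in> fst p} =
      sum w {p \<in> P. bs d \<in> fst p \<and> snd p d < int m} + sum w {p \<in> P. int m \<le> snd p d \<and> 0 < snd p d}"
    using finite_P by (simp add: sum.union_disjoint)
  then show ?thesis
    using nf_T[OF nform_gw d m] tw_sum[OF d, of m w] gw_marked[OF ports_mk[OF d]] by (simp add: algebra_simps)
qed

section \<open>Recovering the weighted chain from the levels\<close>

lemma up_fst: "x \<in> fst p \<Longrightarrow> le_P p q \<Longrightarrow> x \<in> fst q"
  using le_P_D(3) by blast

lemma up_snd: "bs d \<in> fst p \<and> snd p d < i \<Longrightarrow> le_P p q \<Longrightarrow> bs d \<in> fst q \<and> snd q d < i"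
  using le_P_D(3,4) by (meson le_less_trans subsetD)

abbreviation above where "above p \<equiv> {q \<in> supp. le_P p q}"

lemma threshold:
  assumes p: "p \<in> supp" and h: "\<epsilon> * sum w {q \<in> supp. le_P p q \<and> q \<noteq> p} < h" "h \<le> \<epsilon> * sum w (above p)"
    and up: "\<And>p q. Q p \<Longrightarrow> le_P p q \<Longrightarrow> Q q"
  shows "h \<le> \<epsilon> * sum w {q \<in> P. Q q} \<longleftrightarrow> Q p"
proof -
  note \<sigma> = K_D[OF realization_D(2)[OF w]]
  have "h / \<epsilon> \<le> sum w {q \<in> supp. Q q} \<longleftrightarrow> Q p"
    by (rule upsum_threshold[where le = le_P])
      (use \<sigma>(2,4) supp_pos p up h eps_pos in \<open>auto simp: field_simps\<close>)
  then show ?thesis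
    unfolding realization_D(3)[OF w] using eps_pos by (simp add: field_simps)
qed

text \<open>The data at height \<open>h\<close> depends only on comparing \<open>h\<close> with the
  values at marked points, test points and breaks. Each value is the mass of an up-closed condition,
  so by \<open>threshold\<close> the comparison says whether \<open>p\<close> satisfies it.\<close>

lemma Gd_gw:
  assumes p: "p \<in> supp" and h: "\<epsilon> * sum w {q \<in> supp. le_P p q \<and> q \<noteq> p} < h" "h \<le> \<epsilon> * sum w (above p)"
  shows "Gd (gw w) (tw w) h = p"
proof -
  have pP: "p \<in> P" using K_D(1)[OF realization_D(2)[OF w]] p by blast
  note thr = threshold[OF p h]
  have mk: "h \<le> gw w x \<longleftrightarrow> x \<in> fst p" if "x \<in> mk" for x
    unfolding gw_marked[OF that] by (rule thr) (rule up_fst)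
  have mid: "h \<le> gw w (pt d r) \<longleftrightarrow> pt d r \<in> fst p" if "d \<in> ports" for d
    unfolding gw_mid_port[OF that] by (rule thr) (rule up_fst)
  have brk: "h \<le> gw w (pt d (tw w d m)) \<longleftrightarrow> bs d \<in> fst p \<and> snd p d < int m"
    if "d \<in> ports" "1 \<le> m" "m \<le> Dmax" for d m
    unfolding gw_break[OF that] by (rule thr) (rule up_snd)
  note S = Sh_props[OF nform_gw, where h = h]
  have "Sh (gw w) h = fst p"
    by (rule cellular_eqI[OF S(1) P_snd(1)[OF pP]]) (use S(2,3) mk mid in auto)
  moreover have "(if d \<in> ports \<and> h \<le> gw w (bs d) \<and> gw w (pt d r) < h
     then int (card {m\<in>{1..Dmax}. gw w (pt d (tw w d m)) < h}) else 0) = snd p d" for d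
  proof (cases "d \<in> ports \<and> h \<le> gw w (bs d) \<and> gw w (pt d r) < h")
    case True
    then have d: "d \<in> ports" "bs d \<in> fst p" using mk[OF ports_mk] by auto
    have "gw w (pt d (tw w d m)) < h \<longleftrightarrow> int m \<le> snd p d" if "m \<in> {1..Dmax}" for m
      using brk[OF d(1), of m] d(2) that by auto
    then have "{m\<in>{1..Dmax}. gw w (pt d (tw w d m)) < h} = {1..nat (snd p d)}"
      using P_snd(3)[OF pP, of d] by auto
    then show ?thesis using True P_snd(2)[OF pP, of d] by simp
  next
    case False
    then have "\<not> 0 < snd p d"
      unfolding P_snd(4)[OF pP] using mk[OF ports_mk, of d] mid[of d] by auto
    then have "snd p d = 0" using P_snd(2)[OF pP, of d] by simp
    then show ?thesis by (simp only: if_not_P[OF False])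
  qed
  ultimately show ?thesis unfolding Gd_def by (intro prod_eqI) (auto simp: fun_eq_iff)
qed

lemma threshold_interval:
  assumes "0 < h" "h \<le> \<epsilon>"
  obtains p where "p \<in> supp" "\<epsilon> * sum w {q \<in> supp. le_P p q \<and> q \<noteq> p} < h" "h \<le> \<epsilon> * sum w (above p)"
proof -
  note \<sigma> = K_D[OF realization_D(2)[OF w]]
  have sum1: "sum w supp = 1" using w by (simp add: realization_def)
  have h: "0 < h / \<epsilon>" "h / \<epsilon> \<le> 1" using assms eps_pos by auto
  obtain p where "p \<in> supp" "sum w {q \<in> supp. le_P p q \<and> q \<noteq> p} < h / \<epsilon>" "h / \<epsilon> \<le> sum w {q \<in> supp. le_P p q}"
    by (rule upsum_chain[where le = le_P, OF \<sigma>(2) sum1 \<sigma>(4) le_P_trans le_P_antisym h])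
  then show thesis using that[of p] eps_pos by (simp add: field_simps)
qed

lemma above_split: "p \<in> supp \<Longrightarrow> sum w (above p) = w p + sum w {q \<in> supp. le_P p q \<and> q \<noteq> p}"
proof -
  note \<sigma> = K_D[OF realization_D(2)[OF w]]
  assume p: "p \<in> supp"
  then have "le_P p p" using \<sigma>(1) le_P_refl by blast
  then have "above p = insert p {q \<in> supp. le_P p q \<and> q \<noteq> p}" using p by blast
  moreover have 1: "p \<notin> {q \<in> supp. le_P p q \<and> q \<noteq> p}" by simp
  moreover have 2: "finite {q \<in> supp. le_P p q \<and> q \<noteq> p}" using \<sigma>(2) by simp
  ultimately show ?thesis using sum.insert[OF 2 1, of w] by (simp only:)
qed

lemma above_bounds:
  assumes "p \<in> supp"
  shows "0 \<le> sum w {q \<in> supp. le_P p q \<and> q \<noteq> p}" "sum w (above p) \<le> 1"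
proof -
  note \<sigma> = K_D[OF realization_D(2)[OF w]]
  show "0 \<le> sum w {q \<in> supp. le_P p q \<and> q \<noteq> p}" using realization_D(1)[OF w] by (intro sum_nonneg)
  have "sum w (above p) \<le> sum w supp" using \<sigma>(2) realization_D(1)[OF w] by (intro sum_mono2) auto
  then show "sum w (above p) \<le> 1" using w by (simp add: realization_def)
qed

text \<open>The levels with data \<open>p\<close> are the piece of the interval from 0 to
  \<open>\<epsilon>\<close> that \<open>p\<close> occupies in the chain. So the weights can be read
  off from the function, which gives injectivity.\<close>

lemma weight_measure:
  "measure lebesgue {h. 0 < h \<and> h \<le> \<epsilon> \<and> Gd (gw w) (tw w) h = p} = \<epsilon> * w p"
proof (cases "p \<in> supp")
  case True
  let ?a = "\<epsilon> * sum w {q \<in> supp. le_P p q \<and> q \<noteq> p}" and ?b = "\<epsilon> * sum w (above p)"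
  have "?b \<le> \<epsilon> * 1" using above_bounds(2)[OF True] eps_pos by (intro mult_left_mono) auto
  moreover have "?b - ?a = \<epsilon> * w p" unfolding above_split[OF True] by (simp add: distrib_left)
  moreover have "0 \<le> ?a" using above_bounds(1)[OF True] eps_pos by (intro mult_nonneg_nonneg) auto
  ultimately have ab: "0 \<le> ?a" "?b \<le> \<epsilon>" "?b - ?a = \<epsilon> * w p" by (simp_all only: mult_1_right)
  have "{h. 0 < h \<and> h \<le> \<epsilon> \<and> Gd (gw w) (tw w) h = p} = {?a<..?b}"
  proof (intro equalityI subsetI)
    fix h assume "h \<in> {h. 0 < h \<and> h \<le> \<epsilon> \<and> Gd (gw w) (tw w) h = p}"
    then have h: "0 < h" "h \<le> \<epsilon>" "Gd (gw w) (tw w) h = p" by auto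
    obtain q where q: "q \<in> supp" "\<epsilon> * sum w {q' \<in> supp. le_P q q' \<and> q' \<noteq> q} < h" "h \<le> \<epsilon> * sum w (above q)"
      using threshold_interval[OF h(1,2)] by blast
    have "q = p" using Gd_gw[OF q] h(3) by simp
    with q show "h \<in> {?a<..?b}" by simp
  qed (use Gd_gw[OF True] ab in auto)
  moreover have "0 < \<epsilon> * w p" using supp_pos[OF True] eps_pos by (rule mult_pos_pos[rotated])
  then have "?a \<le> ?b" using ab(3) by linarith
  ultimately show ?thesis using ab by simp
next
  case False
  have "{h. 0 < h \<and> h \<le> \<epsilon> \<and> Gd (gw w) (tw w) h = p} = {}"
  proof (rule ccontr)
    assume "{h. 0 < h \<and> h \<le> \<epsilon> \<and> Gd (gw w) (tw w) h = p} \<noteq> {}"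
    then obtain h where h: "0 < h" "h \<le> \<epsilon>" "Gd (gw w) (tw w) h = p" by auto
    obtain q where q: "q \<in> supp" "\<epsilon> * sum w {q' \<in> supp. le_P q q' \<and> q' \<noteq> q} < h" "h \<le> \<epsilon> * sum w (above q)"
      using threshold_interval[OF h(1,2)] by blast
    show False using Gd_gw[OF q] h(3) q(1) False by simp
  qed
  then show ?thesis using False by (simp only: measure_empty) simp
qed

lemma gw_bounds:
  assumes x: "x \<in> pts"
  shows "0 \<le> gw w x" "gw w x \<le> \<epsilon>"
proof -
  have "0 \<le> sum w {p \<in> P. x \<in> fst p}" using realization_D(1)[OF w] by (intro sum_nonneg)
  moreover have "0 \<le> (\<Sum>d\<in>ports. \<Sum>m=1..Dmax. max 0 (tw w d m - adist d x))"
    by (intro sum_nonneg) simp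
  ultimately show "0 \<le> gw w x" unfolding gw_def using eps_pos by (intro add_nonneg_nonneg mult_nonneg_nonneg) auto
  obtain u where u: "u \<in> mk" "gw w x \<le> gw w u" using nf_le_marked[OF nform_gw x] by blast
  have "sum w {p \<in> P. u \<in> fst p} \<le> sum w P" using finite_P realization_D(1)[OF w] by (intro sum_mono2) auto
  then have "\<epsilon> * sum w {p \<in> P. u \<in> fst p} \<le> \<epsilon> * 1"
    using realization_D(4)[OF w] eps_pos by (intro mult_left_mono) auto
  then show "gw w x \<le> \<epsilon>" using u gw_marked[OF u(1)] by simp
qed

lemma cellular_nonempty_marked:
  assumes S: "cellular S" "S \<noteq> {}"
  obtains u where "u \<in> mk" "u \<in> S"
proof -
  obtain x where x: "x \<in> S" using S(2) by blast
  show thesis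
  proof (cases "x \<in> mk")
    case False
    then obtain s where s: "s \<in> segs" "x \<in> seg s" using unmarked_inside x cellular_pts[OF S(1)] by blast
    obtain d where d: "d \<in> ports" "pt d r \<in> seg s" using seg_port[OF s(1)] by blast
    have "pt d r \<in> S" using cellular_inside[OF S(1) s(1) s(2) d(2)] x by blast
    then show thesis using that cell_port_base[OF S(1) d(1)] ports_mk[OF d(1)] by blast
  qed (use that x in blast)
qed

text \<open>The value \<open>\<epsilon>\<close> occurs at a marked point of the least element, which
  all the others contain. Outside the greatest element, which is proper, lies a marked point or a
  test point; no element contains it, so its value is 0.\<close>

lemma gw_attains:
  obtains x y where "x \<in> pts" "gw w x = \<epsilon>" "y \<in> pts" "gw w y = 0"
proof -
  note \<sigma> = K_D[OF realization_D(2)[OF w]]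
  have "\<exists>p\<in>supp. \<forall>q\<in>supp. le_P p q"
    by (rule finite_chain_least[OF \<sigma>(2,3)]) (use \<sigma>(4) le_P_trans in blast)+
  then obtain p where p: "p \<in> supp" "\<And>q. q \<in> supp \<Longrightarrow> le_P p q" by blast
  have pP: "p \<in> P" using \<sigma>(1) p by blast
  obtain u where u: "u \<in> mk" "u \<in> fst p"
    using cellular_nonempty_marked[OF P_snd(1)[OF pP]] P_nonempty_proper[of "fst p" "snd p"] pP by auto
  have "{q \<in> supp. u \<in> fst q} = supp" using p(2) u(2) le_P_D(3) by blast
  then have "sum w {q \<in> P. u \<in> fst q} = sum w P"
    using realization_D(3)[OF w, of "\<lambda>q. u \<in> fst q"] realization_D(3)[OF w, of "\<lambda>_. True"] by simp
  then have x: "u \<in> pts" "gw w u = \<epsilon>" using gw_marked[OF u(1)] realization_D(4)[OF w] u(1) mk_pts by auto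
  have "\<exists>p\<in>supp. \<forall>q\<in>supp. le_P q p"
    by (rule finite_chain_least[OF \<sigma>(2,3)]) (use \<sigma>(4) le_P_trans in blast)+
  then obtain p' where p': "p' \<in> supp" "\<And>q. q \<in> supp \<Longrightarrow> le_P q p'" by blast
  have pP': "p' \<in> P" using \<sigma>(1) p' by blast
  have no: "sum w {q \<in> P. y \<in> fst q} = 0" if "y \<notin> fst p'" for y
  proof -
    have "{q \<in> supp. y \<in> fst q} = {}" using p'(2) le_P_D(3) that by blast
    then show ?thesis unfolding realization_D(3)[OF w, of "\<lambda>q. y \<in> fst q"] by (simp only: sum.empty)
  qed
  have "\<exists>y\<in>pts. gw w y = 0"
  proof (cases "mk \<subseteq> fst p'")
    case False
    then obtain y where y: "y \<in> mk" "y \<notin> fst p'" by blast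
    have "gw w y = 0" unfolding gw_marked[OF y(1)] no[OF y(2)] by simp
    then show ?thesis using mk_pts y(1) by blast
  next
    case True
    have "\<exists>d\<in>ports. pt d r \<notin> fst p'"
    proof (rule ccontr)
      assume "\<not> ?thesis"
      then have all: "pt d r \<in> fst p'" if "d \<in> ports" for d using that by blast
      have "x \<in> fst p'" if x: "x \<in> pts" for x
      proof (cases "x \<in> mk")
        case False
        then obtain s where s: "s \<in> segs" "x \<in> seg s" using unmarked_inside x by blast
        obtain d where d: "d \<in> ports" "pt d r \<in> seg s" using seg_port[OF s(1)] by blast
        show ?thesis using cellular_inside[OF P_snd(1)[OF pP'] s(1) s(2) d(2)] all[OF d(1)] by blast
      qed (use True in blast)
      then have "fst p' = pts" using cellular_pts[OF P_snd(1)[OF pP']] by blast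
      then show False using P_nonempty_proper[of "fst p'" "snd p'"] pP' by simp
    qed
    then obtain d where d: "d \<in> ports" "pt d r \<notin> fst p'" by blast
    have "gw w (pt d r) = 0" unfolding gw_mid_port[OF d(1)] no[OF d(2)] by simp
    then show ?thesis using pt_in_pts[OF ports_dirs[OF d(1)]] by blast
  qed
  then show thesis using that x by blast
qed

end

end

section \<open>The homeomorphism\<close>

context tropical
begin

lemma has_slope_uminus:
  assumes d: "d \<in> dirs" and m: "has_slope \<Gamma> f m d"
  shows "has_slope \<Gamma> (\<lambda>x. - f x) (- m) d"
  using d
proof (cases rule: dirs_cases)
  case fin
  obtain c where "\<forall>\<^sub>F x in at_right 0. f (pt d x) = ereal (c + of_int m * x)"
    using m unfolding has_slope_pt[OF fin] by blast
  then have "\<forall>\<^sub>F x in at_right 0. - f (pt d x) = ereal (- c + of_int (- m) * x)"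
    by eventually_elim simp
  then show ?thesis unfolding has_slope_pt[OF fin] by blast
next
  case (inf e)
  obtain c where "\<forall>\<^sub>F x in at_top. f (ep e (ereal x)) = ereal (c - of_int m * x)"
    using m unfolding inf(1) has_slope_inf by blast
  then have "\<forall>\<^sub>F x in at_top. - f (ep e (ereal x)) = ereal (- c - of_int (- m) * x)"
    by eventually_elim simp
  then show ?thesis unfolding inf(1) has_slope_inf by blast
qed

lemma rational_function_uminus:
  assumes f: "rational_function \<Gamma> f"
  shows "rational_function \<Gamma> (\<lambda>x. - f x)" "div_of \<Gamma> (\<lambda>x. - f x) = (\<lambda>x. - div_of \<Gamma> f x)"
proof -
  have "slope \<Gamma> (\<lambda>x. - f x) d = - slope \<Gamma> f d" if d: "d \<in> dirs" for d
  proof -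
    obtain m where m: "has_slope \<Gamma> f m d" using rational_has_slope[OF f d] by blast
    show ?thesis using slope_eq[OF d m] slope_eq[OF d has_slope_uminus[OF d m]] by simp
  qed
  then show "div_of \<Gamma> (\<lambda>x. - f x) = (\<lambda>x. - div_of \<Gamma> f x)"
    by (auto simp: div_of_def dirs_at_def sum_negf[symmetric] intro!: ext sum.cong)
  show "rational_function \<Gamma> (\<lambda>x. - f x)"
    unfolding rational_function_def
  proof (intro conjI ballI)
    show "continuous_map X euclidean (\<lambda>x. - f x)"
      unfolding continuous_map_from_curve
    proof
      fix e assume "e \<in> E"
      moreover have "continuous_map X euclidean f" using f by (simp add: rational_function_def)
      ultimately have "continuous_on {0..\<l> e} (f \<circ> ep e)"
        by (simp only: continuous_map_from_curve)
      from continuous_on_compose2[OF continuous_uminus_ereal[of UNIV] this subset_UNIV]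
      show "continuous_on {0..\<l> e} ((\<lambda>x. - f x) \<circ> ep e)" by (simp add: o_def)
    qed
    fix x assume "x \<in> pts - infinite_points \<Gamma>"
    then show "\<bar>- f x\<bar> \<noteq> \<infinity>" using f by (simp add: rational_function_def)
  next
    fix e assume e: "e \<in> E"
    have "\<exists>B. finite B \<and> (\<forall>a b. a < b \<and> {a<..<b} \<subseteq> {0<..<\<l> e} - B \<longrightarrow>
      (\<exists>(m :: int) (c :: real). \<forall>t\<in>{a<..<b}. f (ep e t) = ereal c + ereal (of_int m) * t))"
      using f e by (simp add: rational_function_def)
    then obtain B where B: "finite B" "\<And>a b. a < b \<Longrightarrow> {a<..<b} \<subseteq> {0<..<\<l> e} - B \<Longrightarrow>
      (\<exists>(m :: int) (c :: real). \<forall>t\<in>{a<..<b}. f (ep e t) = ereal c + ereal (of_int m) * t)"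
      by blast
    have "\<exists>(m :: int) (c :: real). \<forall>t\<in>{a<..<b}. - f (ep e t) = ereal c + ereal (of_int m) * t"
      if ab: "a < b" "{a<..<b} \<subseteq> {0<..<\<l> e} - B" for a b
    proof -
      obtain m :: int and c :: real where mc: "\<And>t. t \<in> {a<..<b} \<Longrightarrow> f (ep e t) = ereal c + ereal (of_int m) * t"
        using B(2)[OF ab] by blast
      have "- f (ep e t) = ereal (- c) + ereal (of_int (- m)) * t" if t: "t \<in> {a<..<b}" for t
      proof -
        have "0 < t" "t < \<l> e" using t ab(2) by auto
        then obtain x where "t = ereal x" by (cases t) auto
        then show ?thesis using mc[OF t] by simp
      qed
      then show ?thesis by blast
    qed
    with B(1) show "\<exists>B. finite B \<and> (\<forall>a b. a < b \<and> {a<..<b} \<subseteq> {0<..<\<l> e} - B \<longrightarrow>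
      (\<exists>(m :: int) (c :: real). \<forall>t\<in>{a<..<b}. - f (ep e t) = ereal c + ereal (of_int m) * t))"
      by (intro exI[of _ B]) blast
  qed
qed

lemma osc_uminus: "osc \<Gamma> (\<lambda>x. - f x) = osc \<Gamma> f"
  unfolding osc_def
  by (simp add: ereal_SUP_uminus_eq ereal_INF_uminus_eq minus_ereal_def add.commute)

text \<open>\<open>Metric_space\<close> asks for symmetry at all pairs, not only in the link. Hence
  the negation of arbitrary rational functions, infinite values included.\<close>

lemma div_dist_le_swap: "div_dist \<Gamma> D1 D2 \<le> div_dist \<Gamma> D2 D1"
  unfolding div_dist_def
proof (rule INF_greatest)
  fix g assume "g \<in> {g. rational_function \<Gamma> g \<and> add_div \<Gamma> D2 g = D1}"
  then have g: "rational_function \<Gamma> g" "D1 = add_div \<Gamma> D2 g" by auto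
  have "add_div \<Gamma> D1 (\<lambda>x. - g x) = D2"
    unfolding g(2) add_div_def rational_function_uminus(2)[OF g(1)] by simp
  then have "(\<lambda>x. - g x) \<in> {g. rational_function \<Gamma> g \<and> add_div \<Gamma> D1 g = D2}"
    using rational_function_uminus(1)[OF g(1)] by simp
  then have "(INF g\<in>{g. rational_function \<Gamma> g \<and> add_div \<Gamma> D1 g = D2}. osc \<Gamma> g) \<le> osc \<Gamma> (\<lambda>x. - g x)"
    by (rule INF_lower)
  then show "(INF g\<in>{g. rational_function \<Gamma> g \<and> add_div \<Gamma> D1 g = D2}. osc \<Gamma> g) \<le> osc \<Gamma> g"
    by (simp add: osc_uminus)
qed

lemma div_dist_commute: "div_dist \<Gamma> D1 D2 = div_dist \<Gamma> D2 D1"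
  by (rule antisym) (rule div_dist_le_swap)+

lemma osc_nonneg: "0 \<le> osc \<Gamma> f"
proof -
  obtain x where x: "x \<in> pts" using pts_ne by blast
  have "(INF x\<in>pts. f x) \<le> f x" "f x \<le> (SUP x\<in>pts. f x)" using x by (auto intro: INF_lower SUP_upper)
  then have "(INF x\<in>pts. f x) \<le> (SUP x\<in>pts. f x)" by (rule order_trans)
  then show ?thesis
    unfolding osc_def by (cases "INF x\<in>pts. f x"; cases "SUP x\<in>pts. f x") auto
qed

lemma div_dist_nonneg: "0 \<le> div_dist \<Gamma> D1 D2"
  unfolding div_dist_def by (rule INF_greatest) (rule osc_nonneg)

lemma osc_finite:
  assumes "osc \<Gamma> f < \<infinity>" "x \<in> pts"
  shows "\<bar>f x\<bar> \<noteq> \<infinity>"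
proof -
  have le: "(INF x\<in>pts. f x) \<le> f x" "f x \<le> (SUP x\<in>pts. f x)" using assms(2) by (auto intro: INF_lower SUP_upper)
  then show ?thesis
    using assms(1) unfolding osc_def by (cases "INF x\<in>pts. f x"; cases "SUP x\<in>pts. f x"; cases "f x") auto
qed

definition rosc :: "(('v, 'e) point \<Rightarrow> real) \<Rightarrow> real" where
  "rosc g = real_of_ereal (osc \<Gamma> (\<lambda>x. ereal (g x)))"

lemma rosc:
  assumes "pl g"
  shows "osc \<Gamma> (\<lambda>x. ereal (g x)) = ereal (rosc g)" "x \<in> pts \<Longrightarrow> y \<in> pts \<Longrightarrow> g x - g y \<le> rosc g"
    "(\<And>x y. x \<in> pts \<Longrightarrow> y \<in> pts \<Longrightarrow> g x - g y \<le> c) \<Longrightarrow> rosc g \<le> c"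
proof -
  obtain a b where ab: "a \<in> pts" "b \<in> pts" "\<And>z. z \<in> pts \<Longrightarrow> g b \<le> g z \<and> g z \<le> g a"
    using pl_attains[OF assms] by blast
  have *: "osc \<Gamma> (\<lambda>x. ereal (g x)) = ereal (g a - g b)" by (rule osc_pl[OF assms ab])
  then show "osc \<Gamma> (\<lambda>x. ereal (g x)) = ereal (rosc g)" by (simp add: rosc_def)
  have r: "rosc g = g a - g b" using * by (simp add: rosc_def)
  show "x \<in> pts \<Longrightarrow> y \<in> pts \<Longrightarrow> g x - g y \<le> rosc g"
    using ab(3)[of x] ab(3)[of y] r by simp
  show "(\<And>x y. x \<in> pts \<Longrightarrow> y \<in> pts \<Longrightarrow> g x - g y \<le> c) \<Longrightarrow> rosc g \<le> c"
    unfolding r using ab(1,2) by blast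
qed

text \<open>For arbitrary \<open>S\<close> the result of \<open>exit_dir\<close> need not lie in
  \<open>directions\<close>, so \<open>slope_cong\<close> does not apply; but it stays on the edge
  of \<open>d\<close>, and agreement along that edge suffices.\<close>

lemma slope_exit_cong:
  assumes "d \<in> dirs" "\<And>x. x \<in> pts \<Longrightarrow> f x = f' x"
  shows "slope \<Gamma> f (exit_dir \<Gamma> S d) = slope \<Gamma> f' (exit_dir \<Gamma> S d)"
proof -
  have "has_slope \<Gamma> f m (exit_dir \<Gamma> S d) = has_slope \<Gamma> f' m (exit_dir \<Gamma> S d)" for m
    using assms by (cases d) (auto simp: directions_def ep_in_pts)
  then show ?thesis by (simp add: slope_def)
qed

end

context tropical_divisor
begin

definition FD :: "(('v, 'e) point \<Rightarrow> ereal) \<Rightarrow> ereal \<Rightarrow> ('v, 'e) point set \<times> ('e direction \<Rightarrow> int)" where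
  "FD f h = (let S = superlevel \<Gamma> f h; S' = compactified \<Gamma> D S in
     (S', \<lambda>d. if d \<in> outgoing \<Gamma> S' then - slope \<Gamma> f (exit_dir \<Gamma> S d) else 0))"

lemma FD_cong:
  assumes "\<And>x. x \<in> pts \<Longrightarrow> f x = f' x"
  shows "FD f h = FD f' h"
proof -
  have "superlevel \<Gamma> f h = superlevel \<Gamma> f' h" using assms by (auto simp: superlevel_def)
  then show ?thesis
    using slope_exit_cong[OF _ assms] by (auto simp: FD_def Let_def outgoing_def fun_eq_iff)
qed

lemma fine_data_cong:
  assumes "\<And>x. x \<in> pts \<Longrightarrow> f x = f' x"
  shows "fine_data \<Gamma> D f = fine_data \<Gamma> D f'"
proof -
  have ns: "nonsmooth_points \<Gamma> f = nonsmooth_points \<Gamma> f'"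
    using div_of_cong[OF assms] by (simp add: nonsmooth_points_def)
  have "f x = f' x" if "x \<in> mk \<union> nonsmooth_points \<Gamma> f'" for x
    using that assms mk_pts by (auto simp: nonsmooth_points_def)
  then have "f ` (mk \<union> nonsmooth_points \<Gamma> f') = f' ` (mk \<union> nonsmooth_points \<Gamma> f')"
    by (rule image_cong[OF refl])
  then have "levels \<Gamma> D f = levels \<Gamma> D f'"
    unfolding levels_def ns by (simp only:)
  moreover have "fine_data \<Gamma> D f = map (FD f) (levels \<Gamma> D f)" for f
    by (simp add: fine_data_def FD_def)
  moreover have "FD f = FD f'" using FD_cong[OF assms] by auto
  ultimately show ?thesis by simp
qed

end

context small_link
begin

text \<open>\<open>FD\<close> does not mention \<open>\<tau>\<close>, so the data
  \<open>Gd g \<tau>\<close> depends on \<open>g\<close> alone.\<close>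

lemma FD_Gd: "nform g \<tau> \<Longrightarrow> FD (\<lambda>x. ereal (g x)) (ereal h) = Gd g \<tau> h"
  unfolding FD_def Let_def Gd_def using nf_outgoing nf_exit_slope by (auto simp: fun_eq_iff)

section \<open>Bijectivity between weighted chains and divisors in the link\<close>

lemma gw_inj:
  assumes w: "w \<in> realization K" and w': "w' \<in> realization K" and eq: "\<And>x. x \<in> pts \<Longrightarrow> gw w x = gw w' x"
  shows "w = w'"
proof
  fix p
  have "Gd (gw w) (tw w) h = Gd (gw w') (tw w') h" for h
    using FD_Gd[OF nform_gw[OF w], of h] FD_Gd[OF nform_gw[OF w'], of h]
      FD_cong[of "\<lambda>x. ereal (gw w x)" "\<lambda>x. ereal (gw w' x)"] eq by simp
  \<comment> \<open>Both weights are lengths of the same fibre, which the values of the function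
    determine.\<close>
  then have "\<epsilon> * w p = \<epsilon> * w' p"
    unfolding weight_measure[OF w, of p, symmetric] weight_measure[OF w', of p, symmetric] by (simp only:)
  then show "w p = w' p" using eps_pos by simp
qed

text \<open>With fibre lengths as weights, \<open>cake\<close> reproduces the values of
  \<open>g\<close> at marked points, test points and breaks. The values at the breaks give the
  distances by \<open>nf_T\<close>, and a normal form is determined by all of these.\<close>

lemma gw_surj:
  assumes nf: "nform g \<tau>" and bounds: "\<And>x. x \<in> pts \<Longrightarrow> 0 \<le> g x \<and> g x \<le> \<epsilon>"
    and top: "x1 \<in> pts" "g x1 = \<epsilon>" and bot: "x0 \<in> pts" "g x0 = 0"
  obtains w where "w \<in> realization K" "\<And>x. x \<in> pts \<Longrightarrow> gw w x = g x"
proof -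
  let ?G = "Gd g \<tau>"
  let ?A = "\<lambda>p. {h. 0 < h \<and> h \<le> \<epsilon> \<and> ?G h = p}"
  define w where "w p = measure lebesgue (?A p) / \<epsilon>" for p
  obtain u where u: "u \<in> mk" "\<epsilon> \<le> g u" using nf_le_marked[OF nf top(1)] top(2) by auto
  have GP: "?G h \<in> P" if "0 < h" "h \<le> \<epsilon>" for h
    by (rule Gd_P[OF nf u(1) _ bot(1)]) (use that u bot in auto)
  have mono: "le_P (?G h') (?G h)" if "0 < h" "h \<le> h'" "h' \<le> \<epsilon>" for h h'
    by (rule Gd_le[OF nf]) (use GP that in auto)
  \<comment> \<open>The data decreases in the poset as the level rises; two levels with the same
    data enclose only levels with that data, by antisymmetry.\<close>
  have conv: "convex (?A p)" for p
    unfolding convex_contains_segment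
  proof (intro ballI subsetI)
    fix a b h assume ab: "a \<in> ?A p" "b \<in> ?A p" and h: "h \<in> closed_segment a b"
    define l u where "l = min a b" and "u = max a b"
    have lu: "l \<in> ?A p" "u \<in> ?A p" "l \<le> h" "h \<le> u"
      using ab h by (auto simp: l_def u_def min_def max_def closed_segment_eq_real_ivl split: if_splits)
    then have "le_P p (?G h)" "le_P (?G h) p" using mono[of h u] mono[of l h] by auto
    then have "?G h = p" by (rule le_P_antisym[rotated])
    then show "h \<in> ?A p" using lu by auto
  qed
  \<comment> \<open>A condition that the data satisfies exactly at the levels up to \<open>v\<close>
    has mass \<open>v / \<epsilon>\<close>.\<close>
  have cake: "\<epsilon> * sum w {p \<in> P. Q p} = v"
    if "\<And>h. 0 < h \<Longrightarrow> h \<le> \<epsilon> \<Longrightarrow> Q (?G h) \<longleftrightarrow> h \<le> v" "0 \<le> v" "v \<le> \<epsilon>" for Q v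
  proof -
    have "(\<Sum>p\<in>{p \<in> P. Q p}. measure lebesgue (?A p)) = v"
      by (rule layer_cake_sum[OF finite_P conv GP that])
    then show ?thesis using eps_pos by (simp add: w_def sum_divide_distrib[symmetric])
  qed
  have nn: "0 \<le> w p" for p using eps_pos by (simp add: w_def)
  have range: "\<exists>h. 0 < h \<and> h \<le> \<epsilon> \<and> ?G h = p" if "w p \<noteq> 0" for p
  proof (rule ccontr)
    assume "\<not> ?thesis"
    then have "?A p = {}" by blast
    then have "w p = 0" unfolding w_def by (simp only: measure_empty)
    with that show False by simp
  qed
  have sub: "{p. w p \<noteq> 0} \<subseteq> P" using range GP by blast
  have "\<epsilon> * sum w {p \<in> P. True} = \<epsilon>" by (rule cake) (use eps_pos in auto)
  then have sum1: "sum w P = 1" using eps_pos by simp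
  moreover have "sum w P = sum w {p. w p \<noteq> 0}" using sub finite_P by (intro sum.mono_neutral_right) auto
  ultimately have sum1': "sum w {p. w p \<noteq> 0} = 1" by simp
  have "{p. w p \<noteq> 0} \<in> K"
  proof (rule K_I[OF sub])
    show "{p. w p \<noteq> 0} \<noteq> {}" using sum1' by (metis sum.empty zero_neq_one)
    fix p q assume "p \<in> {p. w p \<noteq> 0}" "q \<in> {p. w p \<noteq> 0}"
    then obtain h h' where "0 < h" "h \<le> \<epsilon>" "?G h = p" "0 < h'" "h' \<le> \<epsilon>" "?G h' = q" using range by blast
    then show "le_P p q \<or> le_P q p" using mono[of h h'] mono[of h' h] by (cases "h \<le> h'") auto
  qed
  with nn sum1' have w: "w \<in> realization K" by (simp add: realization_def)
  note nw = nform_gw[OF w]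
  have G: "fst (?G h) = Sh g h" for h by (simp add: Gd_def)
  note S = Sh_props[OF nf]
  have mk: "gw w x = g x" if x: "x \<in> mk" for x
  proof -
    have "\<epsilon> * sum w {p \<in> P. x \<in> fst p} = g x"
      by (rule cake) (use S(2)[OF x] bounds[of x] mk_pts x G in auto)
    then show ?thesis using gw_marked[OF w x] by simp
  qed
  have mid_eq: "gw w (pt d r) = g (pt d r)" if d: "d \<in> ports" for d
  proof -
    have "\<epsilon> * sum w {p \<in> P. pt d r \<in> fst p} = g (pt d r)"
      by (rule cake) (use S(3)[OF d] bounds[of "pt d r"] pt_in_pts[OF ports_dirs[OF d]] G in auto)
    then show ?thesis using gw_mid_port[OF w d] by simp
  qed
  have brk: "gw w (pt d (tw w d m)) = g (pt d (\<tau> d m))" if d: "d \<in> ports" and m: "1 \<le> m" "m \<le> Dmax" for d m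
  proof -
    have tr: "0 \<le> \<tau> d m" "\<tau> d m < r" using nform_D(1)[OF nf d] nform_tau_r[OF nf d] by auto
    have le: "g (pt d (\<tau> d m)) \<le> g (bs d)" "g (pt d r) \<le> g (pt d (\<tau> d m))"
      using nf_antimono[OF nf d, of 0 "\<tau> d m"] nf_antimono[OF nf d, of "\<tau> d m" r] tr pt_0[OF ports_fdirs[OF d]] by auto
    have "\<epsilon> * sum w {p \<in> P. bs d \<in> fst p \<and> snd p d < int m} = g (pt d (\<tau> d m))"
    proof (rule cake)
      fix h
      \<comment> \<open>Larger indices belong to nearer breaks and hence to higher values. So fewer
        than \<open>m\<close> breaks lie below \<open>h\<close> iff the \<open>m\<close>-th one does
        not.\<close>
      have inc: "g (pt d (\<tau> d i)) \<le> g (pt d (\<tau> d j))" if "i \<le> j" for i j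
        using nf_antimono[OF nf d, of "\<tau> d j" "\<tau> d i"] nform_D(1,3)[OF nf d] nform_tau_r[OF nf d, of i] that by auto
      have bsS: "bs d \<in> fst (?G h) \<longleftrightarrow> h \<le> g (bs d)" using S(2)[OF ports_mk[OF d]] G by simp
      show "bs d \<in> fst (?G h) \<and> snd (?G h) d < int m \<longleftrightarrow> h \<le> g (pt d (\<tau> d m))"
      proof (cases "h \<le> g (bs d) \<and> g (pt d r) < h")
        case True
        let ?C = "{j\<in>{1..Dmax}. g (pt d (\<tau> d j)) < h}"
        have c: "snd (?G h) d = int (card ?C)" using True d by (simp add: Gd_def)
        show ?thesis
        proof (cases "h \<le> g (pt d (\<tau> d m))")
          case le: True
          have "?C \<subseteq> {1..m - 1}"
          proof
            fix j assume j: "j \<in> ?C"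
            then have "\<not> m \<le> j" using inc[of m j] le by auto
            with j show "j \<in> {1..m - 1}" by auto
          qed
          then have "card ?C \<le> m - 1" using card_mono[of "{1..m - 1}" ?C] by simp
          then have "card ?C < m" using m by linarith
          then show ?thesis unfolding bsS c using True le by simp
        next
          case gt: False
          have "{1..m} \<subseteq> ?C"
          proof
            fix j assume j: "j \<in> {1..m}"
            then show "j \<in> ?C" using inc[of j m] gt m by auto
          qed
          then have "m \<le> card ?C" using card_mono[of ?C "{1..m}"] by simp
          then show ?thesis unfolding bsS c using True gt by simp
        qed
      next
        case False
        then have "snd (?G h) d = 0" by (auto simp: Gd_def)
        then show ?thesis unfolding bsS using False le m by auto
      qed
    qed (use bounds[OF pt_in_pts[OF ports_dirs[OF d]]] in auto)
    then show ?thesis using gw_break[OF w d m] by simp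
  qed
  have tau: "tw w d m = \<tau> d m" if d: "d \<in> ports" and m: "1 \<le> m" "m \<le> Dmax" for d m
  proof (rule triangular_unique[where t = "tw w d" and t' = "\<tau> d" and M = Dmax and m = m, OF _ m])
    fix m assume m: "1 \<le> m" "m \<le> Dmax"
    show "real m * tw w d m + sum (tw w d) {m<..Dmax} = real m * \<tau> d m + sum (\<tau> d) {m<..Dmax}"
      using nf_T[OF nw d m] nf_T[OF nf d m] brk[OF d m] mk[OF ports_mk[OF d]] by simp
  qed
  have "gw w x = g x" if "x \<in> pts" for x
    using that
  proof (cases rule: point_cases)
    case (arm d t)
    have "(\<Sum>m=1..Dmax. min t (tw w d m)) = (\<Sum>m=1..Dmax. min t (\<tau> d m))"
      by (rule sum.cong) (use tau[OF arm(1)] in auto)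
    then show ?thesis
      using nform_D(4)[OF nw arm(1), of t] nform_D(4)[OF nf arm(1), of t] mk[OF ports_mk[OF arm(1)]] arm by simp
  next
    case (mid e \<alpha> b t)
    have d: "Fwd e (ereal \<alpha>) \<in> ports" by (rule segs_ports(1)[OF mid(1)])
    show ?thesis
      using nf_seg_ends(1)[OF nw mid(1)] nf_seg_ends(1)[OF nf mid(1)] nf_seg_ends(4)[OF nw mid(1), of "ereal t"]
        nf_seg_ends(4)[OF nf mid(1), of "ereal t"] mid_eq[OF d] mid by simp
  qed (rule mk)
  with w show thesis by (rule that)
qed

definition \<phi> :: "(('v, 'e) point set \<times> ('e direction \<Rightarrow> int) \<Rightarrow> real) \<Rightarrow> ('v, 'e) divisor" where
  "\<phi> w = add_div \<Gamma> D (\<lambda>x. ereal (gw w x))"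

lemma gw_pl: "w \<in> realization K \<Longrightarrow> pl (gw w)"
  by (rule nf_pl[OF nform_gw])

lemma phi_eq_imp:
  assumes w: "w \<in> realization K" and f: "rational_function \<Gamma> f" and eq: "add_div \<Gamma> D f = \<phi> w"
  obtains c where "\<And>x. x \<in> pts \<Longrightarrow> f x = ereal (gw w x + c)"
proof -
  have "div_of \<Gamma> f = dv (gw w)" using eq by (auto simp: \<phi>_def add_div_def fun_eq_iff)
  then show thesis using rational_same_div[OF f gw_pl[OF w]] that by blast
qed

text \<open>Equal divisors leave an additive constant open; it is 0 because both functions have
  minimum 0.\<close>

lemma phi_inj:
  assumes w: "w \<in> realization K" and w': "w' \<in> realization K" and eq: "\<phi> w = \<phi> w'"
  shows "w = w'"
proof -
  obtain c where "\<And>x. x \<in> pts \<Longrightarrow> ereal (gw w x) = ereal (gw w' x + c)"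
    using phi_eq_imp[OF w' nf_rational[OF nform_gw[OF w]]] eq by (auto simp: \<phi>_def)
  then have c: "gw w x = gw w' x + c" if "x \<in> pts" for x using that by simp
  obtain y where y: "y \<in> pts" "gw w y = 0" using gw_attains[OF w] by blast
  obtain y' where y': "y' \<in> pts" "gw w' y' = 0" using gw_attains[OF w'] by blast
  have "c = 0" using c[OF y(1)] c[OF y'(1)] y y' gw_bounds(1)[OF w y'(1)] gw_bounds(1)[OF w' y(1)] by linarith
  then show ?thesis using gw_inj[OF w w'] c by simp
qed

lemma phi_link:
  assumes w: "w \<in> realization K"
  shows "\<phi> w \<in> link \<Gamma> D \<epsilon>"
proof -
  note nf = nform_gw[OF w]
  obtain x y where xy: "x \<in> pts" "gw w x = \<epsilon>" "y \<in> pts" "gw w y = 0" using gw_attains[OF w] by blast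
  have "div_dist \<Gamma> D (\<phi> w) = osc \<Gamma> (\<lambda>x. ereal (gw w x))"
    by (rule div_dist_pl[OF gw_pl[OF w] nf_rational[OF nf] \<phi>_def])
  also have "\<dots> = ereal (gw w x - gw w y)"
    by (rule osc_pl[OF gw_pl[OF w] xy(1,3)]) (use gw_bounds[OF w] xy in auto)
  finally have "div_dist \<Gamma> D (\<phi> w) = ereal \<epsilon>" using xy by simp
  moreover have "\<phi> w \<in> linear_system \<Gamma> D"
    using nf_R_space[OF nf] by (auto simp: linear_system_def \<phi>_def)
  ultimately show ?thesis by (simp add: link_def)
qed

lemma link_phi:
  assumes D': "D' \<in> link \<Gamma> D \<epsilon>"
  obtains w where "w \<in> realization K" "D' = \<phi> w"
proof -
  have lin: "D' \<in> linear_system \<Gamma> D" and dist: "div_dist \<Gamma> D D' = ereal \<epsilon>" using D' by (auto simp: link_def)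
  have eff: "0 \<le> D' x" for x
    using lin by (auto simp: linear_system_def R_space_def effective_def)
  \<comment> \<open>A finite distance provides a function of finite oscillation; it has no infinite
    values and can be treated as real-valued.\<close>
  have "(INF g \<in> {g. rational_function \<Gamma> g \<and> add_div \<Gamma> D g = D'}. osc \<Gamma> g) < \<infinity>"
    using dist by (simp add: div_dist_def)
  then obtain f where f: "rational_function \<Gamma> f" "add_div \<Gamma> D f = D'" "osc \<Gamma> f < \<infinity>"
    unfolding INF_less_iff by blast
  define g where "g x = real_of_ereal (f x)" for x
  have fin: "\<bar>f x\<bar> \<noteq> \<infinity>" if "x \<in> pts" for x by (rule osc_finite[OF f(3) that])
  have pl: "pl g" unfolding g_def by (rule pl_of_rational[OF f(1) fin])
  have fg: "f x = ereal (g x)" if "x \<in> pts" for x using fin[OF that] by (simp add: g_def ereal_real)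
  have rat: "rational_function \<Gamma> (\<lambda>x. ereal (g x))" by (rule rational_function_cong[OF f(1) fg])
  have dvg: "D' = add_div \<Gamma> D (\<lambda>x. ereal (g x))" using f(2) div_of_cong[OF fg] by (simp add: add_div_def)
  obtain x1 x0 where x: "x1 \<in> pts" "x0 \<in> pts" "\<And>z. z \<in> pts \<Longrightarrow> g x0 \<le> g z \<and> g z \<le> g x1"
    using pl_attains[OF pl] by blast
  have "ereal \<epsilon> = ereal (g x1 - g x0)"
    using dist div_dist_pl[OF pl rat dvg] osc_pl[OF pl x] by simp
  then have eps: "g x1 - g x0 = \<epsilon>" by simp
  \<comment> \<open>Normalised to minimum 0, like the functions \<open>gw w\<close>.\<close>
  define g1 where "g1 x = g x + (- g x0)" for x
  have pl1: "pl g1" unfolding g1_def by (rule pl_add_const[OF pl])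
  have dv1: "dv g1 = dv g" unfolding g1_def by (rule dv_add_const[OF pl])
  have "0 \<le> D x + dv g1 x" for x using eff[of x] dvg dv1 by (simp add: add_div_def)
  moreover have "g1 y - g1 z \<le> \<epsilon>" if "y \<in> pts" "z \<in> pts" for y z
    using x(3)[OF that(1)] x(3)[OF that(2)] eps by (simp add: g1_def)
  ultimately have nf: "nform g1 (breakpoint g1)" by (rule nform_breakpoint[OF pl1])
  have bounds: "0 \<le> g1 y \<and> g1 y \<le> \<epsilon>" if "y \<in> pts" for y using x(3)[OF that] eps by (simp add: g1_def)
  have ends: "g1 x1 = \<epsilon>" "g1 x0 = 0" using eps by (auto simp: g1_def)
  obtain w where w: "w \<in> realization K" "\<And>x. x \<in> pts \<Longrightarrow> gw w x = g1 x"
    using gw_surj[OF nf bounds x(1) ends(1) x(2) ends(2)] by metis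
  have "dv (gw w) = dv g1" by (rule div_of_cong) (simp add: w(2))
  then have "D' = \<phi> w" using dvg dv1 by (simp add: \<phi>_def add_div_def)
  with w(1) show thesis by (rule that)
qed

lemma link_image: "link \<Gamma> D \<epsilon> = \<phi> ` realization K"
  using phi_link link_phi by blast

lemma diff_pl_rational:
  assumes w: "w \<in> realization K" and w': "w' \<in> realization K"
  shows "pl (\<lambda>x. gw w' x - gw w x)" "rational_function \<Gamma> (\<lambda>x. ereal (gw w' x - gw w x))"
    "\<phi> w' = add_div \<Gamma> (\<phi> w) (\<lambda>x. ereal (gw w' x - gw w x))"
proof -
  note pls = gw_pl[OF w'] gw_pl[OF w]
  show pl: "pl (\<lambda>x. gw w' x - gw w x)" by (rule pl_diff[OF pls])
  have sub: "{x \<in> pts. dv (\<lambda>x. gw w' x - gw w x) x \<noteq> 0} \<subseteq> {x \<in> pts. dv (gw w') x \<noteq> 0} \<union> {x \<in> pts. dv (gw w) x \<noteq> 0}"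
    unfolding dv_diff[OF pls] by auto
  have fin: "finite ({x \<in> pts. dv (gw w') x \<noteq> 0} \<union> {x \<in> pts. dv (gw w) x \<noteq> 0})"
    using finite_subset[OF nf_nonsmooth(2)[OF nform_gw[OF w']] finite_crit]
      finite_subset[OF nf_nonsmooth(2)[OF nform_gw[OF w]] finite_crit] by simp
  show "rational_function \<Gamma> (\<lambda>x. ereal (gw w' x - gw w x))"
    by (rule rational_of_pl[OF pl finite_subset[OF sub fin]])
  show "\<phi> w' = add_div \<Gamma> (\<phi> w) (\<lambda>x. ereal (gw w' x - gw w x))"
    unfolding add_div_def \<phi>_def dv_diff[OF pls] by auto
qed

lemma dist_phi:
  assumes w: "w \<in> realization K" and w': "w' \<in> realization K"
  shows "real_of_ereal (div_dist \<Gamma> (\<phi> w) (\<phi> w')) = rosc (\<lambda>x. gw w' x - gw w x)"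
  using div_dist_pl[OF diff_pl_rational[OF assms]] by (simp add: rosc_def)

section \<open>The metric on the link and continuity\<close>

lemma metric_link: "Metric_space (link \<Gamma> D \<epsilon>) (\<lambda>D1 D2. real_of_ereal (div_dist \<Gamma> D1 D2))"
proof
  show "0 \<le> real_of_ereal (div_dist \<Gamma> D1 D2)" for D1 D2 using div_dist_nonneg by (rule real_of_ereal_pos)
  show "real_of_ereal (div_dist \<Gamma> D1 D2) = real_of_ereal (div_dist \<Gamma> D2 D1)" for D1 D2
    by (simp only: div_dist_commute)
next
  fix D1 D2 assume "D1 \<in> link \<Gamma> D \<epsilon>" "D2 \<in> link \<Gamma> D \<epsilon>"
  then obtain w1 w2 where w: "w1 \<in> realization K" "w2 \<in> realization K" "D1 = \<phi> w1" "D2 = \<phi> w2"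
    unfolding link_image by blast
  note pl = diff_pl_rational(1)[OF w(1,2)]
  show "real_of_ereal (div_dist \<Gamma> D1 D2) = 0 \<longleftrightarrow> D1 = D2"
  proof
    assume "D1 = D2"
    then have "w1 = w2" using phi_inj w by blast
    then have "rosc (\<lambda>x. gw w2 x - gw w1 x) \<le> 0" by (intro rosc(3)[OF pl]) auto
    moreover have "0 \<le> rosc (\<lambda>x. gw w2 x - gw w1 x)" using pts_ne rosc(2)[OF pl] by fastforce
    ultimately show "real_of_ereal (div_dist \<Gamma> D1 D2) = 0" unfolding w(3,4) dist_phi[OF w(1,2)] by simp
  next
    assume "real_of_ereal (div_dist \<Gamma> D1 D2) = 0"
    then have 0: "rosc (\<lambda>x. gw w2 x - gw w1 x) = 0" unfolding w(3,4) dist_phi[OF w(1,2)] .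
    obtain z where z: "z \<in> pts" using pts_ne by blast
    have "gw w2 x = gw w1 x + (gw w2 z - gw w1 z)" if "x \<in> pts" for x
      using rosc(2)[OF pl that z] rosc(2)[OF pl z that] 0 by linarith
    then have "dv (gw w2) = dv (\<lambda>x. gw w1 x + (gw w2 z - gw w1 z))" by (intro div_of_cong) simp
    also have "\<dots> = dv (gw w1)" by (rule dv_add_const[OF gw_pl[OF w(1)]])
    finally show "D1 = D2" unfolding w(3,4) \<phi>_def add_div_def by simp
  qed
next
  fix D1 D2 D3 assume "D1 \<in> link \<Gamma> D \<epsilon>" "D2 \<in> link \<Gamma> D \<epsilon>" "D3 \<in> link \<Gamma> D \<epsilon>"
  then obtain w1 w2 w3 where w: "w1 \<in> realization K" "w2 \<in> realization K" "w3 \<in> realization K"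
    "D1 = \<phi> w1" "D2 = \<phi> w2" "D3 = \<phi> w3"
    unfolding link_image by blast
  have "rosc (\<lambda>x. gw w3 x - gw w1 x) \<le> rosc (\<lambda>x. gw w2 x - gw w1 x) + rosc (\<lambda>x. gw w3 x - gw w2 x)"
  proof (rule rosc(3)[OF diff_pl_rational(1)[OF w(1,3)]])
    fix x y assume xy: "x \<in> pts" "y \<in> pts"
    show "gw w3 x - gw w1 x - (gw w3 y - gw w1 y) \<le> rosc (\<lambda>x. gw w2 x - gw w1 x) + rosc (\<lambda>x. gw w3 x - gw w2 x)"
      using rosc(2)[OF diff_pl_rational(1)[OF w(1,2)] xy] rosc(2)[OF diff_pl_rational(1)[OF w(2,3)] xy] by linarith
  qed
  then show "real_of_ereal (div_dist \<Gamma> D1 D3) \<le> real_of_ereal (div_dist \<Gamma> D1 D2) + real_of_ereal (div_dist \<Gamma> D2 D3)"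
    unfolding w(4-6) dist_phi[OF w(1,2)] dist_phi[OF w(2,3)] dist_phi[OF w(1,3)] .
qed

definition wdist :: "(('v, 'e) point set \<times> ('e direction \<Rightarrow> int) \<Rightarrow> real) \<Rightarrow>
    (('v, 'e) point set \<times> ('e direction \<Rightarrow> int) \<Rightarrow> real) \<Rightarrow> real" where
  "wdist w w' = (\<Sum>p\<in>P. \<bar>w' p - w p\<bar>)"

lemma sum_diff_le:
  assumes "A \<subseteq> P" "\<And>p. p \<in> A \<Longrightarrow> \<bar>k p\<bar> \<le> 1"
  shows "\<bar>(\<Sum>p\<in>A. k p * w' p) - (\<Sum>p\<in>A. k p * w p)\<bar> \<le> wdist w w'"
proof -
  have "\<bar>(\<Sum>p\<in>A. k p * w' p) - (\<Sum>p\<in>A. k p * w p)\<bar> = \<bar>\<Sum>p\<in>A. k p * (w' p - w p)\<bar>"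
    by (simp add: sum_subtractf right_diff_distrib)
  also have "\<dots> \<le> (\<Sum>p\<in>A. \<bar>k p * (w' p - w p)\<bar>)" by (rule sum_abs)
  also have "\<dots> \<le> (\<Sum>p\<in>A. \<bar>w' p - w p\<bar>)"
    by (rule sum_mono) (use assms(2) in \<open>auto simp: abs_mult mult_left_le_one_le\<close>)
  also have "\<dots> \<le> wdist w w'"
    unfolding wdist_def using assms(1) finite_P by (intro sum_mono2) auto
  finally show ?thesis .
qed

lemma tw_lipschitz: "\<bar>tw w' d m - tw w d m\<bar> \<le> \<epsilon> * wdist w w'"
proof -
  let ?A = "{p \<in> P. int m \<le> snd p d}"
  have "\<bar>1 / real_of_int (snd p d)\<bar> \<le> 1" if "p \<in> ?A" for p
    using P_snd(2)[of p d] that by (cases "snd p d = 0") (auto simp: divide_simps)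
  then have "\<bar>(\<Sum>p\<in>?A. 1 / of_int (snd p d) * w' p) - (\<Sum>p\<in>?A. 1 / of_int (snd p d) * w p)\<bar> \<le> wdist w w'"
    by (intro sum_diff_le) auto
  then have "\<epsilon> * \<bar>(\<Sum>p\<in>?A. 1 / of_int (snd p d) * w' p) - (\<Sum>p\<in>?A. 1 / of_int (snd p d) * w p)\<bar> \<le> \<epsilon> * wdist w w'"
    using eps_pos by (intro mult_left_mono) auto
  moreover have "tw w' d m - tw w d m = \<epsilon> * ((\<Sum>p\<in>?A. 1 / of_int (snd p d) * w' p) - (\<Sum>p\<in>?A. 1 / of_int (snd p d) * w p))"
    by (simp add: tw_def right_diff_distrib)
  ultimately show ?thesis using eps_pos by (simp add: abs_mult)
qed

text \<open>The constant counts 1 for the sum over the subgraphs containing \<open>x\<close> and 1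
  for each pair of a port and a break, as \<open>max 0\<close> does not increase
  differences.\<close>

lemma gw_lipschitz: "\<bar>gw w' x - gw w x\<bar> \<le> \<epsilon> * (1 + real (card ports) * real Dmax) * wdist w w'"
proof -
  have "\<bar>sum w' {p \<in> P. x \<in> fst p} - sum w {p \<in> P. x \<in> fst p}\<bar> \<le> wdist w w'"
    using sum_diff_le[of "{p \<in> P. x \<in> fst p}" "\<lambda>_. 1" w' w] by simp
  then have "\<epsilon> * \<bar>sum w' {p \<in> P. x \<in> fst p} - sum w {p \<in> P. x \<in> fst p}\<bar> \<le> \<epsilon> * wdist w w'"
    using eps_pos by (intro mult_left_mono) auto
  then have 1: "\<bar>\<epsilon> * sum w' {p \<in> P. x \<in> fst p} - \<epsilon> * sum w {p \<in> P. x \<in> fst p}\<bar> \<le> \<epsilon> * wdist w w'"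
    using eps_pos by (simp add: abs_mult flip: right_diff_distrib)
  let ?h = "\<lambda>w. \<Sum>d\<in>ports. \<Sum>m=1..Dmax. max 0 (tw w d m - adist d x)"
  let ?k = "\<lambda>d m. max 0 (tw w' d m - adist d x) - max 0 (tw w d m - adist d x)"
  have k: "\<bar>?k d m\<bar> \<le> \<epsilon> * wdist w w'" for d m
  proof -
    have "\<bar>?k d m\<bar> \<le> \<bar>tw w' d m - tw w d m\<bar>" by linarith
    then show ?thesis using tw_lipschitz[of w' d m w] by linarith
  qed
  have "\<bar>\<Sum>m=1..Dmax. ?k d m\<bar> \<le> (\<Sum>m=1..Dmax. \<epsilon> * wdist w w')" for d
    by (rule order_trans[OF sum_abs]) (intro sum_mono k)
  then have "\<bar>\<Sum>d\<in>ports. \<Sum>m=1..Dmax. ?k d m\<bar> \<le> (\<Sum>d\<in>ports. \<Sum>m=1..Dmax. \<epsilon> * wdist w w')"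
    by - (rule order_trans[OF sum_abs], rule sum_mono)
  moreover have "?h w' - ?h w = (\<Sum>d\<in>ports. \<Sum>m=1..Dmax. ?k d m)" by (simp add: sum_subtractf)
  ultimately have "\<bar>?h w' - ?h w\<bar> \<le> real (card ports) * real Dmax * (\<epsilon> * wdist w w')" by simp
  with 1 have "\<bar>gw w' x - gw w x\<bar> \<le> \<epsilon> * wdist w w' + real (card ports) * real Dmax * (\<epsilon> * wdist w w')"
    unfolding gw_def by linarith
  then show ?thesis by (simp add: algebra_simps)
qed

lemma continuous_phi: "continuous_map (top_of_set (realization K)) (link_top \<Gamma> D \<epsilon>) \<phi>"
proof -
  interpret M: Metric_space "link \<Gamma> D \<epsilon>" "\<lambda>D1 D2. real_of_ereal (div_dist \<Gamma> D1 D2)" by (rule metric_link)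
  let ?C = "\<epsilon> * (1 + real (card ports) * real Dmax)"
  have C: "0 < ?C" using eps_pos by (simp add: add_pos_nonneg)
  show ?thesis
    unfolding link_top_def M.continuous_map_to_metric
  proof (intro ballI allI impI)
    fix w \<eta> assume "w \<in> topspace (top_of_set (realization K))" and \<eta>: "(0::real) < \<eta>"
    then have w: "w \<in> realization K" by simp
    \<comment> \<open>The factor 2 pays for the two points at which \<open>rosc\<close> compares the
      difference.\<close>
    define U where "U = {w' \<in> realization K. wdist w w' < \<eta> / (2 * ?C)}"
    have "continuous_on UNIV (\<lambda>w'. wdist w w')"
      unfolding wdist_def
      by (intro continuous_on_sum continuous_on_rabs continuous_on_diff continuous_on_product_coordinates continuous_on_const)
    then have "open {w'. wdist w w' < \<eta> / (2 * ?C)}"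
      by (rule open_Collect_less) (rule continuous_on_const)
    then have "openin (top_of_set (realization K)) (realization K \<inter> {w'. wdist w w' < \<eta> / (2 * ?C)})"
      by (rule openin_open_Int)
    then have "openin (top_of_set (realization K)) U" by (simp add: U_def Collect_conj_eq)
    moreover have "w \<in> U" using w C \<eta> by (simp add: U_def wdist_def)
    moreover have "\<phi> w' \<in> M.mball (\<phi> w) \<eta>" if w': "w' \<in> U" for w'
    proof -
      have w'K: "w' \<in> realization K" and small: "wdist w w' < \<eta> / (2 * ?C)" using w' by (auto simp: U_def)
      have "rosc (\<lambda>x. gw w' x - gw w x) \<le> 2 * (?C * wdist w w')"
      proof (rule rosc(3)[OF diff_pl_rational(1)[OF w w'K]])
        fix x y
        show "gw w' x - gw w x - (gw w' y - gw w y) \<le> 2 * (?C * wdist w w')"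
          using gw_lipschitz[of w' x w] gw_lipschitz[of w' y w] by linarith
      qed
      also have "\<dots> < \<eta>" using small C by (simp add: field_simps)
      finally show ?thesis using phi_link[OF w] phi_link[OF w'K] dist_phi[OF w w'K] by simp
    qed
    ultimately show "\<exists>U. openin (top_of_set (realization K)) U \<and> w \<in> U \<and> (\<forall>w'\<in>U. \<phi> w' \<in> M.mball (\<phi> w) \<eta>)"
      by blast
  qed
qed

text \<open>A continuous bijection from a compact space onto a Hausdorff space; the continuity of
  the fibre lengths in the divisor comes for free.\<close>

lemma homeomorphic_phi: "homeomorphic_map (top_of_set (realization K)) (link_top \<Gamma> D \<epsilon>) \<phi>"
proof -
  interpret M: Metric_space "link \<Gamma> D \<epsilon>" "\<lambda>D1 D2. real_of_ereal (div_dist \<Gamma> D1 D2)" by (rule metric_link)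
  show ?thesis
  proof (rule continuous_imp_homeomorphic_map[OF continuous_phi])
    show "compact_space (top_of_set (realization K))"
      using compact_realization_K by (simp add: compact_space_subtopology)
    show "Hausdorff_space (link_top \<Gamma> D \<epsilon>)" unfolding link_top_def by (rule M.Hausdorff_space_mtopology)
    show "\<phi> ` topspace (top_of_set (realization K)) = topspace (link_top \<Gamma> D \<epsilon>)"
      unfolding link_top_def M.topspace_mtopology by (simp add: link_image)
    show "inj_on \<phi> (topspace (top_of_set (realization K)))" using phi_inj by (auto intro: inj_onI)
  qed
qed

end

section \<open>Cells of the fine subdivision are open simplices\<close>

text \<open>Up-sets of a chain are nested, so comparing their masses amounts to comparing the sets,
  whatever the positive weights are. Hence the order of the levels depends on the support
  only.\<close>

lemma upset_sum_less:
  fixes w :: "'p \<Rightarrow> real"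
  assumes "finite \<sigma>" and pos: "\<And>p. p \<in> \<sigma> \<Longrightarrow> 0 < w p"
    and total: "\<And>p q. p \<in> \<sigma> \<Longrightarrow> q \<in> \<sigma> \<Longrightarrow> le p q \<or> le q p"
    and A: "\<And>p q. Q p \<Longrightarrow> le p q \<Longrightarrow> Q q" and B: "\<And>p q. R p \<Longrightarrow> le p q \<Longrightarrow> R q"
  shows "sum w {p \<in> \<sigma>. Q p} < sum w {p \<in> \<sigma>. R p} \<longleftrightarrow> {p \<in> \<sigma>. Q p} \<subset> {p \<in> \<sigma>. R p}"
proof
  assume sub: "{p \<in> \<sigma>. Q p} \<subset> {p \<in> \<sigma>. R p}"
  then obtain p where "p \<in> {p \<in> \<sigma>. R p} - {p \<in> \<sigma>. Q p}" by blast
  then show "sum w {p \<in> \<sigma>. Q p} < sum w {p \<in> \<sigma>. R p}"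
    using sub assms(1) pos by (intro sum_strict_mono2[of _ _ p]) (auto intro: less_imp_le)
next
  assume less: "sum w {p \<in> \<sigma>. Q p} < sum w {p \<in> \<sigma>. R p}"
  have "\<not> {p \<in> \<sigma>. R p} \<subseteq> {p \<in> \<sigma>. Q p}"
  proof
    assume "{p \<in> \<sigma>. R p} \<subseteq> {p \<in> \<sigma>. Q p}"
    then have "sum w {p \<in> \<sigma>. R p} \<le> sum w {p \<in> \<sigma>. Q p}"
      using assms(1) pos by (intro sum_mono2) (auto intro: less_imp_le)
    with less show False by simp
  qed
  then obtain p where p: "p \<in> \<sigma>" "R p" "\<not> Q p" by blast
  have "R q" if "q \<in> \<sigma>" "Q q" for q
    using total[OF p(1) that(1)] A[of q p] B[of p q] that p by blast
  then show "{p \<in> \<sigma>. Q p} \<subset> {p \<in> \<sigma>. R p}" using p by blast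
qed

context small_link
begin

subsection \<open>The combinatorial data of the fine subdivision\<close>

text \<open>Names for the critical points that do not move with the weights: a marked point, or the
  \<open>m\<close>-th break along a port. Different names may denote the same point.\<close>

definition idx :: "(('v, 'e) point set \<times> ('e direction \<Rightarrow> int) \<Rightarrow> real) \<Rightarrow> (('v, 'e) point + 'e direction \<times> nat) set" where
  "idx w = Inl ` mk \<union> Inr ` {(d, m). d \<in> ports \<and> m \<in> {1..Dmax} \<and> 0 < tw w d m}"

fun ipt :: "(('v, 'e) point set \<times> ('e direction \<Rightarrow> int) \<Rightarrow> real) \<Rightarrow> ('v, 'e) point + 'e direction \<times> nat \<Rightarrow> ('v, 'e) point" where
  "ipt w (Inl u) = u"
| "ipt w (Inr (d, m)) = pt d (tw w d m)"

text \<open>The up-closed condition whose mass, times \<open>\<epsilon>\<close>, is the value of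
  \<open>gw w\<close> at the named point, see \<open>gw_ipt\<close>.\<close>

fun iup :: "('v, 'e) point + 'e direction \<times> nat \<Rightarrow> ('v, 'e) point set \<times> ('e direction \<Rightarrow> int) \<Rightarrow> bool" where
  "iup (Inl u) p \<longleftrightarrow> u \<in> fst p"
| "iup (Inr (d, m)) p \<longleftrightarrow> bs d \<in> fst p \<and> snd p d < int m"

lemma crit_idx: "crit (tw w) = ipt w ` idx w"
proof -
  have "breaks (tw w) = (\<lambda>x. ipt w (Inr x)) ` {(d, m). d \<in> ports \<and> m \<in> {1..Dmax} \<and> 0 < tw w d m}"
    unfolding breaks_def by (rule image_cong) (auto split: prod.splits)
  then show ?thesis unfolding crit_def idx_def image_Un image_image by simp
qed

lemma finite_idx: "finite (idx w)"
proof -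
  have "{(d, m). d \<in> ports \<and> m \<in> {1..Dmax} \<and> 0 < tw w d m} \<subseteq> ports \<times> {1..Dmax}" by auto
  then have "finite {(d, m). d \<in> ports \<and> m \<in> {1..Dmax} \<and> 0 < tw w d m}"
    by (rule finite_subset) (simp add: finite_ports)
  then show ?thesis using finite_mk by (simp add: idx_def)
qed

lemma iup_mono:
  assumes "iup i p" "le_P p q"
  shows "iup i q"
proof (cases i)
  case (Inl u)
  then show ?thesis using assms(1) subsetD[OF le_P_D(3)[OF assms(2)], of u] by simp
next
  case (Inr dm)
  obtain d m where i: "i = Inr (d, m)" using Inr by (cases dm) auto
  then have *: "bs d \<in> fst p" "snd p d < int m" using assms(1) by simp_all
  show ?thesis using * subsetD[OF le_P_D(3)[OF assms(2)] *(1)] le_P_D(4)[OF assms(2) *(1)] i by simp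
qed

lemma gw_ipt:
  assumes w: "w \<in> realization K" and i: "i \<in> idx w"
  shows "gw w (ipt w i) = \<epsilon> * sum w {p \<in> {p. w p \<noteq> 0}. iup i p}"
proof (cases i)
  case (Inl u)
  then have "u \<in> mk" using i by (auto simp: idx_def)
  then show ?thesis using gw_marked[OF w, of u] realization_D(3)[OF w, of "\<lambda>p. u \<in> fst p"] Inl by simp
next
  case (Inr dm)
  then obtain d m where dm: "i = Inr (d, m)" by (cases dm) auto
  then have "d \<in> ports" "1 \<le> m" "m \<le> Dmax" using i by (auto simp: idx_def)
  from gw_break[OF w this] show ?thesis
    using realization_D(3)[OF w, of "\<lambda>p. bs d \<in> fst p \<and> snd p d < int m"] dm by simp
qed

lemma idx_cong:
  assumes w: "w \<in> realization K" and w': "w' \<in> realization K" and eq: "{p. w p \<noteq> 0} = {p. w' p \<noteq> 0}"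
  shows "idx w = idx w'"
proof -
  have "0 < tw w d m \<longleftrightarrow> 0 < tw w' d m" if "m \<in> {1..Dmax}" for d m
    using tw_pos[OF w, of m d] tw_pos[OF w', of m d] that eq by simp
  then have "{(d, m). d \<in> ports \<and> m \<in> {1..Dmax} \<and> 0 < tw w d m} = {(d, m). d \<in> ports \<and> m \<in> {1..Dmax} \<and> 0 < tw w' d m}"
    by auto
  then show ?thesis by (simp only: idx_def)
qed

text \<open>At level 0 the data is the whole curve, which is not a proper subgraph and so lies
  outside the firing poset; \<open>fine_data_set\<close> discards it.\<close>

lemma Gd_0:
  assumes w: "w \<in> realization K"
  shows "Gd (gw w) (tw w) 0 = (pts, \<lambda>_. 0)"
proof -
  have super: "superlevel \<Gamma> (\<lambda>x. ereal (gw w x)) (ereal 0) = pts"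
    using gw_bounds(1)[OF w] by (auto simp: superlevel_def zero_ereal_def)
  have "x \<in> compactified \<Gamma> D pts" if x: "x \<in> pts" for x
  proof (cases "x \<in> mk")
    case False
    then obtain s where "s \<in> segs" "x \<in> seg s" using unmarked_inside[OF x] by blast
    then show ?thesis unfolding mem_compactified using inside_pts by blast
  qed (simp add: mem_compactified x)
  moreover have "compactified \<Gamma> D pts \<subseteq> pts" using mem_compactified by blast
  ultimately have Sh: "Sh (gw w) 0 = pts" unfolding super by blast
  have "\<not> gw w (pt d r) < 0" if "d \<in> ports" for d
    using gw_bounds(1)[OF w pt_in_pts[OF ports_dirs[OF that]], of r] by simp
  then have "(\<lambda>d. if d \<in> ports \<and> 0 \<le> gw w (bs d) \<and> gw w (pt d r) < 0
     then int (card {m\<in>{1..Dmax}. gw w (pt d (tw w d m)) < 0}) else 0) = (\<lambda>_. 0)" by (intro ext if_not_P) blast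
  then show ?thesis unfolding Gd_def Sh by (simp only:)
qed

text \<open>If \<open>p\<close> is the least element satisfying \<open>iup i\<close>, then the
  elements satisfying it are those from \<open>p\<close> upwards. The value at \<open>i\<close> is
  then the upper end of the piece of levels belonging to \<open>p\<close>, so \<open>Gd_gw\<close>
  applies.\<close>

lemma Gd_idx:
  assumes w: "w \<in> realization K" and i: "i \<in> idx w"
  shows "{p \<in> {p. w p \<noteq> 0}. iup i p} = {} \<Longrightarrow> Gd (gw w) (tw w) (gw w (ipt w i)) = (pts, \<lambda>_. 0)"
    "w p \<noteq> 0 \<Longrightarrow> iup i p \<Longrightarrow> (\<And>q. w q \<noteq> 0 \<Longrightarrow> iup i q \<Longrightarrow> le_P p q) \<Longrightarrow> Gd (gw w) (tw w) (gw w (ipt w i)) = p"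
proof -
  show "Gd (gw w) (tw w) (gw w (ipt w i)) = (pts, \<lambda>_. 0)" if e: "{p \<in> {p. w p \<noteq> 0}. iup i p} = {}"
    unfolding gw_ipt[OF assms] e using Gd_0[OF w] by simp
  assume p: "w p \<noteq> 0" "iup i p" "\<And>q. w q \<noteq> 0 \<Longrightarrow> iup i q \<Longrightarrow> le_P p q"
  then have pp: "p \<in> {p. w p \<noteq> 0}" by simp
  have above: "{q \<in> {p. w p \<noteq> 0}. iup i q} = {q \<in> {p. w p \<noteq> 0}. le_P p q}"
    using p iup_mono by blast
  have "sum w {q \<in> {p. w p \<noteq> 0}. le_P p q \<and> q \<noteq> p} < sum w {q \<in> {p. w p \<noteq> 0}. le_P p q}"
    using above_split[OF w pp] supp_pos[OF w pp] by linarith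
  then show "Gd (gw w) (tw w) (gw w (ipt w i)) = p"
    unfolding gw_ipt[OF assms] above using eps_pos by (intro Gd_gw[OF w pp]) auto
qed

lemma fine_data_gw:
  assumes w: "w \<in> realization K"
  shows "fine_data \<Gamma> D (\<lambda>x. ereal (gw w x)) =
    rev (map (Gd (gw w) (tw w)) (sorted_list_of_set ((\<lambda>i. gw w (ipt w i)) ` idx w)))"
  unfolding fine_data_nf[OF nform_gw[OF w]] crit_idx image_image by (rule rev_map[symmetric])

lemma fine_data_supp_eq:
  assumes w: "w \<in> realization K" and w': "w' \<in> realization K" and eq: "{p. w p \<noteq> 0} = {p. w' p \<noteq> 0}"
  shows "fine_data \<Gamma> D (\<lambda>x. ereal (gw w x)) = fine_data \<Gamma> D (\<lambda>x. ereal (gw w' x))"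
proof -
  note \<sigma> = K_D[OF realization_D(2)[OF w]]
  have i': "i \<in> idx w'" if "i \<in> idx w" for i using that idx_cong[OF assms] by simp
  have "map (Gd (gw w) (tw w)) (sorted_list_of_set ((\<lambda>i. gw w (ipt w i)) ` idx w)) =
      map (Gd (gw w') (tw w')) (sorted_list_of_set ((\<lambda>i. gw w' (ipt w' i)) ` idx w))"
  proof (rule sorted_list_of_set_indexed[OF finite_idx])
    fix i j assume ij: "i \<in> idx w" "j \<in> idx w"
    have "sum w {p \<in> {p. w p \<noteq> 0}. iup i p} < sum w {p \<in> {p. w p \<noteq> 0}. iup j p} \<longleftrightarrow>
        {p \<in> {p. w p \<noteq> 0}. iup i p} \<subset> {p \<in> {p. w p \<noteq> 0}. iup j p}"
      by (rule upset_sum_less[where le = le_P, OF \<sigma>(2) supp_pos[OF w] \<sigma>(4) iup_mono iup_mono])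
    moreover have "sum w' {p \<in> {p. w p \<noteq> 0}. iup i p} < sum w' {p \<in> {p. w p \<noteq> 0}. iup j p} \<longleftrightarrow>
        {p \<in> {p. w p \<noteq> 0}. iup i p} \<subset> {p \<in> {p. w p \<noteq> 0}. iup j p}"
      by (rule upset_sum_less[where le = le_P, OF \<sigma>(2) supp_pos[OF w', folded eq] \<sigma>(4) iup_mono iup_mono])
    ultimately show "gw w (ipt w i) < gw w (ipt w j) \<longleftrightarrow> gw w' (ipt w' i) < gw w' (ipt w' j)"
      unfolding gw_ipt[OF w ij(1)] gw_ipt[OF w ij(2)] gw_ipt[OF w' i'[OF ij(1)]] gw_ipt[OF w' i'[OF ij(2)]] eq
      using eps_pos by simp
  next
    fix i assume i: "i \<in> idx w"
    let ?A = "{p \<in> {p. w p \<noteq> 0}. iup i p}"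
    show "Gd (gw w) (tw w) (gw w (ipt w i)) = Gd (gw w') (tw w') (gw w' (ipt w' i))"
    proof (cases "?A = {}")
      case True
      then show ?thesis using Gd_idx(1)[OF w i] Gd_idx(1)[OF w' i'[OF i]] eq by simp
    next
      case False
      have "finite ?A" using \<sigma>(2) by simp
      then have "\<exists>p\<in>?A. \<forall>q\<in>?A. le_P p q"
        by (rule finite_chain_least[OF _ False]) (use \<sigma>(4) le_P_trans in blast)+
      then obtain p where p: "w p \<noteq> 0" "iup i p" "\<And>q. w q \<noteq> 0 \<Longrightarrow> iup i q \<Longrightarrow> le_P p q" by blast
      have p': "w' p \<noteq> 0" "\<And>q. w' q \<noteq> 0 \<Longrightarrow> iup i q \<Longrightarrow> le_P p q" using p eq by blast+
      show ?thesis using Gd_idx(2)[OF w i p] Gd_idx(2)[OF w' i'[OF i] p'(1) p(2) p'(2)] by simp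
    qed
  qed
  then show ?thesis unfolding fine_data_gw[OF w] fine_data_gw[OF w'] idx_cong[OF assms, symmetric] by (simp only:)
qed

text \<open>Every element of the chain starts the up-set of some critical point. For the least
  element a marked point of its subgraph will do. Otherwise the step from the predecessor
  \<open>p'\<close> to \<open>p\<close> is strict, and by \<open>le_P_eqI\<close> it shows at a
  marked point or at a port.\<close>

lemma ex_idx:
  assumes w: "w \<in> realization K" and p: "w p \<noteq> 0"
  obtains i where "i \<in> idx w" "iup i p" "\<And>q. w q \<noteq> 0 \<Longrightarrow> iup i q \<Longrightarrow> le_P p q"
proof -
  note \<sigma> = K_D[OF realization_D(2)[OF w]]
  have pP: "p \<in> P" using \<sigma>(1) p by blast
  let ?L = "{q \<in> {p. w p \<noteq> 0}. le_P q p \<and> q \<noteq> p}"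
  note found = that
  have above: "le_P p q \<or> q \<in> ?L" if "w q \<noteq> 0" for q
    using \<sigma>(4)[of p q] p that le_P_refl[OF pP] by blast
  show thesis
  proof (cases "?L = {}")
    case True
    obtain u where "u \<in> mk" "u \<in> fst p"
      using cellular_nonempty_marked[OF w P_snd(1)[OF pP]] P_nonempty_proper[of "fst p" "snd p"] pP by auto
    then show thesis using that[of "Inl u"] above True by (auto simp: idx_def)
  next
    case False
    have "finite ?L" using \<sigma>(2) by simp
    then have "\<exists>p\<in>?L. \<forall>q\<in>?L. le_P q p"
      by (rule finite_chain_least[OF _ False]) (use \<sigma>(4) le_P_trans in blast)+
    then obtain p' where p': "w p' \<noteq> 0" "le_P p' p" "p' \<noteq> p" "\<And>q. q \<in> ?L \<Longrightarrow> le_P q p'" by blast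
    have p'P: "p' \<in> P" using \<sigma>(1) p' by blast
    have concl: thesis if i: "i \<in> idx w" "iup i p" "\<not> iup i p'" for i
    proof (rule found[OF i(1,2)])
      fix q assume q: "w q \<noteq> 0" "iup i q"
      show "le_P p q" using above[OF q(1)] p'(4)[of q] iup_mono[OF q(2)] i(3) by blast
    qed
    show thesis
    proof (cases "\<exists>x\<in>mk. x \<in> fst p \<and> x \<notin> fst p'")
      case True
      then obtain x where "x \<in> mk" "x \<in> fst p" "x \<notin> fst p'" by blast
      then show thesis by (intro concl[of "Inl x"]) (auto simp: idx_def)
    next
      case noMk: False
      have "\<exists>d\<in>ports. bs d \<in> fst p' \<and> \<not> snd p' d \<le> snd p d"
      proof (rule ccontr)
        assume "\<not> ?thesis"
        then have "p' = p" using noMk by (intro le_P_eqI[OF p'(2)]) blast+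
        with p'(3) show False by simp
      qed
      then obtain d where d: "d \<in> ports" "bs d \<in> fst p'" "snd p d < snd p' d" by force
      \<comment> \<open>The weight of the predecessor: the condition \<open>snd q d < int m\<close>
        fails at \<open>p'\<close> and holds at \<open>p\<close>, and \<open>p'\<close> itself makes
        the \<open>m\<close>-th break positive.\<close>
      define m where "m = nat (snd p' d)"
      have m: "int m = snd p' d" "1 \<le> m" "m \<le> Dmax"
        using d(3) P_snd(2)[OF pP, of d] P_snd(3)[OF p'P, of d] by (auto simp: m_def)
      have "0 < tw w d m" unfolding tw_pos[OF w m(2)] m(1) using p'(1) by (intro bexI[of _ p']) auto
      then have "Inr (d, m) \<in> idx w" using d m by (auto simp: idx_def)
      moreover have "bs d \<in> fst p" using le_P_D(3)[OF p'(2)] d(2) by blast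
      ultimately show thesis using d m by (intro concl[of "Inr (d, m)"]) auto
    qed
  qed
qed

text \<open>The support, and with it the simplex, can be read off from the fine data; thus divisors
  in the same fine cell come from the same open simplex.\<close>

lemma fine_data_set:
  assumes w: "w \<in> realization K"
  shows "set (fine_data \<Gamma> D (\<lambda>x. ereal (gw w x))) \<inter> P = {p. w p \<noteq> 0}"
proof -
  note \<sigma> = K_D[OF realization_D(2)[OF w]]
  have set: "set (fine_data \<Gamma> D (\<lambda>x. ereal (gw w x))) = (\<lambda>i. Gd (gw w) (tw w) (gw w (ipt w i))) ` idx w"
    unfolding fine_data_gw[OF w] using finite_idx by (simp add: image_image)
  show ?thesis
  proof (intro equalityI subsetI)
    fix p assume p: "p \<in> set (fine_data \<Gamma> D (\<lambda>x. ereal (gw w x))) \<inter> P"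
    then obtain i where i: "i \<in> idx w" "p = Gd (gw w) (tw w) (gw w (ipt w i))" unfolding set by blast
    let ?A = "{p \<in> {p. w p \<noteq> 0}. iup i p}"
    show "p \<in> {p. w p \<noteq> 0}"
    proof (cases "?A = {}")
      case True
      then have "p = (pts, \<lambda>_. 0)" using Gd_idx(1)[OF w i(1)] i(2) by simp
      then show ?thesis using p P_nonempty_proper by auto
    next
      case False
      have "finite ?A" using \<sigma>(2) by simp
      then have "\<exists>p\<in>?A. \<forall>q\<in>?A. le_P p q"
        by (rule finite_chain_least[OF _ False]) (use \<sigma>(4) le_P_trans in blast)+
      then obtain q where q: "w q \<noteq> 0" "iup i q" "\<And>q'. w q' \<noteq> 0 \<Longrightarrow> iup i q' \<Longrightarrow> le_P q q'" by blast
      then show ?thesis using Gd_idx(2)[OF w i(1) q] i(2) by simp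
    qed
  next
    fix p assume "p \<in> {p. w p \<noteq> 0}"
    then have p: "w p \<noteq> 0" by simp
    obtain i where i: "i \<in> idx w" "iup i p" "\<And>q. w q \<noteq> 0 \<Longrightarrow> iup i q \<Longrightarrow> le_P p q"
      using ex_idx[OF w p] by blast
    have "p \<in> set (fine_data \<Gamma> D (\<lambda>x. ereal (gw w x)))"
      unfolding set using Gd_idx(2)[OF w i(1) p i(2,3)] i(1) by (metis imageI)
    then show "p \<in> set (fine_data \<Gamma> D (\<lambda>x. ereal (gw w x))) \<inter> P" using \<sigma>(1) p by blast
  qed
qed

lemma nform_add_const: "nform g \<tau> \<Longrightarrow> nform (\<lambda>x. g x + c) \<tau>"
  unfolding nform_def by auto

lemma fine_data_add_const:
  assumes nf: "nform g \<tau>"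
  shows "fine_data \<Gamma> D (\<lambda>x. ereal (g x + c)) = fine_data \<Gamma> D (\<lambda>x. ereal (g x))"
proof -
  have "superlevel \<Gamma> (\<lambda>x. ereal (g x + c)) (ereal (h + c)) = superlevel \<Gamma> (\<lambda>x. ereal (g x)) (ereal h)" for h
    by (simp add: superlevel_def)
  then have "Sh (\<lambda>x. g x + c) (h + c) = Sh g h" for h by simp
  then have "Gd (\<lambda>x. g x + c) \<tau> (h + c) = Gd g \<tau> h" for h
    by (simp only: Gd_def add_less_cancel_right add_le_cancel_right)
  then have "map (Gd (\<lambda>x. g x + c) \<tau>) (sorted_list_of_set ((\<lambda>x. g x + c) ` crit \<tau>)) =
      map (Gd g \<tau>) (sorted_list_of_set (g ` crit \<tau>))"
    by (intro sorted_list_of_set_indexed[OF finite_crit]) auto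
  then show ?thesis
    unfolding fine_data_nf[OF nf] fine_data_nf[OF nform_add_const[OF nf]] by (simp only: rev_map[symmetric])
qed

subsection \<open>The cell structure of the linear system\<close>

lemma phi_marked:
  assumes w: "w \<in> realization K" and x: "x \<in> mk"
  shows "\<phi> w x = D x - (\<Sum>d\<in>{d \<in> ports. bs d = x}. int (card {m\<in>{1..Dmax}. 0 < tw w d m}))"
  using nf_dv_marked[OF nform_gw[OF w] x] by (simp add: \<phi>_def add_div_def)

lemma phi_arm:
  assumes w: "w \<in> realization K" and d: "d \<in> ports" and t: "0 < t" "t < r"
  shows "\<phi> w (pt d t) = int (card {m\<in>{1..Dmax}. tw w d m = t})"
proof -
  have "D (pt d t) = 0" using pt_unmarked[OF d t(1)] t by (auto simp: marked_def)
  then show ?thesis using nf_dv_arm[OF nform_gw[OF w] d t] by (simp add: \<phi>_def add_div_def)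
qed

lemma phi_mid:
  assumes w: "w \<in> realization K" and s: "(e, ereal \<alpha>, b) \<in> segs" "\<alpha> + r \<le> t" "ereal (t + r) \<le> b"
    and x: "Inner e t \<in> pts" "Inner e t \<notin> mk"
  shows "\<phi> w (Inner e t) = 0"
  using nf_dv_mid[OF nform_gw[OF w] s x(1)] x(2) by (simp add: \<phi>_def add_div_def marked_def)

lemma tw_supp:
  assumes w: "w \<in> realization K"
  shows "tw w d m = \<epsilon> * (\<Sum>p\<in>{p \<in> {p. w p \<noteq> 0}. int m \<le> snd p d}. w p / of_int (snd p d))"
proof -
  have "(\<Sum>p\<in>{p \<in> P. int m \<le> snd p d}. w p / of_int (snd p d)) =
      (\<Sum>p\<in>{p \<in> {p. w p \<noteq> 0}. int m \<le> snd p d}. w p / of_int (snd p d))"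
    using finite_P K_D(1)[OF realization_D(2)[OF w]] by (intro sum.mono_neutral_right) auto
  then show ?thesis by (simp add: tw_def)
qed

text \<open>The two sums run over nested sets of elements with positive terms, so they agree only if
  the sets do. Whether two chips of a port coincide is therefore decided by the support of
  \<open>w\<close>.\<close>

lemma tw_eq_iff:
  assumes w: "w \<in> realization K" and m: "1 \<le> m" "1 \<le> m'"
  shows "tw w d m = tw w d m' \<longleftrightarrow> (\<forall>p\<in>{p. w p \<noteq> 0}. int m \<le> snd p d \<longleftrightarrow> int m' \<le> snd p d)"
proof -
  note \<sigma> = K_D[OF realization_D(2)[OF w]]
  have strict: "tw w d n' < tw w d n"
    if n: "1 \<le> n" and p: "w p \<noteq> 0" "int n \<le> snd p d" "\<not> int n' \<le> snd p d" for n n' p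
  proof -
    let ?A = "\<lambda>n. {p \<in> {p. w p \<noteq> 0}. int n \<le> snd p d}"
    have "(\<Sum>p\<in>?A n'. w p / of_int (snd p d)) < (\<Sum>p\<in>?A n. w p / of_int (snd p d))"
    proof (rule sum_strict_mono2)
      show "finite (?A n)" using \<sigma>(2) by simp
      show "?A n' \<subseteq> ?A n" using p by auto
      show "p \<in> ?A n - ?A n'" using p by simp
      show "0 < w p / of_int (snd p d)" using supp_pos[OF w, of p] p n by simp
      show "0 \<le> w q / of_int (snd q d)" if "q \<in> ?A n" for q
        using realization_D(1)[OF w, of q] that n by auto
    qed
    then show ?thesis unfolding tw_supp[OF w] using eps_pos by simp
  qed
  show ?thesis
  proof
    assume eq: "tw w d m = tw w d m'"
    show "\<forall>p\<in>{p. w p \<noteq> 0}. int m \<le> snd p d \<longleftrightarrow> int m' \<le> snd p d"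
      using strict[OF m(1), of _ m'] strict[OF m(2), of _ m] eq by force
  next
    assume "\<forall>p\<in>{p. w p \<noteq> 0}. int m \<le> snd p d \<longleftrightarrow> int m' \<le> snd p d"
    then have "{p \<in> {p. w p \<noteq> 0}. int m \<le> snd p d} = {p \<in> {p. w p \<noteq> 0}. int m' \<le> snd p d}" by blast
    then show "tw w d m = tw w d m'" unfolding tw_supp[OF w] by (simp only:)
  qed
qed

lemma port_line:
  assumes "d \<in> ports"
  obtains e \<kappa> s where "\<And>x. 0 < x \<Longrightarrow> x \<le> r \<Longrightarrow> pt d x = Inner e (\<kappa> + s * x)"
  using assms
proof (cases rule: ports_cases)
  case (Fwd e a b)
  have "pt d x = Inner e (a + 1 * x)" if x: "0 < x" "x \<le> r" for x
  proof -
    have "ereal (a + x) < b" using gap[OF Fwd(2)] x by (auto intro: le_less_trans[of _ "ereal (a + 2 * r)"])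
    then have "pt d x \<in> seg (e, ereal a, b)" using Fwd(1) x by (auto intro!: insideI)
    then show ?thesis using inside_Inner[OF Fwd(2)] Fwd(1) by (auto simp: ep_eq_Inner)
  qed
  then show thesis by (rule that)
next
  case (Bwd e a b)
  have "pt d x = Inner e (b + (- 1) * x)" if x: "0 < x" "x \<le> r" for x
  proof -
    have "pt d x \<in> seg (e, ereal a, ereal b)" using Bwd(1) gap[OF Bwd(2)] x by (auto intro!: insideI)
    then show ?thesis using inside_Inner[OF Bwd(2)] Bwd(1) by (auto simp: ep_eq_Inner)
  qed
  then show thesis by (rule that)
qed

fun icoord :: "('v, 'e) point \<Rightarrow> real" where
  "icoord (Inner e t) = t"
| "icoord (Vert v) = 0"

fun on_edge :: "'e \<Rightarrow> ('v, 'e) point \<Rightarrow> bool" where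
  "on_edge e (Inner e' t) \<longleftrightarrow> e' = e"
| "on_edge e (Vert v) \<longleftrightarrow> False"

lemma on_edge_coord: "on_edge e x \<Longrightarrow> x = Inner e (icoord x)"
  by (cases x) auto

text \<open>Names for the chips inside \<open>e\<close>: marked points that keep a chip, and
  travelling chips by port and number. Like \<open>idx\<close> it depends only on the support of
  \<open>w\<close>, while the positions \<open>epos\<close> vary.\<close>

definition eidx :: "(('v, 'e) point set \<times> ('e direction \<Rightarrow> int) \<Rightarrow> real) \<Rightarrow> 'e \<Rightarrow> (real + 'e direction \<times> nat) set" where
  "eidx w e = Inl ` {t. Inner e t \<in> mk \<and> \<phi> w (Inner e t) \<noteq> 0} \<union>
     Inr ` {(d, m). d \<in> ports \<and> m \<in> {1..Dmax} \<and> 0 < tw w d m \<and> on_edge e (pt d r)}"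

fun epos :: "(('v, 'e) point set \<times> ('e direction \<Rightarrow> int) \<Rightarrow> real) \<Rightarrow> real + 'e direction \<times> nat \<Rightarrow> real" where
  "epos w (Inl t) = t"
| "epos w (Inr (d, m)) = icoord (pt d (tw w d m))"

lemma eidx_cases:
  assumes "k \<in> eidx w e"
  obtains (node) t where "k = Inl t" "Inner e t \<in> mk" "\<phi> w (Inner e t) \<noteq> 0"
  | (chip) d m where "k = Inr (d, m)" "d \<in> ports" "1 \<le> m" "m \<le> Dmax" "0 < tw w d m" "on_edge e (pt d r)"
  using assms unfolding eidx_def by auto

lemma finite_eidx: "finite (eidx w e)"
proof -
  have "finite ((Inner e) -` mk)" using finite_mk by (rule finite_vimageI) (auto simp: inj_def)
  then have "finite {t. Inner e t \<in> mk \<and> \<phi> w (Inner e t) \<noteq> 0}" by (rule finite_subset[rotated]) auto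
  moreover have "finite {(d, m). d \<in> ports \<and> m \<in> {1..Dmax} \<and> 0 < tw w d m \<and> on_edge e (pt d r)}"
    by (rule finite_subset[of _ "ports \<times> {1..Dmax}"]) (auto simp: finite_ports)
  ultimately show ?thesis by (simp add: eidx_def)
qed

lemma on_edge_arm:
  assumes "d \<in> ports" "0 < x" "x \<le> r"
  shows "on_edge e (pt d x) \<longleftrightarrow> on_edge e (pt d r)"
  using port_line[OF assms(1)] assms r_pos by (metis on_edge.simps(1) order.refl)

lemma tw_lt_r: "w \<in> realization K \<Longrightarrow> tw w d m < r"
  using tw_le[of w d m] eps_r by simp

lemma epos_point:
  assumes w: "w \<in> realization K" and "d \<in> ports" "0 < tw w d m" "on_edge e (pt d r)"
  shows "pt d (tw w d m) = Inner e (epos w (Inr (d, m)))"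
  using on_edge_coord[of e "pt d (tw w d m)"] on_edge_arm[OF assms(2,3)] tw_lt_r[OF w, of d m] assms(4) by simp

text \<open>Intersecting with \<open>{t. e \<in> E}\<close> encodes the premise that
  \<open>e\<close> is an edge.\<close>

lemma eidx_image:
  assumes w: "w \<in> realization K"
  shows "{t. 0 < t \<and> ereal t < \<l> e \<and> \<phi> w (Inner e t) \<noteq> 0} \<inter> {t. e \<in> E} = epos w ` eidx w e \<inter> {t. e \<in> E}"
proof (cases "e \<in> E")
  case e: True
  have "{t. 0 < t \<and> ereal t < \<l> e \<and> \<phi> w (Inner e t) \<noteq> 0} = epos w ` eidx w e"
  proof (intro equalityI subsetI)
    fix t assume "t \<in> {t. 0 < t \<and> ereal t < \<l> e \<and> \<phi> w (Inner e t) \<noteq> 0}"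
    then have t: "Inner e t \<in> pts" "\<phi> w (Inner e t) \<noteq> 0" using e by auto
    from t(1) show "t \<in> epos w ` eidx w e"
    proof (cases rule: point_cases)
      case marked
      then have "Inl t \<in> eidx w e" using t by (auto simp: eidx_def)
      then show ?thesis by (metis epos.simps(1) imageI)
    next
      case (arm d x)
      have "card {m\<in>{1..Dmax}. tw w d m = x} \<noteq> 0" using phi_arm[OF w arm(1-3)] arm(4) t(2) by simp
      then have "{m\<in>{1..Dmax}. tw w d m = x} \<noteq> {}" by (metis card.empty)
      then obtain m where m: "m \<in> {1..Dmax}" "tw w d m = x" by blast
      have "on_edge e (pt d r)" using on_edge_arm[OF arm(1,2), of e] arm(3) arm(4)[symmetric] by simp
      then have "Inr (d, m) \<in> eidx w e" using arm m by (auto simp: eidx_def)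
      moreover have "epos w (Inr (d, m)) = t" using m arm(4)[symmetric] by simp
      ultimately show ?thesis by (metis imageI)
    next
      case (mid e' \<alpha> b x)
      have "\<phi> w (Inner e' x) = 0" using phi_mid[OF w mid(1-3)] t(1) mid(5,6) by metis
      then show ?thesis using t(2) mid(5) by simp
    qed
  next
    fix t assume "t \<in> epos w ` eidx w e"
    then obtain k where k: "k \<in> eidx w e" "t = epos w k" by blast
    from k(1) show "t \<in> {t. 0 < t \<and> ereal t < \<l> e \<and> \<phi> w (Inner e t) \<noteq> 0}"
    proof (cases rule: eidx_cases)
      case (node t')
      then show ?thesis using k(2) mk_pts by auto
    next
      case (chip d m)
      have x: "pt d (tw w d m) = Inner e t" using epos_point[OF w chip(2,5,6)] k chip(1) by simp
      have "m \<in> {n\<in>{1..Dmax}. tw w d n = tw w d m}" using chip by auto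
      moreover have "finite {n\<in>{1..Dmax}. tw w d n = tw w d m}" by simp
      ultimately have "card {n\<in>{1..Dmax}. tw w d n = tw w d m} \<noteq> 0" using card_gt_0_iff by blast
      then have "\<phi> w (pt d (tw w d m)) \<noteq> 0" unfolding phi_arm[OF w chip(2,5) tw_lt_r[OF w]] by simp
      then have "\<phi> w (Inner e t) \<noteq> 0" unfolding x .
      moreover have "Inner e t \<in> pts" using pt_in_pts[OF ports_dirs[OF chip(2)]] x by metis
      ultimately show ?thesis by auto
    qed
  qed
  then show ?thesis by simp
qed simp

text \<open>The straight path between two points of an open simplex, along which chips are
  followed.\<close>

definition comb :: "real \<Rightarrow> ('a \<Rightarrow> real) \<Rightarrow> ('a \<Rightarrow> real) \<Rightarrow> 'a \<Rightarrow> real" where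
  "comb s w w' p = (1 - s) * w p + s * w' p"

lemma comb_realization:
  assumes w: "w \<in> realization K" and w': "w' \<in> realization K" and eq: "{p. w p \<noteq> 0} = {p. w' p \<noteq> 0}"
    and s: "0 \<le> s" "s \<le> 1"
  shows "comb s w w' \<in> realization K" "{p. comb s w w' p \<noteq> 0} = {p. w p \<noteq> 0}"
proof -
  have pos: "0 < comb s w w' p" if "w p \<noteq> 0" for p
  proof -
    have "0 < w p" "0 < w' p" using supp_pos[OF w, of p] supp_pos[OF w', of p] eq that by blast+
    then show ?thesis using s by (cases "s = 0") (auto simp: comb_def intro: add_nonneg_pos)
  qed
  have zero: "comb s w w' p = 0" if "w p = 0" for p
  proof -
    have "w' p = 0" using that eq by blast
    with that show ?thesis by (simp add: comb_def)
  qed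
  show supp: "{p. comb s w w' p \<noteq> 0} = {p. w p \<noteq> 0}" using pos zero by (metis less_irrefl)
  have nn: "0 \<le> comb s w w' p" for p using pos[of p] zero[of p] by (cases "w p = 0") auto
  have "sum w {p. w p \<noteq> 0} = 1" "sum w' {p. w p \<noteq> 0} = 1"
    using w w' eq by (auto simp: realization_def)
  then have "sum (comb s w w') {p. w p \<noteq> 0} = 1"
    by (simp add: comb_def sum.distrib sum_distrib_left[symmetric])
  then show "comb s w w' \<in> realization K"
    using nn supp realization_D(2)[OF w] by (simp add: realization_def)
qed

lemma tw_comb: "tw (comb s w w') d m = (1 - s) * tw w d m + s * tw w' d m"
  unfolding tw_def comb_def add_divide_distrib sum.distrib
  by (simp add: sum_distrib_left algebra_simps)

text \<open>Along the straight path the positions of the chips are affine in the parameter. By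
  \<open>pt_inj\<close> and \<open>tw_eq_iff\<close> two chips that meet at one parameter coincide
  at all of them, so \<open>affine_order_agree\<close> keeps their order. The coefficients count
  coinciding breaks, and the support determines these as well.\<close>

lemma edge_coeffs_phi:
  assumes w: "w \<in> realization K" and w': "w' \<in> realization K" and eq: "{p. w p \<noteq> 0} = {p. w' p \<noteq> 0}" and e: "e \<in> E"
  shows "edge_coeffs \<Gamma> (\<phi> w) e = edge_coeffs \<Gamma> (\<phi> w') e"
proof -
  have phi_mk: "\<phi> w x = \<phi> v x" if "x \<in> mk" "v \<in> realization K" "{p. v p \<noteq> 0} = {p. w p \<noteq> 0}" for x v
  proof -
    have "{m\<in>{1..Dmax}. 0 < tw w d m} = {m\<in>{1..Dmax}. 0 < tw v d m}" for d
      using tw_pos[OF w, of _ d] tw_pos[OF that(2), of _ d] that(3) by auto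
    then show ?thesis unfolding phi_marked[OF w that(1)] phi_marked[OF that(2,1)] by (simp only:)
  qed
  have eidx_eq: "eidx v e = eidx w e" if "v \<in> realization K" "{p. v p \<noteq> 0} = {p. w p \<noteq> 0}" for v
  proof -
    have "{t. Inner e t \<in> mk \<and> \<phi> v (Inner e t) \<noteq> 0} = {t. Inner e t \<in> mk \<and> \<phi> w (Inner e t) \<noteq> 0}"
      using phi_mk[OF _ that] by auto
    moreover have "0 < tw v d m \<longleftrightarrow> 0 < tw w d m" if "m \<in> {1..Dmax}" for d m
      using tw_pos[OF w, of m d] tw_pos[OF \<open>v \<in> realization K\<close>, of m d] that \<open>{p. v p \<noteq> 0} = {p. w p \<noteq> 0}\<close> by simp
    then have "{(d, m). d \<in> ports \<and> m \<in> {1..Dmax} \<and> 0 < tw v d m \<and> on_edge e (pt d r)} =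
       {(d, m). d \<in> ports \<and> m \<in> {1..Dmax} \<and> 0 < tw w d m \<and> on_edge e (pt d r)}" by auto
    ultimately show ?thesis by (simp only: eidx_def)
  qed
  have epos_eq: "epos w k = epos w l \<and> epos w' k = epos w' l"
    if kl: "k \<in> eidx w e" "l \<in> eidx w e" and v: "v \<in> realization K" "{p. v p \<noteq> 0} = {p. w p \<noteq> 0}"
      and pos: "epos v k = epos v l" for k l v
  proof -
    \<comment> \<open>A travelling chip sits at a positive distance below \<open>r\<close> from its
      base and so never reaches a marked point.\<close>
    have clash: False if "Inner e t \<in> mk" "Inr (d, m) \<in> eidx w e" "t = epos v (Inr (d, m))" for t d m
    proof -
      have "Inr (d, m) \<in> eidx v e" using that(2) eidx_eq[OF v] by simp
      then have *: "d \<in> ports" "0 < tw v d m" "on_edge e (pt d r)" by (auto simp: eidx_def)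
      then have "pt d (tw v d m) \<in> mk" using epos_point[OF v(1) *] that(1,3) by simp
      then show False using pt_unmarked[OF *(1,2)] tw_lt_r[OF v(1), of d m] r_pos by simp
    qed
    from kl(1) show ?thesis
    proof (cases rule: eidx_cases)
      case k: (node t)
      from kl(2) show ?thesis
      proof (cases rule: eidx_cases)
        case l: (node t')
        then show ?thesis using k pos by simp
      next
        case l: (chip d m)
        have "t = epos v (Inr (d, m))" using pos k(1) l(1) by simp
        then have False using clash[OF k(2), of d m] kl(2) l(1) by simp
        then show ?thesis ..
      qed
    next
      case k: (chip d m)
      from kl(2) show ?thesis
      proof (cases rule: eidx_cases)
        case l: (node t')
        have "t' = epos v (Inr (d, m))" using pos k(1) l(1) by simp
        then have False using clash[OF l(2), of d m] kl(1) k(1) by simp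
        then show ?thesis ..
      next
        case l: (chip d' m')
        have kv: "0 < tw v d m" using kl(1) eidx_eq[OF v] k(1) by (auto simp: eidx_def)
        have lv: "0 < tw v d' m'" using kl(2) eidx_eq[OF v] l(1) by (auto simp: eidx_def)
        have "pt d (tw v d m) = pt d' (tw v d' m')"
          using epos_point[OF v(1) k(2) kv k(6)] epos_point[OF v(1) l(2) lv l(6)] pos k(1) l(1) by simp
        from pt_inj[OF k(2) l(2) kv _ lv _ this]
        have "d = d'" "tw v d m = tw v d' m'"
          using tw_lt_r[OF v(1)] less_imp_le by metis+
        then have "\<forall>p\<in>{p. w p \<noteq> 0}. int m \<le> snd p d \<longleftrightarrow> int m' \<le> snd p d"
          using tw_eq_iff[OF v(1) k(3) l(3), of d] v(2) by simp
        then have "tw w d m = tw w d m'" "tw w' d m = tw w' d m'"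
          using tw_eq_iff[OF w k(3) l(3), of d] tw_eq_iff[OF w' k(3) l(3), of d] eq by auto
        then show ?thesis using k(1) l(1) \<open>d = d'\<close> by simp
      qed
    qed
  qed
  have comb: "epos (comb s w w') k = (1 - s) * epos w k + s * epos w' k"
    if k: "k \<in> eidx w e" and s: "0 \<le> s" "s \<le> 1" for s k
    using k
  proof (cases rule: eidx_cases)
    case (node t)
    then show ?thesis by (simp add: algebra_simps)
  next
    case (chip d m)
    obtain e' \<kappa> z where line: "\<And>x. 0 < x \<Longrightarrow> x \<le> r \<Longrightarrow> pt d x = Inner e' (\<kappa> + z * x)"
      using port_line[OF chip(2)] by blast
    have c: "icoord (pt d (tw v d m)) = \<kappa> + z * tw v d m"
      if v: "v \<in> realization K" "{p. v p \<noteq> 0} = {p. w p \<noteq> 0}" for v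
    proof -
      have "0 < tw v d m" using k eidx_eq[OF v] chip(1) by (auto simp: eidx_def)
      then show ?thesis using line[of "tw v d m"] tw_lt_r[OF v(1), of d m] by simp
    qed
    show ?thesis
      using c[OF comb_realization[OF w w' eq s]] c[OF w refl] c[OF w' eq[symmetric]] chip(1)
      by (simp add: tw_comb algebra_simps)
  qed
  have img: "{t. 0 < t \<and> ereal t < \<l> e \<and> \<phi> w (Inner e t) \<noteq> 0} = epos w ` eidx w e"
    "{t. 0 < t \<and> ereal t < \<l> e \<and> \<phi> w' (Inner e t) \<noteq> 0} = epos w' ` eidx w e"
    using eidx_image[OF w, of e] eidx_image[OF w', of e] eidx_eq[OF w' eq[symmetric]] e by auto
  show ?thesis
    unfolding edge_coeffs_def img
  proof (rule sorted_list_of_set_indexed[OF finite_eidx])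
    fix k l assume kl: "k \<in> eidx w e" "l \<in> eidx w e"
    show "epos w k < epos w l \<longleftrightarrow> epos w' k < epos w' l"
    proof (rule affine_order_agree)
      fix s :: real assume s: "0 \<le> s" "s \<le> 1"
        and "(1 - s) * epos w k + s * epos w' k = (1 - s) * epos w l + s * epos w' l"
      then have "epos (comb s w w') k = epos (comb s w w') l" using comb[OF kl(1) s] comb[OF kl(2) s] by simp
      then show "epos w k = epos w l \<and> epos w' k = epos w' l"
        by (rule epos_eq[OF kl comb_realization[OF w w' eq s]])
    qed
  next
    fix k assume k: "k \<in> eidx w e"
    then show "\<phi> w (Inner e (epos w k)) = \<phi> w' (Inner e (epos w' k))"
    proof (cases rule: eidx_cases)
      case (node t)
      then show ?thesis using phi_mk[OF node(2) w' eq[symmetric]] by simp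
    next
      case (chip d m)
      have pos': "0 < tw w' d m" using k eidx_eq[OF w' eq[symmetric]] chip(1) by (auto simp: eidx_def)
      have "tw w d n = tw w d m \<longleftrightarrow> tw w' d n = tw w' d m" if "n \<in> {1..Dmax}" for n
        using that tw_eq_iff[OF w _ chip(3), of n d] tw_eq_iff[OF w' _ chip(3), of n d] eq by simp
      then have "{n\<in>{1..Dmax}. tw w d n = tw w d m} = {n\<in>{1..Dmax}. tw w' d n = tw w' d m}" by blast
      then have "\<phi> w (pt d (tw w d m)) = \<phi> w' (pt d (tw w' d m))"
        unfolding phi_arm[OF w chip(2,5) tw_lt_r[OF w]] phi_arm[OF w' chip(2) pos' tw_lt_r[OF w']] by (simp only:)
      then show ?thesis
        unfolding chip(1) epos_point[OF w chip(2,5,6)] epos_point[OF w' chip(2) pos' chip(6)] .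
    qed
  qed
qed

text \<open>The start of an edge is a vertex, so \<open>Fwd e 0\<close> is a port, and the slope
  there is minus its number of positive breaks, which the support determines, as it does the
  coefficients at marked points.\<close>

lemma cell_rel_phi:
  assumes w: "w \<in> realization K" and w': "w' \<in> realization K" and eq: "{p. w p \<noteq> 0} = {p. w' p \<noteq> 0}"
  shows "(\<phi> w, \<phi> w') \<in> cell_rel \<Gamma> D"
proof -
  have chips: "{m\<in>{1..Dmax}. 0 < tw w d m} = {m\<in>{1..Dmax}. 0 < tw w' d m}" for d
    using tw_pos[OF w, of _ d] tw_pos[OF w', of _ d] eq by auto
  have mk: "\<phi> w x = \<phi> w' x" if "x \<in> mk" for x
    unfolding phi_marked[OF w that] phi_marked[OF w' that] chips ..
  have "slp (gw w) (Fwd e 0) = slp (gw w') (Fwd e 0)" if e: "e \<in> E" for e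
  proof -
    have "0 \<in> nodes e" by (simp add: nodes_def)
    then have d: "Fwd e 0 \<in> ports" using seg_right_of[OF e _ len_pos[OF e]] segs_ports(1) by metis
    show ?thesis
      unfolding slp_eq[OF ports_dirs[OF d] nf_port[OF nform_gw[OF w] d]]
        slp_eq[OF ports_dirs[OF d] nf_port[OF nform_gw[OF w'] d]] chips ..
  qed
  moreover have "\<forall>v\<in>verts (model \<Gamma>). \<phi> w (Vert v) = \<phi> w' (Vert v)"
    using mk by (auto simp: marked_def)
  moreover have "\<forall>e\<in>E. edge_coeffs \<Gamma> (\<phi> w) e = edge_coeffs \<Gamma> (\<phi> w') e"
    using edge_coeffs_phi[OF assms] by blast
  ultimately show ?thesis
    unfolding cell_rel_def \<phi>_def using nf_R_space[OF nform_gw[OF w]] nf_R_space[OF nform_gw[OF w']] by blast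
qed

lemma fine_rel_phi:
  assumes w: "w \<in> realization K" and w': "w' \<in> realization K"
  shows "(\<phi> w, \<phi> w') \<in> fine_rel \<Gamma> D \<epsilon> \<longleftrightarrow> {p. w p \<noteq> 0} = {p. w' p \<noteq> 0}"
proof
  assume eq: "{p. w p \<noteq> 0} = {p. w' p \<noteq> 0}"
  show "(\<phi> w, \<phi> w') \<in> fine_rel \<Gamma> D \<epsilon>"
    unfolding fine_rel_def
    using cell_rel_phi[OF assms eq] phi_link[OF w] phi_link[OF w'] fine_data_supp_eq[OF assms eq]
      nf_R_space[OF nform_gw[OF w]] nf_R_space[OF nform_gw[OF w']] \<phi>_def by blast
next
  assume "(\<phi> w, \<phi> w') \<in> fine_rel \<Gamma> D \<epsilon>"
  then obtain f g where fg: "f \<in> R_space \<Gamma> D" "g \<in> R_space \<Gamma> D" "\<phi> w = add_div \<Gamma> D f" "\<phi> w' = add_div \<Gamma> D g"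
    "fine_data \<Gamma> D f = fine_data \<Gamma> D g"
    unfolding fine_rel_def by blast
  \<comment> \<open>\<open>fine_rel\<close> allows any functions representing the two divisors. They
    differ from \<open>gw w\<close> by a constant, which leaves the fine data unchanged.\<close>
  have fd: "fine_data \<Gamma> D f = fine_data \<Gamma> D (\<lambda>x. ereal (gw w x))"
    if v: "w \<in> realization K" and f: "f \<in> R_space \<Gamma> D" and eq: "\<phi> w = add_div \<Gamma> D f" for w f
  proof -
    have "rational_function \<Gamma> f" using f by (simp add: R_space_def)
    then obtain c where c: "\<And>x. x \<in> pts \<Longrightarrow> f x = ereal (gw w x + c)"
      using phi_eq_imp[OF v _ eq[symmetric]] by metis
    have "fine_data \<Gamma> D f = fine_data \<Gamma> D (\<lambda>x. ereal (gw w x + c))" by (rule fine_data_cong[OF c])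
    also have "\<dots> = fine_data \<Gamma> D (\<lambda>x. ereal (gw w x))" by (rule fine_data_add_const[OF nform_gw[OF v]])
    finally show ?thesis .
  qed
  show "{p. w p \<noteq> 0} = {p. w' p \<noteq> 0}"
    using fine_data_set[OF w] fine_data_set[OF w'] fd[OF w fg(1,3)] fd[OF w' fg(2,4)] fg(5) by simp
qed

lemma fine_cells_phi: "(\<lambda>\<sigma>. \<phi> ` open_simplex K \<sigma>) ` K = fine_cells \<Gamma> D \<epsilon>"
proof -
  have cls: "fine_rel \<Gamma> D \<epsilon> `` {\<phi> w} = \<phi> ` open_simplex K {p. w p \<noteq> 0}" if w: "w \<in> realization K" for w
  proof (intro equalityI subsetI)
    fix D' assume "D' \<in> fine_rel \<Gamma> D \<epsilon> `` {\<phi> w}"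
    then have rel: "(\<phi> w, D') \<in> fine_rel \<Gamma> D \<epsilon>" by blast
    then have "D' \<in> link \<Gamma> D \<epsilon>" by (auto simp: fine_rel_def)
    then obtain w' where w': "w' \<in> realization K" "D' = \<phi> w'" unfolding link_image by blast
    then show "D' \<in> \<phi> ` open_simplex K {p. w p \<noteq> 0}"
      using fine_rel_phi[OF w w'(1)] rel by (auto simp: open_simplex_def)
  next
    fix D' assume "D' \<in> \<phi> ` open_simplex K {p. w p \<noteq> 0}"
    then obtain w' where w': "w' \<in> realization K" "{p. w' p \<noteq> 0} = {p. w p \<noteq> 0}" "D' = \<phi> w'"
      by (auto simp: open_simplex_def)
    then show "D' \<in> fine_rel \<Gamma> D \<epsilon> `` {\<phi> w}" using fine_rel_phi[OF w w'(1)] by simp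
  qed
  have "\<exists>w\<in>realization K. {p. w p \<noteq> 0} = \<sigma>" if \<sigma>: "\<sigma> \<in> K" for \<sigma>
  proof -
    \<comment> \<open>The barycenter shows that no open simplex is empty.\<close>
    define w where "w p = (if p \<in> \<sigma> then 1 / real (card \<sigma>) else 0)" for p
    have c: "0 < card \<sigma>" using K_D(2,3)[OF \<sigma>] by (simp add: card_gt_0_iff)
    have supp: "{p. w p \<noteq> 0} = \<sigma>" using c by (auto simp: w_def)
    have "sum w \<sigma> = 1" using c by (simp add: w_def)
    then have "w \<in> realization K" using supp \<sigma> by (simp add: realization_def w_def)
    with supp show ?thesis by blast
  qed
  then have "K = (\<lambda>w. {p. w p \<noteq> 0}) ` realization K" using realization_D(2) by blast
  then have "(\<lambda>\<sigma>. \<phi> ` open_simplex K \<sigma>) ` K = (\<lambda>w. \<phi> ` open_simplex K {p. w p \<noteq> 0}) ` realization K"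
    by (metis (no_types, lifting) image_cong image_image)
  also have "\<dots> = (\<lambda>w. fine_rel \<Gamma> D \<epsilon> `` {\<phi> w}) ` realization K"
    by (rule image_cong[OF refl]) (simp add: cls)
  also have "\<dots> = fine_cells \<Gamma> D \<epsilon>"
    unfolding fine_cells_def quotient_def link_image by blast
  finally show ?thesis .
qed

lemma geometric_realization: "is_geometric_realization (link_top \<Gamma> D \<epsilon>) (fine_cells \<Gamma> D \<epsilon>) K"
  unfolding is_geometric_realization_def using homeomorphic_phi fine_cells_phi by blast

end

theorem theorem20:
  fixes \<Gamma> :: "('v, 'e) metric_graph" and D :: "('v, 'e) divisor"
  assumes "tropical_curve \<Gamma>"
    and "is_divisor \<Gamma> D" and "effective D"
    and "\<forall>x \<in> infinite_points \<Gamma>. D x = 0"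
  shows "\<forall>\<^sub>F \<epsilon> in at_right (0 :: real).
    is_geometric_realization (link_top \<Gamma> D \<epsilon>) (fine_cells \<Gamma> D \<epsilon>)
      (order_complex (firing_order \<Gamma> D))"
proof -
  interpret tropical_divisor \<Gamma> D by unfold_locales (use assms in auto)
  \<comment> \<open>The bound \<open>r\<close> depends only on the lengths of the segments, so every
    smaller \<open>\<epsilon>\<close> works.\<close>
  obtain r where r: "0 < r" "\<forall>(e, a, b)\<in>segs. a + ereal (2 * r) < b" using ex_gap by blast
  show ?thesis
  proof (rule eventually_mono[OF eventually_at_right_real[OF r(1)]])
    fix \<epsilon> assume "\<epsilon> \<in> {0<..<r}"
    then interpret small_link \<Gamma> D r \<epsilon> by unfold_locales (use r in auto)
    show "is_geometric_realization (link_top \<Gamma> D \<epsilon>) (fine_cells \<Gamma> D \<epsilon>) (order_complex (firing_order \<Gamma> D))"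
      by (rule geometric_realization)
  qed
qed

end
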